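(* Let $d\ge1$, $s\ge0$, $0<p<\infty$ and $0<q\le\infty$. Then: (a) if $s>0$, there is no reverse Carleson measure for $HF_s^{p,q}(B_d)$; (b) if $2\le q\le\infty$, a finite positive Borel measure $\mu$ on $\overline{B}_d$ is a reverse Carleson measure for $HF_0^{p,q}(B_d)$ if and only if there is $c>0$ with $\mu(Q)\ge c\,\sigma(Q)$ for every non-isotropic ball $Q\subset\partial B_d$; (c) if $0<q\le1$, there is no reverse Carleson measure for $HF_0^{p,q}(B_d)$.
   Context: $B_d$ is the open unit ball of $\mathbb{C}^d$, $\sigma$ the normalized surface measure on $\partial B_d$, $\langle z,w\rangle=\sum z_k\overline{w_k}$. A non-isotropic ball is a set $Q(\zeta,\delta)=\{\xi\in\partial B_d:|1-\langle\zeta,\xi\rangle|\le\delta\}$. For holomorphic $f(z)=\sum_\alpha c_\alpha z^\alpha$ on $B_d$ and $t\in\mathbb{R}$, $(I+\mathcal{R})^tf(z)=\sum_\alpha(1+|\alpha|)^tc_\alpha z^\alpha$ (here $\mathcal{R}f=\sum_k z_k\partial f/\partial z_k$ is the radial derivative). Let $[s]^+$ be the integer part of $s+1$. The holomorphic Triebel–Lizorkin space $HF_s^{p,q}(B_d)$ consists of holomorphic $f$ on $B_d$ with $\|f\|^p_{HF_s^{p,q}}=\int_{\partial B_d}\big(\int_0^1|(I+\mathcal{R})^{[s]^+}f(r\zeta)|^q(1-r^2)^{([s]^+-s)q-1}\,dr\big)^{p/q}d\sigma(\zeta)<\infty$, and for $q=\infty$ with the inner integral replaced by $\big(\sup_{0\le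 r<1}|(I+\mathcal{R})^{[s]^+}f(r\zeta)|(1-r^2)^{[s]^+-s}\big)^p$. A finite positive Borel measure $\mu$ on $\overline{B}_d$ is a reverse Carleson measure for $HF_s^{p,q}$ if there is $C>0$ with $\|f\|_{HF_s^{p,q}}\le C\|f\|_{L^p(\overline{B}_d,\mu)}$ for all $f\in HF_s^{p,q}\cap C(\overline{B}_d)$. *)

theory Defs
  imports "HOL-Analysis.Analysis" "HOL-Probability.Probability"
begin

definition cinner :: "complex ^ 'n \<Rightarrow> complex ^ 'n \<Rightarrow> complex" where
  "cinner z w = (\<Sum>k\<in>UNIV. z $ k * cnj (w $ k))"

definition holo_on :: "(complex ^ 'n) set \<Rightarrow> (complex ^ 'n \<Rightarrow> complex) \<Rightarrow> bool" where
  "holo_on U f \<longleftrightarrow> (\<forall>z\<in>U. \<exists>f'. (f has_derivative f') (at z) \<and>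
      (\<forall>c v. f' (c *s v) = c * f' v))"

text \<open>Radial derivative R f (z) = sum_k z_k df/dz_k = Df(z) applied to z.\<close>
definition radial :: "(complex ^ 'n \<Rightarrow> complex) \<Rightarrow> complex ^ 'n \<Rightarrow> complex" where
  "radial f z = frechet_derivative f (at z) z"

definition IR_pow :: "nat \<Rightarrow> (complex ^ 'n \<Rightarrow> complex) \<Rightarrow> complex ^ 'n \<Rightarrow> complex" where
  "IR_pow k f = ((\<lambda>g z. g z + radial g z) ^^ k) f"

definition splus :: "real \<Rightarrow> nat" where
  "splus s = nat \<lfloor>s + 1\<rfloor>"

text \<open>Normalized surface measure on the unit sphere, realised as the cone measure:
  push-forward of normalized Lebesgue measure on the ball under z |-> z/|z|.\<close>
definition sigma :: "(complex ^ 'n) measure" where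
  "sigma = distr
     (scale_measure (1 / emeasure lborel (ball (0::complex ^ 'n) 1))
        (restrict_space lborel (ball 0 1 - {0})))
     (restrict_space borel (sphere 0 1)) sgn"

definition Qball :: "complex ^ 'n \<Rightarrow> real \<Rightarrow> (complex ^ 'n) set" where
  "Qball \<zeta> \<delta> = {\<xi> \<in> sphere 0 1. cmod (1 - cinner \<zeta> \<xi>) \<le> \<delta>}"

text \<open>x^a for x in [0,\<infinity>] and a > 0.\<close>
definition epow :: "ennreal \<Rightarrow> real \<Rightarrow> ennreal" where
  "epow x a = (if x = \<top> then \<top> else ennreal (enn2real x powr a))"

text \<open>The p-th power of the HF_s^{p,q} (quasi-)norm; q ranges over (0, \<infinity>].\<close>
definition HF_normp :: "real \<Rightarrow> ennreal \<Rightarrow> real \<Rightarrow> (complex ^ 'n \<Rightarrow> complex) \<Rightarrow> ennreal" where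
  "HF_normp p q s f =
    (let k = splus s; g = IR_pow k f in
     if q = \<top> then
       (\<integral>\<^sup>+ \<zeta>. epow (SUP r\<in>{0..<1}. ennreal (cmod (g (r *\<^sub>R \<zeta>)) * (1 - r\<^sup>2) powr (real k - s))) p
          \<partial>sigma)
     else
       (let q' = enn2real q in
        \<integral>\<^sup>+ \<zeta>. epow (\<integral>\<^sup>+ r\<in>{0..<1}. ennreal (cmod (g (r *\<^sub>R \<zeta>)) powr q'
                          * (1 - r\<^sup>2) powr ((real k - s) * q' - 1)) \<partial>lborel) (p / q')
          \<partial>sigma))"

definition fin_borel_cball :: "(complex ^ 'n) measure \<Rightarrow> bool" where
  "fin_borel_cball \<mu> \<longleftrightarrow> finite_measure \<mu> \<and>
     sets \<mu> = sets (restrict_space borel (cball (0::complex ^ 'n) 1))"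

text \<open>Reverse Carleson measure for HF_s^{p,q}: ||f||_HF <= C ||f||_{L^p(mu)} for all
  f in HF_s^{p,q} \<inter> C(closed ball); stated with p-th powers (C^p absorbed in C).\<close>
definition reverse_carleson :: "real \<Rightarrow> ennreal \<Rightarrow> real \<Rightarrow> (complex ^ 'n) measure \<Rightarrow> bool" where
  "reverse_carleson p q s \<mu> \<longleftrightarrow>
     (\<exists>C>0. \<forall>f. holo_on (ball 0 1) f \<and> continuous_on (cball 0 1) f \<and> HF_normp p q s f < \<top>
        \<longrightarrow> HF_normp p q s f \<le> ennreal C * (\<integral>\<^sup>+ z. ennreal (cmod (f z) powr p) \<partial>\<mu>))"

end

theory Submission
  imports Defs "HOL-Complex_Analysis.Complex_Analysis"
begin

text \<open>
  For \<open>q \<ge> 2\<close> the quantity \<open>HF_normp p q 0 f\<close> is dominated by the Hardy norm of \<open>f\<close>. Slicing the sphere by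
  complex lines reduces this to the Littlewood--Paley inequality in the disc. There Green's formula, used with the
  automorphism that moves \<open>z\<close> to the centre, bounds the conditional expectations of the area function of \<open>F\<close> by a power of the maximal
  function, a Garsia type argument turns this into moment bounds, and the maximal function is bounded on \<open>L\<^sup>2\<close>
  by a \<open>T T*\<close> argument. If \<open>\<mu> Q \<ge> c \<sigma> Q\<close> for all \<open>Q\<close>, averaging a continuous function over small balls shows
  that its integral against \<open>\<mu>\<close> is at least \<open>c\<close> times that against \<open>\<sigma>\<close>. Conversely, the functions
  \<open>((1 + cinner z \<eta>) / 2) ^ n\<close> peak at \<open>\<eta>\<close>; testing on them, integrating over \<open>\<eta> \<in> Q\<close> and letting
  \<open>n\<close> tend to infinity gives \<open>\<mu> Q \<ge> c \<sigma> Q\<close>.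

  The nonexistence results use random signs on the monomials attached to words \<open>w\<close> of length \<open>n\<close>, whose
  squared moduli add up to \<open>norm z ^ (2 * n)\<close>. By Khinchine's inequality a single degree \<open>n\<close> has mean
  \<open>HF_normp\<close> of order \<open>n powr (s * p)\<close> but bounded mean \<open>L\<^sup>p(\<mu>)\<close> norm, which excludes \<open>s > 0\<close>. The degrees
  \<open>4, 8, \<dots>, 2 ^ (N + 1)\<close> together have mean \<open>HF_normp\<close> at least of order \<open>N powr (p / q)\<close>, against
  \<open>N powr (p / 2)\<close> on the other side, which excludes \<open>q \<le> 1\<close>.
\<close>

section \<open>Green's formula and Poisson integrals\<close>

text \<open>The Garsia argument expands a power of an integral into time-ordered products, so it
  reaches moments of integer order only. To cover every \<open>p > 0\<close>, the area function is
  built from \<open>|F| powr a\<close> with \<open>a = p / (2 * real k)\<close>, whose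
  \<open>2 * k\<close>-th moment has the size of the \<open>p\<close>-th power of the Hardy norm.
  Small powers of \<open>|F|\<close> are singular at zeros of \<open>F\<close>; therefore
  \<open>|F|^2 + e\<close> replaces \<open>|F|^2\<close>, with constants independent of
  \<open>e\<close>.

  The area function carries the weight \<open>|F| powr (a - 2)\<close>, while the radial integral
  involves \<open>|F'|\<close> alone. A Hoelder interpolation on circles trades the weight for the
  maximal function. When \<open>q > 2\<close>, the remaining \<open>q - 2\<close> powers of the
  derivative are estimated by the maximal function through Cauchy's inequality.

  A slice of \<open>f\<close> is holomorphic only in the open disc, so the disc inequality is
  applied to dilates, and Fatou's lemma returns to \<open>f\<close>.

  For the necessity, the poles \<open>\<eta>\<close> are averaged over \<open>Q\<close> and the
  result is divided by the mass of one peak. It is at most \<open>1\<close> on \<open>Q\<close> and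
  tends to \<open>0\<close> off \<open>Q\<close>, since \<open>Q\<close> is closed.\<close>

definition rad :: "(complex \<Rightarrow> complex) \<Rightarrow> complex \<Rightarrow> complex" where
  "rad G z = z * deriv G z"

lemma rad_holomorphic [holomorphic_intros]:
  "G holomorphic_on S \<Longrightarrow> open S \<Longrightarrow> rad G holomorphic_on S"
  unfolding rad_def by (intro holomorphic_intros)

lemma rcis_in_ball: "0 \<le> r \<Longrightarrow> r < R \<Longrightarrow> complex_of_real r * cis t \<in> ball 0 R"
  by (simp add: norm_mult)

text \<open>On \<open>complex_of_real r * cis t\<close> the operator \<open>rad\<close> is
  \<open>r * d/dr\<close>, and \<open>\<i> * rad\<close> is \<open>d/dt\<close>. In these
  logarithmic coordinates \<open>(cmod z)\<^sup>2\<close> times the Laplacian is a sum of two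
  squares of derivations, without a first-order term.\<close>

lemma polar_deriv_radius:
  assumes "G holomorphic_on ball 0 R" "0 < r" "r < R"
  shows "((\<lambda>r. G (complex_of_real r * cis t)) has_vector_derivative
           rad G (complex_of_real r * cis t) / complex_of_real r) (at r)"
proof -
  have "(G has_field_derivative deriv G (complex_of_real r * cis t)) (at (complex_of_real r * cis t))"
    using assms by (intro holomorphic_derivI[of _ "ball 0 R"] rcis_in_ball) auto
  moreover have "((\<lambda>r. complex_of_real r * cis t) has_vector_derivative cis t) (at r)"
    by (auto intro!: derivative_eq_intros has_vector_derivative_real_field simp: has_vector_derivative_def scaleR_conv_of_real)
  ultimately have "((G \<circ> (\<lambda>r. complex_of_real r * cis t)) has_vector_derivative
      cis t * deriv G (complex_of_real r * cis t)) (at r)"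
    by (intro field_vector_diff_chain_at) auto
  thus ?thesis using assms by (simp add: o_def rad_def mult_ac)
qed

lemma polar_deriv_angle:
  assumes "G holomorphic_on ball 0 R" "0 \<le> r" "r < R"
  shows "((\<lambda>t. G (complex_of_real r * cis t)) has_vector_derivative
           \<i> * rad G (complex_of_real r * cis t)) (at t)"
proof -
  have "(G has_field_derivative deriv G (complex_of_real r * cis t)) (at (complex_of_real r * cis t))"
    using assms by (intro holomorphic_derivI[of _ "ball 0 R"] rcis_in_ball) auto
  moreover have "((\<lambda>t. complex_of_real r * cis t) has_vector_derivative (\<i> * (complex_of_real r * cis t))) (at t)"
    unfolding has_vector_derivative_def
    by (rule derivative_eq_intros refl | simp add: scaleR_conv_of_real algebra_simps)+
  ultimately have "((G \<circ> (\<lambda>t. complex_of_real r * cis t)) has_vector_derivative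
      (\<i> * (complex_of_real r * cis t)) * deriv G (complex_of_real r * cis t)) (at t)"
    by (intro field_vector_diff_chain_at) auto
  thus ?thesis by (simp add: o_def rad_def mult_ac)
qed

lemma has_real_derivative_Re_cnj_mult:
  assumes "(f has_vector_derivative f') (at s)" "(g has_vector_derivative g') (at s)"
  shows "((\<lambda>s. Re (cnj (f s) * g s)) has_real_derivative Re (cnj f' * g s + cnj (f s) * g')) (at s)"
proof -
  have "((\<lambda>s. cnj (f s) * g s) has_vector_derivative (cnj (f s) * g' + cnj f' * g s)) (at s)"
    by (intro has_vector_derivative_mult has_vector_derivative_cnj assms)
  from has_field_derivative_Re[OF this] show ?thesis by (simp add: add.commute)
qed

text \<open>The suffixes 1 and 11 stand for one and two applications of \<open>r * d/dr\<close>, the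
  suffixes 2 and 22 for \<open>d/dt\<close>. Products of first derivatives cancel when the radial
  flux is differentiated, and the angular second derivatives can be added at no cost because
  \<open>b * u2 - u * b2\<close> is periodic.\<close>

lemma green_polar:
  fixes u u1 u11 u2 u22 b b1 b11 b2 b22 :: "real \<Rightarrow> real \<Rightarrow> real"
  assumes r: "0 < r" "r < R"
    and u1: "\<And>r t. 0 < r \<Longrightarrow> r < R \<Longrightarrow> ((\<lambda>r. u r t) has_real_derivative u1 r t / r) (at r)"
    and u11: "\<And>r t. 0 < r \<Longrightarrow> r < R \<Longrightarrow> ((\<lambda>r. u1 r t) has_real_derivative u11 r t / r) (at r)"
    and b1: "\<And>r t. 0 < r \<Longrightarrow> r < R \<Longrightarrow> ((\<lambda>r. b r t) has_real_derivative b1 r t / r) (at r)"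
    and b11: "\<And>r t. 0 < r \<Longrightarrow> r < R \<Longrightarrow> ((\<lambda>r. b1 r t) has_real_derivative b11 r t / r) (at r)"
    and u2: "\<And>t. (u r has_real_derivative u2 r t) (at t)"
    and u22: "\<And>t. (u2 r has_real_derivative u22 r t) (at t)"
    and b2: "\<And>t. (b r has_real_derivative b2 r t) (at t)"
    and b22: "\<And>t. (b2 r has_real_derivative b22 r t) (at t)"
    and cont: "continuous_on ({0<..<R} \<times> {0..2*pi}) (\<lambda>(r,t). u r t)"
      "continuous_on ({0<..<R} \<times> {0..2*pi}) (\<lambda>(r,t). b r t)"
      "continuous_on ({0<..<R} \<times> {0..2*pi}) (\<lambda>(r,t). u1 r t)"
      "continuous_on ({0<..<R} \<times> {0..2*pi}) (\<lambda>(r,t). b1 r t)"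
      "continuous_on ({0<..<R} \<times> {0..2*pi}) (\<lambda>(r,t). u11 r t)"
      "continuous_on ({0<..<R} \<times> {0..2*pi}) (\<lambda>(r,t). b11 r t)"
    and per: "u r (2*pi) = u r 0" "b r (2*pi) = b r 0" "u2 r (2*pi) = u2 r 0" "b2 r (2*pi) = b2 r 0"
  shows "((\<lambda>r. integral {0..2*pi} (\<lambda>t. b r t * u1 r t - u r t * b1 r t)) has_real_derivative
      integral {0..2*pi} (\<lambda>t. b r t * (u11 r t + u22 r t) - u r t * (b11 r t + b22 r t)) / r) (at r)"
proof -
  have sl: "continuous_on {0..2*pi} (\<lambda>t. f s t)"
    if "continuous_on ({0<..<R} \<times> {0..2*pi}) (\<lambda>(r,t). f r t)" "0 < s" "s < R" for f :: "real \<Rightarrow> real \<Rightarrow> real" and s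
  proof -
    have "continuous_on {0..2*pi} (\<lambda>t. (s, t))" "(\<lambda>t. (s,t)) ` {0..2*pi} \<subseteq> {0<..<R} \<times> {0..2*pi}"
      using that(2,3) by (auto intro!: continuous_on_Pair continuous_on_const continuous_on_id)
    from continuous_on_compose2[OF that(1) this] show ?thesis by simp
  qed
  note slc = cont[THEN sl]
  have "((\<lambda>r. integral (cbox 0 (2*pi)) (\<lambda>t. b r t * u1 r t - u r t * b1 r t)) has_field_derivative
      integral (cbox 0 (2*pi)) (\<lambda>t. (b r t * u11 r t - u r t * b11 r t) / r)) (at r within {0<..<R})"
  proof (rule leibniz_rule_field_derivative)
    fix s t assume s: "s \<in> {0<..<R}"
    show "((\<lambda>r. b r t * u1 r t - u r t * b1 r t) has_field_derivative
           (b s t * u11 s t - u s t * b11 s t) / s) (at s within {0<..<R})"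
      using s by (auto intro!: derivative_eq_intros DERIV_subset[OF u1] DERIV_subset[OF u11]
         DERIV_subset[OF b1] DERIV_subset[OF b11] simp: field_simps)
  next
    fix s assume "s \<in> {0<..<R}"
    thus "(\<lambda>t. b s t * u1 s t - u s t * b1 s t) integrable_on cbox 0 (2*pi)"
      by (auto intro!: integrable_continuous_interval continuous_intros slc)
  next
    show "continuous_on ({0<..<R} \<times> cbox 0 (2 * pi)) (\<lambda>(r, t). (b r t * u11 r t - u r t * b11 r t) / r)"
      using cont by (auto simp: case_prod_beta intro!: continuous_intros)
  qed (use r in auto)
  hence 1: "((\<lambda>r. integral {0..2*pi} (\<lambda>t. b r t * u1 r t - u r t * b1 r t)) has_field_derivative
      integral {0..2*pi} (\<lambda>t. (b r t * u11 r t - u r t * b11 r t) / r)) (at r)"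
    using r by (simp add: at_within_open[of r "{0<..<R}"])
  have "((\<lambda>t. b r t * u22 r t - u r t * b22 r t) has_integral
      (b r (2*pi) * u2 r (2*pi) - u r (2*pi) * b2 r (2*pi)) - (b r 0 * u2 r 0 - u r 0 * b2 r 0)) {0..2*pi}"
  proof (rule fundamental_theorem_of_calculus)
    fix t assume "t \<in> {0..2*pi}"
    have "((\<lambda>t. b r t * u2 r t - u r t * b2 r t) has_real_derivative b r t * u22 r t - u r t * b22 r t) (at t)"
      by (auto intro!: derivative_eq_intros u2 u22 b2 b22)
    thus "((\<lambda>t. b r t * u2 r t - u r t * b2 r t) has_vector_derivative b r t * u22 r t - u r t * b22 r t) (at t within {0..2*pi})"

      by (simp add: has_real_derivative_iff_has_vector_derivative[symmetric] has_field_derivative_at_within)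
  qed simp
  hence 2: "((\<lambda>t. b r t * u22 r t - u r t * b22 r t) has_integral 0) {0..2*pi}"
    by (simp add: per)
  have 3: "((\<lambda>t. b r t * u11 r t - u r t * b11 r t) has_integral
     integral {0..2*pi} (\<lambda>t. b r t * u11 r t - u r t * b11 r t)) {0..2*pi}"
    using r by (intro integrable_integral integrable_continuous_interval continuous_on_diff continuous_on_mult slc)
  have "integral {0..2*pi} (\<lambda>t. b r t * (u11 r t + u22 r t) - u r t * (b11 r t + b22 r t))
      = integral {0..2*pi} (\<lambda>t. b r t * u11 r t - u r t * b11 r t)"
    using has_integral_add[OF 3 2] by (intro integral_unique) (simp add: algebra_simps)
  with 1 show ?thesis by simp
qed

section \<open>Functions of the form \<open>h (|G|^2)\<close> in polar coordinates\<close>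

definition lapf :: "(real \<Rightarrow> real) \<Rightarrow> (real \<Rightarrow> real) \<Rightarrow> (complex \<Rightarrow> complex) \<Rightarrow> complex \<Rightarrow> real" where
  "lapf h' h'' G z = 4 * (cmod (rad G z))\<^sup>2 * (h' ((cmod (G z))\<^sup>2) + (cmod (G z))\<^sup>2 * h'' ((cmod (G z))\<^sup>2))"

text \<open>For the function \<open>h ((cmod (G z))\<^sup>2)\<close>, \<open>lapf\<close> is
  \<open>(cmod z)\<^sup>2\<close> times the Laplacian and \<open>radf\<close> is
  \<open>r * d/dr\<close>.\<close>

definition radf :: "(real \<Rightarrow> real) \<Rightarrow> (complex \<Rightarrow> complex) \<Rightarrow> complex \<Rightarrow> real" where
  "radf h' G z = 2 * h' ((cmod (G z))\<^sup>2) * Re (cnj (G z) * rad G z)"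

lemma continuous_on_polar:
  assumes "continuous_on (ball 0 R) (f :: complex \<Rightarrow> real)"
  shows "continuous_on ({0..<R} \<times> UNIV) (\<lambda>(r,t). f (complex_of_real r * cis t))"
  unfolding case_prod_beta
  by (rule continuous_on_compose2[OF assms])
     (auto intro!: continuous_intros rcis_in_ball simp del: mem_ball)

lemma continuous_on_h_norm:
  assumes "continuous_on {0..} h" "continuous_on S (G :: complex \<Rightarrow> complex)"
  shows "continuous_on S (\<lambda>z. h ((cmod (G z))\<^sup>2) :: real)"
  by (rule continuous_on_compose2[OF assms(1)]) (auto intro!: continuous_intros assms)

text \<open>Differentiability at \<open>y = 0\<close> is two-sided, so \<open>h\<close> has to
  extend to slightly negative arguments. The functions \<open>(y + e) powr c\<close> with
  \<open>e > 0\<close> qualify even for small \<open>c\<close>, which is one reason for the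
  regularisation by \<open>e\<close>.\<close>

locale polar_pair =
  fixes h h' h'' :: "real \<Rightarrow> real" and G :: "complex \<Rightarrow> complex" and R :: real
  assumes h: "\<And>y. 0 \<le> y \<Longrightarrow> (h has_real_derivative h' y) (at y)"
    and h': "\<And>y. 0 \<le> y \<Longrightarrow> (h' has_real_derivative h'' y) (at y)"
    and h'': "continuous_on {0..} h''"
    and G: "G holomorphic_on ball 0 R"
begin

lemma cont_h: "continuous_on {0..} h"
  using h by (auto intro!: DERIV_continuous_on[where D=h'] dest: has_field_derivative_at_within)
lemma cont_h': "continuous_on {0..} h'"
  using h' by (auto intro!: DERIV_continuous_on[where D=h''] dest: has_field_derivative_at_within)

lemma cont_G: "continuous_on (ball 0 R) G" "continuous_on (ball 0 R) (rad G)" "continuous_on (ball 0 R) (rad (rad G))"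
  using G by (simp_all add: rad_holomorphic holomorphic_on_imp_continuous_on)

lemma cont_radf: "continuous_on (ball 0 R) (radf h' G)"
  unfolding radf_def by (intro continuous_on_mult continuous_on_const continuous_on_Re continuous_on_cnj
      continuous_on_h_norm[OF cont_h' cont_G(1)] cont_G)

lemma cont_lapf: "continuous_on (ball 0 R) (lapf h' h'' G)"
  unfolding lapf_def by (intro continuous_on_mult continuous_on_add continuous_on_power continuous_on_norm continuous_on_const
      continuous_on_h_norm[OF cont_h' cont_G(1)] continuous_on_h_norm[OF h'' cont_G(1)] cont_G)

lemma cont_hG: "continuous_on (ball 0 R) (\<lambda>z. h ((cmod (G z))\<^sup>2))"
  by (rule continuous_on_h_norm[OF cont_h cont_G(1)])

text \<open>\<open>radf2\<close>, \<open>ang1\<close> and \<open>ang2\<close> are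
  \<open>(r * d/dr)^2\<close>, \<open>d/dt\<close> and \<open>(d/dt)^2\<close> of
  \<open>h ((cmod (G z))\<^sup>2)\<close>.\<close>

definition radf2 where "radf2 z = 4 * h'' ((cmod (G z))\<^sup>2) * (Re (cnj (G z) * rad G z))\<^sup>2
    + 2 * h' ((cmod (G z))\<^sup>2) * ((cmod (rad G z))\<^sup>2 + Re (cnj (G z) * rad (rad G) z))"

definition ang2 where "ang2 z = 4 * h'' ((cmod (G z))\<^sup>2) * (Im (cnj (G z) * rad G z))\<^sup>2
    + 2 * h' ((cmod (G z))\<^sup>2) * ((cmod (rad G z))\<^sup>2 - Re (cnj (G z) * rad (rad G) z))"

definition ang1 where "ang1 z = - 2 * h' ((cmod (G z))\<^sup>2) * Im (cnj (G z) * rad G z)"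

lemma cont_radf2: "continuous_on (ball 0 R) radf2"
  unfolding radf2_def by (intro continuous_on_mult continuous_on_add continuous_on_power continuous_on_norm continuous_on_const
      continuous_on_Re continuous_on_cnj
      continuous_on_h_norm[OF cont_h' cont_G(1)] continuous_on_h_norm[OF h'' cont_G(1)] cont_G)

text \<open>The terms with \<open>rad (rad G)\<close> occur with opposite signs and cancel, because
  the angular derivative of a holomorphic function is \<open>\<i>\<close> times its radial one. The
  squares of the real and imaginary parts of \<open>cnj (G z) * rad G z\<close> combine to
  \<open>|G|^2 |rad G|^2\<close>.\<close>

lemma radf2_add_ang2: "radf2 z + ang2 z = lapf h' h'' G z"
proof -
  have "(Re (cnj (G z) * rad G z))\<^sup>2 + (Im (cnj (G z) * rad G z))\<^sup>2 = (cmod (G z))\<^sup>2 * (cmod (rad G z))\<^sup>2"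
    by (metis cmod_power2 complex_mod_cnj norm_mult power_mult_distrib)
  moreover have "4 * A * P + 2 * B * (M + e) + (4 * A * Q + 2 * B * (M - e)) = 4 * M * (B + N * A)"
    if "P + Q = N * M" for A B P Q M N e :: real
    using that by algebra
  ultimately show ?thesis unfolding radf2_def ang2_def lapf_def by blast
qed

lemma norm_sq_Re: "(cmod w)\<^sup>2 = Re (cnj w * w)"
  by (simp add: cmod_power2) (simp add: power2_eq_square)

lemma deriv_hG:
  assumes "(g has_vector_derivative g') (at s)"
  shows "((\<lambda>s. h ((cmod (g s))\<^sup>2)) has_real_derivative h' ((cmod (g s))\<^sup>2) * (2 * Re (cnj (g s) * g'))) (at s)"
proof -
  have "((\<lambda>s. (cmod (g s))\<^sup>2) has_real_derivative 2 * Re (cnj (g s) * g')) (at s)"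
    using has_real_derivative_Re_cnj_mult[OF assms assms] unfolding norm_sq_Re
    by (rule DERIV_cong) (simp add: algebra_simps)
  from DERIV_chain2[OF h this] show ?thesis by simp
qed

lemma deriv_h'G:
  assumes "(g has_vector_derivative g') (at s)"
  shows "((\<lambda>s. h' ((cmod (g s))\<^sup>2)) has_real_derivative h'' ((cmod (g s))\<^sup>2) * (2 * Re (cnj (g s) * g'))) (at s)"
proof -
  have "((\<lambda>s. (cmod (g s))\<^sup>2) has_real_derivative 2 * Re (cnj (g s) * g')) (at s)"
    using has_real_derivative_Re_cnj_mult[OF assms assms] unfolding norm_sq_Re
    by (rule DERIV_cong) (simp add: algebra_simps)
  from DERIV_chain2[OF h' this] show ?thesis by simp
qed

lemma deriv_r:
  assumes "0 < r" "r < R"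
  shows "((\<lambda>r. h ((cmod (G (complex_of_real r * cis t)))\<^sup>2)) has_real_derivative radf h' G (complex_of_real r * cis t) / r) (at r)"
  by (rule DERIV_cong[OF deriv_hG[OF polar_deriv_radius[OF G assms]]])
     (use assms in \<open>simp add: radf_def field_simps\<close>)

lemma deriv_rr:
  assumes r: "0 < r" "r < R"
  shows "((\<lambda>r. radf h' G (complex_of_real r * cis t)) has_real_derivative radf2 (complex_of_real r * cis t) / r) (at r)"
  unfolding radf_def
  apply (rule DERIV_cong)
  apply (rule DERIV_mult DERIV_const deriv_h'G has_real_derivative_Re_cnj_mult polar_deriv_radius[OF _ r] G holomorphic_intros open_ball)+
  using r apply (simp add: radf2_def field_simps power2_eq_square cmod_power2[unfolded power2_eq_square])
  done

lemma deriv_t: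
  assumes "0 < r" "r < R"
  shows "((\<lambda>t. h ((cmod (G (complex_of_real r * cis t)))\<^sup>2)) has_real_derivative ang1 (complex_of_real r * cis t)) (at t)"
  by (rule DERIV_cong[OF deriv_hG[OF polar_deriv_angle[OF G]]])
     (use assms in \<open>simp_all add: ang1_def field_simps\<close>)

lemma deriv_tt:
  assumes r: "0 < r" "r < R"
  shows "((\<lambda>t. ang1 (complex_of_real r * cis t)) has_real_derivative ang2 (complex_of_real r * cis t)) (at t)"
proof -
  have *: "Im (cnj a * b) = Re (cnj a * (-\<i> * b))" for a b by simp
  have d: "((\<lambda>t. - \<i> * rad G (complex_of_real r * cis t)) has_vector_derivative
        (- \<i> * (\<i> * rad (rad G) (complex_of_real r * cis t)))) (at t)" for t
    by (intro has_vector_derivative_mult_right polar_deriv_angle[of _ R] holomorphic_intros G) (use r in auto)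
  have p: "((\<lambda>t. G (complex_of_real r * cis t)) has_vector_derivative
           \<i> * rad G (complex_of_real r * cis t)) (at t)" for t
    by (rule polar_deriv_angle[OF G]) (use r in auto)
  show ?thesis
    unfolding ang1_def *
    apply (rule DERIV_cong)
     apply (rule DERIV_mult DERIV_const deriv_h'G has_real_derivative_Re_cnj_mult p d)+
    apply (simp add: ang2_def field_simps power2_eq_square cmod_power2[unfolded power2_eq_square])
    done
qed

end

text \<open>Two different outer functions are needed: one carries the powers of
  \<open>|F|^2 + e\<close>, the other is either a constant or the comparison function built from a
  disc automorphism.\<close>

lemma green_circle:
  assumes "polar_pair h h' h'' G R" "polar_pair k k' k'' H R" and r: "0 < r" "r < R"
  shows "((\<lambda>r. integral {0..2*pi} (\<lambda>t.
        k ((cmod (H (complex_of_real r * cis t)))\<^sup>2) * radf h' G (complex_of_real r * cis t)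
        - h ((cmod (G (complex_of_real r * cis t)))\<^sup>2) * radf k' H (complex_of_real r * cis t))) has_real_derivative
      integral {0..2*pi} (\<lambda>t.
        k ((cmod (H (complex_of_real r * cis t)))\<^sup>2) * lapf h' h'' G (complex_of_real r * cis t)
        - h ((cmod (G (complex_of_real r * cis t)))\<^sup>2) * lapf k' k'' H (complex_of_real r * cis t)) / r) (at r)"
proof -
  interpret a: polar_pair h h' h'' G R by fact
  interpret b: polar_pair k k' k'' H R by fact
  have c: "continuous_on ({0<..<R} \<times> {0..2*pi}) (\<lambda>(r,t). f (complex_of_real r * cis t))"
    if "continuous_on (ball 0 R) f" for f :: "complex \<Rightarrow> real"
    by (rule continuous_on_subset[OF continuous_on_polar[OF that]]) auto
  have e: "cis (2*pi) = cis 0" by simp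
  note g = green_polar[where u="\<lambda>r t. h ((cmod (G (complex_of_real r * cis t)))\<^sup>2)"
      and b="\<lambda>r t. k ((cmod (H (complex_of_real r * cis t)))\<^sup>2)"
      and ?u1.0="\<lambda>r t. radf h' G (complex_of_real r * cis t)" and ?b1.0="\<lambda>r t. radf k' H (complex_of_real r * cis t)"
      and ?u11.0="\<lambda>r t. a.radf2 (complex_of_real r * cis t)" and ?b11.0="\<lambda>r t. b.radf2 (complex_of_real r * cis t)"
      and ?u2.0="\<lambda>r t. a.ang1 (complex_of_real r * cis t)" and ?b2.0="\<lambda>r t. b.ang1 (complex_of_real r * cis t)"
      and ?u22.0="\<lambda>r t. a.ang2 (complex_of_real r * cis t)" and ?b22.0="\<lambda>r t. b.ang2 (complex_of_real r * cis t)",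
      OF r a.deriv_r a.deriv_rr b.deriv_r b.deriv_rr a.deriv_t[OF r] a.deriv_tt[OF r]
      b.deriv_t[OF r] b.deriv_tt[OF r] c[OF a.cont_hG] c[OF b.cont_hG] c[OF a.cont_radf] c[OF b.cont_radf]
      c[OF a.cont_radf2] c[OF b.cont_radf2], unfolded a.radf2_add_ang2 b.radf2_add_ang2]
  show ?thesis by (rule g) (simp_all add: e)
qed

text \<open>Green's formula against the constant \<open>1\<close> shows that the flux
  \<open>J\<close> has nonnegative derivative. It starts at \<open>0\<close>, so it stays
  nonnegative, and \<open>J r / r\<close> is the derivative of the circle mean
  \<open>M\<close>.\<close>

lemma lapf_nonneg_imp_circle_mean:
  assumes P: "polar_pair h h' h'' G R" and R: "1 < R"
    and lap: "\<And>z. z \<in> ball 0 R \<Longrightarrow> 0 \<le> lapf h' h'' G z"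
  shows "2 * pi * h ((cmod (G 0))\<^sup>2) \<le> integral {0..2*pi} (\<lambda>t. h ((cmod (G (cis t)))\<^sup>2))"
proof -
  interpret polar_pair h h' h'' G R by fact
  define J where "J r = integral {0..2*pi} (\<lambda>t. radf h' G (complex_of_real r * cis t))" for r
  define M where "M r = integral {0..2*pi} (\<lambda>t. h ((cmod (G (complex_of_real r * cis t)))\<^sup>2))" for r
  have one: "polar_pair (\<lambda>_. 1) (\<lambda>_. 0) (\<lambda>_. 0) (\<lambda>_. 0) R"
    by unfold_locales auto
  have "radf (\<lambda>_. 0) (\<lambda>_. 0) z = 0" "lapf (\<lambda>_. 0) (\<lambda>_. 0) (\<lambda>_. 0) z = 0" for z
    by (simp_all add: radf_def lapf_def)
  hence dJ: "(J has_real_derivative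
      integral {0..2*pi} (\<lambda>t. lapf h' h'' G (complex_of_real r * cis t)) / r) (at r)" if "0 < r" "r < R" for r
    using green_circle[OF P one that] by (simp add: J_def[abs_def])
  have cont: "continuous_on {0..1} (\<lambda>r. integral (cbox 0 (2*pi)) (\<lambda>t. f (complex_of_real r * cis t)))"
    if "continuous_on (ball 0 R) f" for f :: "complex \<Rightarrow> real"
  proof (rule integral_continuous_on_param)
    show "continuous_on ({0..1} \<times> cbox 0 (2*pi)) (\<lambda>(r, t). f (complex_of_real r * cis t))"
      by (rule continuous_on_subset[OF continuous_on_polar[OF that]]) (use R in auto)
  qed
  have contJ: "continuous_on {0..1} J" using cont[OF cont_radf] by (simp add: J_def[abs_def])
  have contM: "continuous_on {0..1} M" using cont[OF cont_hG] by (simp add: M_def[abs_def])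
  have J0: "J 0 = 0" by (simp add: J_def radf_def rad_def)
  have Jnn: "0 \<le> J r" if "0 \<le> r" "r \<le> 1" for r
  proof -
    have "J 0 \<le> J r"
    proof (rule DERIV_nonneg_imp_increasing_open[OF that(1)])
      fix x assume x: "0 < x" "x < r"
      have "0 \<le> integral {0..2*pi} (\<lambda>t. lapf h' h'' G (complex_of_real x * cis t))"
        using x that R by (intro integral_nonneg lap rcis_in_ball)
          (auto intro!: integrable_continuous_interval continuous_on_compose2[OF cont_lapf] continuous_intros
             simp: norm_mult)
      thus "\<exists>y. (J has_real_derivative y) (at x) \<and> 0 \<le> y"
        using dJ[of x] x that R by (intro exI conjI) (assumption | simp)+
    qed (rule continuous_on_subset[OF contJ], use that in auto)
    thus ?thesis by (simp add: J0)
  qed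
  have dM: "(M has_real_derivative J r / r) (at r)" if r: "0 < r" "r < R" for r
  proof -
    have "((\<lambda>r. integral (cbox 0 (2*pi)) (\<lambda>t. h ((cmod (G (complex_of_real r * cis t)))\<^sup>2))) has_field_derivative
      integral (cbox 0 (2*pi)) (\<lambda>t. radf h' G (complex_of_real r * cis t) / r)) (at r within {0<..<R})"
    proof (rule leibniz_rule_field_derivative)
      fix s t assume s: "s \<in> {0<..<R}"
      show "((\<lambda>r. h ((cmod (G (complex_of_real r * cis t)))\<^sup>2)) has_field_derivative radf h' G (complex_of_real s * cis t) / s) (at s within {0<..<R})"
        using deriv_r[of s t] s by (simp add: has_field_derivative_at_within)
    next
      fix s assume "s \<in> {0<..<R}"
      thus "(\<lambda>t. h ((cmod (G (complex_of_real s * cis t)))\<^sup>2)) integrable_on cbox 0 (2*pi)"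
        by (auto intro!: integrable_continuous_interval continuous_on_compose2[OF cont_hG] continuous_intros simp: norm_mult)
    next
      have "continuous_on ({0<..<R} \<times> cbox 0 (2 * pi)) (\<lambda>(r, t). radf h' G (complex_of_real r * cis t))"
        by (rule continuous_on_subset[OF continuous_on_polar[OF cont_radf]]) auto
      thus "continuous_on ({0<..<R} \<times> cbox 0 (2 * pi)) (\<lambda>(r, t). radf h' G (complex_of_real r * cis t) / r)"
        by (auto simp: case_prod_beta intro!: continuous_intros)
    qed (use r in auto)
    thus ?thesis
      using r by (simp add: at_within_open[of r "{0<..<R}"] M_def[abs_def] J_def)
  qed
  have "M 0 \<le> M 1"
  proof (rule DERIV_nonneg_imp_increasing_open[where f=M])
    fix x :: real assume x: "0 < x" "x < 1"
    show "\<exists>y. (M has_real_derivative y) (at x) \<and> 0 \<le> y"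
      using dM[of x] Jnn[of x] x R by (intro exI[of _ "J x / x"]) auto
  qed (use contM in auto)
  thus ?thesis by (simp add: M_def)
qed

section \<open>The Poisson kernel, without the factor 1 / (2 pi), and automorphisms of the
  disc\<close>

definition Pk :: "complex \<Rightarrow> real \<Rightarrow> real" where
  "Pk z t = (1 - (cmod z)\<^sup>2) / (cmod (cis t - z))\<^sup>2"

lemma cis_neq: "cmod z < 1 \<Longrightarrow> cis t \<noteq> z" by auto

lemma Pk_pos: "cmod z < 1 \<Longrightarrow> 0 < Pk z t"
  unfolding Pk_def by (intro divide_pos_pos) (auto simp: abs_square_less_1)

lemma Pk_nonneg [simp]: "cmod z < 1 \<Longrightarrow> 0 \<le> Pk z t"
  using Pk_pos less_imp_le by blast

lemma continuous_on_Pk [continuous_intros]: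
  "cmod z < 1 \<Longrightarrow> continuous_on S f \<Longrightarrow> continuous_on S (\<lambda>t. Pk z (f t))"
  unfolding Pk_def by (intro continuous_intros) (use cis_neq in auto)

lemma cmod_mobius_id:
  "(cmod (1 + cnj z * w))\<^sup>2 - (cmod (w + z))\<^sup>2 = (1 - (cmod z)\<^sup>2) * (1 - (cmod w)\<^sup>2)"
  unfolding cmod_power2 by (simp add: algebra_simps power2_eq_square)

lemma Re_one_minus_pos: "cmod w < 1 \<Longrightarrow> 0 < Re (1 - w)"
  using abs_Re_le_cmod[of w] by auto

lemma cmod_cis_diff: "cmod (1 - cnj w * cis t) = cmod (cis t - w)"
proof -
  have "cis t - w = cis t * cnj (1 - cnj w * cis t)" by (simp add: algebra_simps cis_cnj cis_mult)
  thus ?thesis by (simp only: norm_mult norm_cis complex_mod_cnj mult_1_left)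
qed

text \<open>An automorphism that sends \<open>0\<close> to \<open>z\<close> pushes arc length
  forward to the density \<open>Pk z\<close>. Statements about values at the centre thereby become
  statements about Poisson integrals at \<open>z\<close>.\<close>

lemma mobius_on_circle:
  assumes z: "cmod z < 1"
  obtains p R where "1 < R" "p holomorphic_on ball 0 R" "p 0 = z" "\<And>w. w \<in> cball 0 1 \<Longrightarrow> p w \<in> cball 0 1"
    "\<And>f. continuous_on (sphere 0 1) f \<Longrightarrow>
       integral {0..2*pi} (\<lambda>s. f (p (cis s))) = integral {0..2*pi} (\<lambda>t. f (cis t) * Pk z t :: real)"
proof -
  \<comment> \<open>\<open>s\<close> is a continuous argument of the boundary values of
    \<open>(w - z) / (1 - cnj z * w)\<close>: at \<open>cis t\<close> that quotient equals
    \<open>cis t * cnj w' / w'\<close> with \<open>w' = 1 - cnj z * cis t\<close>. Since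
    \<open>Re w' > 0\<close>, the principal logarithm is smooth along the whole circle.\<close>
  define s where "s t = t - 2 * Im (Ln (1 - cnj z * cis t))" for t
  \<comment> \<open>The factor \<open>cis (s 0)\<close> makes \<open>p\<close> fix the point
    \<open>1\<close>, so that the substitution maps \<open>{0..2*pi}\<close> onto itself rather than
    onto a shifted interval.\<close>
  define p where "p w = (w * cis (s 0) + z) / (1 + cnj z * (w * cis (s 0)))" for w
  \<comment> \<open>Up to the radius \<open>2 - cmod z\<close> the denominator of \<open>p\<close>
    does not vanish, because
    \<open>cmod z * (2 - cmod z) = 1 - (1 - cmod z)\<^sup>2 < 1\<close>.\<close>
  define R where "R = 1 + (1 - cmod z)"
  have R: "1 < R" using z by (simp add: R_def)
  have zR: "cmod z * R < 1"
  proof -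
    have "cmod z * R = 1 - (1 - cmod z)\<^sup>2" by (simp add: R_def power2_eq_square algebra_simps)
    thus ?thesis using z by simp
  qed
  have nz: "1 + cnj z * (w * cis (s 0)) \<noteq> 0" if "cmod w < R" for w
  proof
    assume "1 + cnj z * (w * cis (s 0)) = 0"
    hence "cnj z * (w * cis (s 0)) = -1" by (simp add: add_eq_0_iff)
    hence "cmod (cnj z * (w * cis (s 0))) = 1" by (metis norm_minus_cancel norm_one)
    hence "cmod z * cmod w = 1" by (simp add: norm_mult)
    moreover have "cmod z * cmod w \<le> cmod z * R" using that by (intro mult_left_mono) auto
    ultimately show False using zR by simp
  qed
  have p_hol: "p holomorphic_on ball 0 R"
    unfolding p_def by (intro holomorphic_intros) (use nz in auto)
  have p_ball: "p w \<in> cball 0 1" if "w \<in> cball 0 1" for w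
  proof -
    let ?v = "w * cis (s 0)"
    have "(cmod (1 + cnj z * ?v))\<^sup>2 - (cmod (?v + z))\<^sup>2 \<ge> 0"
      unfolding cmod_mobius_id using that z by (intro mult_nonneg_nonneg) (auto simp: norm_mult abs_square_le_1)
    hence "cmod (?v + z) \<le> cmod (1 + cnj z * ?v)" by (simp add: power2_le_iff_abs_le)
    thus ?thesis using nz[of w] that R by (simp add: p_def norm_divide divide_le_eq_1)
  qed
  have W: "cmod (cnj z * cis t) < 1" for t using z by (simp add: norm_mult)
  have ds: "(s has_real_derivative Pk z t) (at t)" for t
  proof -
    let ?w = "1 - cnj z * cis t"
    have w: "0 < Re ?w" by (rule Re_one_minus_pos[OF W])
    hence wn: "?w \<notin> \<real>\<^sub>\<le>\<^sub>0" using complex_nonpos_Reals_iff by force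
    have "((\<lambda>t. 1 - cnj z * cis t) has_vector_derivative (- (cnj z * (\<i> * cis t)))) (at t)"
      unfolding has_vector_derivative_def
      by (rule derivative_eq_intros refl | simp add: scaleR_conv_of_real algebra_simps)+
    from field_vector_diff_chain_at[OF this, of Ln] has_field_derivative_Ln[OF wn]
    have "((Ln \<circ> (\<lambda>t. 1 - cnj z * cis t)) has_vector_derivative - (cnj z * (\<i> * cis t)) * inverse ?w) (at t)"
      by blast
    from has_field_derivative_Im[OF this]
    have "((\<lambda>t. Im (Ln (1 - cnj z * cis t))) has_real_derivative Im (- (cnj z * (\<i> * cis t)) * inverse ?w)) (at t)"
      by (simp add: o_def)
    hence "(s has_real_derivative 1 - 2 * Im (- (cnj z * (\<i> * cis t)) * inverse ?w)) (at t)"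
      unfolding s_def[abs_def] by (rule DERIV_diff[OF DERIV_ident DERIV_cmult])
    moreover have "1 - 2 * Im (- (cnj z * (\<i> * cis t)) * inverse ?w) = Pk z t"
    proof -
      have "Im (- (cnj z * (\<i> * cis t)) * inverse ?w) = - Re (cnj z * cis t * inverse ?w)"
        by (simp add: algebra_simps)
      also have "cnj z * cis t * inverse ?w = inverse ?w - 1"
      proof -
        have "inverse ?w * ?w = 1" using w by (intro left_inverse) (metis less_irrefl zero_complex.sel(1))
        thus ?thesis by (simp add: algebra_simps)
      qed
      finally have *: "1 - 2 * Im (- (cnj z * (\<i> * cis t)) * inverse ?w) = 2 * Re (inverse ?w) - 1" by simp
      note N = cmod_cis_diff[of z t, symmetric]
      have "(cmod ?w)\<^sup>2 \<noteq> 0"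
        using w by (metis less_irrefl norm_eq_zero zero_complex.sel(1) zero_eq_power2)
      moreover have "(cmod ?w)\<^sup>2 = 1 - 2 * Re (cnj z * cis t) + (cmod z)\<^sup>2"
      proof -
        have "(cmod ?w)\<^sup>2 = 1 - 2 * Re (cnj z * cis t) + (cmod (cnj z * cis t))\<^sup>2"
          unfolding cmod_power2 by (simp add: power2_eq_square algebra_simps)
        thus ?thesis by (simp add: norm_mult)
      qed
      moreover have "Re (inverse ?w) = Re ?w / (cmod ?w)\<^sup>2" unfolding cmod_power2 by (simp only: inverse_complex.simps)
      ultimately show ?thesis unfolding * Pk_def N by (simp add: field_simps)
    qed
    ultimately show ?thesis by simp
  qed
  have s2: "s (2*pi) = s 0 + 2 * pi" by (simp add: s_def)
  have pcis: "p (cis (s t - s 0)) = cis t" for t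
  proof -
    let ?w = "1 - cnj z * cis t"
    have w: "0 < Re ?w" by (rule Re_one_minus_pos[OF W])
    hence w0: "?w \<noteq> 0" by (metis less_irrefl zero_complex.sel(1))
    have "cis (- 2 * Im (Ln ?w)) = cnj ?w / ?w"
    proof -
      have "?w = exp (Ln ?w)" using w0 by simp
      also have "\<dots> = of_real (exp (Re (Ln ?w))) * cis (Im (Ln ?w))" by (simp add: exp_eq_polar)
      finally have e: "?w = of_real (exp (Re (Ln ?w))) * cis (Im (Ln ?w))" .
      hence "cnj ?w = of_real (exp (Re (Ln ?w))) * cis (- Im (Ln ?w))"
        by (metis complex_cnj_complex_of_real complex_cnj_mult cis_cnj)
      with e have "cnj ?w / ?w = cis (- Im (Ln ?w)) / cis (Im (Ln ?w))"
        by (metis mult_divide_mult_cancel_left_if exp_not_eq_zero of_real_eq_0_iff)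
      thus ?thesis by (simp add: cis_divide)
    qed
    hence "cis (s t) = cis t * (cnj ?w / ?w)"
      unfolding s_def by (metis cis_mult diff_conv_add_uminus mult_minus_left)
    moreover have "cis t * cnj ?w = cis t - z" by (simp add: algebra_simps cis_cnj cis_mult)
    ultimately have c: "cis (s t) = (cis t - z) / ?w" by simp
    have "cis (s t - s 0) * cis (s 0) = cis (s t)" by (simp add: cis_mult)
    hence "p (cis (s t - s 0)) = ((cis t - z) / ?w + z) / (1 + cnj z * ((cis t - z) / ?w))"
      by (simp add: p_def c)
    also have "(cis t - z) / ?w + z = cis t * (1 - cnj z * z) / ?w"
      using w0 by (simp add: field_simps)
    also have "1 + cnj z * ((cis t - z) / ?w) = (1 - cnj z * z) / ?w"
      using w0 by (simp add: field_simps)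
    also have "cis t * (1 - cnj z * z) / ?w / ((1 - cnj z * z) / ?w) = cis t"
    proof -
      have "cmod (cnj z * z) < 1" using z by (simp add: norm_mult abs_square_less_1 power2_eq_square[symmetric])
      hence "1 - cnj z * z \<noteq> 0" by (metis eq_iff_diff_eq_0 less_irrefl norm_one)
      thus ?thesis using w0 by simp
    qed
    finally show ?thesis .
  qed
  have cov: "integral {0..2*pi} (\<lambda>s. f (p (cis s))) = integral {0..2*pi} (\<lambda>t. f (cis t) * Pk z t)"
    if f: "continuous_on (sphere 0 1) f" for f :: "complex \<Rightarrow> real"
  proof -
    have pc: "continuous_on (sphere 0 1) p"
      using R by (intro continuous_on_subset[OF holomorphic_on_imp_continuous_on[OF p_hol]]) auto
    have ps: "p w \<in> sphere 0 1" if "w \<in> sphere 0 1" for w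
    proof -
      let ?v = "w * cis (s 0)"
      have "(cmod (1 + cnj z * ?v))\<^sup>2 - (cmod (?v + z))\<^sup>2 = 0"
        unfolding cmod_mobius_id using that by (auto simp: norm_mult)
      hence "cmod (?v + z) = cmod (1 + cnj z * ?v)" by simp
      thus ?thesis using nz[of w] that R by (simp add: p_def norm_divide)
    qed
    have cc: "continuous_on UNIV (\<lambda>s. f (p (cis s)))"
      by (rule continuous_on_compose2[OF f], rule continuous_on_compose2[OF pc])
         (use ps in \<open>auto intro!: continuous_intros\<close>)
    define g where "g t = s t - s 0" for t
    have dg: "(g has_real_derivative Pk z t) (at t)" for t
      unfolding g_def[abs_def] using ds by (auto intro!: derivative_eq_intros)
    have mono: "g x \<le> g y" if "x \<le> y" for x y
      using DERIV_nonneg_imp_nondecreasing[OF that] dg Pk_nonneg[OF z] by blast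
    have g0: "g 0 = 0" "g (2*pi) = 2*pi" by (simp_all add: g_def s2)
    have "((\<lambda>t. Pk z t *\<^sub>R f (p (cis (g t)))) has_integral integral {g 0..g (2*pi)} (\<lambda>s. f (p (cis s)))) {0..2*pi}"
    proof (rule has_integral_substitution[where c=0 and d="2*pi"])
      show "g ` {0..2 * pi} \<subseteq> {0..2 * pi}"
        using mono[of 0] mono[of _ "2*pi"] g0 by auto
      show "continuous_on {0..2*pi} (\<lambda>s. f (p (cis s)))" by (rule continuous_on_subset[OF cc]) auto
    qed (use g0 dg in \<open>auto intro: has_field_derivative_at_within\<close>)
    thus ?thesis unfolding g0 by (simp add: g_def pcis integral_unique mult.commute)
  qed
  show thesis
    by (rule that[OF R p_hol _ p_ball cov]) (simp_all add: p_def)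
qed

text \<open>The sub-mean value inequality at the centre is applied to \<open>G\<close> composed with
  the automorphism. The condition \<open>lap\<close> says that \<open>h (|G|^2)\<close> is
  subharmonic for every holomorphic \<open>G\<close>.\<close>

lemma sub_poisson:
  assumes P: "polar_pair h h' h'' G R" and R: "1 < R" and z: "cmod z < 1"
    and lap: "\<And>y. y \<ge> 0 \<Longrightarrow> 0 \<le> h' y + y * h'' y"
  shows "2 * pi * h ((cmod (G z))\<^sup>2) \<le> integral {0..2*pi} (\<lambda>t. h ((cmod (G (cis t)))\<^sup>2) * Pk z t)"
proof -
  interpret polar_pair h h' h'' G R by fact
  obtain p R1 where p: "1 < R1" "p holomorphic_on ball 0 R1" "p 0 = z" "\<And>w. w \<in> cball 0 1 \<Longrightarrow> p w \<in> cball 0 1"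
    "\<And>f. continuous_on (sphere 0 1) f \<Longrightarrow>
       integral {0..2*pi} (\<lambda>s. f (p (cis s))) = integral {0..2*pi} (\<lambda>t. f (cis t) * Pk z t :: real)"
    using mobius_on_circle[OF z] by metis
  \<comment> \<open>The automorphism maps the closed disc into itself, hence by compactness maps a
    slightly larger disc into \<open>ball 0 R\<close>. The composition is thus holomorphic past the
    closed disc.\<close>
  have "open (ball 0 R1 \<inter> p -` ball 0 R)"
    by (intro continuous_open_preimage holomorphic_on_imp_continuous_on p open_ball)
  moreover have "cball 0 1 \<subseteq> ball 0 R1 \<inter> p -` ball 0 R" using p R by fastforce
  ultimately obtain e where e: "e > 0" "(\<Union>x\<in>cball 0 1. ball x e) \<subseteq> ball 0 R1 \<inter> p -` ball 0 R"
    using compact_subset_open_imp_ball_epsilon_subset[OF compact_cball] by metis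
  have sub: "ball 0 (1+e) \<subseteq> ball 0 R1 \<inter> p -` ball 0 R"
  proof
    fix w :: complex assume w: "w \<in> ball 0 (1+e)"
    show "w \<in> ball 0 R1 \<inter> p -` ball 0 R"
    proof (cases "cmod w \<le> 1")
      case True thus ?thesis using e by (force)
    next
      case False
      have "w \<noteq> 0" using False by (metis norm_zero zero_le_one)
      have "w \<in> ball (sgn w) e" "sgn w \<in> cball 0 1"
      proof -
        have "sgn w - w = of_real (1 / cmod w - 1) * w" by (use \<open>w \<noteq> 0\<close> in \<open>simp add: sgn_div_norm scaleR_conv_of_real field_simps\<close>)
        hence "cmod (sgn w - w) = \<bar>1 / cmod w - 1\<bar> * cmod w" by (metis norm_mult norm_of_real)
        also have "\<dots> = cmod w - 1" using False \<open>w \<noteq> 0\<close> by (simp add: field_simps abs_if)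
        finally show "w \<in> ball (sgn w) e" using w by (simp add: dist_norm)
        show "sgn w \<in> cball 0 1" by (simp add: norm_sgn)
      qed
      thus ?thesis using e by blast
    qed
  qed
  have comp: "(\<lambda>w. G (p w)) holomorphic_on ball 0 (1+e)"
    using holomorphic_on_compose_gen[OF holomorphic_on_subset[OF p(2)] G, of "ball 0 (1+e)"] sub
    by (auto simp: o_def)
  have P2: "polar_pair h h' h'' (\<lambda>w. G (p w)) (1+e)"
    by unfold_locales (use h h' h'' comp in auto)
  have "2 * pi * h ((cmod (G (p 0)))\<^sup>2) \<le> integral {0..2*pi} (\<lambda>t. h ((cmod (G (p (cis t))))\<^sup>2))"
    by (rule lapf_nonneg_imp_circle_mean[OF P2]) (use e in \<open>auto simp: lapf_def intro!: mult_nonneg_nonneg lap\<close>)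
  also have "\<dots> = integral {0..2*pi} (\<lambda>t. h ((cmod (G (cis t)))\<^sup>2) * Pk z t)"
    by (rule p(5)) (use R in \<open>auto intro!: continuous_on_subset[OF cont_hG]\<close>)
  finally show ?thesis by (simp add: p)
qed

text \<open>Cauchy's formula at the centre for \<open>f\<close> composed with the automorphism,
  followed by the change of variable on the circle.\<close>

lemma poisson_Re:
  assumes "f holomorphic_on ball 0 R" "1 < R" "cmod z < 1"
  shows "integral {0..2*pi} (\<lambda>t. Re (f (cis t)) * Pk z t) = 2 * pi * Re (f z)"
proof -
  obtain p R1 where p: "1 < R1" "p holomorphic_on ball 0 R1" "p 0 = z" "\<And>w. w \<in> cball 0 1 \<Longrightarrow> p w \<in> cball 0 1"
    "\<And>f. continuous_on (sphere 0 1) f \<Longrightarrow>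
       integral {0..2*pi} (\<lambda>s. f (p (cis s))) = integral {0..2*pi} (\<lambda>t. f (cis t) * Pk z t :: real)"
    using mobius_on_circle[OF assms(3)] by metis
  have contf: "continuous_on (cball 0 1) f" "f holomorphic_on ball 0 1"
    using assms by (auto intro!: holomorphic_on_imp_continuous_on elim!: holomorphic_on_subset)
  have contp: "continuous_on (cball 0 1) p"
    using p(1) by (intro continuous_on_subset[OF holomorphic_on_imp_continuous_on[OF p(2)]]) auto
  have pb: "p w \<in> ball 0 R" if "w \<in> cball 0 1" for w using p(4)[OF that] assms by auto
  have "((\<lambda>u. f (p u) / (u - 0)) has_contour_integral (2 * of_real pi * \<i> * f (p 0))) (circlepath 0 1)"
  proof (rule Cauchy_integral_circlepath)
    show "continuous_on (cball 0 1) (\<lambda>u. f (p u))"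
      by (rule continuous_on_compose2[OF contf(1) contp]) (use p in auto)
    have "(f \<circ> p) holomorphic_on ball 0 1"
      by (rule holomorphic_on_compose_gen[OF _ assms(1)]) (use p pb in \<open>auto elim!: holomorphic_on_subset\<close>)
    thus "(\<lambda>u. f (p u)) holomorphic_on ball 0 1" by (simp add: o_def)
  qed auto
  hence "((\<lambda>t. f (p (cis t)) / cis t * \<i> * cis t) has_integral 2 * of_real pi * \<i> * f z) {0..2*pi}"
    unfolding circlepath_def by (subst (asm) has_contour_integral_part_circlepath_iff) (auto simp: p)
  hence "((\<lambda>t. f (p (cis t)) * \<i>) has_integral 2 * of_real pi * \<i> * f z) {0..2*pi}"
    by (simp add: field_simps)
  from has_integral_mult_right[OF this, of "-\<i>"]
  have "((\<lambda>t. f (p (cis t))) has_integral of_real (2 * pi) * f z) {0..2*pi}" by (simp add: mult_ac)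
  from has_integral_Re[OF this]
  have "integral {0..2*pi} (\<lambda>t. Re (f (p (cis t)))) = 2 * pi * Re (f z)"
    by (intro integral_unique) simp
  also have "integral {0..2*pi} (\<lambda>t. Re (f (p (cis t)))) = integral {0..2*pi} (\<lambda>t. Re (f (cis t)) * Pk z t)"
    by (rule p(5)) (auto intro!: continuous_intros continuous_on_subset[OF contf(1)])
  finally show ?thesis .
qed

text \<open>On the circle \<open>Pk w\<close> is the real part of the Herglotz kernel
  \<open>(1 + cnj w * u) / (1 - cnj w * u)\<close>, which is holomorphic on a larger disc. Its
  Poisson integral is therefore its real part at \<open>z\<close>.\<close>

lemma Pk_semigroup:
  assumes "cmod z < 1" "cmod w < 1"
  shows "integral {0..2*pi} (\<lambda>t. Pk w t * Pk z t) = 2 * pi * ((1 - (cmod (w * z))\<^sup>2) / (cmod (1 - cnj w * z))\<^sup>2)"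
proof -
  define R where "R = 1 + (1 - cmod w)"
  have R: "1 < R" using assms by (simp add: R_def)
  have wR: "cmod w * R < 1"
  proof -
    have "cmod w * R = 1 - (1 - cmod w)\<^sup>2" by (simp add: R_def power2_eq_square algebra_simps)
    thus ?thesis using assms by simp
  qed
  have nz: "1 - cnj w * u \<noteq> 0" if "cmod u < R" for u
  proof
    assume "1 - cnj w * u = 0"
    hence "cmod (cnj w * u) = 1" by (metis eq_iff_diff_eq_0 norm_one)
    moreover have "cmod w * cmod u \<le> cmod w * R" using that by (intro mult_left_mono) auto
    ultimately show False using wR by (simp add: norm_mult)
  qed
  define f where "f u = (1 + cnj w * u) / (1 - cnj w * u)" for u
  have hol: "f holomorphic_on ball 0 R"
    unfolding f_def by (intro holomorphic_intros) (use nz in auto)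
  have Ref: "Re (f u) = (1 - (cmod (w * u))\<^sup>2) / (cmod (1 - cnj w * u))\<^sup>2" for u
  proof -
    have "Re (f u) = Re ((1 + cnj w * u) * cnj (1 - cnj w * u)) / (cmod (1 - cnj w * u))\<^sup>2"
      unfolding f_def by (subst complex_div_cnj) (simp add: Re_divide_of_real flip: of_real_power)
    also have "Re ((1 + v) * cnj (1 - v)) = 1 - (cmod v)\<^sup>2" for v
      unfolding cmod_power2 by (simp add: power2_eq_square algebra_simps)
    finally show ?thesis by (simp add: norm_mult)
  qed
  have "Re (f (cis t)) = Pk w t" for t
    unfolding Ref Pk_def cmod_cis_diff by (simp add: norm_mult)
  thus ?thesis using poisson_Re[OF hol R assms(1)] by (simp add: Ref)
qed

lemma Pk_zero: "Pk 0 t = 1" by (simp add: Pk_def)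

lemma integral_Pk: "cmod z < 1 \<Longrightarrow> integral {0..2*pi} (Pk z) = 2 * pi"
  using Pk_semigroup[of z 0] by (simp add: Pk_zero)

lemma cmod_mobius_id_minus:
  "(cmod (1 - cnj z * w))\<^sup>2 - (cmod (w - z))\<^sup>2 = (1 - (cmod z)\<^sup>2) * (1 - (cmod w)\<^sup>2)"
  using cmod_mobius_id[of "-z" w] by simp

lemma nn_integral_continuous_Icc:
  fixes f :: "real \<Rightarrow> real"
  assumes "continuous_on {a..b} f" "\<And>x. x \<in> {a..b} \<Longrightarrow> 0 \<le> f x"
  shows "(\<integral>\<^sup>+x\<in>{a..b}. ennreal (f x) \<partial>lborel) = ennreal (integral {a..b} f)"
  using assms by (intro nn_integral_has_integral_lebesgue' integrable_integral integrable_continuous_interval)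

definition circ :: "real measure" where
  "circ = restrict_space lborel {0..2*pi}"

lemma space_circ [simp]: "space circ = {0..2*pi}"
  by (simp add: circ_def space_restrict_space)

lemma measurable_circ [measurable (raw)]: "f \<in> borel_measurable borel \<Longrightarrow> f \<in> borel_measurable circ"
  unfolding circ_def by (intro measurable_restrict_space1) simp

lemma finite_measure_circ: "finite_measure circ"
  by (rule finite_measureI) (simp add: circ_def emeasure_restrict_space)

lemma sigma_finite_circ: "sigma_finite_measure circ"
  using finite_measure_circ by (simp add: finite_measure.axioms(1) finite_measure_def)

lemma nn_integral_circ: "(\<integral>\<^sup>+t. f t \<partial>circ) = (\<integral>\<^sup>+t\<in>{0..2*pi}. f t \<partial>lborel)"
  unfolding circ_def by (subst nn_integral_restrict_space) auto

lemma nn_integral_circ_continuous: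
  fixes f :: "real \<Rightarrow> real"
  assumes "continuous_on {0..2*pi} f" "\<And>x. x \<in> {0..2*pi} \<Longrightarrow> 0 \<le> f x"
  shows "(\<integral>\<^sup>+x. ennreal (f x) \<partial>circ) = ennreal (integral {0..2*pi} f)"
  unfolding nn_integral_circ using assms by (rule nn_integral_continuous_Icc)

text \<open>By \<open>cmod_mobius_id_minus\<close> this is \<open>1 - |\<phi>|^2\<close>. It
  replaces the Green function of the disc, to which it is comparable near the circle, and has no
  logarithmic pole.\<close>

definition green_kernel :: "complex \<Rightarrow> complex \<Rightarrow> real" where
  "green_kernel z w = (1 - (cmod z)\<^sup>2) * (1 - (cmod w)\<^sup>2) / (cmod (1 - cnj z * w))\<^sup>2"

text \<open>Green's formula on the disc for \<open>u\<close> and \<open>1 - |\<phi>|\<^sup>2\<close>, with \<open>\<phi>\<close> the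
  automorphism of the disc that vanishes at \<open>z\<close>; the latter function is superharmonic, is zero on
  the circle, and has normal derivative \<open>-2 Pk z\<close> there.\<close>

lemma green_area_bound:
  assumes P: "polar_pair h h' h'' G R" and R: "1 < R" and z: "cmod z < 1"
    and lap: "\<And>y. y \<ge> 0 \<Longrightarrow> 0 \<le> h' y + y * h'' y" and hnn: "\<And>y. y \<ge> 0 \<Longrightarrow> 0 \<le> h y"
  shows "(\<integral>\<^sup>+r\<in>{1/2..1}. (\<integral>\<^sup>+t. ennreal (green_kernel z (complex_of_real r * cis t)
            * lapf h' h'' G (complex_of_real r * cis t)) \<partial>circ) \<partial>lborel)
      \<le> ennreal (2 * integral {0..2*pi} (\<lambda>t. h ((cmod (G (cis t)))\<^sup>2) * Pk z t))"
proof -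
  define R1 where "R1 = min R (1 + (1 - cmod z))"
  have R1: "1 < R1" "R1 \<le> R" using R z by (auto simp: R1_def)
  have zR: "cmod z * R1 < 1"
  proof -
    have "cmod z * R1 \<le> cmod z * (1 + (1 - cmod z))" by (intro mult_left_mono) (auto simp: R1_def)
    also have "\<dots> = 1 - (1 - cmod z)\<^sup>2" by (simp add: power2_eq_square algebra_simps)
    also have "\<dots> < 1" using z by simp
    finally show ?thesis .
  qed
  have nz: "1 - cnj z * u \<noteq> 0" if "cmod u < R1" for u
  proof
    assume "1 - cnj z * u = 0"
    hence "cmod (cnj z * u) = 1" by (metis eq_iff_diff_eq_0 norm_one)
    moreover have "cmod z * cmod u \<le> cmod z * R1" using that by (intro mult_left_mono) auto
    ultimately show False using zR by (simp add: norm_mult)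
  qed
  define p where "p w = (w - z) / (1 - cnj z * w)" for w
  have p_hol: "p holomorphic_on ball 0 R1"
    unfolding p_def by (intro holomorphic_intros) (use nz in auto)
  have P1: "polar_pair h h' h'' G R1"
    using P R1 unfolding polar_pair_def by (auto elim!: holomorphic_on_subset)
  have P2: "polar_pair (\<lambda>y. 1 - y) (\<lambda>_. -1) (\<lambda>_. 0) p R1"
    by unfold_locales (use p_hol in \<open>auto intro!: derivative_eq_intros\<close>)
  interpret a: polar_pair h h' h'' G R1 by fact
  interpret b: polar_pair "\<lambda>y. 1 - y" "\<lambda>_. -1" "\<lambda>_. 0" p R1 by fact
  have pk: "1 - (cmod (p w))\<^sup>2 = green_kernel z w" if "cmod w < R1" for w
  proof -
    have "(cmod (1 - cnj z * w))\<^sup>2 \<noteq> 0" using nz[OF that] by simp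
    thus ?thesis unfolding green_kernel_def p_def norm_divide power_divide
      using cmod_mobius_id_minus[of z w] by (simp add: field_simps)
  qed
  define K where "K r t = (1 - (cmod (p (complex_of_real r * cis t)))\<^sup>2) * radf h' G (complex_of_real r * cis t)
        - h ((cmod (G (complex_of_real r * cis t)))\<^sup>2) * radf (\<lambda>_. -1) p (complex_of_real r * cis t)" for r t
  define L where "L r t = (1 - (cmod (p (complex_of_real r * cis t)))\<^sup>2) * lapf h' h'' G (complex_of_real r * cis t)
        - h ((cmod (G (complex_of_real r * cis t)))\<^sup>2) * lapf (\<lambda>_. -1) (\<lambda>_. 0) p (complex_of_real r * cis t)" for r t
  define L1 where "L1 r t = (1 - (cmod (p (complex_of_real r * cis t)))\<^sup>2) * lapf h' h'' G (complex_of_real r * cis t)" for r t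
  define J where "J r = integral {0..2*pi} (K r)" for r
  have dJ: "(J has_real_derivative integral {0..2*pi} (L r) / r) (at r)" if "0 < r" "r < R1" for r
    using green_circle[OF P1 P2 that] by (simp add: J_def[abs_def] K_def[abs_def] L_def[abs_def])
  have cK: "continuous_on (ball 0 R1) (\<lambda>w. (1 - (cmod (p w))\<^sup>2) * radf h' G w - h ((cmod (G w))\<^sup>2) * radf (\<lambda>_. -1) p w)"
    by (intro continuous_on_diff continuous_on_mult a.cont_radf a.cont_hG b.cont_radf b.cont_hG)
  have cL: "continuous_on (ball 0 R1) (\<lambda>w. (1 - (cmod (p w))\<^sup>2) * lapf h' h'' G w - h ((cmod (G w))\<^sup>2) * lapf (\<lambda>_. -1) (\<lambda>_. 0) p w)"
    by (intro continuous_on_diff continuous_on_mult a.cont_lapf a.cont_hG b.cont_lapf b.cont_hG)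
  have cL1: "continuous_on (ball 0 R1) (\<lambda>w. (1 - (cmod (p w))\<^sup>2) * lapf h' h'' G w)"
    by (intro continuous_on_diff continuous_on_mult a.cont_lapf b.cont_hG)
  have "continuous_on {0..1} (\<lambda>r. integral (cbox 0 (2*pi)) (K r))"
  proof (rule integral_continuous_on_param)
    show "continuous_on ({0..1} \<times> cbox 0 (2*pi)) (\<lambda>(r, t). K r t)"
      unfolding K_def by (rule continuous_on_subset[OF continuous_on_polar[OF cK]]) (use R1 in auto)
  qed
  hence contJ: "continuous_on {0..1} J" by (simp add: J_def[abs_def])
  have J0: "J 0 = 0" by (simp add: J_def K_def[abs_def] radf_def rad_def)
  have slice: "continuous_on {0..2*pi} (\<lambda>t. f (complex_of_real r * cis t))"
    if "continuous_on (ball 0 R1) f" "0 \<le> r" "r \<le> 1" for f :: "complex \<Rightarrow> real" and r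
    by (rule continuous_on_compose2[OF that(1)]) (use that R1 in \<open>auto intro!: continuous_intros simp: norm_mult\<close>)
  \<comment> \<open>\<open>1 - |p|^2\<close> is superharmonic and \<open>h \<ge> 0\<close>, so the
    second term of \<open>L\<close> has the favourable sign and may be dropped.\<close>
  have Lge: "0 \<le> L1 r t \<and> L1 r t \<le> L r t" if "0 \<le> r" "r \<le> 1" for r t
  proof -
    have cr: "cmod (complex_of_real r * cis t) \<le> 1" "cmod (complex_of_real r * cis t) < R1"
      using that R1 by (auto simp: norm_mult)
    hence "0 \<le> 1 - (cmod (p (complex_of_real r * cis t)))\<^sup>2"
      unfolding pk[OF cr(2)] green_kernel_def using z
      by (intro divide_nonneg_nonneg mult_nonneg_nonneg) (auto simp: abs_square_le_1)
    moreover have "0 \<le> lapf h' h'' G (complex_of_real r * cis t)"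
      unfolding lapf_def by (intro mult_nonneg_nonneg lap) auto
    moreover have "lapf (\<lambda>_. -1) (\<lambda>_. 0) p (complex_of_real r * cis t) \<le> 0"
      unfolding lapf_def by simp
    hence "h ((cmod (G (complex_of_real r * cis t)))\<^sup>2) * lapf (\<lambda>_. -1) (\<lambda>_. 0) p (complex_of_real r * cis t) \<le> 0"
      by (intro mult_nonneg_nonpos hnn) auto
    ultimately show ?thesis unfolding L1_def L_def by simp
  qed
  have Lint: "L r integrable_on {0..2*pi}" "L1 r integrable_on {0..2*pi}" if "0 \<le> r" "r \<le> 1" for r
    unfolding L_def[abs_def] L1_def[abs_def]
    using slice[OF cL that] slice[OF cL1 that] by (auto intro!: integrable_continuous_interval)
  have IL: "0 \<le> integral {0..2*pi} (L1 r)" "integral {0..2*pi} (L1 r) \<le> integral {0..2*pi} (L r)" if "0 \<le> r" "r \<le> 1" for r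
    using Lge[OF that] Lint[OF that] by (auto intro!: integral_nonneg integral_le)
  \<comment> \<open>The flux through the circle of radius \<open>1/2\<close> is nonnegative, so the
    inner disc can be discarded.\<close>
  have "J 0 \<le> J (1/2)"
  proof (rule DERIV_nonneg_imp_increasing_open[where f=J])
    fix x :: real assume x: "0 < x" "x < 1/2"
    show "\<exists>y. (J has_real_derivative y) (at x) \<and> 0 \<le> y"
      using dJ[of x] IL[of x] x R1 by (intro exI[of _ "integral {0..2*pi} (L x) / x"]) auto
  qed (auto intro: continuous_on_subset[OF contJ])
  hence Jh: "0 \<le> J (1/2)" by (simp add: J0)
  have "(\<integral>\<^sup>+r\<in>{1/2..1}. (\<integral>\<^sup>+t. ennreal (green_kernel z (complex_of_real r * cis t)
            * lapf h' h'' G (complex_of_real r * cis t)) \<partial>circ) \<partial>lborel)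
      = (\<integral>\<^sup>+r\<in>{1/2..1}. ennreal (integral {0..2*pi} (L1 r)) \<partial>lborel)"
  proof (intro nn_integral_cong, split split_indicator, intro impI conjI)
    fix r :: real assume "r \<in> {1/2..1}"
    hence r: "0 \<le> r" "r \<le> 1" by auto
    have "(\<integral>\<^sup>+t. ennreal (L1 r t) \<partial>circ) = ennreal (integral {0..2*pi} (L1 r))"
      using slice[OF cL1 r] Lge[OF r] by (intro nn_integral_circ_continuous) (auto simp: L1_def[abs_def])
    moreover have "L1 r t = green_kernel z (complex_of_real r * cis t) * lapf h' h'' G (complex_of_real r * cis t)" for t
      unfolding L1_def using r R1 by (subst pk) (auto simp: norm_mult)
    ultimately show "(\<integral>\<^sup>+t. ennreal (green_kernel z (complex_of_real r * cis t)
            * lapf h' h'' G (complex_of_real r * cis t)) \<partial>circ) * 1 = ennreal (integral {0..2*pi} (L1 r)) * 1" by simp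
  qed auto
  also have "\<dots> \<le> (\<integral>\<^sup>+r\<in>{1/2..1}. ennreal (integral {0..2*pi} (L r) / r) \<partial>lborel)"
  proof (intro nn_integral_mono, split split_indicator, intro impI conjI)
    fix r :: real assume "r \<in> {1/2..1}"
    hence r: "0 < r" "r \<le> 1" by auto
    have "integral {0..2*pi} (L1 r) * r \<le> integral {0..2*pi} (L1 r) * 1"
      using r IL[of r] by (intro mult_left_mono) auto
    also have "\<dots> \<le> integral {0..2*pi} (L r)" using r IL[of r] by auto
    finally show "ennreal (integral {0..2*pi} (L1 r)) * 1 \<le> ennreal (integral {0..2*pi} (L r) / r) * 1"
      using r by (simp add: ennreal_leI field_simps)
  qed auto
  also have "\<dots> = ennreal (J 1 - J (1/2))"
  proof (rule nn_integral_has_integral_lebesgue')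
    show "((\<lambda>r. integral {0..2*pi} (L r) / r) has_integral J 1 - J (1/2)) {1/2..1}"
    proof (rule fundamental_theorem_of_calculus)
      fix r :: real assume "r \<in> {1/2..1}"
      thus "(J has_vector_derivative integral {0..2*pi} (L r) / r) (at r within {1/2..1})"
        using dJ[of r] R1 by (auto simp: has_real_derivative_iff_has_vector_derivative[symmetric] has_field_derivative_at_within)
    qed simp
    fix r :: real assume "r \<in> {1/2..1}"
    thus "0 \<le> integral {0..2*pi} (L r) / r" using IL[of r] by auto
  qed
  also have "\<dots> \<le> ennreal (J 1)" using Jh by (intro ennreal_leI) auto
  also have "J 1 = 2 * integral {0..2*pi} (\<lambda>t. h ((cmod (G (cis t)))\<^sup>2) * Pk z t)"
  proof -
    have "K 1 t = 2 * (h ((cmod (G (cis t)))\<^sup>2) * Pk z t)" for t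
    proof -
      have n0: "1 - cnj z * cis t \<noteq> 0" using nz[of "cis t"] R1 by simp
      have d: "deriv p (cis t) = (1 - cnj z * z) / (1 - cnj z * cis t)\<^sup>2"
        unfolding p_def[abs_def]
        by (rule DERIV_imp_deriv) (use n0 in \<open>auto intro!: derivative_eq_intros simp: field_simps power2_eq_square\<close>)
      have "cnj (p (cis t)) * rad p (cis t) = (cnj (cis t - z) * cis t) * (1 - cnj z * z) /
           (cnj (1 - cnj z * cis t) * (1 - cnj z * cis t)\<^sup>2)"
        unfolding rad_def d by (simp add: p_def)
      also have "cnj (cis t - z) * cis t = 1 - cnj z * cis t" by (simp add: algebra_simps cis_cnj cis_mult)
      also have "(1 - cnj z * cis t) * (1 - cnj z * z) / (cnj (1 - cnj z * cis t) * (1 - cnj z * cis t)\<^sup>2)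
          = (1 - cnj z * z) / (cnj (1 - cnj z * cis t) * (1 - cnj z * cis t))"
        using n0 by (simp add: power2_eq_square)
      also have "\<dots> = complex_of_real ((1 - (cmod z)\<^sup>2) / (cmod (1 - cnj z * cis t))\<^sup>2)"
        using complex_norm_square[of z] complex_norm_square[of "1 - cnj z * cis t"]
        by (simp only: of_real_divide of_real_diff of_real_1 mult.commute)
      finally have "Re (cnj (p (cis t)) * rad p (cis t)) = Pk z t"
        by (simp only: Re_complex_of_real Pk_def cmod_cis_diff)
      hence r: "radf (\<lambda>_. -1) p (cis t) = - 2 * Pk z t" unfolding radf_def by simp
      have "1 - (cmod (p (cis t)))\<^sup>2 = 0" using pk[of "cis t"] R1 by (simp add: green_kernel_def)
      thus ?thesis unfolding K_def using r by simp
    qed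
    hence "K 1 = (\<lambda>t. 2 * (h ((cmod (G (cis t)))\<^sup>2) * Pk z t))" by blast
    thus ?thesis unfolding J_def by (simp only: integral_mult_right)
  qed
  finally show ?thesis .
qed

lemma borel_measurable_ident_circ [measurable]: "(\<lambda>x. x) \<in> borel_measurable circ"
  by (intro measurable_circ) simp

lemma cis_borel_circ [measurable]: "cis \<in> borel_measurable circ"
  by (intro measurable_circ borel_measurable_continuous_onI continuous_intros)

lemma Pk_borel [measurable (raw)]:
  "f \<in> borel_measurable M \<Longrightarrow> g \<in> borel_measurable M \<Longrightarrow> (\<lambda>x. Pk (f x) (g x)) \<in> borel_measurable M"
proof -
  assume [measurable]: "f \<in> borel_measurable M" "g \<in> borel_measurable M"
  have [measurable]: "cis \<in> borel_measurable borel"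
    by (intro borel_measurable_continuous_onI continuous_intros)
  show ?thesis unfolding Pk_def by measurable
qed

section \<open>Harnack inequalities and compositions of Poisson kernels\<close>

definition rc :: "real \<Rightarrow> real \<Rightarrow> complex" where "rc r t = complex_of_real r * cis t"

lemma cmod_rc: "0 \<le> r \<Longrightarrow> cmod (rc r t) = r"
  by (simp add: rc_def norm_mult)

lemma rc_borel [measurable (raw)]:
  "f \<in> borel_measurable M \<Longrightarrow> g \<in> borel_measurable M \<Longrightarrow> (\<lambda>x. rc (f x) (g x)) \<in> borel_measurable M"
proof -
  assume [measurable]: "f \<in> borel_measurable M" "g \<in> borel_measurable M"
  have [measurable]: "cis \<in> borel_measurable borel"
    by (intro borel_measurable_continuous_onI continuous_intros)
  show ?thesis unfolding rc_def by measurable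
qed

lemma cmod_cis_rc: "cmod (cis t - rc r s) = cmod (1 - complex_of_real r * cis (s - t))"
proof -
  have "cis t - rc r s = cis t * (1 - complex_of_real r * cis (s - t))"
    by (simp add: rc_def algebra_simps cis_mult)
  thus ?thesis by (simp add: norm_mult)
qed

lemma Pk_rc_sym: "Pk (rc r s) t = Pk (rc r t) s"
proof -
  have "cnj (1 - complex_of_real r * cis (s - t)) = 1 - complex_of_real r * cis (t - s)"
    by (simp add: cis_cnj)
  hence "cmod (cis t - rc r s) = cmod (cis s - rc r t)"
    unfolding cmod_cis_rc by (metis complex_mod_cnj)
  thus ?thesis by (simp add: Pk_def rc_def norm_mult)
qed

text \<open>A displacement by at most half the distance to the circle enlarges the numerator of the
  kernel by at most \<open>3\<close>, and the distance \<open>cmod (cis t - w)\<close> is at least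
  half of \<open>cmod (cis t - z)\<close>; hence \<open>12 = 3 * 4\<close>.\<close>

lemma harnack:
  assumes z: "cmod z < 1" and w: "cmod (w - z) \<le> (1 - cmod z) / 2"
  shows "cmod w < 1" "Pk w t \<le> 12 * Pk z t"
proof -
  have cw: "cmod w \<le> cmod z + cmod (w - z)" "cmod z \<le> cmod w + cmod (w - z)"
    using norm_triangle_ineq[of z "w - z"] norm_triangle_ineq[of w "z - w"] by (auto simp: norm_minus_commute)
  show 1: "cmod w < 1" using cw w z by argo
  have d: "1 - cmod z \<le> cmod (cis t - z)"
    using norm_triangle_ineq2[of "cis t" z] by simp
  have "cmod (cis t - z) \<le> cmod (cis t - w) + cmod (w - z)"
    using norm_triangle_ineq[of "cis t - w" "w - z"] by simp
  hence e: "cmod (cis t - z) \<le> 2 * cmod (cis t - w)" using d w by argo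
  have pz: "0 < cmod (cis t - z)" using cis_neq[OF z] by simp
  have pw: "0 < cmod (cis t - w)" using cis_neq[OF 1] by simp
  have "(cmod (cis t - z))\<^sup>2 \<le> (2 * cmod (cis t - w))\<^sup>2" using e by (intro power_mono) auto
  hence e2: "(cmod (cis t - z))\<^sup>2 \<le> 4 * (cmod (cis t - w))\<^sup>2" by (simp add: power_mult_distrib)
  have "1 - (cmod w)\<^sup>2 = (1 - cmod w) * (1 + cmod w)" by (simp add: power2_eq_square algebra_simps)
  also have "\<dots> \<le> (1 - cmod w) * 2" using 1 by (intro mult_left_mono) auto
  also have "\<dots> \<le> 3 * (1 - cmod z)" using cw w by argo
  also have "\<dots> \<le> 3 * ((1 - cmod z) * (1 + cmod z))"
  proof (rule mult_left_mono)
    have "(1 - cmod z) * 1 \<le> (1 - cmod z) * (1 + cmod z)" using z by (intro mult_left_mono) auto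
    thus "1 - cmod z \<le> (1 - cmod z) * (1 + cmod z)" by simp
  qed simp
  also have "\<dots> = 3 * (1 - (cmod z)\<^sup>2)" by (simp add: power2_eq_square algebra_simps)
  finally have n: "1 - (cmod w)\<^sup>2 \<le> 3 * (1 - (cmod z)\<^sup>2)" .
  have nw: "0 \<le> 1 - (cmod w)\<^sup>2" using 1 by (simp add: abs_square_le_1)
  have "Pk w t = (1 - (cmod w)\<^sup>2) / (cmod (cis t - w))\<^sup>2" by (simp add: Pk_def)
  also have "\<dots> \<le> (3 * (1 - (cmod z)\<^sup>2)) / ((cmod (cis t - z))\<^sup>2 / 4)"
    using n nw e2 pz pw by (intro frac_le) auto
  also have "\<dots> = 12 * Pk z t" by (simp add: Pk_def)
  finally show "Pk w t \<le> 12 * Pk z t" .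
qed

text \<open>The same comparison with the boundary point moved in place of the interior one: a chord
  of length \<open>1 - r\<close> at most doubles the distance to \<open>rc r t\<close>, since that
  distance is already at least \<open>1 - r\<close>.\<close>

lemma harnack_angle:
  assumes "0 \<le> r" "r < 1" and c: "cmod (cis s - cis s') \<le> 1 - r"
  shows "Pk (rc r t) s \<le> 4 * Pk (rc r t) s'"
proof -
  have z: "cmod (rc r t) = r" using assms by (simp add: cmod_rc)
  have d: "1 - r \<le> cmod (cis s - rc r t)"
    using norm_triangle_ineq2[of "cis s" "rc r t"] z by simp
  have "cmod (cis s' - rc r t) \<le> cmod (cis s - rc r t) + cmod (cis s' - cis s)"
    using norm_triangle_ineq[of "cis s - rc r t" "cis s' - cis s"] by simp
  hence e: "cmod (cis s' - rc r t) \<le> 2 * cmod (cis s - rc r t)" using d c by (simp add: norm_minus_commute)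
  have p: "0 < cmod (cis s' - rc r t)" "0 < cmod (cis s - rc r t)" using cis_neq[of "rc r t"] z assms by auto
  have "(cmod (cis s' - rc r t))\<^sup>2 \<le> (2 * cmod (cis s - rc r t))\<^sup>2" using e by (intro power_mono) auto
  hence e2: "(cmod (cis s' - rc r t))\<^sup>2 / 4 \<le> (cmod (cis s - rc r t))\<^sup>2" by (simp add: power_mult_distrib)
  have "Pk (rc r t) s \<le> (1 - (cmod (rc r t))\<^sup>2) / ((cmod (cis s' - rc r t))\<^sup>2 / 4)"
    unfolding Pk_def using e2 p z assms by (intro frac_le) (auto simp: abs_square_le_1)
  thus ?thesis by (simp add: Pk_def algebra_simps)
qed

lemma nn_integral_Pk_Pk:
  assumes "cmod z < 1" "cmod w < 1"
  shows "(\<integral>\<^sup>+t. ennreal (Pk w t * Pk z t) \<partial>circ) = ennreal (2 * pi * ((1 - (cmod (w * z))\<^sup>2) / (cmod (1 - cnj w * z))\<^sup>2))"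
  by (subst nn_integral_circ_continuous) (use assms in \<open>auto simp: Pk_semigroup intro!: continuous_intros\<close>)

lemma nn_integral_Pk: "cmod z < 1 \<Longrightarrow> (\<integral>\<^sup>+t. ennreal (Pk z t) \<partial>circ) = ennreal (2 * pi)"
  using nn_integral_circ_continuous[of "Pk z"] by (simp add: integral_Pk continuous_on_Pk)

lemma Pk_Pk_aux:
  assumes "0 \<le> r" "r \<le> p" "p < 1"
  shows "1 - (cmod (rc p t * rc r s))\<^sup>2 \<le> 2 * (1 - r\<^sup>2)" "0 \<le> 1 - (cmod (rc p t * rc r s))\<^sup>2" "0 < cmod (1 - cnj (rc p t) * rc r s)"
proof -
  have c: "cmod (rc p t * rc r s) = p * r" using assms by (simp add: norm_mult cmod_rc)
  have "r * r \<le> p * r" using assms by (intro mult_right_mono) auto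
  hence "(r * r)\<^sup>2 \<le> (p * r)\<^sup>2" using assms by (intro power_mono) auto
  moreover have "1 - (r * r)\<^sup>2 = (1 - r\<^sup>2) * (1 + r\<^sup>2)" by (simp add: power2_eq_square algebra_simps)
  moreover have "(1 - r\<^sup>2) * (1 + r\<^sup>2) \<le> (1 - r\<^sup>2) * 2"
    using assms by (intro mult_left_mono) (auto simp: abs_square_le_1)
  ultimately show "1 - (cmod (rc p t * rc r s))\<^sup>2 \<le> 2 * (1 - r\<^sup>2)" unfolding c by argo
  have "p * r \<le> p * 1" using assms by (intro mult_left_mono) auto
  hence "p * r < 1" using assms by simp
  thus "0 \<le> 1 - (cmod (rc p t * rc r s))\<^sup>2" unfolding c using assms by (simp add: abs_square_le_1)
  have "cmod (cnj (rc p t) * rc r s) < 1" using c \<open>p * r < 1\<close> by (simp add: norm_mult)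
  thus "0 < cmod (1 - cnj (rc p t) * rc r s)" by (metis eq_iff_diff_eq_0 less_irrefl norm_one zero_less_norm_iff)
qed

text \<open>In the semigroup formula the numerator \<open>1 - (p * r)\<^sup>2\<close> is at most
  \<open>2 * (1 - r\<^sup>2)\<close> because \<open>r \<le> p\<close>, and the factor
  \<open>1 - p\<close> supplies the second factor of the Green kernel. This turns a product of two
  kernels, integrated over the circle, into a Green potential.\<close>

lemma Pk_Pk_green:
  assumes "0 \<le> r" "r \<le> p" "p < 1"
  shows "ennreal (1 - p) * (\<integral>\<^sup>+x. ennreal (Pk (rc p t) x * Pk (rc r s) x) \<partial>circ) \<le> ennreal (4 * pi) * ennreal (green_kernel (rc r s) (rc p t))"
proof -
  note a = Pk_Pk_aux[OF assms, of t s]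
  have b: "cmod (1 - cnj (rc p t) * rc r s) = cmod (1 - cnj (rc r s) * rc p t)"
    by (metis complex_cnj_cnj complex_cnj_diff complex_cnj_mult complex_cnj_one complex_mod_cnj mult.commute)
  have "ennreal (1 - p) * (\<integral>\<^sup>+x. ennreal (Pk (rc p t) x * Pk (rc r s) x) \<partial>circ)
      = ennreal ((1 - p) * (2 * pi * ((1 - (cmod (rc p t * rc r s))\<^sup>2) / (cmod (1 - cnj (rc p t) * rc r s))\<^sup>2)))"
    using assms by (subst nn_integral_Pk_Pk) (simp_all add: cmod_rc ennreal_mult'[symmetric] del: times_divide_eq_right)
  also have "\<dots> \<le> ennreal ((1 - p\<^sup>2) * (2 * pi * ((2 * (1 - r\<^sup>2)) / (cmod (1 - cnj (rc r s) * rc p t))\<^sup>2)))"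
  proof (intro ennreal_leI mult_mono)
    show "1 - p \<le> 1 - p\<^sup>2" using assms by (simp add: power2_eq_square mult_left_le)
    show "(1 - (cmod (rc p t * rc r s))\<^sup>2) / (cmod (1 - cnj (rc p t) * rc r s))\<^sup>2
       \<le> 2 * (1 - r\<^sup>2) / (cmod (1 - cnj (rc r s) * rc p t))\<^sup>2"
      unfolding b using a by (intro divide_right_mono) auto
  qed (use a assms in \<open>auto simp: abs_square_le_1\<close>)
  also have "\<dots> = ennreal (4 * pi) * ennreal (green_kernel (rc r s) (rc p t))"
  proof -
    have "(1 - p\<^sup>2) * (2 * pi * ((2 * (1 - r\<^sup>2)) / (cmod (1 - cnj (rc r s) * rc p t))\<^sup>2)) = 4 * pi * green_kernel (rc r s) (rc p t)"
      using assms by (simp add: green_kernel_def cmod_rc algebra_simps)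
    thus ?thesis by (simp only: ennreal_mult'[symmetric] pi_ge_zero zero_le_mult_iff zero_le_numeral simp_thms)
  qed
  finally show ?thesis .
qed

text \<open>Averaging over the finer scale \<open>1 - p\<close> hardly changes the wider kernel:
  \<open>cmod (cis t - rc r s)\<close> is at most twice the distance in the semigroup formula. The
  constant is \<open>2 * pi\<close>, times \<open>2\<close> from the numerator, times
  \<open>4\<close>.\<close>

lemma Pk_Pk_le:
  assumes "0 \<le> r" "r \<le> p" "p < 1"
  shows "(\<integral>\<^sup>+x. ennreal (Pk (rc p t) x * Pk (rc r s) x) \<partial>circ) \<le> ennreal (16 * pi) * ennreal (Pk (rc r s) t)"
proof -
  note a = Pk_Pk_aux[OF assms, of t s]
  have b: "cmod (1 - cnj (rc p t) * rc r s) = cmod (1 - complex_of_real (p * r) * cis (s - t))"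
    by (simp add: rc_def cis_cnj cis_mult mult_ac) (metis (no_types, opaque_lifting) cis_mult diff_conv_add_uminus mult.assoc mult.commute)
  have "cmod (cis t - rc r s) \<le> cmod (1 - complex_of_real (p * r) * cis (s - t)) + cmod (complex_of_real (r * (1 - p)) * cis (s - t))"
    unfolding cmod_cis_rc
    using norm_triangle_ineq4[of "1 - complex_of_real (p * r) * cis (s - t)" "complex_of_real (r * (1 - p)) * cis (s - t)"]
    by (simp add: algebra_simps)
  also have "cmod (complex_of_real (r * (1 - p)) * cis (s - t)) = \<bar>r * (1 - p)\<bar>"
    by (simp only: norm_mult norm_of_real norm_cis mult_1_right)
  also have "\<bar>r * (1 - p)\<bar> = r * (1 - p)" using assms by simp
  also have "r * (1 - p) \<le> 1 - p * r" using assms by (simp add: algebra_simps)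
  also have "1 - p * r \<le> cmod (1 - complex_of_real (p * r) * cis (s - t))"
    using norm_triangle_ineq2[of 1 "complex_of_real (p * r) * cis (s - t)"] assms by (simp add: norm_mult)
  finally have "cmod (cis t - rc r s) \<le> 2 * cmod (1 - cnj (rc p t) * rc r s)" unfolding b by simp
  hence "(cmod (cis t - rc r s))\<^sup>2 \<le> (2 * cmod (1 - cnj (rc p t) * rc r s))\<^sup>2" by (intro power_mono) auto
  hence c: "(cmod (cis t - rc r s))\<^sup>2 / 4 \<le> (cmod (1 - cnj (rc p t) * rc r s))\<^sup>2" by (simp add: power_mult_distrib)
  have pz: "0 < cmod (cis t - rc r s)" using cis_neq[of "rc r s" t] assms by (simp add: cmod_rc)
  have "(\<integral>\<^sup>+x. ennreal (Pk (rc p t) x * Pk (rc r s) x) \<partial>circ)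
      = ennreal (2 * pi * ((1 - (cmod (rc p t * rc r s))\<^sup>2) / (cmod (1 - cnj (rc p t) * rc r s))\<^sup>2))"
    using assms by (intro nn_integral_Pk_Pk) (auto simp: cmod_rc)
  also have "\<dots> \<le> ennreal (2 * pi * (2 * (1 - r\<^sup>2) / ((cmod (cis t - rc r s))\<^sup>2 / 4)))"
    using a c pz assms by (intro ennreal_leI mult_left_mono frac_le) (auto simp: abs_square_le_1)
  also have "2 * pi * (2 * (1 - r\<^sup>2) / ((cmod (cis t - rc r s))\<^sup>2 / 4)) = 16 * pi * Pk (rc r s) t"
    using assms by (simp add: Pk_def cmod_rc)
  also have "ennreal \<dots> = ennreal (16 * pi) * ennreal (Pk (rc r s) t)"
    using assms by (simp add: ennreal_mult' cmod_rc)
  finally show ?thesis .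
qed

text \<open>For radii in unknown order one keeps both candidates. This is the form needed for the
  linearised maximal operator, where the radius varies with the angle.\<close>

lemma Pk_Pk_le_sum:
  assumes "0 \<le> r" "r < 1" "0 \<le> p" "p < 1"
  shows "(\<integral>\<^sup>+x. ennreal (Pk (rc p t) x * Pk (rc r s) x) \<partial>circ)
     \<le> ennreal (16 * pi) * (ennreal (Pk (rc r s) t) + ennreal (Pk (rc p t) s))"
proof (cases "r \<le> p")
  case True
  show ?thesis
    by (rule order.trans[OF Pk_Pk_le]) (use assms True in \<open>auto intro!: mult_left_mono\<close>)
next
  case False
  have "(\<integral>\<^sup>+x. ennreal (Pk (rc p t) x * Pk (rc r s) x) \<partial>circ) = (\<integral>\<^sup>+x. ennreal (Pk (rc r s) x * Pk (rc p t) x) \<partial>circ)"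
    by (simp add: mult.commute)
  also have "\<dots> \<le> ennreal (16 * pi) * ennreal (Pk (rc p t) s)" by (rule Pk_Pk_le) (use assms False in auto)
  finally show ?thesis by (rule order.trans) (auto intro!: mult_left_mono)
qed

text \<open>A case distinction on \<open>y \<le> ennreal l * x\<close> covers infinite values
  without subtraction.\<close>

lemma ennreal_young:
  fixes x y :: ennreal
  assumes "0 < l"
  shows "x * y \<le> ennreal l * x\<^sup>2 + ennreal (1 / l) * y\<^sup>2"
proof (cases "y \<le> ennreal l * x")
  case True
  have "x * y \<le> x * (ennreal l * x)" by (intro mult_left_mono True) auto
  also have "\<dots> = ennreal l * x\<^sup>2" by (simp add: power2_eq_square mult_ac)
  finally show ?thesis by (rule order.trans) simp
next
  case False
  have 1: "ennreal (1 / l) * ennreal l = 1"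
    using assms by (subst ennreal_mult[symmetric]) auto
  have "ennreal (1 / l) * (ennreal l * x) \<le> ennreal (1 / l) * y" using False by (intro mult_left_mono) auto
  hence "x \<le> ennreal (1 / l) * y" by (simp add: mult.assoc[symmetric] 1)
  hence "x * y \<le> ennreal (1 / l) * y * y" by (intro mult_right_mono) auto
  also have "\<dots> = ennreal (1 / l) * y\<^sup>2" by (simp add: power2_eq_square mult_ac)
  finally show ?thesis by (rule order.trans) simp
qed

lemma nn_integral_young:
  assumes [measurable]: "f \<in> borel_measurable M" "g \<in> borel_measurable M" and "0 < l"
  shows "(\<integral>\<^sup>+x. f x * g x \<partial>M) \<le> ennreal l * (\<integral>\<^sup>+x. (f x)\<^sup>2 \<partial>M) + ennreal (1 / l) * (\<integral>\<^sup>+x. (g x)\<^sup>2 \<partial>M)"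
proof -
  have "(\<integral>\<^sup>+x. f x * g x \<partial>M) \<le> (\<integral>\<^sup>+x. ennreal l * (f x)\<^sup>2 + ennreal (1 / l) * (g x)\<^sup>2 \<partial>M)"
    by (intro nn_integral_mono ennreal_young assms)
  also have "\<dots> = ennreal l * (\<integral>\<^sup>+x. (f x)\<^sup>2 \<partial>M) + ennreal (1 / l) * (\<integral>\<^sup>+x. (g x)\<^sup>2 \<partial>M)"
    by (subst nn_integral_add) (auto simp: nn_integral_cmult)
  finally show ?thesis .
qed

text \<open>Absorption fails at \<open>\<top>\<close>, so finiteness of \<open>a\<close> must be
  known beforehand. The a priori bounds \<open>L2_valid_start\<close> and \<open>A_bounded\<close>,
  whose constants are not uniform, serve to provide it.\<close>

lemma ennreal_absorb_half:
  fixes a b :: ennreal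
  assumes "a \<le> b + ennreal (1/2) * a" "a < \<top>"
  shows "a \<le> 2 * b"
proof (cases b)
  case (real y)
  obtain x where x: "a = ennreal x" "0 \<le> x" using assms(2) by (cases a) auto
  have "ennreal (1/2) * a = ennreal (1/2 * x)" unfolding x(1) by (rule ennreal_mult[symmetric]) (use x in auto)
  hence "ennreal x \<le> ennreal y + ennreal (1/2 * x)" using assms(1) x real by simp
  also have "\<dots> = ennreal (y + 1/2 * x)" using x real by (intro ennreal_plus[symmetric]) auto
  finally have "ennreal x \<le> ennreal (y + 1/2 * x)" .
  hence "x \<le> y + 1/2 * x" using x real by (subst (asm) ennreal_le_iff) auto
  hence "ennreal x \<le> ennreal (2 * y)" by (intro ennreal_leI) auto
  thus ?thesis using x real by (simp add: ennreal_mult')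
next
  case top
  thus ?thesis by (simp add: ennreal_mult_top)
qed

section \<open>A maximal inequality for Poisson integrals\<close>

definition PI :: "real \<Rightarrow> (real \<Rightarrow> ennreal) \<Rightarrow> real \<Rightarrow> ennreal" where
  "PI r V s = (\<integral>\<^sup>+t. ennreal (Pk (rc r s) t) * V t \<partial>circ)"

interpretation circ: sigma_finite_measure circ by (rule sigma_finite_circ)
interpretation circ2: pair_sigma_finite circ circ by unfold_locales

text \<open>An \<open>L\<^sup>2\<close> bound \<open>M\<close> for the linearised maximal operator \<open>T f s = PI (\<rho> s) f s\<close> improves to
  \<open>256 pi sqrt M\<close>, because the kernel of \<open>T T*\<close> is bounded by the kernel of \<open>T\<close> plus its transpose.\<close>

context
  fixes \<rho> :: "real \<Rightarrow> real" and R :: real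
  assumes \<rho> [measurable]: "\<rho> \<in> borel_measurable circ"
    and \<rho>_range: "\<And>s. 0 \<le> \<rho> s" "\<And>s. \<rho> s \<le> R" and R: "R < 1"
begin

lemma \<rho>_lt: "\<rho> s < 1" using \<rho>_range(2)[of s] R by simp

lemma PI_measurable [measurable]:
  assumes [measurable]: "f \<in> borel_measurable circ"
  shows "(\<lambda>s. PI (\<rho> s) f s) \<in> borel_measurable circ"
  unfolding PI_def by measurable

definition L2_valid :: "real \<Rightarrow> bool" where
  "L2_valid M \<longleftrightarrow> (\<forall>f\<in>borel_measurable circ. (\<integral>\<^sup>+s. (PI (\<rho> s) f s)\<^sup>2 \<partial>circ) \<le> ennreal M * (\<integral>\<^sup>+s. (f s)\<^sup>2 \<partial>circ))"

lemma L2_valid_improve: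
  assumes M: "0 < M" and valid: "L2_valid M"
  shows "L2_valid (256 * pi * sqrt M)"
  unfolding L2_valid_def
proof
  fix f :: "real \<Rightarrow> ennreal" assume f[measurable]: "f \<in> borel_measurable circ"
  define k where "k s t = ennreal (Pk (rc (\<rho> s) s) t)" for s t
  have k_meas [measurable]: "(\<lambda>(s,t). k s t) \<in> borel_measurable (circ \<Otimes>\<^sub>M circ)"
    unfolding k_def by measurable
  have k_meas' [measurable]: "(\<lambda>t. k s t) \<in> borel_measurable circ" for s
    unfolding k_def by measurable
  have k_meas'' [measurable]: "(\<lambda>s. k s t) \<in> borel_measurable circ" for t
    unfolding k_def by measurable
  define S where "S s = PI (\<rho> s) f s" for s
  have S: "S s = (\<integral>\<^sup>+t. k s t * f t \<partial>circ)" for s by (simp add: S_def PI_def k_def)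
  have S_meas [measurable]: "S \<in> borel_measurable circ" unfolding S_def[abs_def] by measurable
  define F where "F = (\<integral>\<^sup>+s. (f s)\<^sup>2 \<partial>circ)"
  define I where "I = (\<integral>\<^sup>+s. (S s)\<^sup>2 \<partial>circ)"
  \<comment> \<open>\<open>B\<close> is the adjoint of the linearised operator applied to
    \<open>S\<close>. By duality the square integral \<open>I\<close> of \<open>S\<close> is the
    pairing of \<open>f\<close> with \<open>B\<close>, so it remains to bound \<open>B\<close> in
    mean square.\<close>
  define B where "B t = (\<integral>\<^sup>+s. k s t * S s \<partial>circ)" for t
  have B_meas [measurable]: "B \<in> borel_measurable circ" unfolding B_def by measurable
  show "(\<integral>\<^sup>+s. (PI (\<rho> s) f s)\<^sup>2 \<partial>circ) \<le> ennreal (256 * pi * sqrt M) * (\<integral>\<^sup>+s. (f s)\<^sup>2 \<partial>circ)"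
  proof (cases "F = \<top>")
    case True
    thus ?thesis using M by (simp add: F_def ennreal_mult_top)
  next
    case False
    have IM: "I \<le> ennreal M * F" using valid f by (simp add: L2_valid_def I_def F_def S_def)
    \<comment> \<open>The a priori constant \<open>M\<close> guarantees finiteness, which permits
      the absorption at the end.\<close>
    have Ifin: "I < \<top>" using False by (intro le_less_trans[OF IM]) (auto simp: ennreal_mult_less_top less_top)
    have "I = (\<integral>\<^sup>+s. (\<integral>\<^sup>+t. S s * (k s t * f t) \<partial>circ) \<partial>circ)"
      unfolding I_def power2_eq_square by (subst (2) S) (simp add: nn_integral_cmult)
    also have "\<dots> = (\<integral>\<^sup>+t. (\<integral>\<^sup>+s. S s * (k s t * f t) \<partial>circ) \<partial>circ)"
      by (rule circ2.Fubini'[symmetric]) measurable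
    also have "\<dots> = (\<integral>\<^sup>+t. f t * B t \<partial>circ)"
      unfolding B_def by (intro nn_integral_cong) (auto simp: nn_integral_cmult[symmetric] mult_ac)
    finally have I1: "I = (\<integral>\<^sup>+t. f t * B t \<partial>circ)" .
    have "(\<integral>\<^sup>+t. (B t)\<^sup>2 \<partial>circ) = (\<integral>\<^sup>+t. (\<integral>\<^sup>+s. (\<integral>\<^sup>+s'. (k s t * S s) * (k s' t * S s') \<partial>circ) \<partial>circ) \<partial>circ)"
    proof (rule nn_integral_cong)
      fix t
      have "(B t)\<^sup>2 = (\<integral>\<^sup>+s. (k s t * S s) * B t \<partial>circ)"
        unfolding power2_eq_square by (simp add: nn_integral_multc B_def)
      also have "\<dots> = (\<integral>\<^sup>+s. (\<integral>\<^sup>+s'. (k s t * S s) * (k s' t * S s') \<partial>circ) \<partial>circ)"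
        unfolding B_def by (simp add: nn_integral_cmult)
      finally show "(B t)\<^sup>2 = (\<integral>\<^sup>+s. (\<integral>\<^sup>+s'. (k s t * S s) * (k s' t * S s') \<partial>circ) \<partial>circ)" .
    qed
    also have "\<dots> = (\<integral>\<^sup>+s. (\<integral>\<^sup>+t. (\<integral>\<^sup>+s'. (k s t * S s) * (k s' t * S s') \<partial>circ) \<partial>circ) \<partial>circ)"
      by (rule circ2.Fubini') measurable
    also have "\<dots> = (\<integral>\<^sup>+s. (\<integral>\<^sup>+s'. (\<integral>\<^sup>+t. (k s t * S s) * (k s' t * S s') \<partial>circ) \<partial>circ) \<partial>circ)"
      by (intro nn_integral_cong circ2.Fubini') measurable
    also have "\<dots> = (\<integral>\<^sup>+s. (\<integral>\<^sup>+s'. S s * S s' * (\<integral>\<^sup>+t. k s t * k s' t \<partial>circ) \<partial>circ) \<partial>circ)"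
      by (intro nn_integral_cong) (auto simp: nn_integral_cmult[symmetric] mult_ac)
    also have "\<dots> \<le> (\<integral>\<^sup>+s. (\<integral>\<^sup>+s'. S s * S s' * (ennreal (16 * pi) * (k s' s + k s s')) \<partial>circ) \<partial>circ)"
    proof (intro nn_integral_mono mult_left_mono)
      fix s s'
      have "(\<integral>\<^sup>+t. k s t * k s' t \<partial>circ) = (\<integral>\<^sup>+t. ennreal (Pk (rc (\<rho> s) s) t * Pk (rc (\<rho> s') s') t) \<partial>circ)"
        using \<rho>_lt \<rho>_range by (simp add: k_def ennreal_mult' cmod_rc)
      also have "\<dots> \<le> ennreal (16 * pi) * (k s' s + k s s')"
        unfolding k_def by (rule Pk_Pk_le_sum) (use \<rho>_lt \<rho>_range in auto)
      finally show "(\<integral>\<^sup>+t. k s t * k s' t \<partial>circ) \<le> ennreal (16 * pi) * (k s' s + k s s')" .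
    qed auto
    also have "\<dots> = ennreal (16 * pi) * ((\<integral>\<^sup>+s. (\<integral>\<^sup>+s'. S s * S s' * k s' s \<partial>circ) \<partial>circ) + (\<integral>\<^sup>+s. (\<integral>\<^sup>+s'. S s * S s' * k s s' \<partial>circ) \<partial>circ))"
    proof -
      have e: "S s * S s' * (ennreal (16 * pi) * (k s' s + k s s')) = ennreal (16 * pi) * (S s * S s' * k s' s + S s * S s' * k s s')" for s s'
        by (simp only: distrib_left mult.left_commute[of _ "ennreal (16 * pi)"])
      have [measurable]: "(\<lambda>s'. S s * S s' * k s' s) \<in> borel_measurable circ" "(\<lambda>s'. S s * S s' * k s s') \<in> borel_measurable circ" for s
        by measurable
      have [measurable]: "(\<lambda>s. \<integral>\<^sup>+s'. S s * S s' * k s' s \<partial>circ) \<in> borel_measurable circ"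
        "(\<lambda>s. \<integral>\<^sup>+s'. S s * S s' * k s s' \<partial>circ) \<in> borel_measurable circ"
        by measurable
      show ?thesis unfolding e
        by (subst nn_integral_cmult, measurable)
           (subst nn_integral_add, measurable, subst nn_integral_cmult, measurable, subst nn_integral_add, simp_all)
    qed
    also have "(\<integral>\<^sup>+s. (\<integral>\<^sup>+s'. S s * S s' * k s' s \<partial>circ) \<partial>circ) = (\<integral>\<^sup>+s. (\<integral>\<^sup>+s'. S s * S s' * k s s' \<partial>circ) \<partial>circ)"
      by (subst circ2.Fubini') (simp_all add: mult_ac)
    also have "(\<integral>\<^sup>+s. (\<integral>\<^sup>+s'. S s * S s' * k s s' \<partial>circ) \<partial>circ) = (\<integral>\<^sup>+s. S s * PI (\<rho> s) S s \<partial>circ)"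
      unfolding PI_def k_def[symmetric] by (intro nn_integral_cong) (auto simp: nn_integral_cmult[symmetric] mult_ac)
    also have "ennreal (16 * pi) * (x + x) = ennreal (32 * pi) * x" for x
    proof -
      have "ennreal (32 * pi) = ennreal (16 * pi) + ennreal (16 * pi)" by (subst ennreal_plus[symmetric]) auto
      thus ?thesis by (simp only: distrib_left distrib_right)
    qed
    also have "(\<integral>\<^sup>+s. S s * PI (\<rho> s) S s \<partial>circ)
      \<le> ennreal (sqrt M) * I + ennreal (1 / sqrt M) * (\<integral>\<^sup>+s. (PI (\<rho> s) S s)\<^sup>2 \<partial>circ)"
      unfolding I_def using M by (intro nn_integral_young) auto
    also have "(\<integral>\<^sup>+s. (PI (\<rho> s) S s)\<^sup>2 \<partial>circ) \<le> ennreal M * I"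
      using valid S_meas by (simp add: L2_valid_def I_def)
    also have "ennreal (sqrt M) * I + ennreal (1 / sqrt M) * (ennreal M * I) = ennreal (2 * sqrt M) * I"
    proof -
      have "ennreal (1 / sqrt M) * ennreal M = ennreal (sqrt M)"
        using M by (subst ennreal_mult[symmetric]) (auto simp: real_div_sqrt)
      hence "ennreal (sqrt M) * I + ennreal (1 / sqrt M) * (ennreal M * I) = (ennreal (sqrt M) + ennreal (sqrt M)) * I"
        by (simp add: mult.assoc[symmetric] distrib_right)
      thus ?thesis using M by (simp add: ennreal_plus[symmetric] del: ennreal_plus)
    qed
    finally have BI: "(\<integral>\<^sup>+t. (B t)\<^sup>2 \<partial>circ) \<le> ennreal (32 * pi) * (ennreal (2 * sqrt M) * I)"
      by (simp add: mult_left_mono)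
    \<comment> \<open>\<open>l\<close> is chosen such that
      \<open>(1 / l) * (32 * pi) * (2 * sqrt M) = 1/2\<close>.\<close>
    define l where "l = 128 * pi * sqrt M"
    have l: "0 < l" using M by (simp add: l_def)
    have "I \<le> ennreal l * F + ennreal (1 / l) * (\<integral>\<^sup>+t. (B t)\<^sup>2 \<partial>circ)"
      unfolding I1 F_def by (rule nn_integral_young) (use l in auto)
    also have "\<dots> \<le> ennreal l * F + ennreal (1 / l) * (ennreal (32 * pi) * (ennreal (2 * sqrt M) * I))"
      by (intro add_left_mono mult_left_mono BI) auto
    also have "ennreal (1 / l) * (ennreal (32 * pi) * (ennreal (2 * sqrt M) * I)) = ennreal (1/2) * I"
      using M l unfolding mult.assoc[symmetric]
      by (simp add: ennreal_mult'[symmetric] l_def)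
    finally have "I \<le> 2 * (ennreal l * F)" using Ifin by (rule ennreal_absorb_half)
    also have "\<dots> = ennreal (256 * pi * sqrt M) * F"
      using M by (simp add: l_def mult.assoc[symmetric] ennreal_mult'[symmetric] ennreal_numeral[symmetric] del: ennreal_numeral)
    finally show ?thesis by (simp add: I_def S_def F_def)
  qed
qed

lemma L2_valid_mono: "L2_valid M \<Longrightarrow> M \<le> M' \<Longrightarrow> L2_valid M'"
  unfolding L2_valid_def by (meson ennreal_leI mult_right_mono order.trans zero_le)

text \<open>All radii stay below \<open>R < 1\<close>, so the kernel is bounded by
  \<open>1 / (1 - R)\<^sup>2\<close>. The resulting constant depends on \<open>R\<close>, but it
  only starts the iteration.\<close>

lemma L2_valid_start: "\<exists>M>0. L2_valid M"
proof -
  define b where "b = 1 / (1 - R)\<^sup>2"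
  have b: "0 < b" using R by (simp add: b_def)
  have kb: "Pk (rc (\<rho> s) s) t \<le> b" for s t
  proof -
    have "1 - R \<le> cmod (cis t - rc (\<rho> s) s)"
      using norm_triangle_ineq2[of "cis t" "rc (\<rho> s) s"] \<rho>_range[of s] by (simp add: cmod_rc)
    hence "(1 - R)\<^sup>2 \<le> (cmod (cis t - rc (\<rho> s) s))\<^sup>2" using R by (intro power_mono) auto
    thus ?thesis unfolding Pk_def b_def using R by (intro frac_le) (auto simp: abs_square_le_1)
  qed
  have "L2_valid (b\<^sup>2 * (2 * pi * (4 * pi)))"
    unfolding L2_valid_def
  proof
    fix f :: "real \<Rightarrow> ennreal" assume f[measurable]: "f \<in> borel_measurable circ"
    let ?F = "\<integral>\<^sup>+s. (f s)\<^sup>2 \<partial>circ"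
    have em: "emeasure circ {0..2*pi} = ennreal (2 * pi)"
      by (simp add: circ_def emeasure_restrict_space)
    have "(\<integral>\<^sup>+t. f t \<partial>circ)\<^sup>2 = (\<integral>\<^sup>+s. (\<integral>\<^sup>+t. f s * f t \<partial>circ) \<partial>circ)"
      by (simp add: power2_eq_square nn_integral_cmult nn_integral_multc)
    also have "\<dots> \<le> (\<integral>\<^sup>+s. (\<integral>\<^sup>+t. (f s)\<^sup>2 + (f t)\<^sup>2 \<partial>circ) \<partial>circ)"
      using ennreal_young[of 1] by (intro nn_integral_mono) simp
    also have "\<dots> = ennreal (4 * pi) * ?F"
    proof -
      have "ennreal (4 * pi) = ennreal (2 * pi) + ennreal (2 * pi)" by (subst ennreal_plus[symmetric]) auto
      thus ?thesis by (simp add: nn_integral_add nn_integral_cmult nn_integral_multc em distrib_right mult.commute[of _ "ennreal (2 * pi)"])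
    qed
    finally have f2: "(\<integral>\<^sup>+t. f t \<partial>circ)\<^sup>2 \<le> ennreal (4 * pi) * ?F" .
    have "(PI (\<rho> s) f s)\<^sup>2 \<le> ennreal (b\<^sup>2) * (ennreal (4 * pi) * ?F)" for s
    proof -
      have "PI (\<rho> s) f s \<le> (\<integral>\<^sup>+t. ennreal b * f t \<partial>circ)"
        unfolding PI_def by (intro nn_integral_mono mult_right_mono ennreal_leI kb) auto
      also have "\<dots> = ennreal b * (\<integral>\<^sup>+t. f t \<partial>circ)" by (rule nn_integral_cmult) measurable
      finally have "(PI (\<rho> s) f s)\<^sup>2 \<le> (ennreal b * (\<integral>\<^sup>+t. f t \<partial>circ))\<^sup>2" by (intro power_mono) auto
      also have "\<dots> = ennreal (b\<^sup>2) * (\<integral>\<^sup>+t. f t \<partial>circ)\<^sup>2"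
        using b by (simp add: power_mult_distrib ennreal_power)
      also have "\<dots> \<le> ennreal (b\<^sup>2) * (ennreal (4 * pi) * ?F)" by (intro mult_left_mono f2) auto
      finally show ?thesis .
    qed
    hence "(\<integral>\<^sup>+s. (PI (\<rho> s) f s)\<^sup>2 \<partial>circ) \<le> (\<integral>\<^sup>+s. ennreal (b\<^sup>2) * (ennreal (4 * pi) * ?F) \<partial>circ)"
      by (intro nn_integral_mono)
    also have "\<dots> = ennreal (b\<^sup>2 * (2 * pi * (4 * pi))) * ?F"
    proof -
      have "ennreal (b\<^sup>2 * (2 * pi * (4 * pi))) = ennreal (b\<^sup>2) * (ennreal (4 * pi) * ennreal (2 * pi))"
        by (simp add: ennreal_mult'[symmetric] mult_ac)
      thus ?thesis by (simp only: nn_integral_const space_circ em) (simp only: mult_ac)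
    qed
    finally show "(\<integral>\<^sup>+s. (PI (\<rho> s) f s)\<^sup>2 \<partial>circ) \<le> ennreal (b\<^sup>2 * (2 * pi * (4 * pi))) * ?F" .
  qed
  moreover have "0 < b\<^sup>2 * (2 * pi * (4 * pi))" using b by simp
  ultimately show ?thesis by blast
qed

text \<open>Measured in units of \<open>D\<^sup>2\<close> with \<open>D = 256 * pi\<close>, one
  improvement replaces a constant \<open>x\<close> by its square root. After \<open>n\<close> steps
  \<open>x powr (1 / 2 ^ n)\<close> is at most \<open>2\<close>, however large the initial constant
  was.\<close>

lemma L2_valid_absolute: "L2_valid (2 * (256 * pi)\<^sup>2)"
proof -
  obtain M where M: "0 < M" "L2_valid M" using L2_valid_start by blast
  define D where "D = 256 * pi"
  define x where "x = M / D\<^sup>2"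
  have D: "0 < D" by (simp add: D_def)
  have x: "0 < x" using M D by (simp add: x_def)
  have v: "L2_valid (D\<^sup>2 * x powr (1 / 2 ^ n))" for n
  proof (induction n)
    case 0 thus ?case using M D x by (simp add: x_def)
  next
    case (Suc n)
    have "L2_valid (D * sqrt (D\<^sup>2 * x powr (1 / 2 ^ n)))"
      unfolding D_def by (rule L2_valid_improve[OF _ Suc[unfolded D_def]]) (use x in auto)
    also have "sqrt (D\<^sup>2 * x powr (1 / 2 ^ n)) = D * x powr (1 / 2 ^ Suc n)"
      using D x by (simp add: real_sqrt_mult powr_half_sqrt[symmetric] powr_powr mult.commute)
    finally show ?case by (simp add: power2_eq_square mult.assoc)
  qed
  obtain n where n: "x < 2 ^ n" using real_arch_pow[of 2 x] by auto
  have "x powr (1 / 2 ^ n) \<le> (2 powr (2 ^ n)) powr (1 / 2 ^ n)"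
  proof (rule powr_mono2)
    have "(2::real) ^ n \<le> 2 ^ (2 ^ n)" by (intro power_increasing) (auto intro: less_imp_le[OF less_exp])
    also have "\<dots> = 2 powr real (2 ^ n)" by (rule powr_realpow[symmetric]) simp
    finally show "x \<le> 2 powr (2 ^ n)" using n by simp
  qed (use x in auto)
  also have "\<dots> = 2" by (simp add: powr_powr)
  finally have "D\<^sup>2 * x powr (1 / 2 ^ n) \<le> D\<^sup>2 * 2" by (intro mult_left_mono) auto
  from L2_valid_mono[OF v this] show ?thesis by (simp add: D_def mult.commute)
qed

end

text \<open>Among finitely many radii the supremum is attained at a measurable choice
  \<open>sel n s\<close>, whose values stay below some \<open>R < 1\<close>. The bound for the
  linearised operator does not depend on \<open>R\<close>, so monotone convergence extends it to the
  whole sequence.\<close>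

lemma maximal_L2:
  fixes rr :: "nat \<Rightarrow> real"
  assumes rr: "\<And>n. 0 \<le> rr n" "\<And>n. rr n < 1" and V [measurable]: "V \<in> borel_measurable circ"
  shows "(\<integral>\<^sup>+s. (SUP n. PI (rr n) V s)\<^sup>2 \<partial>circ) \<le> ennreal (2 * (256 * pi)\<^sup>2) * (\<integral>\<^sup>+s. (V s)\<^sup>2 \<partial>circ)"
proof -
  define sel where "sel = rec_nat (\<lambda>_. rr 0) (\<lambda>n f s. if PI (f s) V s < PI (rr (Suc n)) V s then rr (Suc n) else f s)"
  have sel0: "sel 0 s = rr 0" for s by (simp add: sel_def)
  have selS: "sel (Suc n) s = (if PI (sel n s) V s < PI (rr (Suc n)) V s then rr (Suc n) else sel n s)" for n s
    by (simp add: sel_def)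
  have sel_rr: "\<exists>k\<le>n. sel n s = rr k" for n s
    by (induction n) (auto simp: sel0 selS le_Suc_eq)
  have sel_meas: "sel n \<in> borel_measurable circ" for n
  proof (induction n)
    case 0 thus ?case by (simp add: sel0[abs_def])
  next
    case (Suc n)
    note [measurable] = Suc
    have [measurable]: "(\<lambda>s. PI (sel n s) V s) \<in> borel_measurable circ" "(\<lambda>s. PI (rr (Suc n)) V s) \<in> borel_measurable circ"
      unfolding PI_def by measurable
    show ?case unfolding selS[abs_def] by measurable
  qed
  define S where "S n s = PI (sel n s) V s" for n s
  have S_meas [measurable]: "S n \<in> borel_measurable circ" for n
    unfolding S_def[abs_def] PI_def using sel_meas[of n] by measurable
  have S_Suc: "S n s \<le> S (Suc n) s" "PI (rr (Suc n)) V s \<le> S (Suc n) s" for n s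
    by (auto simp: S_def selS)
  have S_mono: "incseq S" by (rule incseq_SucI) (simp add: le_fun_def S_Suc)
  have S_ge: "PI (rr n) V s \<le> S n s" for n s
  proof (cases n)
    case 0 thus ?thesis by (simp add: S_def sel0)
  next
    case (Suc m) thus ?thesis using S_Suc(2)[where n=m] by simp
  qed
  have bound: "(\<integral>\<^sup>+s. (S n s)\<^sup>2 \<partial>circ) \<le> ennreal (2 * (256 * pi)\<^sup>2) * (\<integral>\<^sup>+s. (V s)\<^sup>2 \<partial>circ)" for n
  proof -
    define R where "R = Max (rr ` {..n})"
    have R: "R < 1" unfolding R_def using rr by (subst Max_less_iff) auto
    have "0 \<le> sel n s" "sel n s \<le> R" for s
      using sel_rr[of n s] rr unfolding R_def by (auto intro!: Max_ge)
    from L2_valid_absolute[OF sel_meas this R] show ?thesis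
      unfolding S_def using V sel_meas \<open>\<And>s. 0 \<le> sel n s\<close> \<open>\<And>s. sel n s \<le> R\<close> R
      by (subst (asm) L2_valid_def) auto
  qed
  have "(SUP n. PI (rr n) V s)\<^sup>2 \<le> (SUP n. (S n s)\<^sup>2)" for s
  proof -
    have "(SUP n. PI (rr n) V s) \<le> (SUP n. S n s)" by (intro SUP_mono) (use S_ge in auto)
    hence "(SUP n. PI (rr n) V s)\<^sup>2 \<le> (SUP n. S n s) * (SUP n. S n s)"
      unfolding power2_eq_square by (intro mult_mono) auto
    also have "\<dots> = (SUP n. SUP m. S n s * S m s)"
      by (simp add: SUP_mult_left_ennreal SUP_mult_right_ennreal mult.commute)
    also have "\<dots> \<le> (SUP n. (S n s)\<^sup>2)"
    proof (intro SUP_least)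
      fix n m :: nat
      have "S n s \<le> S (max n m) s" "S m s \<le> S (max n m) s" using S_mono by (auto simp: incseq_def le_fun_def)
      hence "S n s * S m s \<le> (S (max n m) s)\<^sup>2" unfolding power2_eq_square by (intro mult_mono) auto
      also have "\<dots> \<le> (SUP n. (S n s)\<^sup>2)" by (rule SUP_upper) simp
      finally show "S n s * S m s \<le> (SUP n. (S n s)\<^sup>2)" .
    qed
    finally show ?thesis .
  qed
  hence "(\<integral>\<^sup>+s. (SUP n. PI (rr n) V s)\<^sup>2 \<partial>circ) \<le> (\<integral>\<^sup>+s. (SUP n. (S n s)\<^sup>2) \<partial>circ)"
    by (intro nn_integral_mono)
  also have "\<dots> = (SUP n. (\<integral>\<^sup>+s. (S n s)\<^sup>2 \<partial>circ))"
    by (intro nn_integral_monotone_convergence_SUP)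
       (use S_mono in \<open>auto simp: incseq_def le_fun_def intro!: power_mono\<close>)
  also have "\<dots> \<le> ennreal (2 * (256 * pi)\<^sup>2) * (\<integral>\<^sup>+s. (V s)\<^sup>2 \<partial>circ)"
    by (intro SUP_least bound)
  finally show ?thesis .
qed

lemma emeasure_circ: "emeasure circ {0..2*pi} = ennreal (2 * pi)"
  by (simp add: circ_def emeasure_restrict_space)

lemma green_kernel_borel [measurable (raw)]:
  "f \<in> borel_measurable M \<Longrightarrow> g \<in> borel_measurable M \<Longrightarrow> (\<lambda>x. green_kernel (f x) (g x)) \<in> borel_measurable M"
proof -
  assume [measurable]: "f \<in> borel_measurable M" "g \<in> borel_measurable M"
  have [measurable]: "cnj \<in> borel_measurable borel"
    by (intro borel_measurable_continuous_onI continuous_intros)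
  show ?thesis unfolding green_kernel_def by measurable
qed

section \<open>Moments of the area function\<close>

text \<open>If \<open>g\<close> is read as time, a power of a continuous increasing process is a
  multiple of the integral of its increments against a power of its past. Ties in \<open>g\<close>
  spoil the exact identity. Splitting the total at \<open>g x\<close> and exchanging the two
  variables in the later part gives the inequality at the cost of a factor \<open>2\<close> per
  step.\<close>

lemma prefix_power_le:
  fixes f :: "'a \<Rightarrow> ennreal" and g :: "'a \<Rightarrow> real"
  assumes "sigma_finite_measure M" and f [measurable]: "f \<in> borel_measurable M" and g [measurable]: "g \<in> borel_measurable M"
  shows "(\<integral>\<^sup>+x. f x \<partial>M) ^ Suc n \<le> 2 ^ n * (\<integral>\<^sup>+x. f x * (\<integral>\<^sup>+y. f y * indicator {y. g y \<le> g x} y \<partial>M) ^ n \<partial>M)"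
proof (induction n)
  case 0 show ?case by simp
next
  case (Suc n)
  interpret sigma_finite_measure M by fact
  interpret pair_sigma_finite M M by unfold_locales
  define I where "I = (\<integral>\<^sup>+x. f x \<partial>M)"
  define P where "P x = (\<integral>\<^sup>+y. f y * indicator {y. g y \<le> g x} y \<partial>M)" for x
  have ind [measurable]: "(\<lambda>(x,y). indicator {y. g y \<le> g x} y :: ennreal) \<in> borel_measurable (M \<Otimes>\<^sub>M M)"
  proof -
    have "(\<lambda>(x,y). indicator {y. g y \<le> g x} y :: ennreal) = (\<lambda>z. if g (snd z) \<le> g (fst z) then 1 else 0)"
      by (auto simp: fun_eq_iff)
    thus ?thesis by simp
  qed
  have ind' [measurable]: "(\<lambda>(x,y). indicator {y. g y > g x} y :: ennreal) \<in> borel_measurable (M \<Otimes>\<^sub>M M)"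
  proof -
    have "(\<lambda>(x,y). indicator {y. g y > g x} y :: ennreal) = (\<lambda>z. if g (snd z) > g (fst z) then 1 else 0)"
      by (auto simp: fun_eq_iff)
    thus ?thesis by simp
  qed
  have P_meas [measurable]: "P \<in> borel_measurable M" unfolding P_def by measurable
  have P_mono: "P x \<le> P y" if "g x \<le> g y" for x y
    unfolding P_def using that by (intro nn_integral_mono mult_left_mono) (auto split: split_indicator)
  have split: "I = P x + (\<integral>\<^sup>+y. f y * indicator {y. g y > g x} y \<partial>M)" if "x \<in> space M" for x
  proof -
    have [measurable]: "(\<lambda>y. indicator {y. g y \<le> g x} y :: ennreal) \<in> borel_measurable M"
      "(\<lambda>y. indicator {y. g y > g x} y :: ennreal) \<in> borel_measurable M"
      using measurable_compose[OF measurable_Pair1'[OF that] ind] measurable_compose[OF measurable_Pair1'[OF that] ind'] by auto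
    have "I = (\<integral>\<^sup>+y. f y * indicator {y. g y \<le> g x} y + f y * indicator {y. g y > g x} y \<partial>M)"
      unfolding I_def by (intro nn_integral_cong) (auto split: split_indicator)
    thus ?thesis unfolding P_def by (subst (asm) nn_integral_add) auto
  qed
  have "I ^ Suc (Suc n) = I ^ Suc n * I" by (rule power_Suc2)
  also have "\<dots> \<le> (2 ^ n * (\<integral>\<^sup>+x. f x * P x ^ n \<partial>M)) * I"
    using Suc by (intro mult_right_mono) (auto simp: I_def P_def)
  also have "\<dots> = 2 ^ n * (\<integral>\<^sup>+x. f x * P x ^ n * I \<partial>M)"
    by (subst nn_integral_multc) (simp_all add: mult.assoc)
  also have "(\<integral>\<^sup>+x. f x * P x ^ n * I \<partial>M) = (\<integral>\<^sup>+x. f x * P x ^ n * (P x + (\<integral>\<^sup>+y. f y * indicator {y. g y > g x} y \<partial>M)) \<partial>M)"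
    by (intro nn_integral_cong) (metis split)
  also have "\<dots> = (\<integral>\<^sup>+x. f x * P x ^ Suc n \<partial>M) + (\<integral>\<^sup>+x. f x * P x ^ n * (\<integral>\<^sup>+y. f y * indicator {y. g y > g x} y \<partial>M) \<partial>M)"
    by (simp add: distrib_left nn_integral_add mult_ac)
  also have "(\<integral>\<^sup>+x. f x * P x ^ n * (\<integral>\<^sup>+y. f y * indicator {y. g y > g x} y \<partial>M) \<partial>M)
     = (\<integral>\<^sup>+x. (\<integral>\<^sup>+y. f x * P x ^ n * (f y * indicator {y. g y > g x} y) \<partial>M) \<partial>M)"
    by (intro nn_integral_cong nn_integral_cmult[symmetric])
       (auto intro!: borel_measurable_times_ennreal measurable_compose[OF measurable_Pair1' ind', simplified])
  also have "\<dots> = (\<integral>\<^sup>+y. (\<integral>\<^sup>+x. f x * P x ^ n * (f y * indicator {y. g y > g x} y) \<partial>M) \<partial>M)"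
    by (rule Fubini'[symmetric]) measurable
  also have "\<dots> \<le> (\<integral>\<^sup>+y. (\<integral>\<^sup>+x. (f y * P y ^ n) * (f x * indicator {x. g x \<le> g y} x) \<partial>M) \<partial>M)"
  proof (intro nn_integral_mono)
    fix x y
    show "f x * P x ^ n * (f y * indicator {y. g y > g x} y) \<le> (f y * P y ^ n) * (f x * indicator {x. g x \<le> g y} x)"
    proof (cases "g x < g y")
      case True
      have "f x * P x ^ n * f y \<le> f x * P y ^ n * f y"
        using P_mono[of x y] True by (intro mult_mono power_mono) auto
      thus ?thesis using True by (simp add: mult_ac)
    qed auto
  qed
  also have "\<dots> = (\<integral>\<^sup>+y. (f y * P y ^ n) * P y \<partial>M)"
    unfolding P_def
    by (intro nn_integral_cong nn_integral_cmult)
       (auto intro!: borel_measurable_times_ennreal measurable_compose[OF measurable_Pair1' ind, simplified])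
  also have "\<dots> = (\<integral>\<^sup>+x. f x * P x ^ Suc n \<partial>M)" by (simp add: mult_ac)
  also have "2 ^ n * (x + x) = 2 ^ Suc n * x" for x :: ennreal
    by (simp add: mult_2[symmetric] mult_ac)
  finally show ?case by (simp add: add_left_mono I_def P_def mult_left_mono)
qed

lemma cmod_cis_minus_one_le: "cmod (cis x - 1) \<le> \<bar>x\<bar>"
proof -
  have "cos x = 1 - 2 * (sin (x/2))\<^sup>2" using cos_double_sin[of "x/2"] by simp
  moreover have "(cmod (cis x - 1))\<^sup>2 = 2 - 2 * cos x"
    unfolding cmod_power2 using sin_cos_squared_add[of x] by (simp add: power2_eq_square algebra_simps)
  ultimately have "(cmod (cis x - 1))\<^sup>2 = (2 * \<bar>sin (x/2)\<bar>)\<^sup>2" by (simp add: power_mult_distrib)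
  hence "cmod (cis x - 1) = 2 * \<bar>sin (x/2)\<bar>" by (subst (asm) power2_eq_iff_nonneg) auto
  also have "\<dots> \<le> \<bar>x\<bar>" using abs_sin_x_le_abs_x[of "x/2"] by simp
  finally show ?thesis .
qed

text \<open>On an arc of length \<open>1 - r\<close> next to \<open>s\<close> the kernel is at least
  \<open>1 / (4 * (1 - r))\<close>.\<close>

lemma near_mass:
  assumes r: "0 \<le> r" "r < 1" and s: "s \<in> {0..2*pi}"
  shows "ennreal (1/4) \<le> (\<integral>\<^sup>+t. ennreal (Pk (rc r s) t) * indicator {t. cmod (cis t - cis s) \<le> 1 - r} t \<partial>circ)"
proof -
  \<comment> \<open>\<open>circ\<close> lives on an interval whose end points are not identified, so
    the arc is taken to the right of \<open>s\<close> in the first half and to its left in the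
    second.\<close>
  define l where "l = (if s \<le> pi then s else s - (1 - r))"
  have pi1: "1 < pi" using pi_gt3 by simp
  have l: "{l..l+(1-r)} \<subseteq> {0..2*pi}" using s r pi1 by (auto simp: l_def split: if_splits)
  have near: "cmod (cis t - cis s) \<le> 1 - r" if "t \<in> {l..l+(1-r)}" for t
  proof -
    have "cmod (cis t - cis s) \<le> \<bar>t - s\<bar>"
    proof -
      have "cis t - cis s = cis s * (cis (t - s) - 1)" by (simp add: algebra_simps cis_mult)
      hence "cmod (cis t - cis s) = cmod (cis (t - s) - 1)" by (simp add: norm_mult)
      also have "\<dots> \<le> \<bar>t - s\<bar>" by (rule cmod_cis_minus_one_le)
      finally show ?thesis .
    qed
    also have "\<dots> \<le> 1 - r" using that r by (auto simp: l_def split: if_splits)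
    finally show ?thesis .
  qed
  have pk: "1 / (4 * (1 - r)) \<le> Pk (rc r s) t" if "cmod (cis t - cis s) \<le> 1 - r" for t
  proof -
    have "cis s - rc r s = of_real (1 - r) * cis s" by (simp add: rc_def algebra_simps)
    hence "cmod (cis s - rc r s) = 1 - r" using r by (simp only: norm_mult norm_of_real norm_cis) simp
    hence "cmod (cis t - rc r s) \<le> 2 * (1 - r)"
      using norm_triangle_ineq[of "cis t - cis s" "cis s - rc r s"] that by simp
    hence le: "(cmod (cis t - rc r s))\<^sup>2 \<le> (2 * (1 - r))\<^sup>2" by (intro power_mono) auto
    have pos: "0 < cmod (cis t - rc r s)" using cis_neq[of "rc r s" t] r by (simp add: cmod_rc)
    have "1 / (4 * d) = d / (2 * d)\<^sup>2" if "0 < d" for d :: real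
      using that by (simp add: power2_eq_square)
    from this[of "1 - r"] have "1 / (4 * (1 - r)) = (1 - r) / (2 * (1 - r))\<^sup>2" using r by simp
    also have "\<dots> \<le> (1 - (cmod (rc r s))\<^sup>2) / (cmod (cis t - rc r s))\<^sup>2"
      using le pos r by (intro frac_le) (auto simp: cmod_rc power2_eq_square mult_left_le abs_square_le_1[unfolded power2_eq_square])
    finally show ?thesis by (simp add: Pk_def)
  qed
  have "ennreal (1/4) = ennreal (1 / (4 * (1 - r))) * ennreal (1 - r)"
    using r by (subst ennreal_mult'[symmetric]) auto
  also have "ennreal (1 - r) = emeasure lborel {l..l+(1-r)}" using r by simp
  also have "ennreal (1 / (4 * (1 - r))) * emeasure lborel {l..l+(1-r)} = (\<integral>\<^sup>+t. ennreal (1 / (4 * (1 - r))) * indicator {l..l+(1-r)} t \<partial>lborel)"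
    by (subst nn_integral_cmult_indicator) auto
  also have "\<dots> \<le> (\<integral>\<^sup>+t. ennreal (Pk (rc r s) t) * indicator {t. cmod (cis t - cis s) \<le> 1 - r} t * indicator {0..2*pi} t \<partial>lborel)"
    using l near pk by (intro nn_integral_mono) (auto split: split_indicator intro!: ennreal_leI)
  finally show ?thesis by (simp add: nn_integral_circ)
qed

text \<open>Radii below \<open>1/2\<close> are left out since \<open>lapf\<close> contains the
  factor \<open>(cmod z)\<^sup>2\<close>, which degenerates at the centre. In the radial integral
  they are handled by Cauchy's estimate, see \<open>N_powr_le\<close>.\<close>

definition radii :: "real measure" where "radii = restrict_space lborel {1/2..<1}"

lemma space_radii [simp]: "space radii = {1/2..<1}"
  by (simp add: radii_def space_restrict_space)

lemma measurable_radii [measurable (raw)]: "f \<in> borel_measurable borel \<Longrightarrow> f \<in> borel_measurable radii"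
  unfolding radii_def by (intro measurable_restrict_space1) simp

lemma borel_measurable_ident_radii [measurable]: "(\<lambda>x. x) \<in> borel_measurable radii"
  by (intro measurable_radii) simp

lemma emeasure_radii: "emeasure radii {1/2..<1} = ennreal (1/2)"
  by (simp add: radii_def emeasure_restrict_space)

lemma finite_measure_radii: "finite_measure radii"
  by (rule finite_measureI) (simp add: emeasure_radii)

interpretation radii: finite_measure radii by (rule finite_measure_radii)
interpretation rcirc: pair_sigma_finite radii circ by unfold_locales

abbreviation annulus :: "(real \<times> real) measure" where "annulus \<equiv> radii \<Otimes>\<^sub>M circ"

lemma sigma_finite_annulus: "sigma_finite_measure annulus"
  by (rule rcirc.P.sigma_finite_measure_axioms)

interpretation annulus: sigma_finite_measure annulus by (rule sigma_finite_annulus)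
interpretation acirc: pair_sigma_finite annulus circ by unfold_locales
interpretation aann: pair_sigma_finite annulus annulus by unfold_locales

text \<open>The area function uses the Poisson kernel as a smooth weight in place of the indicator
  of an approach region; this makes the semigroup formula available for products of
  densities.\<close>

definition sqk :: "(complex \<Rightarrow> real) \<Rightarrow> real \<times> real \<Rightarrow> real \<Rightarrow> ennreal" where
  "sqk \<phi> z s = ennreal ((1 - fst z) * Pk (rc (fst z) (snd z)) s * \<phi> (rc (fst z) (snd z)))"

definition sqf :: "(complex \<Rightarrow> real) \<Rightarrow> real \<Rightarrow> ennreal" where
  "sqf \<phi> s = (\<integral>\<^sup>+z. sqk \<phi> z s \<partial>annulus)"

definition sqf_upto :: "(complex \<Rightarrow> real) \<Rightarrow> real \<Rightarrow> real \<Rightarrow> ennreal" where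
  "sqf_upto \<phi> r s = (\<integral>\<^sup>+z. sqk \<phi> z s * indicator {z. fst z \<le> r} z \<partial>annulus)"

text \<open>A continuous analogue of Garsia's lemma: \<open>m\<close>-th moments of the increasing process
  \<open>sqf_upto\<close> are controlled by those of a majorant \<open>Y\<close> of its conditional expectations.\<close>

lemma area_moment_garsia:
  fixes \<phi> :: "complex \<Rightarrow> real" and Y :: "real \<Rightarrow> ennreal"
  assumes \<phi> [measurable]: "\<phi> \<in> borel_measurable borel" and nn: "\<And>w. 0 \<le> \<phi> w" and Y [measurable]: "Y \<in> borel_measurable circ"
    and green: "\<And>r s. 1/2 \<le> r \<Longrightarrow> r < 1 \<Longrightarrow>
       (\<integral>\<^sup>+z. ennreal (green_kernel (rc r s) (rc (fst z) (snd z)) * \<phi> (rc (fst z) (snd z))) \<partial>annulus) \<le> Y s"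
  shows "(\<integral>\<^sup>+s. sqf \<phi> s ^ Suc (Suc n) \<partial>circ)
     \<le> ennreal (2 ^ (2 * n + 1) * 4 ^ (n + 2) * (4 * pi)) * (\<integral>\<^sup>+s. Y s * sqf \<phi> s ^ Suc n \<partial>circ)"
proof -
  define K where "K z s = sqk \<phi> z s" for z s
  define A where "A = sqf_upto \<phi>"
  have [measurable]: "(\<lambda>(z,s). K z s) \<in> borel_measurable (annulus \<Otimes>\<^sub>M circ)" unfolding K_def sqk_def by measurable
  have [measurable]: "(\<lambda>(s,z). K z s) \<in> borel_measurable (circ \<Otimes>\<^sub>M annulus)" unfolding K_def sqk_def by measurable
  have K1 [measurable]: "(\<lambda>z. K z s) \<in> borel_measurable annulus" for s unfolding K_def sqk_def by measurable
  have K2 [measurable]: "(\<lambda>s. K z s) \<in> borel_measurable circ" for z unfolding K_def sqk_def by measurable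
  have ind_eq: "indicator {z. fst z \<le> r} z = (if fst z \<le> r then 1 else (0::ennreal))" for z :: "real \<times> real" and r by auto
  have A: "A r s = (\<integral>\<^sup>+z. K z s * indicator {z. fst z \<le> r} z \<partial>annulus)" for r s by (simp add: A_def sqf_upto_def K_def)
  have F: "sqf \<phi> s = (\<integral>\<^sup>+z. K z s \<partial>annulus)" for s by (simp add: sqf_def K_def)
  have [measurable]: "(\<lambda>(y,s). A (fst y) s) \<in> borel_measurable (annulus \<Otimes>\<^sub>M circ)"
    unfolding A ind_eq K_def sqk_def by measurable
  have [measurable]: "(\<lambda>(s,y). A (fst y) s) \<in> borel_measurable (circ \<Otimes>\<^sub>M annulus)"
    unfolding A ind_eq K_def sqk_def by measurable
  have [measurable]: "(\<lambda>s. A r s) \<in> borel_measurable circ" for r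
    unfolding A ind_eq K_def sqk_def by measurable
  have [measurable]: "(\<lambda>y. A (fst y) s) \<in> borel_measurable annulus" for s
    unfolding A ind_eq K_def sqk_def by measurable
  have [measurable]: "sqf \<phi> \<in> borel_measurable circ" unfolding F[abs_def] K_def sqk_def by measurable
  have A_le: "A r s \<le> sqf \<phi> s" for r s
    unfolding A F by (intro nn_integral_mono) (auto split: split_indicator)
  \<comment> \<open>\<open>Q y\<close> is the share of the point \<open>y\<close> in the power
    \<open>Suc n\<close> of the process: the density at \<open>y\<close> times a power of the past
    up to the radius of \<open>y\<close>.\<close>
  define Q where "Q y s = K y s * A (fst y) s ^ n" for y s
  have Q1 [measurable]: "(\<lambda>(y,s). Q y s) \<in> borel_measurable (annulus \<Otimes>\<^sub>M circ)" unfolding Q_def by measurable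
  have Q2 [measurable]: "(\<lambda>s. Q y s) \<in> borel_measurable circ" for y unfolding Q_def by measurable
  have Q3 [measurable]: "(\<lambda>(s,y). Q y s) \<in> borel_measurable (circ \<Otimes>\<^sub>M annulus)" unfolding Q_def by measurable
  have Q4 [measurable]: "(\<lambda>y. Q y s) \<in> borel_measurable annulus" for s unfolding Q_def by measurable
  have A_pow: "A r s ^ Suc n \<le> 2 ^ n * (\<integral>\<^sup>+y. Q y s * indicator {y. fst y \<le> r} y \<partial>annulus)" for r s
  proof -
    have "A r s ^ Suc n \<le> 2 ^ n * (\<integral>\<^sup>+x. K x s * indicator {z. fst z \<le> r} x *
         (\<integral>\<^sup>+y. K y s * indicator {z. fst z \<le> r} y * indicator {y. fst y \<le> fst x} y \<partial>annulus) ^ n \<partial>annulus)"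
      unfolding A by (rule prefix_power_le[OF sigma_finite_annulus]) (unfold ind_eq, measurable)
    also have "\<dots> \<le> 2 ^ n * (\<integral>\<^sup>+x. K x s * indicator {z. fst z \<le> r} x * A (fst x) s ^ n \<partial>annulus)"
      unfolding A by (intro mult_left_mono nn_integral_mono power_mono) (auto split: split_indicator)
    finally show ?thesis by (simp add: Q_def mult_ac)
  qed
  \<comment> \<open>Two applications of \<open>prefix_power_le\<close> single out the outermost
    point \<open>z\<close> and the next one \<open>y\<close>, with
    \<open>fst y \<le> fst z\<close>.\<close>
  have F_pow: "sqf \<phi> s ^ Suc (Suc n) \<le> ennreal (2 ^ (2 * n + 1)) *
     (\<integral>\<^sup>+z. (\<integral>\<^sup>+y. K z s * Q y s * indicator {y. fst y \<le> fst z} y \<partial>annulus) \<partial>annulus)" for s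
  proof -
    have "sqf \<phi> s ^ Suc (Suc n) \<le> 2 ^ Suc n * (\<integral>\<^sup>+z. K z s * A (fst z) s ^ Suc n \<partial>annulus)"
      unfolding F A by (rule prefix_power_le[OF sigma_finite_annulus]) measurable
    also have "\<dots> \<le> 2 ^ Suc n * (\<integral>\<^sup>+z. K z s * (2 ^ n * (\<integral>\<^sup>+y. Q y s * indicator {y. fst y \<le> fst z} y \<partial>annulus)) \<partial>annulus)"
      by (intro mult_left_mono nn_integral_mono A_pow) auto
    also have "\<dots> = 2 ^ Suc n * (2 ^ n * (\<integral>\<^sup>+z. K z s * (\<integral>\<^sup>+y. Q y s * indicator {y. fst y \<le> fst z} y \<partial>annulus) \<partial>annulus))"
    proof -
      define J where "J z = (\<integral>\<^sup>+y. Q y s * indicator {y. fst y \<le> fst z} y \<partial>annulus)" for z :: "real \<times> real"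
      have [measurable]: "J \<in> borel_measurable annulus"
        unfolding J_def ind_eq by measurable
      have "(\<integral>\<^sup>+z. K z s * (2 ^ n * J z) \<partial>annulus) = (\<integral>\<^sup>+z. 2 ^ n * (K z s * J z) \<partial>annulus)"
        by (simp only: mult.left_commute)
      also have "\<dots> = 2 ^ n * (\<integral>\<^sup>+z. K z s * J z \<partial>annulus)"
        by (rule nn_integral_cmult) (intro borel_measurable_times_ennreal K1, measurable)
      finally show ?thesis unfolding J_def by (rule arg_cong)
    qed
    also have "\<dots> = 2 ^ Suc n * (2 ^ n * (\<integral>\<^sup>+z. (\<integral>\<^sup>+y. K z s * (Q y s * indicator {y. fst y \<le> fst z} y) \<partial>annulus) \<partial>annulus))"
      unfolding ind_eq by (subst nn_integral_cmult, measurable)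
    also have "(2::ennreal) ^ Suc n * (2 ^ n * x) = ennreal (2 ^ (2 * n + 1)) * x" for x
    proof -
      have 1: "ennreal (2 ^ (2 * n + 1)) = 2 ^ (2 * n + 1)" by (subst ennreal_power[symmetric]) auto
      have "Suc n + n = 2 * n + 1" by simp
      hence "(2::ennreal) ^ Suc n * 2 ^ n = 2 ^ (2 * n + 1)" by (metis power_add)
      thus ?thesis unfolding 1 by (metis mult.assoc)
    qed
    finally show ?thesis by (simp add: mult.assoc)
  qed
  \<comment> \<open>Every kernel inside \<open>Q y\<close> belongs to a radius at most
    \<open>fst y\<close>, so each of the \<open>Suc n\<close> factors changes by at most
    \<open>4\<close> when \<open>s\<close> moves by a chord of length
    \<open>1 - fst y\<close>.\<close>
  have Q_harnack: "Q y s \<le> 4 ^ Suc n * Q y s'" if y: "y \<in> space annulus" and c: "cmod (cis s - cis s') \<le> 1 - fst y" for y s s'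
  proof -
    have Kh: "K z s \<le> 4 * K z s'" if z: "z \<in> space annulus" and c: "cmod (cis s - cis s') \<le> 1 - fst z" for z
    proof -
      have fz: "1/2 \<le> fst z" "fst z < 1" using z by (auto simp: space_pair_measure)
      have "(1 - fst z) * Pk (rc (fst z) (snd z)) s * \<phi> (rc (fst z) (snd z)) \<le> (1 - fst z) * (4 * Pk (rc (fst z) (snd z)) s') * \<phi> (rc (fst z) (snd z))"
        using fz c nn by (intro mult_right_mono mult_left_mono harnack_angle) auto
      also have "\<dots> = 4 * ((1 - fst z) * Pk (rc (fst z) (snd z)) s' * \<phi> (rc (fst z) (snd z)))" by simp
      finally have "K z s \<le> ennreal (4 * ((1 - fst z) * Pk (rc (fst z) (snd z)) s' * \<phi> (rc (fst z) (snd z))))"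
        unfolding K_def sqk_def by (rule ennreal_leI)
      thus ?thesis by (simp add: K_def sqk_def ennreal_mult')
    qed
    have "A (fst y) s \<le> (\<integral>\<^sup>+z. 4 * (K z s' * indicator {z. fst z \<le> fst y} z) \<partial>annulus)"
      unfolding A using c by (intro nn_integral_mono) (auto split: split_indicator intro!: Kh simp: mult.assoc[symmetric])
    also have "\<dots> = 4 * A (fst y) s'" unfolding A ind_eq by (rule nn_integral_cmult) measurable
    finally have Ah: "A (fst y) s \<le> 4 * A (fst y) s'" .
    have "Q y s \<le> (4 * K y s') * (4 * A (fst y) s') ^ n"
      unfolding Q_def using Kh[OF y c] Ah by (intro mult_mono power_mono) auto
    thus ?thesis by (simp add: Q_def power_mult_distrib mult_ac)
  qed
  \<comment> \<open>Consequently \<open>Q y\<close> is dominated by its own Poisson average at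
    radius \<open>fst y\<close>; this replaces measurability with respect to the past. The
    additional factor \<open>4\<close> is the reciprocal of the mass in
    \<open>near_mass\<close>.\<close>
  have Q_smooth: "Q y s \<le> 4 ^ (n + 2) * (\<integral>\<^sup>+t. ennreal (Pk (rc (fst y) t) s) * Q y t \<partial>circ)"
    if y: "y \<in> space annulus" and s: "s \<in> {0..2*pi}" for y s
  proof -
    have r: "0 \<le> fst y" "fst y < 1" using y by (auto simp: space_pair_measure)
    let ?N = "\<lambda>t. indicator {t. cmod (cis t - cis s) \<le> 1 - fst y} t :: ennreal"
    have N: "?N t = (if cmod (cis t - cis s) \<le> 1 - fst y then 1 else 0)" for t by auto
    have "ennreal (1/4) * Q y s \<le> (\<integral>\<^sup>+t. ennreal (Pk (rc (fst y) s) t) * ?N t \<partial>circ) * Q y s"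
      by (intro mult_right_mono near_mass r s) auto
    also have "\<dots> = (\<integral>\<^sup>+t. ennreal (Pk (rc (fst y) s) t) * ?N t * Q y s \<partial>circ)"
      unfolding N by (rule nn_integral_multc[symmetric]) measurable
    also have "\<dots> \<le> (\<integral>\<^sup>+t. 4 ^ Suc n * (ennreal (Pk (rc (fst y) t) s) * Q y t) \<partial>circ)"
    proof (intro nn_integral_mono)
      fix t
      show "ennreal (Pk (rc (fst y) s) t) * ?N t * Q y s \<le> 4 ^ Suc n * (ennreal (Pk (rc (fst y) t) s) * Q y t)"
      proof (cases "cmod (cis t - cis s) \<le> 1 - fst y")
        case True
        have "Q y s \<le> 4 ^ Suc n * Q y t" using True by (intro Q_harnack y) (simp add: norm_minus_commute)
        hence "ennreal (Pk (rc (fst y) s) t) * Q y s \<le> ennreal (Pk (rc (fst y) s) t) * (4 ^ Suc n * Q y t)"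
          by (intro mult_left_mono) auto
        thus ?thesis using True by (simp add: Pk_rc_sym[of _ s t] mult_ac)
      qed auto
    qed
    also have "\<dots> = 4 ^ Suc n * (\<integral>\<^sup>+t. ennreal (Pk (rc (fst y) t) s) * Q y t \<partial>circ)"
      by (rule nn_integral_cmult) measurable
    finally have "4 * (ennreal (1/4) * Q y s) \<le> 4 * (4 ^ Suc n * (\<integral>\<^sup>+t. ennreal (Pk (rc (fst y) t) s) * Q y t \<partial>circ))"
      by (rule mult_left_mono) auto
    moreover have "4 * ennreal (1/4) = 1"
    proof -
      have "4 * ennreal (1/4) = ennreal 4 * ennreal (1/4)" by simp
      also have "\<dots> = 1" by (subst ennreal_mult[symmetric]) auto
      finally show ?thesis .
    qed
    ultimately show ?thesis by (simp add: mult.assoc[symmetric])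
  qed
  \<comment> \<open>The average from \<open>Q_smooth\<close> meets \<open>K z\<close> in a
    composition of two Poisson kernels, which \<open>Pk_Pk_green\<close> bounds by the Green kernel.
    The integral over the later points \<open>z\<close> is then the conditional expectation of the
    future, which \<open>green\<close> bounds by \<open>Y\<close>.\<close>
  have main: "(\<integral>\<^sup>+z. (\<integral>\<^sup>+s. K z s * Q y s \<partial>circ) * indicator {z. fst y \<le> fst z} z \<partial>annulus)
      \<le> ennreal (4 ^ (n + 2) * (4 * pi)) * (\<integral>\<^sup>+t. Y t * Q y t \<partial>circ)" if y: "y \<in> space annulus" for y
  proof -
    have r: "1/2 \<le> fst y" "fst y < 1" using y by (auto simp: space_pair_measure)
    have inner: "(\<integral>\<^sup>+s. K z s * Q y s \<partial>circ) * indicator {z. fst y \<le> fst z} z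
       \<le> ennreal (4 ^ (n + 2) * (4 * pi)) * (\<integral>\<^sup>+t. Q y t * ennreal (green_kernel (rc (fst y) t) (rc (fst z) (snd z)) * \<phi> (rc (fst z) (snd z))) \<partial>circ)"
      if z: "z \<in> space annulus" for z
    proof (cases "fst y \<le> fst z")
      case True
      have rz: "1/2 \<le> fst z" "fst z < 1" using z by (auto simp: space_pair_measure)
      let ?w = "rc (fst z) (snd z)"
      have "(\<integral>\<^sup>+s. K z s * Q y s \<partial>circ) \<le> (\<integral>\<^sup>+s. K z s * (4 ^ (n + 2) * (\<integral>\<^sup>+t. ennreal (Pk (rc (fst y) t) s) * Q y t \<partial>circ)) \<partial>circ)"
        by (intro nn_integral_mono mult_left_mono Q_smooth y) auto
      also have "\<dots> = 4 ^ (n + 2) * (\<integral>\<^sup>+s. K z s * (\<integral>\<^sup>+t. ennreal (Pk (rc (fst y) t) s) * Q y t \<partial>circ) \<partial>circ)"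
        by (subst nn_integral_cmult[symmetric], measurable) (simp add: mult_ac)
      also have "(\<integral>\<^sup>+s. K z s * (\<integral>\<^sup>+t. ennreal (Pk (rc (fst y) t) s) * Q y t \<partial>circ) \<partial>circ)
          = (\<integral>\<^sup>+s. (\<integral>\<^sup>+t. K z s * (ennreal (Pk (rc (fst y) t) s) * Q y t) \<partial>circ) \<partial>circ)"
        by (intro nn_integral_cong nn_integral_cmult[symmetric]) measurable
      also have "\<dots> = (\<integral>\<^sup>+t. (\<integral>\<^sup>+s. K z s * (ennreal (Pk (rc (fst y) t) s) * Q y t) \<partial>circ) \<partial>circ)"
        by (rule circ2.Fubini'[symmetric]) measurable
      also have "\<dots> \<le> (\<integral>\<^sup>+t. ennreal (4 * pi) * (Q y t * ennreal (green_kernel (rc (fst y) t) ?w * \<phi> ?w)) \<partial>circ)"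
      proof (intro nn_integral_mono)
        fix t
        have "(\<integral>\<^sup>+s. K z s * (ennreal (Pk (rc (fst y) t) s) * Q y t) \<partial>circ)
          = (\<integral>\<^sup>+s. (ennreal (\<phi> ?w) * Q y t * ennreal (1 - fst z)) * (ennreal (Pk ?w s * Pk (rc (fst y) t) s)) \<partial>circ)"
          using rz r nn by (intro nn_integral_cong) (simp add: K_def sqk_def ennreal_mult' mult_ac cmod_rc)
        also have "\<dots> = (ennreal (\<phi> ?w) * Q y t * ennreal (1 - fst z)) * (\<integral>\<^sup>+s. ennreal (Pk ?w s * Pk (rc (fst y) t) s) \<partial>circ)"
          by (rule nn_integral_cmult) measurable
        also have "\<dots> = (ennreal (\<phi> ?w) * Q y t) * (ennreal (1 - fst z) * (\<integral>\<^sup>+s. ennreal (Pk ?w s * Pk (rc (fst y) t) s) \<partial>circ))"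
          by (simp add: mult_ac)
        also have "\<dots> \<le> (ennreal (\<phi> ?w) * Q y t) * (ennreal (4 * pi) * ennreal (green_kernel (rc (fst y) t) ?w))"
          using r rz True by (intro mult_left_mono Pk_Pk_green) auto
        also have "\<dots> = ennreal (4 * pi) * (Q y t * ennreal (green_kernel (rc (fst y) t) ?w * \<phi> ?w))"
          unfolding ennreal_mult''[OF nn] by (simp only: mult_ac)
        finally show "(\<integral>\<^sup>+s. K z s * (ennreal (Pk (rc (fst y) t) s) * Q y t) \<partial>circ)
           \<le> ennreal (4 * pi) * (Q y t * ennreal (green_kernel (rc (fst y) t) ?w * \<phi> ?w))" .
      qed
      also have "\<dots> = ennreal (4 * pi) * (\<integral>\<^sup>+t. Q y t * ennreal (green_kernel (rc (fst y) t) ?w * \<phi> ?w) \<partial>circ)"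
        by (rule nn_integral_cmult) measurable
      also have "4 ^ (n + 2) * (ennreal (4 * pi) * x) = ennreal (4 ^ (n + 2) * (4 * pi)) * x" for x
      proof -
        have "ennreal (4 ^ (n + 2) * (4 * pi)) = ennreal (4 ^ (n + 2)) * ennreal (4 * pi)" by (rule ennreal_mult) auto
        also have "ennreal (4 ^ (n + 2)) = 4 ^ (n + 2)" by (subst ennreal_power[symmetric]) auto
        finally show ?thesis by (simp add: mult.assoc)
      qed
      finally show ?thesis using True by (simp add: mult_left_mono)
    qed auto
    have "(\<integral>\<^sup>+z. (\<integral>\<^sup>+s. K z s * Q y s \<partial>circ) * indicator {z. fst y \<le> fst z} z \<partial>annulus)
      \<le> (\<integral>\<^sup>+z. ennreal (4 ^ (n + 2) * (4 * pi)) * (\<integral>\<^sup>+t. Q y t * ennreal (green_kernel (rc (fst y) t) (rc (fst z) (snd z)) * \<phi> (rc (fst z) (snd z))) \<partial>circ) \<partial>annulus)"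
      by (intro nn_integral_mono inner)
    also have "\<dots> = ennreal (4 ^ (n + 2) * (4 * pi)) * (\<integral>\<^sup>+z. (\<integral>\<^sup>+t. Q y t * ennreal (green_kernel (rc (fst y) t) (rc (fst z) (snd z)) * \<phi> (rc (fst z) (snd z))) \<partial>circ) \<partial>annulus)"
      by (rule nn_integral_cmult) measurable
    also have "(\<integral>\<^sup>+z. (\<integral>\<^sup>+t. Q y t * ennreal (green_kernel (rc (fst y) t) (rc (fst z) (snd z)) * \<phi> (rc (fst z) (snd z))) \<partial>circ) \<partial>annulus)
      = (\<integral>\<^sup>+t. (\<integral>\<^sup>+z. Q y t * ennreal (green_kernel (rc (fst y) t) (rc (fst z) (snd z)) * \<phi> (rc (fst z) (snd z))) \<partial>annulus) \<partial>circ)"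
      by (rule acirc.Fubini'[symmetric]) measurable
    also have "\<dots> = (\<integral>\<^sup>+t. Q y t * (\<integral>\<^sup>+z. ennreal (green_kernel (rc (fst y) t) (rc (fst z) (snd z)) * \<phi> (rc (fst z) (snd z))) \<partial>annulus) \<partial>circ)"
      by (intro nn_integral_cong nn_integral_cmult) measurable
    also have "\<dots> \<le> (\<integral>\<^sup>+t. Q y t * Y t \<partial>circ)"
      using r by (intro nn_integral_mono mult_left_mono green) auto
    finally have "(\<integral>\<^sup>+z. (\<integral>\<^sup>+s. K z s * Q y s \<partial>circ) * indicator {z. fst y \<le> fst z} z \<partial>annulus)
      \<le> ennreal (4 ^ (n + 2) * (4 * pi)) * (\<integral>\<^sup>+t. Q y t * Y t \<partial>circ)" by (simp add: mult_left_mono)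
    thus ?thesis by (simp only: mult.commute[of "Q y _"])
  qed
  have ind2 [measurable]: "(\<lambda>(x,y). indicator {y. fst y \<le> fst x} y :: ennreal) \<in> borel_measurable (annulus \<Otimes>\<^sub>M annulus)"
    unfolding ind_eq by measurable
  have "(\<integral>\<^sup>+s. sqf \<phi> s ^ Suc (Suc n) \<partial>circ) \<le> (\<integral>\<^sup>+s. ennreal (2 ^ (2 * n + 1)) *
     (\<integral>\<^sup>+z. (\<integral>\<^sup>+y. K z s * Q y s * indicator {y. fst y \<le> fst z} y \<partial>annulus) \<partial>annulus) \<partial>circ)"
    by (intro nn_integral_mono F_pow)
  also have "\<dots> = ennreal (2 ^ (2 * n + 1)) *
     (\<integral>\<^sup>+s. (\<integral>\<^sup>+z. (\<integral>\<^sup>+y. K z s * Q y s * indicator {y. fst y \<le> fst z} y \<partial>annulus) \<partial>annulus) \<partial>circ)"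
    unfolding ind_eq by (rule nn_integral_cmult) measurable
  also have "(\<integral>\<^sup>+s. (\<integral>\<^sup>+z. (\<integral>\<^sup>+y. K z s * Q y s * indicator {y. fst y \<le> fst z} y \<partial>annulus) \<partial>annulus) \<partial>circ)
     = (\<integral>\<^sup>+z. (\<integral>\<^sup>+s. (\<integral>\<^sup>+y. K z s * Q y s * indicator {y. fst y \<le> fst z} y \<partial>annulus) \<partial>circ) \<partial>annulus)"
    unfolding ind_eq by (rule acirc.Fubini') measurable
  also have "\<dots> = (\<integral>\<^sup>+z. (\<integral>\<^sup>+y. (\<integral>\<^sup>+s. K z s * Q y s * indicator {y. fst y \<le> fst z} y \<partial>circ) \<partial>annulus) \<partial>annulus)"
    unfolding ind_eq by (intro nn_integral_cong acirc.Fubini') measurable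
  also have "\<dots> = (\<integral>\<^sup>+y. (\<integral>\<^sup>+z. (\<integral>\<^sup>+s. K z s * Q y s * indicator {y. fst y \<le> fst z} y \<partial>circ) \<partial>annulus) \<partial>annulus)"
    unfolding ind_eq by (rule aann.Fubini'[symmetric]) measurable
  also have "\<dots> = (\<integral>\<^sup>+y. (\<integral>\<^sup>+z. (\<integral>\<^sup>+s. K z s * Q y s \<partial>circ) * indicator {z. fst y \<le> fst z} z \<partial>annulus) \<partial>annulus)"
  proof (intro nn_integral_cong)
    fix y z :: "real \<times> real"
    show "(\<integral>\<^sup>+s. K z s * Q y s * indicator {y. fst y \<le> fst z} y \<partial>circ) = (\<integral>\<^sup>+s. K z s * Q y s \<partial>circ) * indicator {z. fst y \<le> fst z} z"
      by (subst nn_integral_multc, measurable) (simp add: indicator_def)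
  qed
  also have "\<dots> \<le> (\<integral>\<^sup>+y. ennreal (4 ^ (n + 2) * (4 * pi)) * (\<integral>\<^sup>+t. Y t * Q y t \<partial>circ) \<partial>annulus)"
    by (intro nn_integral_mono main)
  also have "\<dots> = ennreal (4 ^ (n + 2) * (4 * pi)) * (\<integral>\<^sup>+y. (\<integral>\<^sup>+t. Y t * Q y t \<partial>circ) \<partial>annulus)"
    by (rule nn_integral_cmult) measurable
  also have "(\<integral>\<^sup>+y. (\<integral>\<^sup>+t. Y t * Q y t \<partial>circ) \<partial>annulus) = (\<integral>\<^sup>+t. (\<integral>\<^sup>+y. Y t * Q y t \<partial>annulus) \<partial>circ)"
    by (rule acirc.Fubini'[symmetric]) measurable
  also have "\<dots> \<le> (\<integral>\<^sup>+t. Y t * sqf \<phi> t ^ Suc n \<partial>circ)"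
  proof (intro nn_integral_mono)
    fix t
    have "(\<integral>\<^sup>+y. Y t * Q y t \<partial>annulus) = Y t * (\<integral>\<^sup>+y. Q y t \<partial>annulus)" by (rule nn_integral_cmult) measurable
    also have "\<dots> \<le> Y t * (\<integral>\<^sup>+y. K y t * sqf \<phi> t ^ n \<partial>annulus)"
      unfolding Q_def by (intro mult_left_mono nn_integral_mono power_mono A_le) auto
    also have "(\<integral>\<^sup>+y. K y t * sqf \<phi> t ^ n \<partial>annulus) = sqf \<phi> t * sqf \<phi> t ^ n"
      unfolding F by (rule nn_integral_multc) measurable
    finally show "(\<integral>\<^sup>+y. Y t * Q y t \<partial>annulus) \<le> Y t * sqf \<phi> t ^ Suc n" by simp
  qed
  finally have "(\<integral>\<^sup>+s. sqf \<phi> s ^ Suc (Suc n) \<partial>circ) \<le> ennreal (2 ^ (2 * n + 1)) * (ennreal (4 ^ (n + 2) * (4 * pi)) * (\<integral>\<^sup>+t. Y t * sqf \<phi> t ^ Suc n \<partial>circ))"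
    by (simp add: mult_left_mono)
  also have "\<dots> = ennreal (2 ^ (2 * n + 1) * 4 ^ (n + 2) * (4 * pi)) * (\<integral>\<^sup>+t. Y t * sqf \<phi> t ^ Suc n \<partial>circ)"
    by (simp only: mult.assoc[symmetric], subst ennreal_mult[symmetric]) (auto simp: mult.assoc)
  finally show ?thesis .
qed

section \<open>Regularised powers and Young's inequality\<close>

lemma polar_pair_powr:
  assumes e: "0 < e" and G: "G holomorphic_on ball 0 R"
  shows "polar_pair (\<lambda>y. (y + e) powr c) (\<lambda>y. c * (y + e) powr (c - 1)) (\<lambda>y. c * ((c - 1) * (y + e) powr (c - 2))) G R"
proof
  fix y :: real assume y: "0 \<le> y"
  show "((\<lambda>y. (y + e) powr c) has_real_derivative c * (y + e) powr (c - 1)) (at y)"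
    using y e by (auto intro!: derivative_eq_intros)
  show "((\<lambda>y. c * (y + e) powr (c - 1)) has_real_derivative c * ((c - 1) * (y + e) powr (c - 2))) (at y)"
    using y e by (auto intro!: derivative_eq_intros simp: algebra_simps)
next
  show "continuous_on {0..} (\<lambda>y. c * ((c - 1) * (y + e) powr (c - 2)))"
    using e by (intro continuous_intros) auto
qed fact

lemma polar_pair_scale:
  "polar_pair h h' h'' G R \<Longrightarrow> polar_pair (\<lambda>y. d * h y) (\<lambda>y. d * h' y) (\<lambda>y. d * h'' y) G R"
  unfolding polar_pair_def by (auto intro!: DERIV_cmult continuous_on_mult_left)

lemma lapf_scale: "lapf (\<lambda>y. d * h' y) (\<lambda>y. d * h'' y) G w = d * lapf h' h'' G w"
  by (simp add: lapf_def algebra_simps)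

text \<open>Both bounds come from the closed form
  \<open>c * (y + e) powr (c - 2) * (c * y + e)\<close>; for \<open>c \<le> 1\<close> the last
  factor is at least \<open>c * (y + e)\<close>.\<close>

lemma powr_laplacian:
  fixes y e c :: real
  assumes "0 \<le> y" "0 < e" "0 \<le> c"
  shows "0 \<le> c * (y + e) powr (c - 1) + y * (c * ((c - 1) * (y + e) powr (c - 2)))"
    and "c \<le> 1 \<Longrightarrow> c\<^sup>2 * (y + e) powr (c - 1) \<le> c * (y + e) powr (c - 1) + y * (c * ((c - 1) * (y + e) powr (c - 2)))"
proof -
  let ?Q = "(y + e) powr (c - 2)"
  have "(y + e) powr (c - 1) = (y + e) powr ((c - 2) + 1)" by simp
  also have "\<dots> = ?Q * (y + e)" using assms by (subst powr_add) auto
  finally have q: "(y + e) powr (c - 1) = ?Q * (y + e)" .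
  have eq: "c * (y + e) powr (c - 1) + y * (c * ((c - 1) * (y + e) powr (c - 2))) = c * ?Q * (c * y + e)"
    unfolding q by (simp add: algebra_simps)
  show "0 \<le> c * (y + e) powr (c - 1) + y * (c * ((c - 1) * (y + e) powr (c - 2)))"
    unfolding eq using assms by (intro mult_nonneg_nonneg add_nonneg_nonneg) auto
  assume "c \<le> 1"
  hence "c * (y + e) \<le> c * y + e" using assms by (simp add: distrib_left mult_left_le_one_le)
  hence "c * ?Q * (c * (y + e)) \<le> c * ?Q * (c * y + e)" using assms by (intro mult_left_mono) auto
  thus "c\<^sup>2 * (y + e) powr (c - 1) \<le> c * (y + e) powr (c - 1) + y * (c * ((c - 1) * (y + e) powr (c - 2)))"
    unfolding eq unfolding q by (simp only: power2_eq_square mult_ac)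
qed

lemma ennreal_young_power:
  fixes x y :: ennreal
  assumes K: "0 < K"
  shows "x * y ^ j \<le> ennreal (K ^ j) * x ^ Suc j + ennreal (1 / K) * y ^ Suc j"
proof (cases "y \<le> ennreal K * x")
  case True
  have "x * y ^ j \<le> x * (ennreal K * x) ^ j" using True by (intro mult_left_mono power_mono) auto
  also have "\<dots> = ennreal (K ^ j) * x ^ Suc j" using K by (simp add: power_mult_distrib ennreal_power mult_ac)
  finally show ?thesis by (rule order.trans) simp
next
  case False
  have 1: "ennreal (1 / K) * ennreal K = 1" using K by (subst ennreal_mult[symmetric]) auto
  have "ennreal (1 / K) * (ennreal K * x) \<le> ennreal (1 / K) * y" using False by (intro mult_left_mono) auto
  hence "x \<le> ennreal (1 / K) * y" by (simp add: mult.assoc[symmetric] 1)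
  hence "x * y ^ j \<le> ennreal (1 / K) * y * y ^ j" by (intro mult_right_mono) auto
  also have "\<dots> = ennreal (1 / K) * y ^ Suc j" by (simp add: mult_ac)
  finally show ?thesis by (rule order.trans) simp
qed

section \<open>Littlewood--Paley inequalities in the disc\<close>

text \<open>Dyadic radii form a net for Harnack's inequality: each radius exceeds one of them by at
  most half of that one's distance to the circle. A countable supremum therefore controls all
  radii.\<close>

lemma dyadic_radius:
  assumes "0 \<le> r" "r < (1::real)"
  obtains n where "1 - (1/2) ^ n \<le> r" "r \<le> 1 - (1/2) ^ Suc n"
proof -
  obtain N where N: "(1/2) ^ N < 1 - r" using real_arch_pow_inv[of "1 - r" "1/2"] assms by auto
  define n where "n = (LEAST n. (1/2) ^ Suc n \<le> 1 - r)"
  have ex: "(1/2::real) ^ Suc N \<le> 1 - r"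
  proof -
    have "(1/2::real) ^ Suc N \<le> (1/2) ^ N" by (rule power_decreasing) auto
    thus ?thesis using N by linarith
  qed
  have 1: "(1/2) ^ Suc n \<le> 1 - r" unfolding n_def by (rule LeastI[where P="\<lambda>n. (1/2) ^ Suc n \<le> 1 - r" and k=N, OF ex])
  have 2: "1 - r \<le> (1/2) ^ n"
  proof (cases n)
    case 0 thus ?thesis using assms by simp
  next
    case (Suc m)
    hence "m < (LEAST n. (1/2) ^ Suc n \<le> 1 - r)" by (simp add: n_def)
    hence "\<not> (1/2) ^ Suc m \<le> 1 - r" by (rule not_less_Least)
    thus ?thesis using Suc by simp
  qed
  show thesis by (rule that[of n]) (use 1 2 in auto)
qed

text \<open>\<open>k\<close> is an integer because the moment argument works with integer powers.
  The condition \<open>p \<le> 4 * real k\<close> amounts to \<open>a \<le> 2\<close>, the range in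
  which \<open>powr_laplacian\<close> bounds the Laplacian of \<open>vv powr (a / 2)\<close> from
  below.\<close>

locale disc_fun =
  fixes F :: "complex \<Rightarrow> complex" and R e p :: real and k :: nat
  assumes F: "F holomorphic_on ball 0 R" and R: "1 < R" and e: "0 < e" and p: "0 < p"
    and k: "1 \<le> k" "p \<le> 4 * real k"
begin

text \<open>Degrees in \<open>F\<close> explain the exponents. A quantity of degree \<open>a\<close>
  has a \<open>2 * k\<close>-th power of degree \<open>p\<close>, and \<open>V\<close> has degree
  \<open>p / 2\<close>, so that its maximal function \<open>S\<close> has a square of degree
  \<open>p\<close> and the mean-square bound applies to it.\<close>

definition a where "a = p / (2 * real k)"
definition vv where "vv w = (cmod (F w))\<^sup>2 + e"
definition V where "V t = vv (cis t) powr (p / 4)"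
definition S where "S s = (SUP n. PI (1 - (1/2) ^ n) (\<lambda>t. ennreal (V t)) s)"
definition Sr where "Sr s = enn2real (S s)"
text \<open>The maximal function rescaled to degree one; it bounds \<open>|F|\<close> close to the
  radius ending at \<open>cis s\<close>. The constant \<open>24\<close> is the one in
  \<open>vv_le\<close>.\<close>

definition W where "W s = (24 * Sr s) powr (2 / p)"
text \<open>On the annulus this is, up to a constant, a lower bound for the Laplacian of
  \<open>vv powr (a / 2)\<close>. The indicator makes the function Borel on the whole plane.\<close>

definition phi where "phi w = indicator (ball 0 R) w * (vv w powr (a / 2 - 1) * (cmod (deriv F w))\<^sup>2)"

lemma a: "0 < a" "a \<le> 2" using p k by (auto simp: a_def divide_le_eq)

lemma vv_pos: "0 < vv w" using e by (simp add: vv_def add_nonneg_pos)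

lemma V_pos: "0 < V t" using vv_pos[of "cis t"] by (simp add: V_def)

lemma cont_F: "continuous_on (ball 0 R) F" "continuous_on (ball 0 R) (deriv F)"
  using F by (auto intro!: holomorphic_on_imp_continuous_on holomorphic_deriv)

lemma cont_vv: "continuous_on (ball 0 R) (\<lambda>w. vv w powr c)"
  unfolding vv_def using e by (intro continuous_intros cont_F) (auto simp: add_nonneg_eq_0_iff)

lemma cont_vv_cis: "continuous_on X (\<lambda>t. vv (cis t) powr c)"
  by (rule continuous_on_compose2[OF cont_vv]) (use R in \<open>auto intro!: continuous_intros\<close>)

lemma cont_V: "continuous_on X V" unfolding V_def[abs_def] by (rule cont_vv_cis)

lemma V_meas [measurable]: "V \<in> borel_measurable circ" "V \<in> borel_measurable borel"
  by (auto intro!: measurable_circ borel_measurable_continuous_onI cont_V)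

lemma phi_nonneg: "0 \<le> phi w" by (simp add: phi_def)

lemma phi_meas [measurable]: "phi \<in> borel_measurable borel"
proof -
  have "(\<lambda>w. indicator (ball 0 R) w *\<^sub>R (vv w powr (a / 2 - 1) * (cmod (deriv F w))\<^sup>2)) \<in> borel_measurable borel"
    by (intro borel_measurable_continuous_on_indicator continuous_intros cont_vv cont_F) auto
  thus ?thesis by (simp add: phi_def[abs_def])
qed

lemma nn_integral_Pk_V:
  assumes "cmod w < 1"
  shows "(\<integral>\<^sup>+t. ennreal (Pk w t) * ennreal (V t) \<partial>circ) = ennreal (integral {0..2*pi} (\<lambda>t. V t * Pk w t))"
proof -
  have "(\<integral>\<^sup>+t. ennreal (Pk w t) * ennreal (V t) \<partial>circ) = (\<integral>\<^sup>+t. ennreal (V t * Pk w t) \<partial>circ)"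
    using assms V_pos less_imp_le by (intro nn_integral_cong) (simp add: ennreal_mult' mult.commute)
  also have "\<dots> = ennreal (integral {0..2*pi} (\<lambda>t. V t * Pk w t))"
    using assms V_pos[THEN less_imp_le] by (intro nn_integral_circ_continuous continuous_intros cont_V) auto
  finally show ?thesis .
qed

lemma S_meas [measurable]: "S \<in> borel_measurable circ"
  unfolding S_def PI_def by measurable

lemma PI_le_S:
  assumes r: "0 \<le> r" "r < 1"
  shows "PI r (\<lambda>t. ennreal (V t)) s \<le> 12 * S s"
proof -
  obtain n where n: "1 - (1/2) ^ n \<le> r" "r \<le> 1 - (1/2) ^ Suc n" using dyadic_radius[OF r] .
  define q :: real where "q = 1 - (1/2) ^ n"
  have "(1/2::real) ^ n \<le> 1" by (rule power_le_one) auto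
  hence q: "0 \<le> q" "q < 1" by (auto simp: q_def)
  have "rc r s - rc q s = complex_of_real (r - q) * cis s" by (simp add: rc_def algebra_simps)
  hence "cmod (rc r s - rc q s) = \<bar>r - q\<bar>" by (simp only: norm_mult norm_of_real norm_cis mult_1_right)
  also have "\<dots> \<le> (1 - q) / 2" using n by (simp add: q_def)
  finally have d: "cmod (rc r s - rc q s) \<le> (1 - cmod (rc q s)) / 2" using q by (simp add: cmod_rc)
  have "PI r (\<lambda>t. ennreal (V t)) s \<le> (\<integral>\<^sup>+t. 12 * (ennreal (Pk (rc q s) t) * ennreal (V t)) \<partial>circ)"
    unfolding PI_def
  proof (intro nn_integral_mono)
    fix t
    have "Pk (rc r s) t \<le> 12 * Pk (rc q s) t" by (rule harnack(2)[OF _ d]) (use q in \<open>simp add: cmod_rc\<close>)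
    hence "ennreal (Pk (rc r s) t) \<le> ennreal (12 * Pk (rc q s) t)" by (rule ennreal_leI)
    also have "\<dots> = 12 * ennreal (Pk (rc q s) t)" using q by (simp add: ennreal_mult')
    finally show "ennreal (Pk (rc r s) t) * ennreal (V t) \<le> 12 * (ennreal (Pk (rc q s) t) * ennreal (V t))"
      by (simp only: mult.assoc[symmetric]) (rule mult_right_mono, auto)
  qed
  also have "\<dots> = 12 * PI q (\<lambda>t. ennreal (V t)) s"
    unfolding PI_def by (rule nn_integral_cmult) measurable
  also have "\<dots> \<le> 12 * S s"
    unfolding S_def q_def by (intro mult_left_mono SUP_upper) auto
  finally show ?thesis .
qed

lemma S_fin: "S s < \<top>"
proof -
  have "compact (V ` {0..2*pi})" by (intro compact_continuous_image cont_V) auto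
  hence "bdd_above (V ` {0..2*pi})" by (intro bounded_imp_bdd_above compact_imp_bounded)
  then obtain B where B: "\<And>t. t \<in> {0..2*pi} \<Longrightarrow> V t \<le> B"
    unfolding bdd_above_def by blast
  have "PI (1 - (1/2) ^ n) (\<lambda>t. ennreal (V t)) s \<le> ennreal B * ennreal (2 * pi)" for n
  proof -
    have z: "cmod (rc (1 - (1/2) ^ n) s) < 1" using power_le_one[of "1/2::real" n] by (subst cmod_rc) auto
    have "PI (1 - (1/2) ^ n) (\<lambda>t. ennreal (V t)) s \<le> (\<integral>\<^sup>+t. ennreal B * ennreal (Pk (rc (1 - (1/2) ^ n) s) t) \<partial>circ)"
      unfolding PI_def using B by (intro nn_integral_mono) (auto simp: mult.commute intro!: mult_right_mono ennreal_leI)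
    also have "\<dots> = ennreal B * ennreal (2 * pi)"
      by (subst nn_integral_cmult) (simp_all add: nn_integral_Pk[OF z])
    finally show ?thesis .
  qed
  hence "S s \<le> ennreal B * ennreal (2 * pi)" unfolding S_def by (intro SUP_least)
  also have "\<dots> < \<top>" by (simp add: ennreal_mult_less_top)
  finally show ?thesis .
qed

lemma S_eq: "S s = ennreal (Sr s)" unfolding Sr_def using S_fin by (simp add: less_top)

lemma Sr_nonneg: "0 \<le> Sr s" by (simp add: Sr_def)

text \<open>The sequence of dyadic radii begins with \<open>0\<close>, where the Poisson integral is
  the integral of \<open>V\<close>, and \<open>V > 0\<close> because \<open>e > 0\<close>. Negative
  powers of and quotients by the maximal function are thus unproblematic.\<close>

lemma Sr_pos: "0 < Sr s"
proof -
  have "0 < integral {0..2*pi} V"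
  proof -
    obtain t0 where "\<forall>t\<in>{0..2*pi}. V t0 \<le> V t"
      using continuous_attains_inf[of "{0..2*pi}" V] cont_V by auto
    hence "integral {0..2*pi} (\<lambda>_. V t0) \<le> integral {0..2*pi} V"
      by (intro integral_le integrable_continuous_interval cont_V continuous_intros) auto
    thus ?thesis using V_pos[of t0] by (auto intro: less_le_trans[of 0 "2 * pi * V t0"])
  qed
  moreover have "ennreal (integral {0..2*pi} V) \<le> S s"
  proof -
    have "ennreal (integral {0..2*pi} V) = PI (1 - (1/2) ^ 0) (\<lambda>t. ennreal (V t)) s"
      unfolding PI_def by (simp add: rc_def Pk_zero nn_integral_circ_continuous[OF cont_V] V_pos[THEN less_imp_le])
    also have "\<dots> \<le> S s" unfolding S_def by (rule SUP_upper) simp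
    finally show ?thesis .
  qed
  ultimately have "0 < S s" by (metis ennreal_less_zero_iff less_le_trans)
  thus ?thesis unfolding S_eq by (simp add: ennreal_less_zero_iff)
qed

lemma Sr_meas [measurable]: "Sr \<in> borel_measurable circ" unfolding Sr_def by measurable

lemma integral_Pk_V_le:
  assumes r: "0 \<le> r" "r < 1"
  shows "integral {0..2*pi} (\<lambda>t. V t * Pk (rc r s) t) \<le> 12 * Sr s"
proof -
  have "ennreal (integral {0..2*pi} (\<lambda>t. V t * Pk (rc r s) t)) \<le> 12 * S s"
    using PI_le_S[OF r, of s] unfolding PI_def using r by (subst (asm) nn_integral_Pk_V) (auto simp: cmod_rc)
  also have "\<dots> = ennreal (12 * Sr s)" by (simp add: S_eq ennreal_mult')
  finally show ?thesis using Sr_nonneg by (subst (asm) ennreal_le_iff) auto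
qed

lemma vv_sub: "cmod w < 1 \<Longrightarrow> 2 * pi * vv w powr (p / 4) \<le> integral {0..2*pi} (\<lambda>t. V t * Pk w t)"
  unfolding vv_def V_def using p e
  by (intro sub_poisson[OF polar_pair_powr[OF e F] R] powr_laplacian(1)) auto

text \<open>Harnack's inequality is applied twice, from \<open>w\<close> to the radius through
  \<open>cis s\<close> and from there to a dyadic radius. The constant \<open>24\<close> is
  \<open>12 * 12 / 6\<close>, where \<open>6\<close> bounds \<open>2 * pi\<close> from
  below.\<close>

lemma vv_le:
  assumes r: "0 \<le> r" "r < 1" and w: "cmod (w - rc r s) \<le> (1 - r) / 2"
  shows "vv w powr (p / 4) \<le> 24 * Sr s"
proof -
  have z: "cmod (rc r s) < 1" "cmod (w - rc r s) \<le> (1 - cmod (rc r s)) / 2" using r w by (auto simp: cmod_rc)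
  have w1: "cmod w < 1" by (rule harnack(1)[OF z])
  have "2 * pi * vv w powr (p / 4) \<le> integral {0..2*pi} (\<lambda>t. V t * Pk w t)" by (rule vv_sub[OF w1])
  also have "\<dots> \<le> integral {0..2*pi} (\<lambda>t. 12 * (V t * Pk (rc r s) t))"
  proof (rule integral_le)
    fix t
    have "V t * Pk w t \<le> V t * (12 * Pk (rc r s) t)"
      using harnack(2)[OF z] V_pos[of t] by (intro mult_left_mono) auto
    thus "V t * Pk w t \<le> 12 * (V t * Pk (rc r s) t)" by simp
  qed (use w1 z in \<open>auto intro!: integrable_continuous_interval continuous_intros cont_V\<close>)
  also have "\<dots> = 12 * integral {0..2*pi} (\<lambda>t. V t * Pk (rc r s) t)" by simp
  also have "\<dots> \<le> 12 * (12 * Sr s)" by (intro mult_left_mono integral_Pk_V_le r) auto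
  finally have 1: "2 * pi * vv w powr (p / 4) \<le> 144 * Sr s" by simp
  have "6 * vv w powr (p / 4) \<le> 2 * pi * vv w powr (p / 4)" using pi_gt3 by (intro mult_right_mono) auto
  thus ?thesis using 1 by simp
qed

lemma W_pos: "0 < W s" using Sr_pos[of s] by (simp add: W_def)

lemma F_le_W:
  assumes r: "0 \<le> r" "r < 1" and w: "cmod (w - rc r s) \<le> (1 - r) / 2"
  shows "cmod (F w) \<le> W s"
proof -
  have "cmod (F w) = sqrt ((cmod (F w))\<^sup>2)" by simp
  also have "\<dots> \<le> sqrt (vv w)" using e by (intro real_sqrt_le_mono) (simp add: vv_def)
  also have "\<dots> = (vv w powr (p / 4)) powr (2 / p)"
    using p vv_pos[of w] by (simp add: powr_powr powr_half_sqrt)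
  also have "\<dots> \<le> W s" unfolding W_def using vv_le[OF assms] p by (intro powr_mono2) auto
  finally show ?thesis .
qed

text \<open>Cauchy's inequality on the disc of radius \<open>(1 - r) / 2\<close>, on which
  \<open>F_le_W\<close> gives \<open>cmod (F w) \<le> W s\<close>.\<close>

lemma deriv_F_le:
  assumes r: "0 \<le> r" "r < 1"
  shows "(1 - r) * cmod (deriv F (rc r s)) \<le> 2 * W s"
proof -
  let ?d = "(1 - r) / 2"
  have sub: "cball (rc r s) ?d \<subseteq> ball 0 R"
  proof
    fix w assume "w \<in> cball (rc r s) ?d"
    hence "cmod (w - rc r s) \<le> (1 - cmod (rc r s)) / 2" using r by (simp add: cmod_rc dist_norm norm_minus_commute)
    from harnack(1)[OF _ this] r R show "w \<in> ball 0 R" by (simp add: cmod_rc)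
  qed
  have "cmod ((deriv ^^ 1) F (rc r s)) \<le> fact 1 * W s / ?d ^ 1"
  proof (rule Cauchy_inequality)
    show "F holomorphic_on ball (rc r s) ?d" by (rule holomorphic_on_subset[OF F]) (use sub in auto)
    show "continuous_on (cball (rc r s) ?d) F" by (rule continuous_on_subset[OF cont_F(1) sub])
    fix x assume "cmod (rc r s - x) = ?d"
    thus "cmod (F x) \<le> W s" by (intro F_le_W[OF r]) (simp add: norm_minus_commute)
  qed (use r in auto)
  thus ?thesis using r by (simp add: field_simps)
qed

definition Y where "Y s = 64 / a\<^sup>2 * (12 * Sr s) powr (1 / real k)"

text \<open>The \<open>k\<close>-th power of \<open>vv powr (a / 2)\<close> is \<open>V\<close>, so
  this is Hoelder's inequality with a worse constant: below the level \<open>l\<close> the function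
  is at most \<open>l\<close>, above it at most \<open>V * l / l ^ k\<close>. The choice of
  \<open>l\<close> balances the two parts, and \<open>8\<close> exceeds
  \<open>2 * pi + 1\<close>.\<close>

lemma u_sub:
  assumes r: "0 \<le> r" "r < 1"
  shows "integral {0..2*pi} (\<lambda>t. vv (cis t) powr (a / 2) * Pk (rc r s) t) \<le> 8 * (12 * Sr s) powr (1 / real k)"
proof -
  define l where "l = (12 * Sr s) powr (1 / real k)"
  have l: "0 < l" using Sr_pos[of s] by (simp add: l_def)
  have lk: "l ^ k = 12 * Sr s" using Sr_pos[of s] k by (simp add: l_def powr_realpow[symmetric] powr_powr)
  have z: "cmod (rc r s) < 1" using r by (simp add: cmod_rc)
  have u_le: "vv (cis t) powr (a / 2) \<le> l + V t * l / l ^ k" for t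
  proof (cases "vv (cis t) powr (a / 2) \<le> l")
    case True
    thus ?thesis using l V_pos[of t] by (auto intro: order.trans)
  next
    case False
    let ?u = "vv (cis t) powr (a / 2)"
    have Vu: "V t = ?u ^ k" using k p vv_pos[of "cis t"]
      by (simp add: V_def powr_realpow[symmetric] powr_powr a_def)
    obtain j where j: "k = Suc j" using k by (cases k) auto
    have "?u * l ^ k = ?u * l ^ j * l" by (simp add: j)
    also have "\<dots> \<le> ?u * ?u ^ j * l" using False l by (intro mult_right_mono mult_left_mono power_mono) auto
    finally have "?u \<le> V t * l / l ^ k" using l by (simp add: Vu j field_simps)
    thus ?thesis using l by simp
  qed
  have "integral {0..2*pi} (\<lambda>t. vv (cis t) powr (a / 2) * Pk (rc r s) t)
     \<le> integral {0..2*pi} (\<lambda>t. l * Pk (rc r s) t + l / l ^ k * (V t * Pk (rc r s) t))"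
  proof (rule integral_le)
    fix t
    have "vv (cis t) powr (a / 2) * Pk (rc r s) t \<le> (l + V t * l / l ^ k) * Pk (rc r s) t"
      using u_le z by (intro mult_right_mono) auto
    thus "vv (cis t) powr (a / 2) * Pk (rc r s) t \<le> l * Pk (rc r s) t + l / l ^ k * (V t * Pk (rc r s) t)"
      by (simp add: algebra_simps)
  qed (use z l in \<open>auto intro!: integrable_continuous_interval continuous_intros cont_V cont_vv_cis\<close>)
  also have "\<dots> = integral {0..2*pi} (\<lambda>t. l * Pk (rc r s) t) + integral {0..2*pi} (\<lambda>t. l / l ^ k * (V t * Pk (rc r s) t))"
    using z by (intro integral_add integrable_continuous_interval continuous_intros cont_V) auto
  also have "\<dots> = l * integral {0..2*pi} (Pk (rc r s)) + l / l ^ k * integral {0..2*pi} (\<lambda>t. V t * Pk (rc r s) t)"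
    by simp
  also have "\<dots> \<le> l * (2 * pi) + l / l ^ k * (12 * Sr s)"
    unfolding integral_Pk[OF z] using l by (intro add_left_mono mult_left_mono integral_Pk_V_le r) auto
  also have "l / l ^ k * (12 * Sr s) = l" unfolding lk[symmetric] using l by simp
  also have "l * (2 * pi) + l = l * (2 * pi + 1)" by (simp add: algebra_simps)
  also have "\<dots> \<le> l * 8" using l pi_less_4 pi_approx by (intro mult_left_mono) auto
  finally show ?thesis by (simp add: l_def mult.commute)
qed

text \<open>The multiple \<open>4 / a\<^sup>2\<close> of \<open>(y + e) powr (a / 2)\<close> has a
  Laplacian that dominates \<open>phi\<close> where \<open>cmod w \<ge> 1/2\<close>. The Green bound
  contributes another \<open>2\<close> and \<open>u_sub\<close> an \<open>8\<close>, whence the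
  \<open>64 / a\<^sup>2\<close> in \<open>Y\<close>.\<close>

lemma green_phi:
  assumes r: "1/2 \<le> r" "r < 1"
  shows "(\<integral>\<^sup>+z. ennreal (green_kernel (rc r s) (rc (fst z) (snd z)) * phi (rc (fst z) (snd z))) \<partial>annulus) \<le> ennreal (Y s)"
proof -
  let ?h' = "\<lambda>y. a / 2 * (y + e) powr (a / 2 - 1)"
  let ?h'' = "\<lambda>y. a / 2 * ((a / 2 - 1) * (y + e) powr (a / 2 - 2))"
  let ?z = "rc r s"
  have z: "cmod ?z < 1" using r by (simp add: cmod_rc)
  have phi_lap: "phi w \<le> lapf (\<lambda>y. 4 / a\<^sup>2 * ?h' y) (\<lambda>y. 4 / a\<^sup>2 * ?h'' y) F w" if w: "1/2 \<le> cmod w" "cmod w < 1" for w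
  proof -
    have "(a / 2)\<^sup>2 * vv w powr (a / 2 - 1) \<le> ?h' ((cmod (F w))\<^sup>2) + (cmod (F w))\<^sup>2 * ?h'' ((cmod (F w))\<^sup>2)"
      unfolding vv_def using e a by (intro powr_laplacian(2)) auto
    hence "4 * (cmod (rad F w))\<^sup>2 * ((a / 2)\<^sup>2 * vv w powr (a / 2 - 1)) \<le> lapf ?h' ?h'' F w"
      unfolding lapf_def by (intro mult_left_mono) auto
    moreover have "4 * (cmod (rad F w))\<^sup>2 * ((a / 2)\<^sup>2 * vv w powr (a / 2 - 1)) = a\<^sup>2 * (cmod w)\<^sup>2 * phi w"
      using w R by (simp add: rad_def phi_def norm_mult power_mult_distrib power_divide)
    moreover have "a\<^sup>2 * (1/2)\<^sup>2 * phi w \<le> a\<^sup>2 * (cmod w)\<^sup>2 * phi w"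
      using w phi_nonneg[of w] by (intro mult_right_mono mult_left_mono power_mono) auto
    ultimately have "a\<^sup>2 * (1/2)\<^sup>2 * phi w \<le> lapf ?h' ?h'' F w" by linarith
    hence "4 / a\<^sup>2 * (a\<^sup>2 * (1/2)\<^sup>2 * phi w) \<le> 4 / a\<^sup>2 * lapf ?h' ?h'' F w" by (intro mult_left_mono) auto
    moreover have "4 / a\<^sup>2 * (a\<^sup>2 * (1/2)\<^sup>2 * phi w) = phi w" using a by (simp add: power2_eq_square)
    ultimately show ?thesis unfolding lapf_scale by linarith
  qed
  have gk: "0 \<le> green_kernel ?z w" if "cmod w < 1" for w
    unfolding green_kernel_def using z that by (intro divide_nonneg_nonneg mult_nonneg_nonneg) (auto simp: abs_square_le_1)
  have gf [measurable]: "(\<lambda>z. ennreal (green_kernel ?z (rc (fst z) (snd z)) * phi (rc (fst z) (snd z)))) \<in> borel_measurable annulus"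
    by measurable
  have "(\<integral>\<^sup>+z. ennreal (green_kernel ?z (rc (fst z) (snd z)) * phi (rc (fst z) (snd z))) \<partial>annulus)
     = (\<integral>\<^sup>+x. (\<integral>\<^sup>+t. ennreal (green_kernel ?z (rc x t) * phi (rc x t)) \<partial>circ) \<partial>radii)"
    using circ.nn_integral_fst[OF gf] by simp
  also have "\<dots> = (\<integral>\<^sup>+x\<in>{1/2..<1}. (\<integral>\<^sup>+t. ennreal (green_kernel ?z (rc x t) * phi (rc x t)) \<partial>circ) \<partial>lborel)"
    unfolding radii_def by (subst nn_integral_restrict_space) auto
  also have "\<dots> \<le> (\<integral>\<^sup>+x\<in>{1/2..1}. (\<integral>\<^sup>+t. ennreal (green_kernel ?z (complex_of_real x * cis t)
       * lapf (\<lambda>y. 4 / a\<^sup>2 * ?h' y) (\<lambda>y. 4 / a\<^sup>2 * ?h'' y) F (complex_of_real x * cis t)) \<partial>circ) \<partial>lborel)"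
    using gk phi_lap
    by (intro nn_integral_mono) (auto split: split_indicator simp: cmod_rc rc_def[symmetric] intro!: nn_integral_mono ennreal_leI mult_left_mono)
  also have "\<dots> \<le> ennreal (2 * integral {0..2*pi} (\<lambda>t. (4 / a\<^sup>2 * ((cmod (F (cis t)))\<^sup>2 + e) powr (a / 2)) * Pk ?z t))"
  proof (rule green_area_bound[OF polar_pair_scale[OF polar_pair_powr[OF e F]] R z])
    fix y :: real assume y: "0 \<le> y"
    have "0 \<le> 4 / a\<^sup>2 * (?h' y + y * ?h'' y)"
      using y e a by (intro mult_nonneg_nonneg powr_laplacian(1)) auto
    thus "0 \<le> 4 / a\<^sup>2 * ?h' y + y * (4 / a\<^sup>2 * ?h'' y)" by (simp only: distrib_left mult.left_commute)
    show "0 \<le> 4 / a\<^sup>2 * (y + e) powr (a / 2)" by simp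
  qed
  also have "2 * integral {0..2*pi} (\<lambda>t. (4 / a\<^sup>2 * ((cmod (F (cis t)))\<^sup>2 + e) powr (a / 2)) * Pk ?z t)
      = 4 / a\<^sup>2 * (2 * integral {0..2*pi} (\<lambda>t. vv (cis t) powr (a / 2) * Pk ?z t))"
    by (simp only: vv_def mult.assoc integral_mult_right mult.left_commute[of 2])
  also have "ennreal \<dots> \<le> ennreal (4 / a\<^sup>2 * (2 * (8 * (12 * Sr s) powr (1 / real k))))"
    using r by (intro ennreal_leI mult_left_mono u_sub) auto
  also have "4 / a\<^sup>2 * (2 * (8 * (12 * Sr s) powr (1 / real k))) = Y s" by (simp add: Y_def)
  finally show ?thesis .
qed

definition A where "A s = sqf phi s"

lemma A_meas [measurable]: "A \<in> borel_measurable circ"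
  unfolding A_def sqf_def sqk_def by measurable

text \<open>Everything is continuous on the closed disc. The bound depends on \<open>F\<close> and
  only supplies the finiteness of \<open>A\<close>.\<close>

lemma A_bounded: "\<exists>B. \<forall>s. A s \<le> ennreal B"
proof -
  have "compact ((\<lambda>w. vv w powr (a / 2 - 1) * (cmod (deriv F w))\<^sup>2) ` cball 0 1)"
    by (intro compact_continuous_image continuous_intros
        continuous_on_subset[OF cont_vv] continuous_on_subset[OF cont_F(2)]) (use R in auto)
  hence "bdd_above ((\<lambda>w. vv w powr (a / 2 - 1) * (cmod (deriv F w))\<^sup>2) ` cball 0 1)"
    by (intro bounded_imp_bdd_above compact_imp_bounded)
  then obtain B where B: "\<And>w. w \<in> cball 0 1 \<Longrightarrow> vv w powr (a / 2 - 1) * (cmod (deriv F w))\<^sup>2 \<le> B"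
    unfolding bdd_above_def by blast
  have "0 \<le> vv 0 powr (a / 2 - 1) * (cmod (deriv F 0))\<^sup>2" by simp
  also have "\<dots> \<le> B" by (rule B) simp
  finally have B0: "0 \<le> B" .
  have Bphi: "phi w \<le> B" if "cmod w < 1" for w
    using B[of w] B0 that by (auto simp: phi_def split: split_indicator)
  have "A s \<le> ennreal (B * (2 * pi) * (1/2))" for s
  proof -
    have "A s \<le> (\<integral>\<^sup>+z. ennreal B * ennreal (Pk (rc (fst z) s) (snd z)) \<partial>annulus)"
      unfolding A_def sqf_def
    proof (rule nn_integral_mono)
      fix z assume "z \<in> space annulus"
      hence z: "1/2 \<le> fst z" "fst z < 1" by (auto simp: space_pair_measure)
      have "(1 - fst z) * Pk (rc (fst z) (snd z)) s * phi (rc (fst z) (snd z)) \<le> 1 * Pk (rc (fst z) (snd z)) s * B"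
        using z B0 phi_nonneg by (intro mult_mono Bphi) (auto simp: cmod_rc)
      thus "sqk phi z s \<le> ennreal B * ennreal (Pk (rc (fst z) s) (snd z))"
        unfolding sqk_def using B0 by (subst ennreal_mult'[symmetric]) (auto simp: Pk_rc_sym[of _ s] mult.commute intro!: ennreal_leI)
    qed
    also have "\<dots> = (\<integral>\<^sup>+r. (\<integral>\<^sup>+t. ennreal B * ennreal (Pk (rc r s) t) \<partial>circ) \<partial>radii)"
      by (subst circ.nn_integral_fst[symmetric]) simp_all
    also have "\<dots> = (\<integral>\<^sup>+r. ennreal B * ennreal (2 * pi) \<partial>radii)"
      by (intro nn_integral_cong) (simp add: nn_integral_cmult nn_integral_Pk cmod_rc)
    also have "\<dots> = ennreal (B * (2 * pi) * (1/2))"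
      using B0 unfolding nn_integral_const space_radii emeasure_radii by (simp add: ennreal_mult'[symmetric] del: ennreal_half)
    finally show ?thesis .
  qed
  thus ?thesis by blast
qed

definition CG :: real where "CG = 2 ^ (2 * (2 * k - 2) + 1) * 4 ^ (2 * k) * (4 * pi)"
definition CA where "CA = 2 * (CG * (2 * CG) ^ (2 * k - 1)) * ((64 / a\<^sup>2) ^ (2 * k) * 144)"

lemma CA_nonneg: "0 \<le> CA" by (simp add: CA_def CG_def)

text \<open>With \<open>n = 2 * k - 2\<close> the Garsia bound concerns the exponent
  \<open>2 * k\<close>, and Young's inequality with parameter \<open>2 * CG\<close> leaves half of
  the left-hand side for absorption. Since \<open>Y\<close> contains a \<open>k\<close>-th root of
  the maximal function, its \<open>2 * k\<close>-th power is a multiple of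
  \<open>(S s)\<^sup>2\<close>.\<close>

lemma A_moment: "(\<integral>\<^sup>+s. A s ^ (2 * k) \<partial>circ) \<le> ennreal CA * (\<integral>\<^sup>+s. (S s)\<^sup>2 \<partial>circ)"
proof -
  define n where "n = 2 * k - 2"
  have n: "Suc (Suc n) = 2 * k" "Suc n = 2 * k - 1" "n + 2 = 2 * k" using k by (auto simp: n_def)
  have CG': "CG = 2 ^ (2 * n + 1) * 4 ^ (n + 2) * (4 * pi)" by (simp only: CG_def n(3)) (simp only: n_def)
  have CG: "0 < CG" by (simp add: CG_def)
  have Ym [measurable]: "(\<lambda>s. ennreal (Y s)) \<in> borel_measurable circ" unfolding Y_def by measurable
  let ?I = "\<integral>\<^sup>+s. A s ^ Suc (Suc n) \<partial>circ"
  obtain B where B: "\<And>s. A s \<le> ennreal B" using A_bounded by blast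
  have "?I \<le> (\<integral>\<^sup>+s. ennreal B ^ Suc (Suc n) \<partial>circ)" using B by (intro nn_integral_mono power_mono) auto
  also have "\<dots> < \<top>" by (simp add: emeasure_circ ennreal_mult_less_top power_less_top_ennreal)
  finally have fin: "?I < \<top>" .
  have "?I \<le> ennreal CG * (\<integral>\<^sup>+s. ennreal (Y s) * A s ^ Suc n \<partial>circ)"
    using area_moment_garsia[OF phi_meas phi_nonneg Ym green_phi, of n] by (simp only: A_def CG')
  also have "\<dots> \<le> ennreal CG * (\<integral>\<^sup>+s. ennreal ((2 * CG) ^ Suc n) * ennreal (Y s) ^ Suc (Suc n) + ennreal (1 / (2 * CG)) * A s ^ Suc (Suc n) \<partial>circ)"
    using CG by (intro mult_left_mono nn_integral_mono ennreal_young_power) auto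
  also have "(\<integral>\<^sup>+s. ennreal ((2 * CG) ^ Suc n) * ennreal (Y s) ^ Suc (Suc n) + ennreal (1 / (2 * CG)) * A s ^ Suc (Suc n) \<partial>circ)
     = ennreal ((2 * CG) ^ Suc n) * (\<integral>\<^sup>+s. ennreal (Y s) ^ Suc (Suc n) \<partial>circ) + ennreal (1 / (2 * CG)) * ?I"
    by (subst nn_integral_add) (simp_all add: nn_integral_cmult del: power_Suc)
  also have "ennreal CG * \<dots> = ennreal CG * (ennreal ((2 * CG) ^ Suc n) * (\<integral>\<^sup>+s. ennreal (Y s) ^ Suc (Suc n) \<partial>circ)) + ennreal (1/2) * ?I"
  proof -
    have "ennreal CG * ennreal (1 / (2 * CG)) = ennreal (CG * (1 / (2 * CG)))" using CG by (intro ennreal_mult[symmetric]) auto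
    also have "CG * (1 / (2 * CG)) = 1 / 2" using CG by simp
    finally show ?thesis by (simp only: distrib_left mult.assoc[symmetric])
  qed
  finally have "?I \<le> 2 * (ennreal CG * (ennreal ((2 * CG) ^ Suc n) * (\<integral>\<^sup>+s. ennreal (Y s) ^ Suc (Suc n) \<partial>circ)))"
    using fin by (intro ennreal_absorb_half) auto
  also have "(\<integral>\<^sup>+s. ennreal (Y s) ^ Suc (Suc n) \<partial>circ) = ennreal ((64 / a\<^sup>2) ^ (2 * k) * 144) * (\<integral>\<^sup>+s. (S s)\<^sup>2 \<partial>circ)"
  proof -
    have "ennreal (Y s) ^ Suc (Suc n) = ennreal ((64 / a\<^sup>2) ^ (2 * k) * 144) * (S s)\<^sup>2" for s
    proof -
      have Y0: "0 \<le> Y s" by (simp add: Y_def)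
      have "((12 * Sr s) powr (1 / real k)) ^ k = 12 * Sr s"
        using Sr_pos[of s] k by (simp add: powr_realpow[symmetric] powr_powr)
      hence "((12 * Sr s) powr (1 / real k)) ^ (2 * k) = (12 * Sr s)\<^sup>2"
        by (metis mult.commute power_mult)
      hence "Y s ^ (2 * k) = (64 / a\<^sup>2) ^ (2 * k) * 144 * (Sr s)\<^sup>2"
        unfolding Y_def power_mult_distrib by (simp only: power_mult_distrib mult.assoc) simp
      moreover have "ennreal (Y s) ^ Suc (Suc n) = ennreal (Y s ^ (2 * k))"
        unfolding n(1) by (rule ennreal_power[OF Y0])
      moreover have "(S s)\<^sup>2 = ennreal ((Sr s)\<^sup>2)" unfolding S_eq by (rule ennreal_power[OF Sr_nonneg])
      ultimately show ?thesis by (simp add: ennreal_mult')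
    qed
    thus ?thesis by (simp only:) (rule nn_integral_cmult, measurable)
  qed
  also have "2 * (ennreal CG * (ennreal ((2 * CG) ^ Suc n) * (ennreal ((64 / a\<^sup>2) ^ (2 * k) * 144) * x))) = ennreal CA * x" for x
  proof -
    have m: "ennreal (x1 * (x2 * x3) * x4) = ennreal x1 * (ennreal x2 * (ennreal x3 * ennreal x4))"
      if "0 \<le> x1" "0 \<le> x2" "0 \<le> x3" for x1 x2 x3 x4
      using that by (simp add: ennreal_mult' mult.assoc)
    have "ennreal CA = ennreal 2 * (ennreal CG * (ennreal ((2 * CG) ^ Suc n) * ennreal ((64 / a\<^sup>2) ^ (2 * k) * 144)))"
      unfolding CA_def n(2) by (rule m) (use CG in auto)
    thus ?thesis by (simp add: mult.assoc)
  qed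
  finally show ?thesis unfolding n(1) .
qed

lemma S_moment: "(\<integral>\<^sup>+s. (S s)\<^sup>2 \<partial>circ) \<le> ennreal (2 * (256 * pi)\<^sup>2) * (\<integral>\<^sup>+s. ennreal (vv (cis s) powr (p / 2)) \<partial>circ)"
proof -
  have "(\<integral>\<^sup>+s. (S s)\<^sup>2 \<partial>circ) \<le> ennreal (2 * (256 * pi)\<^sup>2) * (\<integral>\<^sup>+s. (ennreal (V s))\<^sup>2 \<partial>circ)"
    unfolding S_def by (rule maximal_L2) (auto intro: power_le_one)
  moreover have "(ennreal (V s))\<^sup>2 = ennreal (vv (cis s) powr (p / 2))" for s
  proof -
    have "V s ^ 2 = vv (cis s) powr (p / 2)"
      unfolding V_def power2_eq_square powr_add[symmetric] by simp
    thus ?thesis using V_pos[of s] by (simp add: ennreal_power)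
  qed
  ultimately show ?thesis by simp
qed

end

section \<open>Interpolation inequalities for the derivative\<close>

lemma powr_add_le_2:
  assumes "0 \<le> x" "0 \<le> y" "0 < c" "c \<le> (1::real)"
  shows "(x + y) powr c \<le> 2 * (x powr c + y powr c)"
proof -
  have "(x + y) powr c \<le> (2 * max x y) powr c" using assms by (intro powr_mono2) auto
  also have "\<dots> = 2 powr c * max x y powr c" using assms by (subst powr_mult) auto
  also have "\<dots> \<le> 2 powr 1 * (x powr c + y powr c)"
    using assms by (intro mult_mono powr_mono) (auto simp: max_def)
  finally show ?thesis by simp
qed

text \<open>\<open>G\<close> will be the derivative of \<open>F\<close>, which may vanish and
  carries no regularisation; hence \<open>e\<close> is sent to \<open>0\<close> here. The factor
  \<open>2\<close> comes from \<open>powr_add_le_2\<close>.\<close>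

lemma sub_poisson_powr:
  assumes G: "G holomorphic_on ball 0 R" and R: "1 < R" and z: "cmod z < 1" and c: "0 < c" "c \<le> 1"
  shows "2 * pi * ((cmod (G z))\<^sup>2) powr c \<le> 2 * integral {0..2*pi} (\<lambda>t. ((cmod (G (cis t)))\<^sup>2) powr c * Pk z t)"
proof (rule field_le_epsilon)
  fix d :: real assume d: "0 < d"
  define e where "e = (d / (4 * pi)) powr (1 / c)"
  have e: "0 < e" using d by (simp add: e_def)
  have ec: "e powr c = d / (4 * pi)" using d c by (simp add: e_def powr_powr)
  have cG: "continuous_on (sphere 0 1) G"
    by (rule continuous_on_subset[OF holomorphic_on_imp_continuous_on[OF G]]) (use R in auto)
  have cc: "continuous_on UNIV (\<lambda>t. G (cis t))"
    by (rule continuous_on_compose2[OF cG]) (auto intro!: continuous_intros)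
  have ci: "continuous_on {0..2*pi} (\<lambda>t. ((cmod (G (cis t)))\<^sup>2) powr c)"
    using c by (intro continuous_on_powr' continuous_intros continuous_on_subset[OF cc]) auto
  have ci': "continuous_on {0..2*pi} (\<lambda>t. ((cmod (G (cis t)))\<^sup>2 + e) powr c)"
    using c e by (intro continuous_on_powr' continuous_intros continuous_on_subset[OF cc]) (auto simp: add_nonneg_eq_0_iff)
  have "2 * pi * ((cmod (G z))\<^sup>2) powr c \<le> 2 * pi * ((cmod (G z))\<^sup>2 + e) powr c"
    using e c by (intro mult_left_mono powr_mono2) auto
  also have "\<dots> \<le> integral {0..2*pi} (\<lambda>t. ((cmod (G (cis t)))\<^sup>2 + e) powr c * Pk z t)"
    using e c by (intro sub_poisson[OF polar_pair_powr[OF e G] R z] powr_laplacian(1)) auto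
  also have "\<dots> \<le> integral {0..2*pi} (\<lambda>t. 2 * (((cmod (G (cis t)))\<^sup>2) powr c * Pk z t) + 2 * e powr c * Pk z t)"
  proof (rule integral_le)
    fix t
    have "((cmod (G (cis t)))\<^sup>2 + e) powr c * Pk z t \<le> 2 * (((cmod (G (cis t)))\<^sup>2) powr c + e powr c) * Pk z t"
      using z e c by (intro mult_right_mono powr_add_le_2) auto
    thus "((cmod (G (cis t)))\<^sup>2 + e) powr c * Pk z t \<le> 2 * (((cmod (G (cis t)))\<^sup>2) powr c * Pk z t) + 2 * e powr c * Pk z t"
      by (simp add: algebra_simps)
  qed (use z in \<open>auto intro!: integrable_continuous_interval continuous_on_mult continuous_on_add continuous_on_const continuous_on_Pk continuous_on_id ci ci'\<close>)
  also have "\<dots> = 2 * integral {0..2*pi} (\<lambda>t. ((cmod (G (cis t)))\<^sup>2) powr c * Pk z t) + 2 * e powr c * integral {0..2*pi} (Pk z)"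
    using z by (subst integral_add) (auto intro!: integrable_continuous_interval continuous_on_mult continuous_on_const continuous_on_Pk continuous_on_id ci)
  also have "2 * e powr c * integral {0..2*pi} (Pk z) = d" unfolding integral_Pk[OF z] ec by simp
  finally show "2 * pi * ((cmod (G z))\<^sup>2) powr c \<le> 2 * integral {0..2*pi} (\<lambda>t. ((cmod (G (cis t)))\<^sup>2) powr c * Pk z t) + d" .
qed

text \<open>It stands in for Hoelder's inequality: when \<open>X\<close> and \<open>Y\<close>
  dominate the integrals of \<open>x\<close> and \<open>y\<close>, the right-hand side integrates to
  at most twice \<open>X powr (1 - \<theta>) * Y powr \<theta>\<close>.\<close>

lemma geometric_le_sum:
  fixes x y X Y \<theta> :: real
  assumes "0 \<le> x" "0 \<le> y" "0 < X" "0 < Y" "0 < \<theta>" "\<theta> \<le> 1"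
  shows "x powr (1 - \<theta>) * y powr \<theta> \<le> X powr (1 - \<theta>) * Y powr \<theta> * (x / X + y / Y)"
proof -
  define u v where "u = x / X" and "v = y / Y"
  have uv: "0 \<le> u" "0 \<le> v" using assms by (auto simp: u_def v_def)
  have xy: "x = X * u" "y = Y * v" using assms by (auto simp: u_def v_def)
  have "u powr (1 - \<theta>) * v powr \<theta> \<le> max u v powr (1 - \<theta>) * max u v powr \<theta>"
    using uv assms by (intro mult_mono powr_mono2) auto
  also have "\<dots> = max u v" using uv by (simp add: powr_add[symmetric])
  also have "\<dots> \<le> u + v" using uv by auto
  finally have "u powr (1 - \<theta>) * v powr \<theta> \<le> u + v" .
  hence "X powr (1 - \<theta>) * Y powr \<theta> * (u powr (1 - \<theta>) * v powr \<theta>) \<le> X powr (1 - \<theta>) * Y powr \<theta> * (u + v)"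
    by (intro mult_left_mono) auto
  thus ?thesis using assms uv unfolding u_def[symmetric] v_def[symmetric] xy by (simp add: powr_mult mult_ac)
qed

text \<open>The radii \<open>r / p\<close> and \<open>p\<close> have comparable distance to the
  circle, as \<open>1 - r / p \<le> 4/3 * (1 - p)\<close>. The numerator costs \<open>8/3\<close>
  and the denominator \<open>4\<close>, and \<open>32/3\<close> is rounded up.\<close>

lemma Pk_shift_le:
  assumes r: "1/2 \<le> r" "r < 1" and p: "p = (1 + r) / 2"
  shows "Pk (rc (r / p) s) t \<le> 11 * Pk (rc p s) t"
proof -
  have p1: "3/4 \<le> p" "p < 1" using r p by auto
  define q where "q = r / p"
  have q: "0 \<le> q" "q < 1" using r p p1 by (auto simp: q_def divide_less_eq)
  have rp: "r = 2 * p - 1" using p by simp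
  have "p * (2 - p) \<le> 1" using sum_squares_bound[of p 1] by (simp add: power2_eq_square algebra_simps)
  have qp: "q \<le> p"
  proof -
    have "2 * p - 1 \<le> p * p" using sum_squares_bound[of p 1] by (simp add: power2_eq_square)
    thus ?thesis using p1 by (simp add: q_def rp divide_le_eq)
  qed
  have q2: "1 - q \<le> 4/3 * (1 - p)"
  proof -
    have "1 - q = (1 - p) / p" using p1 by (simp add: q_def rp field_simps)
    also have "\<dots> \<le> (1 - p) / (3/4)" using p1 by (intro divide_left_mono) auto
    finally show ?thesis by simp
  qed
  have d: "1 - q \<le> cmod (cis t - rc q s)" using norm_triangle_ineq2[of "cis t" "rc q s"] q by (simp add: cmod_rc)
  have "rc q s - rc p s = complex_of_real (q - p) * cis s" by (simp add: rc_def algebra_simps)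
  hence "cmod (rc q s - rc p s) = \<bar>q - p\<bar>" by (simp only: norm_mult norm_of_real norm_cis mult_1_right)
  hence "cmod (cis t - rc p s) \<le> cmod (cis t - rc q s) + \<bar>q - p\<bar>"
    using norm_triangle_ineq[of "cis t - rc q s" "rc q s - rc p s"] by simp
  hence "cmod (cis t - rc p s) \<le> 2 * cmod (cis t - rc q s)" using d qp p1 by simp
  hence "(cmod (cis t - rc p s))\<^sup>2 \<le> (2 * cmod (cis t - rc q s))\<^sup>2" by (intro power_mono) auto
  hence e: "(cmod (cis t - rc p s))\<^sup>2 / 4 \<le> (cmod (cis t - rc q s))\<^sup>2" by (simp add: power_mult_distrib)
  have pos: "0 < cmod (cis t - rc p s)" using cis_neq[of "rc p s" t] p1 by (simp add: cmod_rc)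
  have "1 - q\<^sup>2 = (1 - q) * (1 + q)" by (simp add: power2_eq_square algebra_simps)
  also have "\<dots> \<le> (4/3 * (1 - p)) * (2 * 1)" using q q2 by (intro mult_mono) auto
  also have "\<dots> \<le> 8/3 * ((1 - p) * (1 + p))"
  proof -
    have "(1 - p) * 1 \<le> (1 - p) * (1 + p)" using p1 by (intro mult_left_mono) auto
    thus ?thesis by simp
  qed
  also have "\<dots> = 8/3 * (1 - p\<^sup>2)" by (simp add: power2_eq_square algebra_simps)
  finally have n: "1 - q\<^sup>2 \<le> 8/3 * (1 - p\<^sup>2)" .
  have p2: "0 \<le> 1 - p\<^sup>2" using p1 by (simp add: abs_square_le_1)
  have "Pk (rc q s) t \<le> (8/3 * (1 - p\<^sup>2)) / ((cmod (cis t - rc p s))\<^sup>2 / 4)"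
    unfolding Pk_def using e n pos q p2 by (intro frac_le) (auto simp: cmod_rc)
  also have "\<dots> = 32/3 * Pk (rc p s) t" using p1 by (simp add: Pk_def cmod_rc)
  also have "\<dots> \<le> 11 * Pk (rc p s) t" using p1 by (intro mult_right_mono) (auto simp: cmod_rc)
  finally show ?thesis by (simp add: q_def)
qed

section \<open>Domination of the derivative by the area function\<close>

context disc_fun
begin

text \<open>The exponent at which the powers of \<open>vv\<close> cancel in
  \<open>v0 powr (1 - \<theta>) * phi powr \<theta>\<close>, leaving a pure power of
  \<open>|F'|\<close>.\<close>

definition \<theta> where "\<theta> = (p / 4) / (1 - a / 2 + p / 4)"

lemma \<theta>: "0 < \<theta>" "\<theta> \<le> 1" "(p / 4) * (1 - \<theta>) = (1 - a / 2) * \<theta>"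
proof -
  have d: "0 < 1 - a / 2 + p / 4" using a p by auto
  show "0 < \<theta>" "\<theta> \<le> 1" using a p d by (auto simp: \<theta>_def divide_le_eq)
  show "(p / 4) * (1 - \<theta>) = (1 - a / 2) * \<theta>" using d by (simp add: \<theta>_def field_simps)
qed

definition CQ where "CQ = 11 * 4 powr ((2 - a) * 2 / p)"

text \<open>Pointwise \<open>|F'|^2 = phi * vv powr (1 - a / 2)\<close>, but the maximal function at
  \<open>s\<close> bounds \<open>vv\<close> only near the radius through \<open>cis s\<close>, not
  on the whole circle of radius \<open>q\<close>. So the sub-mean value property is used for the
  smaller power \<open>\<theta>\<close> of \<open>|F'|^2\<close>, and interpolation separates the
  mean of \<open>phi\<close> from the mean of \<open>vv powr (p / 4)\<close>, which the maximal
  function does control.\<close>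

lemma deriv_F_sq_le:
  assumes r: "1/2 \<le> r" "r < 1" and q: "q = (1 + r) / 2"
  shows "ennreal ((cmod (deriv F (rc r s)))\<^sup>2) \<le> ennreal (CQ * W s powr (2 - a)) * (\<integral>\<^sup>+t. ennreal (Pk (rc q t) s * phi (rc q t)) \<partial>circ)"
proof -
  have q1: "3/4 \<le> q" "q < 1" "r < q" using r q by auto
  \<comment> \<open>Rescaling by \<open>q\<close> turns the circle of radius \<open>q\<close> into
    the unit circle and moves \<open>rc r s\<close> to \<open>z\<close>.\<close>
  define z where "z = rc (r / q) s"
  have rq: "0 \<le> r / q" "r / q < 1" using r q1 by (auto simp: divide_less_eq)
  have z1: "cmod z < 1" using rq by (simp add: z_def cmod_rc)
  define G where "G w = deriv F (of_real q * w)" for w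
  have "G holomorphic_on ball 0 (R / q)"
  proof -
    have "(deriv F \<circ> (\<lambda>w. of_real q * w)) holomorphic_on ball 0 (R / q)"
      by (rule holomorphic_on_compose_gen[of _ _ _ "ball 0 R"])
         (use q1 F in \<open>auto intro!: holomorphic_intros simp: norm_mult field_simps\<close>)
    thus ?thesis by (simp add: o_def G_def[abs_def])
  qed
  moreover have "1 < R / q" using q1 R by (simp add: less_divide_eq)
  ultimately have sp: "2 * pi * ((cmod (G z))\<^sup>2) powr \<theta> \<le> 2 * integral {0..2*pi} (\<lambda>t. ((cmod (G (cis t)))\<^sup>2) powr \<theta> * Pk z t)"
    using z1 \<theta> by (intro sub_poisson_powr)
  have Gz: "G z = deriv F (rc r s)" using q1 by (simp add: G_def z_def rc_def)
  have Gc: "G (cis t) = deriv F (rc q t)" for t by (simp add: G_def rc_def)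
  have rcR: "rc q t \<in> ball 0 R" for t using q1 R by (simp add: cmod_rc)
  have crc: "continuous_on UNIV (rc q)" unfolding rc_def[abs_def] by (intro continuous_intros)
  have cv: "continuous_on UNIV (\<lambda>t. vv (rc q t) powr c)" for c
    by (rule continuous_on_compose2[OF cont_vv crc]) (use rcR in auto)
  have cd: "continuous_on UNIV (\<lambda>t. deriv F (rc q t))"
    by (rule continuous_on_compose2[OF cont_F(2) crc]) (use rcR in auto)
  have phi_eq: "phi (rc q t) = vv (rc q t) powr (a / 2 - 1) * (cmod (deriv F (rc q t)))\<^sup>2" for t
    using rcR[of t] by (simp add: phi_def)
  have cphi: "continuous_on X (\<lambda>t. phi (rc q t))" for X
    unfolding phi_eq by (rule continuous_on_subset[OF _ subset_UNIV]) (intro continuous_intros cv cd)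
  have cv': "continuous_on X (\<lambda>t. vv (rc q t) powr c)" for X c by (rule continuous_on_subset[OF cv]) auto
  define v0 where "v0 t = vv (rc q t) powr (p / 4)" for t
  have v0: "0 < v0 t" for t using vv_pos[of "rc q t"] by (simp add: v0_def)
  have split: "((cmod (deriv F (rc q t)))\<^sup>2) powr \<theta> = v0 t powr (1 - \<theta>) * phi (rc q t) powr \<theta>" for t
  proof -
    have "v0 t powr (1 - \<theta>) * phi (rc q t) powr \<theta> = vv (rc q t) powr ((p / 4) * (1 - \<theta>) + (a / 2 - 1) * \<theta>) * ((cmod (deriv F (rc q t)))\<^sup>2) powr \<theta>"
      unfolding phi_eq v0_def using vv_pos[of "rc q t"] by (simp add: powr_mult powr_powr powr_add)
    also have "(p / 4) * (1 - \<theta>) + (a / 2 - 1) * \<theta> = 0" using \<theta>(3) by (simp add: algebra_simps)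
    finally show ?thesis using vv_pos[of "rc q t"] by simp
  qed
  \<comment> \<open>The constant \<open>96\<close> is \<open>16 * pi * 12 / (2 * pi)\<close>: the
    composition of kernels, the bound \<open>integral_Pk_V_le\<close>, and the normalisation in
    \<open>vv_sub\<close>.\<close>
  define X where "X = 96 * Sr s"
  have X: "0 < X" using Sr_pos by (simp add: X_def)
  have IX: "integral {0..2*pi} (\<lambda>t. v0 t * Pk z t) \<le> X"
  proof -
    have "ennreal (2 * pi * integral {0..2*pi} (\<lambda>t. v0 t * Pk z t)) = (\<integral>\<^sup>+t. ennreal (2 * pi * (v0 t * Pk z t)) \<partial>circ)"
      using z1 v0[THEN less_imp_le] cv' unfolding v0_def integral_mult_right[symmetric]
      by (intro nn_integral_circ_continuous[symmetric] continuous_on_mult continuous_on_const continuous_on_Pk continuous_on_id) auto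
    also have "\<dots> \<le> (\<integral>\<^sup>+t. (\<integral>\<^sup>+y. ennreal (Pk z t) * (ennreal (Pk (rc q t) y) * ennreal (V y)) \<partial>circ) \<partial>circ)"
    proof (intro nn_integral_mono)
      fix t
      have c1: "cmod (rc q t) < 1" using q1 by (simp add: cmod_rc)
      have "2 * pi * (v0 t * Pk z t) = Pk z t * (2 * pi * v0 t)" by simp
      also have "\<dots> \<le> Pk z t * integral {0..2*pi} (\<lambda>y. V y * Pk (rc q t) y)"
        unfolding v0_def using z1 vv_sub[OF c1] by (intro mult_left_mono) auto
      finally have "ennreal (2 * pi * (v0 t * Pk z t)) \<le> ennreal (Pk z t) * (\<integral>\<^sup>+y. ennreal (Pk (rc q t) y) * ennreal (V y) \<partial>circ)"
        unfolding nn_integral_Pk_V[OF c1] using z1 by (simp add: ennreal_mult'[symmetric] ennreal_leI)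
      also have "\<dots> = (\<integral>\<^sup>+y. ennreal (Pk z t) * (ennreal (Pk (rc q t) y) * ennreal (V y)) \<partial>circ)"
        by (rule nn_integral_cmult[symmetric]) measurable
      finally show "ennreal (2 * pi * (v0 t * Pk z t)) \<le> (\<integral>\<^sup>+y. ennreal (Pk z t) * (ennreal (Pk (rc q t) y) * ennreal (V y)) \<partial>circ)" .
    qed
    also have "\<dots> = (\<integral>\<^sup>+y. (\<integral>\<^sup>+t. ennreal (Pk z t) * (ennreal (Pk (rc q t) y) * ennreal (V y)) \<partial>circ) \<partial>circ)"
      by (rule circ2.Fubini'[symmetric]) measurable
    also have "\<dots> \<le> (\<integral>\<^sup>+y. ennreal (16 * pi) * (ennreal (Pk z y) * ennreal (V y)) \<partial>circ)"
    proof (intro nn_integral_mono)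
      fix y
      have "(\<integral>\<^sup>+t. ennreal (Pk z t) * (ennreal (Pk (rc q t) y) * ennreal (V y)) \<partial>circ)
         = (\<integral>\<^sup>+t. ennreal (Pk (rc q y) t * Pk z t) * ennreal (V y) \<partial>circ)"
        using z1 q1 by (intro nn_integral_cong) (simp add: Pk_rc_sym[of q _ y] ennreal_mult' cmod_rc mult_ac)
      also have "\<dots> = (\<integral>\<^sup>+t. ennreal (Pk (rc q y) t * Pk z t) \<partial>circ) * ennreal (V y)"
        by (rule nn_integral_multc) measurable
      also have "\<dots> \<le> (ennreal (16 * pi) * ennreal (Pk z y)) * ennreal (V y)"
      proof (intro mult_right_mono)
        have "r = 2 * q - 1" using q by simp
        hence "r \<le> q * q" using sum_squares_bound[of q 1] by (simp add: power2_eq_square)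
        hence "r / q \<le> q" using q1 by (simp add: divide_le_eq)
        thus "(\<integral>\<^sup>+t. ennreal (Pk (rc q y) t * Pk z t) \<partial>circ) \<le> ennreal (16 * pi) * ennreal (Pk z y)"
          unfolding z_def using rq q1 by (intro Pk_Pk_le) auto
      qed auto
      finally show "(\<integral>\<^sup>+t. ennreal (Pk z t) * (ennreal (Pk (rc q t) y) * ennreal (V y)) \<partial>circ) \<le> ennreal (16 * pi) * (ennreal (Pk z y) * ennreal (V y))"
        by (simp add: mult.assoc)
    qed
    also have "\<dots> = ennreal (16 * pi) * (\<integral>\<^sup>+y. ennreal (Pk z y) * ennreal (V y) \<partial>circ)"
      by (rule nn_integral_cmult) measurable
    also have "\<dots> = ennreal (16 * pi * integral {0..2*pi} (\<lambda>t. V t * Pk z t))"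
      by (simp add: nn_integral_Pk_V[OF z1] ennreal_mult'[symmetric])
    also have "\<dots> \<le> ennreal (16 * pi * (12 * Sr s))"
      unfolding z_def by (intro ennreal_leI mult_left_mono integral_Pk_V_le rq) auto
    finally have "2 * pi * integral {0..2*pi} (\<lambda>t. v0 t * Pk z t) \<le> 16 * pi * (12 * Sr s)"
      using Sr_nonneg[of s] by (subst (asm) ennreal_le_iff) auto
    hence "pi * integral {0..2*pi} (\<lambda>t. v0 t * Pk z t) \<le> pi * X" by (simp add: X_def)
    thus ?thesis by simp
  qed
  define I where "I = integral {0..2*pi} (\<lambda>t. phi (rc q t) * Pk z t)"
  have I0: "0 \<le> I" unfolding I_def using z1 phi_nonneg
    by (intro integral_nonneg integrable_continuous_interval continuous_on_mult cphi continuous_on_Pk continuous_on_id) auto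
  define E where "E = X powr ((1 - \<theta>) / \<theta>)"
  have E: "0 < E" using X by (simp add: E_def)
  \<comment> \<open>\<open>I\<close> may be zero, whereas \<open>geometric_le_sum\<close> divides by
    its bound; the estimate is therefore proved for every \<open>y > I\<close>.\<close>
  have le_all: "(cmod (deriv F (rc r s)))\<^sup>2 / E \<le> y" if y: "I < y" for y
  proof -
    have y0: "0 < y" using y I0 by simp
    have "2 * pi * ((cmod (deriv F (rc r s)))\<^sup>2) powr \<theta> \<le> 2 * integral {0..2*pi} (\<lambda>t. ((cmod (deriv F (rc q t)))\<^sup>2) powr \<theta> * Pk z t)"
      using sp unfolding Gz Gc .
    also have "integral {0..2*pi} (\<lambda>t. ((cmod (deriv F (rc q t)))\<^sup>2) powr \<theta> * Pk z t)
       \<le> integral {0..2*pi} (\<lambda>t. X powr (1 - \<theta>) * y powr \<theta> * (1 / X * (v0 t * Pk z t) + 1 / y * (phi (rc q t) * Pk z t)))"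
    proof (rule integral_le)
      fix t
      have "((cmod (deriv F (rc q t)))\<^sup>2) powr \<theta> * Pk z t \<le> (X powr (1 - \<theta>) * y powr \<theta> * (v0 t / X + phi (rc q t) / y)) * Pk z t"
        unfolding split using X y0 \<theta> v0[of t] phi_nonneg z1 by (intro mult_right_mono geometric_le_sum) auto
      thus "((cmod (deriv F (rc q t)))\<^sup>2) powr \<theta> * Pk z t \<le> X powr (1 - \<theta>) * y powr \<theta> * (1 / X * (v0 t * Pk z t) + 1 / y * (phi (rc q t) * Pk z t))"
        by (simp add: algebra_simps)
    next
      show "(\<lambda>t. ((cmod (deriv F (rc q t)))\<^sup>2) powr \<theta> * Pk z t) integrable_on {0..2*pi}"
        using \<theta> z1 by (intro integrable_continuous_interval continuous_on_mult continuous_on_powr' continuous_intros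
             continuous_on_subset[OF cd]) auto
    qed (use z1 X y0 in \<open>auto intro!: integrable_continuous_interval continuous_on_mult continuous_on_add continuous_on_divide continuous_on_const cphi cv'[folded v0_def] continuous_on_Pk continuous_on_id simp: v0_def\<close>)
    also have "\<dots> = X powr (1 - \<theta>) * y powr \<theta> * (1 / X * integral {0..2*pi} (\<lambda>t. v0 t * Pk z t) + 1 / y * I)"
    proof -
      have "integral {0..2*pi} (\<lambda>t. 1 / X * (v0 t * Pk z t) + 1 / y * (phi (rc q t) * Pk z t))
        = integral {0..2*pi} (\<lambda>t. 1 / X * (v0 t * Pk z t)) + integral {0..2*pi} (\<lambda>t. 1 / y * (phi (rc q t) * Pk z t))"
        using z1 unfolding v0_def
        by (intro integral_add integrable_continuous_interval continuous_on_mult continuous_on_const cphi cv' continuous_on_Pk continuous_on_id) auto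
      thus ?thesis unfolding I_def by (simp only: integral_mult_right)
    qed
    also have "\<dots> \<le> X powr (1 - \<theta>) * y powr \<theta> * (1 / X * X + 1 / y * y)"
      using X y0 y IX by (intro mult_left_mono add_mono) auto
    also have "\<dots> = X powr (1 - \<theta>) * y powr \<theta> * 2" using X y0 by simp
    finally have "2 * pi * ((cmod (deriv F (rc r s)))\<^sup>2) powr \<theta> \<le> 4 * (X powr (1 - \<theta>) * y powr \<theta>)" by simp
    moreover have "4 * ((cmod (deriv F (rc r s)))\<^sup>2) powr \<theta> \<le> 2 * pi * ((cmod (deriv F (rc r s)))\<^sup>2) powr \<theta>"
      using pi_gt3 by (intro mult_right_mono) auto
    ultimately have "((cmod (deriv F (rc r s)))\<^sup>2) powr \<theta> \<le> X powr (1 - \<theta>) * y powr \<theta>" by linarith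
    hence "(((cmod (deriv F (rc r s)))\<^sup>2) powr \<theta>) powr (1 / \<theta>) \<le> (X powr (1 - \<theta>) * y powr \<theta>) powr (1 / \<theta>)"
      using \<theta> by (intro powr_mono2) auto
    also have "\<dots> = E * y" using X y0 \<theta> by (simp add: powr_mult powr_powr E_def)
    also have "(((cmod (deriv F (rc r s)))\<^sup>2) powr \<theta>) powr (1 / \<theta>) = (cmod (deriv F (rc r s)))\<^sup>2"
      using \<theta> by (simp add: powr_powr)
    finally show ?thesis using E by (simp add: divide_le_eq mult.commute)
  qed
  hence "(cmod (deriv F (rc r s)))\<^sup>2 / E \<le> I" by (rule dense_ge)
  hence 1: "(cmod (deriv F (rc r s)))\<^sup>2 \<le> E * I" using E by (simp add: divide_le_eq mult.commute)
  have EW: "E = 4 powr ((2 - a) * 2 / p) * W s powr (2 - a)"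
  proof -
    have "(1 - \<theta>) / \<theta> = (1 - a / 2) / (p / 4)"
      using \<theta> p by (simp add: frac_eq_eq mult.commute)
    also have "\<dots> = (2 - a) * 2 / p" using p by (simp add: field_simps)
    finally have "E = (4 * (24 * Sr s)) powr ((2 - a) * 2 / p)" by (simp add: E_def X_def)
    also have "\<dots> = 4 powr ((2 - a) * 2 / p) * (24 * Sr s) powr ((2 - a) * 2 / p)"
      using Sr_pos[of s] by (subst powr_mult) auto
    also have "(24 * Sr s) powr ((2 - a) * 2 / p) = W s powr (2 - a)"
      unfolding W_def using Sr_pos[of s] by (simp add: powr_powr mult.commute)
    finally show ?thesis .
  qed
  have "ennreal I = (\<integral>\<^sup>+t. ennreal (phi (rc q t) * Pk z t) \<partial>circ)"
    unfolding I_def using z1 phi_nonneg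
    by (intro nn_integral_circ_continuous[symmetric] continuous_on_mult cphi continuous_on_Pk continuous_on_id) auto
  also have "\<dots> \<le> (\<integral>\<^sup>+t. ennreal 11 * ennreal (Pk (rc q t) s * phi (rc q t)) \<partial>circ)"
  proof (intro nn_integral_mono)
    fix t
    have "phi (rc q t) * Pk z t \<le> phi (rc q t) * (11 * Pk (rc q s) t)"
      unfolding z_def using r q phi_nonneg by (intro mult_left_mono Pk_shift_le) auto
    also have "\<dots> = 11 * (Pk (rc q t) s * phi (rc q t))" by (simp add: Pk_rc_sym[of q s t])
    finally show "ennreal (phi (rc q t) * Pk z t) \<le> ennreal 11 * ennreal (Pk (rc q t) s * phi (rc q t))"
      by (subst ennreal_mult'[symmetric]) (auto intro: ennreal_leI)
  qed
  also have "\<dots> = ennreal 11 * (\<integral>\<^sup>+t. ennreal (Pk (rc q t) s * phi (rc q t)) \<partial>circ)"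
    by (rule nn_integral_cmult) measurable
  finally have 2: "ennreal I \<le> ennreal 11 * (\<integral>\<^sup>+t. ennreal (Pk (rc q t) s * phi (rc q t)) \<partial>circ)" .
  have "ennreal ((cmod (deriv F (rc r s)))\<^sup>2) \<le> ennreal E * ennreal I"
    using 1 E by (subst ennreal_mult'[symmetric]) (auto intro: ennreal_leI)
  also have "\<dots> \<le> ennreal E * (ennreal 11 * (\<integral>\<^sup>+t. ennreal (Pk (rc q t) s * phi (rc q t)) \<partial>circ))"
    by (intro mult_left_mono 2) auto
  also have "\<dots> = ennreal (CQ * W s powr (2 - a)) * (\<integral>\<^sup>+t. ennreal (Pk (rc q t) s * phi (rc q t)) \<partial>circ)"
    unfolding EW CQ_def mult.assoc[symmetric] using W_pos[of s]
    by (simp add: ennreal_mult'[symmetric] mult_ac del: ennreal_numeral)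
  finally show ?thesis .
qed

text \<open>As \<open>r\<close> varies, the circles of radius \<open>q = (1 + r) / 2\<close> sweep
  out part of the annulus, and \<open>1 - r = 2 * (1 - q)\<close> matches the weight in
  \<open>sqk\<close>. The substitution contributes the second factor \<open>2\<close> in
  \<open>4 * CQ\<close>.\<close>

lemma square_function_le:
  "(\<integral>\<^sup>+r. ennreal ((1 - r) * (cmod (deriv F (rc r s)))\<^sup>2) \<partial>radii) \<le> ennreal (4 * CQ * W s powr (2 - a)) * A s"
proof -
  define H where "H q = (\<integral>\<^sup>+t. ennreal ((1 - q) * Pk (rc q t) s * phi (rc q t)) \<partial>circ) * indicator {3/4..<1} q" for q :: real
  have Hm [measurable]: "H \<in> borel_measurable borel" unfolding H_def by measurable
  let ?c = "ennreal (2 * (CQ * W s powr (2 - a)))"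
  have c0: "0 \<le> CQ * W s powr (2 - a)" by (simp add: CQ_def)
  have "(\<integral>\<^sup>+r. ennreal ((1 - r) * (cmod (deriv F (rc r s)))\<^sup>2) \<partial>radii) \<le> (\<integral>\<^sup>+r. ?c * H (1/2 + 1/2 * r) \<partial>radii)"
  proof (intro nn_integral_mono)
    fix r assume "r \<in> space radii"
    hence r: "1/2 \<le> r" "r < 1" by auto
    define q where "q = (1 + r) / 2"
    have q: "3/4 \<le> q" "q < 1" "1 - r = 2 * (1 - q)" using r by (auto simp: q_def field_simps)
    have "ennreal ((1 - r) * (cmod (deriv F (rc r s)))\<^sup>2) = ennreal (1 - r) * ennreal ((cmod (deriv F (rc r s)))\<^sup>2)"
      using r by (intro ennreal_mult) auto
    also have "\<dots> \<le> ennreal (1 - r) * (ennreal (CQ * W s powr (2 - a)) * (\<integral>\<^sup>+t. ennreal (Pk (rc q t) s * phi (rc q t)) \<partial>circ))"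
      by (intro mult_left_mono deriv_F_sq_le[OF r]) (auto simp: q_def)
    also have "\<dots> = ?c * (ennreal (1 - q) * (\<integral>\<^sup>+t. ennreal (Pk (rc q t) s * phi (rc q t)) \<partial>circ))"
    proof -
      have "ennreal (1 - r) * ennreal (CQ * W s powr (2 - a)) = ennreal ((1 - r) * (CQ * W s powr (2 - a)))"
        using r c0 by (intro ennreal_mult[symmetric]) auto
      also have "(1 - r) * (CQ * W s powr (2 - a)) = 2 * (CQ * W s powr (2 - a)) * (1 - q)" unfolding q(3) by simp
      also have "ennreal \<dots> = ?c * ennreal (1 - q)" using q(2) c0 by (intro ennreal_mult) auto
      finally have "ennreal (1 - r) * ennreal (CQ * W s powr (2 - a)) = ?c * ennreal (1 - q)" .
      thus ?thesis by (simp only: mult.assoc[symmetric])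
    qed
    also have "ennreal (1 - q) * (\<integral>\<^sup>+t. ennreal (Pk (rc q t) s * phi (rc q t)) \<partial>circ) = H q"
    proof -
      have "ennreal (1 - q) * (\<integral>\<^sup>+t. ennreal (Pk (rc q t) s * phi (rc q t)) \<partial>circ)
        = (\<integral>\<^sup>+t. ennreal (1 - q) * ennreal (Pk (rc q t) s * phi (rc q t)) \<partial>circ)"
        by (rule nn_integral_cmult[symmetric]) measurable
      also have "\<dots> = (\<integral>\<^sup>+t. ennreal ((1 - q) * Pk (rc q t) s * phi (rc q t)) \<partial>circ)"
        using q by (intro nn_integral_cong) (simp add: ennreal_mult'[symmetric] mult.assoc)
      finally show ?thesis using q by (simp add: H_def)
    qed
    also have "q = 1/2 + 1/2 * r" by (simp add: q_def field_simps)
    finally show "ennreal ((1 - r) * (cmod (deriv F (rc r s)))\<^sup>2) \<le> ?c * H (1/2 + 1/2 * r)" .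
  qed
  also have "\<dots> \<le> (\<integral>\<^sup>+r. ?c * H (1/2 + 1/2 * r) \<partial>lborel)"
    unfolding radii_def by (subst nn_integral_restrict_space) (auto intro!: nn_integral_mono split: split_indicator)
  also have "\<dots> = ?c * (\<integral>\<^sup>+r. H (1/2 + 1/2 * r) \<partial>lborel)"
  proof (rule nn_integral_cmult)
    have "(\<lambda>r. H (1/2 + 1/2 * r)) \<in> borel_measurable borel" by (rule measurable_compose[OF _ Hm]) simp
    thus "(\<lambda>r. H (1/2 + 1/2 * r)) \<in> borel_measurable lborel" by simp
  qed
  also have "(\<integral>\<^sup>+r. H (1/2 + 1/2 * r) \<partial>lborel) = 2 * (\<integral>\<^sup>+q. H q \<partial>lborel)"
  proof -
    have "(\<integral>\<^sup>+q. H q \<partial>lborel) = ennreal (1/2) * (\<integral>\<^sup>+r. H (1/2 + 1/2 * r) \<partial>lborel)"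
      using nn_integral_real_affine[OF Hm, of "1/2" "1/2"] by simp
    hence "2 * (\<integral>\<^sup>+q. H q \<partial>lborel) = (2 * ennreal (1/2)) * (\<integral>\<^sup>+r. H (1/2 + 1/2 * r) \<partial>lborel)" by (simp only: mult.assoc)
    moreover have "2 * ennreal (1/2) = ennreal 2 * ennreal (1/2)" by simp
    moreover have "ennreal 2 * ennreal (1/2) = 1" by (subst ennreal_mult[symmetric]) auto
    ultimately show ?thesis by simp
  qed
  also have "(\<integral>\<^sup>+q. H q \<partial>lborel) \<le> A s"
  proof -
    have [measurable]: "(\<lambda>z. sqk phi z s) \<in> borel_measurable (radii \<Otimes>\<^sub>M circ)" unfolding sqk_def by measurable
    have "(\<integral>\<^sup>+q. H q \<partial>lborel) \<le> (\<integral>\<^sup>+q\<in>{1/2..<1}. (\<integral>\<^sup>+t. ennreal ((1 - q) * Pk (rc q t) s * phi (rc q t)) \<partial>circ) \<partial>lborel)"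
      unfolding H_def by (intro nn_integral_mono) (auto split: split_indicator)
    also have "\<dots> = (\<integral>\<^sup>+q. (\<integral>\<^sup>+t. sqk phi (q, t) s \<partial>circ) \<partial>radii)"
      unfolding radii_def sqk_def by (subst nn_integral_restrict_space) auto
    also have "\<dots> = A s"
      unfolding A_def sqf_def by (rule circ.nn_integral_fst) measurable
    finally show ?thesis .
  qed
  also have "?c * (2 * x) = ennreal (4 * CQ * W s powr (2 - a)) * x" for x
  proof -
    have "ennreal (4 * CQ * W s powr (2 - a)) = ennreal 2 * ?c"
      using c0 by (subst ennreal_mult[symmetric]) (auto simp: mult_ac)
    thus ?thesis by (simp add: mult_ac)
  qed
  finally show ?thesis by (simp add: mult_left_mono)
qed

text \<open>The modulus of \<open>(I + R) F\<close> for the radial derivative \<open>R\<close> in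
  one variable.\<close>

definition N where "N r s = cmod (F (rc r s) + rc r s * deriv F (rc r s))"

lemma N_le:
  assumes r: "0 \<le> r" "r < 1"
  shows "N r s \<le> cmod (F (rc r s)) + cmod (deriv F (rc r s))" "N r s * (1 - r\<^sup>2) \<le> 6 * W s"
proof -
  have "N r s \<le> cmod (F (rc r s)) + r * cmod (deriv F (rc r s))"
    unfolding N_def using norm_triangle_ineq[of "F (rc r s)" "rc r s * deriv F (rc r s)"] r by (simp add: norm_mult cmod_rc)
  also have "r * cmod (deriv F (rc r s)) \<le> 1 * cmod (deriv F (rc r s))" using r by (intro mult_right_mono) auto
  finally show 1: "N r s \<le> cmod (F (rc r s)) + cmod (deriv F (rc r s))" by simp
  have r2: "1 - r\<^sup>2 \<le> 2 * (1 - r)"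
  proof -
    have "1 - r\<^sup>2 = (1 - r) * (1 + r)" by (simp add: power2_eq_square algebra_simps)
    also have "\<dots> \<le> (1 - r) * 2" using r by (intro mult_left_mono) auto
    finally show ?thesis by simp
  qed
  have "N r s * (1 - r\<^sup>2) \<le> (cmod (F (rc r s)) + cmod (deriv F (rc r s))) * (2 * (1 - r))"
    using 1 r2 r by (intro mult_mono) (auto simp: abs_square_le_1)
  also have "\<dots> = 2 * ((1 - r) * cmod (F (rc r s))) + 2 * ((1 - r) * cmod (deriv F (rc r s)))" by (simp add: algebra_simps)
  also have "\<dots> \<le> 2 * (1 * W s) + 2 * (2 * W s)"
  proof -
    have "(1 - r) * cmod (F (rc r s)) \<le> 1 * W s"
      using r F_le_W[OF r, of "rc r s" s] by (intro mult_mono) auto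
    thus ?thesis using deriv_F_le[OF r, of s] by linarith
  qed
  finally show "N r s * (1 - r\<^sup>2) \<le> 6 * W s" by simp
qed

text \<open>Of the \<open>q\<close> factors \<open>N r s\<close>, all but two are bounded through
  \<open>N r s * (1 - r\<^sup>2) \<le> 6 * W s\<close>, and two are kept for the square function;
  this is where \<open>q \<ge> 2\<close> enters. Below radius \<open>1/2\<close> the derivative too
  is at most a multiple of \<open>W s\<close>.\<close>

lemma N_powr_le:
  assumes r: "0 \<le> r" "r < 1" and q: "2 \<le> q"
  shows "N r s powr q * (1 - r\<^sup>2) powr (q - 1)
    \<le> (6 * W s) powr (q - 2) * (36 * (W s)\<^sup>2 + 4 * ((1 - r) * (cmod (deriv F (rc r s)))\<^sup>2) * indicator {1/2..<1} r)"
proof -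
  let ?d = "cmod (deriv F (rc r s))" and ?f = "cmod (F (rc r s))"
  have f: "?f \<le> W s" using F_le_W[OF r, of "rc r s" s] r by simp
  have d: "(1 - r) * ?d \<le> 2 * W s" by (rule deriv_F_le[OF r])
  have x0: "0 < 1 - r\<^sup>2" using r by (simp add: abs_square_less_1)
  have N0: "0 \<le> N r s" by (simp add: N_def)
  have r2: "1 - r\<^sup>2 \<le> 2 * (1 - r)"
  proof -
    have "1 - r\<^sup>2 = (1 - r) * (1 + r)" by (simp add: power2_eq_square algebra_simps)
    also have "\<dots> \<le> (1 - r) * 2" using r by (intro mult_left_mono) auto
    finally show ?thesis by simp
  qed
  have "N r s powr q * (1 - r\<^sup>2) powr (q - 1) = (N r s * (1 - r\<^sup>2)) powr (q - 2) * ((N r s)\<^sup>2 * (1 - r\<^sup>2))"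
  proof (cases "N r s = 0")
    case False
    hence Np: "0 < N r s" using N0 by simp
    have "N r s powr q = N r s powr ((q - 2) + 2)" by simp
    also have "\<dots> = N r s powr (q - 2) * (N r s)\<^sup>2" using Np by (subst powr_add) simp
    finally have 1: "N r s powr q = N r s powr (q - 2) * (N r s)\<^sup>2" .
    have "(1 - r\<^sup>2) powr (q - 1) = (1 - r\<^sup>2) powr ((q - 2) + 1)" by simp
    also have "\<dots> = (1 - r\<^sup>2) powr (q - 2) * (1 - r\<^sup>2)" using x0 by (subst powr_add) simp
    finally have 2: "(1 - r\<^sup>2) powr (q - 1) = (1 - r\<^sup>2) powr (q - 2) * (1 - r\<^sup>2)" .
    show ?thesis unfolding 1 2 using Np x0 by (simp add: powr_mult mult_ac)
  qed simp
  also have "\<dots> \<le> (6 * W s) powr (q - 2) * (36 * (W s)\<^sup>2 + 4 * ((1 - r) * ?d\<^sup>2) * indicator {1/2..<1} r)"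
  proof (rule mult_mono)
    show "(N r s * (1 - r\<^sup>2)) powr (q - 2) \<le> (6 * W s) powr (q - 2)"
      using q N0 x0 N_le(2)[OF r, of s] by (intro powr_mono2) auto
    have "(N r s)\<^sup>2 \<le> (?f + ?d)\<^sup>2" using N_le(1)[OF r, of s] N0 by (intro power_mono) auto
    also have "\<dots> \<le> 2 * (?f\<^sup>2 + ?d\<^sup>2)" using sum_squares_bound[of ?f ?d] by (simp add: power2_eq_square algebra_simps)
    finally have "(N r s)\<^sup>2 * (1 - r\<^sup>2) \<le> 2 * (?f\<^sup>2 + ?d\<^sup>2) * (2 * (1 - r))"
      using r2 x0 by (intro mult_mono) auto
    also have "\<dots> = 4 * (?f\<^sup>2 * (1 - r)) + 4 * ((1 - r) * ?d\<^sup>2)" by (simp add: algebra_simps)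
    also have "?f\<^sup>2 * (1 - r) \<le> (W s)\<^sup>2 * 1" using f r by (intro mult_mono power_mono) auto
    finally have 1: "(N r s)\<^sup>2 * (1 - r\<^sup>2) \<le> 4 * (W s)\<^sup>2 + 4 * ((1 - r) * ?d\<^sup>2)" by simp
    show "(N r s)\<^sup>2 * (1 - r\<^sup>2) \<le> 36 * (W s)\<^sup>2 + 4 * ((1 - r) * ?d\<^sup>2) * indicator {1/2..<1} r"
    proof (cases "1/2 \<le> r")
      case True
      thus ?thesis using 1 r by (simp add: indicator_def) (smt (verit) zero_le_power2)
    next
      case False
      have "(1 - r) * ?d\<^sup>2 * (1/2) \<le> (1 - r) * ?d\<^sup>2 * (1 - r)" using False r by (intro mult_left_mono) auto
      also have "\<dots> = ((1 - r) * ?d)\<^sup>2" by (simp add: power2_eq_square)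
      also have "\<dots> \<le> (2 * W s)\<^sup>2" using d r by (intro power_mono) auto
      finally have "(1 - r) * ?d\<^sup>2 \<le> 8 * (W s)\<^sup>2" by (simp add: power_mult_distrib)
      thus ?thesis using 1 False by simp
    qed
  qed (use N0 x0 in auto)
  finally show ?thesis .
qed

definition CN where "CN q = 6 powr q * (1 + CQ)"

lemma inner_le:
  assumes q: "2 \<le> q"
  shows "(\<integral>\<^sup>+r\<in>{0..<1}. ennreal (N r s powr q * (1 - r\<^sup>2) powr (q - 1)) \<partial>lborel)
    \<le> ennreal (CN q) * (ennreal (W s powr q) + ennreal (W s powr (q - a)) * A s)"
proof -
  let ?d = "\<lambda>r. cmod (deriv F (rc r s))"
  let ?c = "(6 * W s) powr (q - 2)"
  have Wp: "0 < W s" by (rule W_pos)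
  have CQ0: "0 \<le> CQ" by (simp add: CQ_def)
  have dm [measurable]: "(\<lambda>r. indicator {1/2..<1} r * ((1 - r) * (?d r)\<^sup>2)) \<in> borel_measurable borel"
  proof -
    have "(\<lambda>r. indicator {1/2..<1} r *\<^sub>R ((1 - r) * (?d r)\<^sup>2)) \<in> borel_measurable borel"
      by (intro borel_measurable_continuous_on_indicator continuous_intros continuous_on_compose2[OF cont_F(2)])
         (use R in \<open>auto simp: rc_def norm_mult intro!: continuous_intros\<close>)
    thus ?thesis by simp
  qed
  have "(\<integral>\<^sup>+r\<in>{0..<1}. ennreal (N r s powr q * (1 - r\<^sup>2) powr (q - 1)) \<partial>lborel)
     \<le> (\<integral>\<^sup>+r. ennreal (?c * 36 * (W s)\<^sup>2) * indicator {0..<1} r + ennreal (?c * 4) * ennreal (indicator {1/2..<1} r * ((1 - r) * (?d r)\<^sup>2)) \<partial>lborel)"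
  proof (intro nn_integral_mono)
    fix r :: real
    show "ennreal (N r s powr q * (1 - r\<^sup>2) powr (q - 1)) * indicator {0..<1} r
      \<le> ennreal (?c * 36 * (W s)\<^sup>2) * indicator {0..<1} r + ennreal (?c * 4) * ennreal (indicator {1/2..<1} r * ((1 - r) * (?d r)\<^sup>2))"
    proof (cases "r \<in> {0..<1}")
      case True
      hence r: "0 \<le> r" "r < 1" by auto
      have "ennreal (N r s powr q * (1 - r\<^sup>2) powr (q - 1)) \<le> ennreal (?c * 36 * (W s)\<^sup>2 + (?c * 4) * (indicator {1/2..<1} r * ((1 - r) * (?d r)\<^sup>2)))"
        using N_powr_le[OF r q, of s] by (intro ennreal_leI) (simp add: algebra_simps)
      also have "\<dots> = ennreal (?c * 36 * (W s)\<^sup>2) + ennreal (?c * 4) * ennreal (indicator {1/2..<1} r * ((1 - r) * (?d r)\<^sup>2))"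
        using r by (subst ennreal_plus) (auto simp: ennreal_mult')
      finally show ?thesis using True by simp
    qed auto
  qed
  also have "\<dots> = ennreal (?c * 36 * (W s)\<^sup>2) + ennreal (?c * 4) * (\<integral>\<^sup>+r. ennreal (indicator {1/2..<1} r * ((1 - r) * (?d r)\<^sup>2)) \<partial>lborel)"
    by (subst nn_integral_add) (simp_all add: nn_integral_cmult nn_integral_cmult_indicator)
  also have "(\<integral>\<^sup>+r. ennreal (indicator {1/2..<1} r * ((1 - r) * (?d r)\<^sup>2)) \<partial>lborel) = (\<integral>\<^sup>+r. ennreal ((1 - r) * (?d r)\<^sup>2) \<partial>radii)"
    unfolding radii_def by (subst nn_integral_restrict_space) (auto intro!: nn_integral_cong split: split_indicator)
  also have "\<dots> \<le> ennreal (4 * CQ * W s powr (2 - a)) * A s" by (rule square_function_le)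
  also have "ennreal (?c * 36 * (W s)\<^sup>2) + ennreal (?c * 4) * (ennreal (4 * CQ * W s powr (2 - a)) * A s)
     \<le> ennreal (CN q) * (ennreal (W s powr q) + ennreal (W s powr (q - a)) * A s)"
  proof -
    have c6: "?c = 6 powr (q - 2) * W s powr (q - 2)" using Wp by (simp add: powr_mult)
    have e6: "6 powr (q - 2) * 36 = 6 powr q"
    proof -
      have "6 powr q = 6 powr ((q - 2) + 2)" by simp
      also have "\<dots> = 6 powr (q - 2) * 36" by (subst powr_add) simp
      finally show ?thesis by simp
    qed
    have eW: "W s powr (q - 2) * (W s)\<^sup>2 = W s powr q"
    proof -
      have "W s powr q = W s powr ((q - 2) + 2)" by simp
      also have "\<dots> = W s powr (q - 2) * (W s)\<^sup>2" using Wp by (subst powr_add) simp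
      finally show ?thesis by simp
    qed
    have eWa: "W s powr (q - 2) * W s powr (2 - a) = W s powr (q - a)" by (simp add: powr_add[symmetric])
    have "?c * 36 * (W s)\<^sup>2 = (6 powr (q - 2) * 36) * (W s powr (q - 2) * (W s)\<^sup>2)" unfolding c6 by (simp add: mult_ac)
    also have "\<dots> \<le> CN q * W s powr q" unfolding e6 eW CN_def using CQ0 by (intro mult_right_mono) (auto simp: algebra_simps)
    finally have 1: "?c * 36 * (W s)\<^sup>2 \<le> CN q * W s powr q" .
    have "?c * 4 * (4 * CQ * W s powr (2 - a)) = (6 powr (q - 2) * 16 * CQ) * (W s powr (q - 2) * W s powr (2 - a))" unfolding c6 by (simp add: mult_ac)
    also have "\<dots> \<le> CN q * W s powr (q - a)"
    proof -
      have "6 powr (q - 2) * 16 * CQ \<le> 6 powr (q - 2) * 36 * CQ" using CQ0 by (intro mult_right_mono mult_left_mono) auto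
      also have "\<dots> \<le> CN q" unfolding e6 CN_def using CQ0 by (simp add: algebra_simps)
      finally show ?thesis unfolding eWa by (intro mult_right_mono) auto
    qed
    finally have 2: "?c * 4 * (4 * CQ * W s powr (2 - a)) \<le> CN q * W s powr (q - a)" .
    have CN0: "0 \<le> CN q" using CQ0 by (simp add: CN_def)
    have "ennreal (?c * 36 * (W s)\<^sup>2) + ennreal (?c * 4) * (ennreal (4 * CQ * W s powr (2 - a)) * A s)
      = ennreal (?c * 36 * (W s)\<^sup>2) + ennreal (?c * 4 * (4 * CQ * W s powr (2 - a))) * A s"
      using CQ0 by (simp add: ennreal_mult' mult.assoc)
    also have "\<dots> \<le> ennreal (CN q * W s powr q) + ennreal (CN q * W s powr (q - a)) * A s"
      using 1 2 by (intro add_mono mult_right_mono ennreal_leI) auto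
    also have "\<dots> = ennreal (CN q) * (ennreal (W s powr q) + ennreal (W s powr (q - a)) * A s)"
      using CN0 by (simp add: ennreal_mult' distrib_left mult.assoc)
    finally show ?thesis .
  qed
  finally show ?thesis by (simp add: add_left_mono mult_left_mono)
qed

end

lemma epow_le_ennreal:
  assumes "x \<le> ennreal y" "0 \<le> y" "0 \<le> c"
  shows "epow x c \<le> ennreal (y powr c)"
proof -
  have "x < \<top>" using assms(1) by (auto simp: less_top[symmetric] top_unique)
  moreover have "enn2real x \<le> y" using assms by (simp add: enn2real_leI)
  ultimately show ?thesis using assms unfolding epow_def by (auto intro!: ennreal_leI powr_mono2)
qed

context disc_fun
begin

definition CF where "CF q = CN q powr (p / q) * 4 ^ k"

text \<open>With \<open>w = W s powr a\<close> the inner integral is at most a multiple of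
  \<open>W s powr (q - a) * (w + A s)\<close>. Enlarging \<open>w\<close> to \<open>w + A s\<close>
  in the first factor gives a pure power, whose \<open>p / q\<close>-th power is
  \<open>(w + A s) ^ (2 * k)\<close> because \<open>p / a = 2 * real k\<close>; the exponent
  \<open>q\<close> has disappeared.\<close>

lemma inner_powr_le:
  assumes q: "2 \<le> q"
  shows "epow (\<integral>\<^sup>+r\<in>{0..<1}. ennreal (N r s powr q * (1 - r\<^sup>2) powr (q - 1)) \<partial>lborel) (p / q)
     \<le> ennreal (CF q) * (576 * (S s)\<^sup>2 + A s ^ (2 * k))"
proof -
  obtain B where "A s \<le> ennreal B" using A_bounded by blast
  hence "A s < \<top>" by (auto simp: less_top[symmetric] top_unique)
  then obtain x where x: "A s = ennreal x" "0 \<le> x" by (cases "A s") auto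
  have W: "0 < W s" by (rule W_pos)
  have CN0: "0 \<le> CN q" by (simp add: CN_def CQ_def)
  define w where "w = W s powr a"
  have w: "0 < w" using W by (simp add: w_def)
  have le: "(\<integral>\<^sup>+r\<in>{0..<1}. ennreal (N r s powr q * (1 - r\<^sup>2) powr (q - 1)) \<partial>lborel)
     \<le> ennreal (CN q * (W s powr (q - a) * (w + x)))"
  proof -
    have "W s powr (q - a) * (w + x) = W s powr q + W s powr (q - a) * x"
      by (simp add: w_def distrib_left powr_add[symmetric])
    thus ?thesis using inner_le[OF q, of s] x CN0 by (simp add: ennreal_mult'[symmetric] ennreal_plus[symmetric] del: ennreal_plus)
  qed
  have p2k: "p / a = 2 * real k" using p k by (simp add: a_def)
  have "epow (\<integral>\<^sup>+r\<in>{0..<1}. ennreal (N r s powr q * (1 - r\<^sup>2) powr (q - 1)) \<partial>lborel) (p / q)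
     \<le> ennreal ((CN q * (W s powr (q - a) * (w + x))) powr (p / q))"
    by (rule epow_le_ennreal[OF le]) (use CN0 w x p q in auto)
  also have "(CN q * (W s powr (q - a) * (w + x))) powr (p / q) \<le> CF q * (576 * (Sr s)\<^sup>2 + x ^ (2 * k))"
  proof -
    have "(CN q * (W s powr (q - a) * (w + x))) powr (p / q) = CN q powr (p / q) * ((W s powr (q - a)) powr (p / q) * (w + x) powr (p / q))"
      using CN0 w x by (simp add: powr_mult)
    also have "(W s powr (q - a)) powr (p / q) = w powr ((q - a) * p / (q * a))"
      unfolding w_def using a q by (simp add: powr_powr)
    also have "\<dots> \<le> (w + x) powr ((q - a) * p / (q * a))"
      using w x a q p by (intro powr_mono2) auto
    also have "(w + x) powr ((q - a) * p / (q * a)) * (w + x) powr (p / q) = (w + x) powr (2 * real k)"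
    proof -
      have "(q - a) * p / (q * a) + p / q = p / a" using a q by (simp add: field_simps)
      thus ?thesis by (simp add: powr_add[symmetric] p2k)
    qed
    also have "(w + x) powr (2 * real k) = (w + x) ^ (2 * k)"
      using w x by (subst powr_realpow[symmetric]) auto
    also have "(w + x) ^ (2 * k) \<le> (2 * max w x) ^ (2 * k)" using w x by (intro power_mono) auto
    also have "\<dots> = 4 ^ k * max w x ^ (2 * k)" by (simp add: power_mult_distrib power_mult)
    also have "max w x ^ (2 * k) \<le> w ^ (2 * k) + x ^ (2 * k)" using w x by (simp add: max_def)
    also have "w ^ (2 * k) = W s powr p"
      using W k p by (simp add: w_def powr_realpow[symmetric] powr_powr a_def)
    also have "W s powr p = (24 * Sr s)\<^sup>2"
      unfolding W_def using p Sr_pos[of s] by (simp add: powr_powr)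
    finally show ?thesis using CN0 by (simp add: CF_def power_mult_distrib mult_left_mono mult_right_mono algebra_simps)
  qed
  finally have "epow (\<integral>\<^sup>+r\<in>{0..<1}. ennreal (N r s powr q * (1 - r\<^sup>2) powr (q - 1)) \<partial>lborel) (p / q)
     \<le> ennreal (CF q * (576 * (Sr s)\<^sup>2 + x ^ (2 * k)))" by (simp add: ennreal_leI)
  also have "\<dots> = ennreal (CF q) * (576 * (S s)\<^sup>2 + A s ^ (2 * k))"
  proof -
    have CF0: "0 \<le> CF q" by (simp add: CF_def)
    have "ennreal (576 * (Sr s)\<^sup>2 + x ^ (2 * k)) = 576 * (S s)\<^sup>2 + A s ^ (2 * k)"
      unfolding S_eq x using Sr_nonneg[of s] x(2) by (simp add: ennreal_power ennreal_mult')
    thus ?thesis using CF0 by (simp add: ennreal_mult')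
  qed
  finally show ?thesis .
qed

definition CM :: real where "CM = 2 * (256 * pi)\<^sup>2"

lemma LP_integral:
  assumes q: "2 \<le> q"
  shows "(\<integral>\<^sup>+s. epow (\<integral>\<^sup>+r\<in>{0..<1}. ennreal (N r s powr q * (1 - r\<^sup>2) powr (q - 1)) \<partial>lborel) (p / q) \<partial>circ)
    \<le> ennreal (CF q * (576 + CA) * CM) * (\<integral>\<^sup>+s. ennreal (vv (cis s) powr (p / 2)) \<partial>circ)"
proof -
  have "(\<integral>\<^sup>+s. epow (\<integral>\<^sup>+r\<in>{0..<1}. ennreal (N r s powr q * (1 - r\<^sup>2) powr (q - 1)) \<partial>lborel) (p / q) \<partial>circ)
     \<le> (\<integral>\<^sup>+s. ennreal (CF q) * (576 * (S s)\<^sup>2 + A s ^ (2 * k)) \<partial>circ)"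
    by (intro nn_integral_mono inner_powr_le q)
  also have "\<dots> = ennreal (CF q) * (576 * (\<integral>\<^sup>+s. (S s)\<^sup>2 \<partial>circ) + (\<integral>\<^sup>+s. A s ^ (2 * k) \<partial>circ))"
    by (simp add: nn_integral_cmult nn_integral_add)
  also have "\<dots> \<le> ennreal (CF q) * (576 * (\<integral>\<^sup>+s. (S s)\<^sup>2 \<partial>circ) + ennreal CA * (\<integral>\<^sup>+s. (S s)\<^sup>2 \<partial>circ))"
    by (intro mult_left_mono add_left_mono A_moment) auto
  also have "\<dots> = ennreal (CF q) * (ennreal (576 + CA) * (\<integral>\<^sup>+s. (S s)\<^sup>2 \<partial>circ))"
    using CA_nonneg by (simp add: distrib_right)
  also have "\<dots> \<le> ennreal (CF q) * (ennreal (576 + CA) * (ennreal CM * (\<integral>\<^sup>+s. ennreal (vv (cis s) powr (p / 2)) \<partial>circ)))"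
    unfolding CM_def by (intro mult_left_mono S_moment) auto
  also have "\<dots> = ennreal (CF q * (576 + CA) * CM) * (\<integral>\<^sup>+s. ennreal (vv (cis s) powr (p / 2)) \<partial>circ)"
    using CA_nonneg by (simp add: CF_def ennreal_mult' mult.assoc del: ennreal_plus)
  finally show ?thesis .
qed

lemma LP_sup:
  "(\<integral>\<^sup>+s. epow (SUP r\<in>{0..<1}. ennreal (N r s * (1 - r\<^sup>2))) p \<partial>circ)
    \<le> ennreal (6 powr p * 576 * CM) * (\<integral>\<^sup>+s. ennreal (vv (cis s) powr (p / 2)) \<partial>circ)"
proof -
  have "epow (SUP r\<in>{0..<1}. ennreal (N r s * (1 - r\<^sup>2))) p \<le> ennreal (6 powr p * 576) * (S s)\<^sup>2" for s
  proof -
    have "epow (SUP r\<in>{0..<1}. ennreal (N r s * (1 - r\<^sup>2))) p \<le> ennreal ((6 * W s) powr p)"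
      using W_pos[of s] p N_le(2) by (intro epow_le_ennreal SUP_least ennreal_leI) auto
    also have "(6 * W s) powr p = 6 powr p * 576 * (Sr s)\<^sup>2"
    proof -
      have "W s powr p = (24 * Sr s)\<^sup>2"
        unfolding W_def using p Sr_pos[of s] by (simp add: powr_powr)
      thus ?thesis using W_pos[of s] by (simp add: powr_mult power_mult_distrib)
    qed
    also have "ennreal \<dots> = ennreal (6 powr p * 576) * (S s)\<^sup>2"
      unfolding S_eq using Sr_nonneg[of s] by (simp add: ennreal_power ennreal_mult')
    finally show ?thesis .
  qed
  hence "(\<integral>\<^sup>+s. epow (SUP r\<in>{0..<1}. ennreal (N r s * (1 - r\<^sup>2))) p \<partial>circ) \<le> (\<integral>\<^sup>+s. ennreal (6 powr p * 576) * (S s)\<^sup>2 \<partial>circ)"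
    by (intro nn_integral_mono)
  also have "\<dots> = ennreal (6 powr p * 576) * (\<integral>\<^sup>+s. (S s)\<^sup>2 \<partial>circ)" by (rule nn_integral_cmult) measurable
  also have "\<dots> \<le> ennreal (6 powr p * 576) * (ennreal CM * (\<integral>\<^sup>+s. ennreal (vv (cis s) powr (p / 2)) \<partial>circ))"
    unfolding CM_def by (intro mult_left_mono S_moment) auto
  also have "\<dots> = ennreal (6 powr p * 576 * CM) * (\<integral>\<^sup>+s. ennreal (vv (cis s) powr (p / 2)) \<partial>circ)"
    by (simp add: ennreal_mult' mult.assoc)
  finally show ?thesis .
qed

end

section \<open>The disc inequality for finite and infinite exponents together\<close>

definition slice_norm :: "ennreal \<Rightarrow> (real \<Rightarrow> real) \<Rightarrow> ennreal" where
  "slice_norm q g = (if q = \<top> then (SUP r\<in>{0..<1}. ennreal (g r * (1 - r\<^sup>2)))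
     else (\<integral>\<^sup>+r\<in>{0..<1}. ennreal (g r powr enn2real q * (1 - r\<^sup>2) powr (enn2real q - 1)) \<partial>lborel))"

definition slice_pow :: "ennreal \<Rightarrow> real \<Rightarrow> (real \<Rightarrow> real) \<Rightarrow> ennreal" where
  "slice_pow q p g = epow (slice_norm q g) (if q = \<top> then p else p / enn2real q)"

theorem littlewood_paley_disc:
  assumes p: "0 < p" and q: "2 \<le> q"
  shows "\<exists>C>0. \<forall>F R e. F holomorphic_on ball 0 R \<longrightarrow> 1 < R \<longrightarrow> 0 < e \<longrightarrow>
    (\<integral>\<^sup>+s. slice_pow q p (\<lambda>r. cmod (F (rc r s) + rc r s * deriv F (rc r s))) \<partial>circ)
      \<le> ennreal C * (\<integral>\<^sup>+s. ennreal (((cmod (F (cis s)))\<^sup>2 + e) powr (p / 2)) \<partial>circ)"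
proof -
  define k where "k = nat \<lceil>p\<rceil>"
  have k: "1 \<le> k" "p \<le> 4 * real k" using p unfolding k_def by linarith+
  \<comment> \<open>The constants of the locale depend only on \<open>p\<close>, \<open>k\<close>
    and \<open>q\<close>, so they can be named before \<open>F\<close>, \<open>R\<close> and
    \<open>e\<close> are fixed.\<close>
  define C where "C = (if q = \<top> then 6 powr p * 576 * disc_fun.CM
     else disc_fun.CF p k (enn2real q) * (576 + disc_fun.CA p k) * disc_fun.CM)"
  show ?thesis
  proof (intro exI[of _ "max C 1"] conjI allI impI)
    fix F R e assume F: "F holomorphic_on ball 0 R" "1 < R" "0 < (e::real)"
    interpret disc_fun F R e p k by unfold_locales (use F k p in auto)
    have "(\<integral>\<^sup>+s. slice_pow q p (\<lambda>r. cmod (F (rc r s) + rc r s * deriv F (rc r s))) \<partial>circ)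
      \<le> ennreal C * (\<integral>\<^sup>+s. ennreal (((cmod (F (cis s)))\<^sup>2 + e) powr (p / 2)) \<partial>circ)"
    proof (cases "q = \<top>")
      case True
      thus ?thesis using LP_sup unfolding slice_pow_def slice_norm_def C_def N_def vv_def by simp
    next
      case False
      have "2 \<le> enn2real q"
      proof -
        have "enn2real 2 \<le> enn2real q" using q False by (intro enn2real_mono) (auto simp: less_top)
        thus ?thesis by simp
      qed
      from LP_integral[OF this] False show ?thesis
        unfolding slice_pow_def slice_norm_def C_def N_def vv_def by simp
    qed
    also have "\<dots> \<le> ennreal (max C 1) * (\<integral>\<^sup>+s. ennreal (((cmod (F (cis s)))\<^sup>2 + e) powr (p / 2)) \<partial>circ)"
      by (intro mult_right_mono ennreal_leI) auto
    finally show "(\<integral>\<^sup>+s. slice_pow q p (\<lambda>r. cmod (F (rc r s) + rc r s * deriv F (rc r s))) \<partial>circ)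
      \<le> ennreal (max C 1) * (\<integral>\<^sup>+s. ennreal (((cmod (F (cis s)))\<^sup>2 + e) powr (p / 2)) \<partial>circ)" .
  qed auto
qed

section \<open>Unitary invariance of the surface measure\<close>

lemma nn_integral_lborel_translate:
  fixes f :: "'a::euclidean_space \<Rightarrow> ennreal"
  assumes [measurable]: "f \<in> borel_measurable borel"
  shows "(\<integral>\<^sup>+x. f (c + x) \<partial>lborel) = (\<integral>\<^sup>+x. f x \<partial>lborel)"
proof -
  have "(\<integral>\<^sup>+x. f x \<partial>lborel) = (\<integral>\<^sup>+x. f x \<partial>distr lborel borel ((+) c))" by (simp add: lborel_distr_plus)
  also have "\<dots> = (\<integral>\<^sup>+x. f (c + x) \<partial>lborel)" by (subst nn_integral_distr) auto
  finally show ?thesis ..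
qed

text \<open>Uniqueness of translation invariant measures, in the form needed for isometries: integrate
  \<open>f (T x + y) g y\<close> over both variables with \<open>g\<close> the indicator of the unit ball.\<close>

lemma nn_integral_lborel_isometry:
  fixes f :: "'a::euclidean_space \<Rightarrow> ennreal" and T :: "'a \<Rightarrow> 'a"
  assumes f [measurable]: "f \<in> borel_measurable borel" and lin: "linear T" and iso: "\<And>x. norm (T x) = norm x"
  shows "(\<integral>\<^sup>+x. f (T x) \<partial>lborel) = (\<integral>\<^sup>+x. f x \<partial>lborel)"
proof -
  have T [measurable]: "T \<in> borel_measurable borel"
    using lin by (intro borel_measurable_continuous_onI linear_continuous_on) (simp add: linear_conv_bounded_linear)
  have inj: "inj T"
    using lin iso by (metis linear_injective_0 norm_eq_zero)
  hence "surj T" using lin linear_injective_imp_surjective by blast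
  then obtain U where U: "\<And>y. T (U y) = y" by (metis surj_def)
  define g where "g = (indicator (ball 0 1) :: 'a \<Rightarrow> ennreal)"
  have [measurable]: "g \<in> borel_measurable borel" unfolding g_def by (intro borel_measurable_indicator) simp
  define v where "v = (\<integral>\<^sup>+y. g y \<partial>lborel)"
  have v: "v = emeasure lborel (ball (0::'a) 1)" by (simp add: v_def g_def)
  have v0: "v \<noteq> 0"
  proof
    assume "v = 0"
    hence "measure lborel (ball (0::'a) 1) = 0" by (simp add: v measure_def)
    thus False using content_ball_pos[of 1 "0::'a"] by simp
  qed
  have vfin: "v \<noteq> \<top>" unfolding v using emeasure_bounded_finite[of "ball (0::'a) 1"] by (simp add: less_top)
  have "(\<integral>\<^sup>+x. f (T x) \<partial>lborel) * v = (\<integral>\<^sup>+y. (\<integral>\<^sup>+x. f (T x) * g y \<partial>lborel) \<partial>lborel)"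
    unfolding v_def by (simp add: nn_integral_multc nn_integral_cmult)
  also have "\<dots> = (\<integral>\<^sup>+y. (\<integral>\<^sup>+x. f (T x + y) * g y \<partial>lborel) \<partial>lborel)"
  proof (rule nn_integral_cong)
    fix y
    have "(\<integral>\<^sup>+x. f (T (U y + x)) * g y \<partial>lborel) = (\<integral>\<^sup>+x. f (T x) * g y \<partial>lborel)"
      by (rule nn_integral_lborel_translate[where f="\<lambda>x. f (T x) * g y"]) measurable
    thus "(\<integral>\<^sup>+x. f (T x) * g y \<partial>lborel) = (\<integral>\<^sup>+x. f (T x + y) * g y \<partial>lborel)"
      by (simp add: linear_add[OF lin] U add.commute)
  qed
  also have "\<dots> = (\<integral>\<^sup>+x. (\<integral>\<^sup>+y. f (T x + y) * g y \<partial>lborel) \<partial>lborel)"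
    by (rule lborel_pair.Fubini') measurable
  also have "\<dots> = (\<integral>\<^sup>+x. (\<integral>\<^sup>+y. f y * g (y - T x) \<partial>lborel) \<partial>lborel)"
  proof (rule nn_integral_cong)
    fix x
    have "(\<integral>\<^sup>+y. f (T x + y) * g ((T x + y) - T x) \<partial>lborel) = (\<integral>\<^sup>+y. f y * g (y - T x) \<partial>lborel)"
      by (rule nn_integral_lborel_translate[where f="\<lambda>y. f y * g (y - T x)"]) measurable
    thus "(\<integral>\<^sup>+y. f (T x + y) * g y \<partial>lborel) = (\<integral>\<^sup>+y. f y * g (y - T x) \<partial>lborel)" by simp
  qed
  also have "\<dots> = (\<integral>\<^sup>+y. (\<integral>\<^sup>+x. f y * g (y - T x) \<partial>lborel) \<partial>lborel)"
    by (rule lborel_pair.Fubini'[symmetric]) measurable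
  also have "\<dots> = (\<integral>\<^sup>+y. f y * v \<partial>lborel)"
  proof (rule nn_integral_cong)
    fix y
    have "(\<integral>\<^sup>+x. f y * g (y - T x) \<partial>lborel) = (\<integral>\<^sup>+x. f y * g (y - T (U y + x)) \<partial>lborel)"
      by (rule nn_integral_lborel_translate[where f="\<lambda>x. f y * g (y - T x)", symmetric]) measurable
    also have "\<dots> = (\<integral>\<^sup>+x. f y * g x \<partial>lborel)"
      by (simp add: linear_add[OF lin] U g_def indicator_def iso)
    also have "\<dots> = f y * v" unfolding v_def by (rule nn_integral_cmult) measurable
    finally show "(\<integral>\<^sup>+x. f y * g (y - T x) \<partial>lborel) = f y * v" .
  qed
  also have "\<dots> = (\<integral>\<^sup>+y. f y \<partial>lborel) * v" by (rule nn_integral_multc) measurable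
  finally have "(\<integral>\<^sup>+x. f (T x) \<partial>lborel) * v = (\<integral>\<^sup>+y. f y \<partial>lborel) * v" .
  hence "(\<integral>\<^sup>+x. f (T x) \<partial>lborel) * v / v = (\<integral>\<^sup>+y. f y \<partial>lborel) * v / v" by simp
  thus ?thesis using v0 vfin by (simp add: ennreal_mult_divide_eq)
qed

lemma space_sigma [simp]: "space (sigma :: (complex ^ 'n) measure) = sphere 0 1"
  by (simp add: sigma_def space_restrict_space)

lemma sets_sigma: "sets (sigma :: (complex ^ 'n) measure) = sets (restrict_space borel (sphere 0 1))"
  by (simp add: sigma_def)

lemma measurable_sigma [measurable (raw)]:
  "f \<in> borel_measurable borel \<Longrightarrow> f \<in> borel_measurable (sigma :: (complex ^ 'n) measure)"
  by (subst measurable_cong_sets[OF sets_sigma refl]) (rule measurable_restrict_space1)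

lemma borel_measurable_ident_sigma [measurable]: "(\<lambda>x. x) \<in> borel_measurable (sigma :: (complex ^ 'n) measure)"
  by (intro measurable_sigma) simp

lemma nn_integral_sigma:
  fixes f :: "complex ^ 'n \<Rightarrow> ennreal"
  assumes [measurable]: "f \<in> borel_measurable borel"
  shows "(\<integral>\<^sup>+x. f x \<partial>sigma) = (1 / emeasure lborel (ball (0::complex ^ 'n) 1))
     * (\<integral>\<^sup>+x. f (sgn x) * indicator (ball 0 1 - {0}) x \<partial>lborel)"
proof -
  let ?M = "scale_measure (1 / emeasure lborel (ball (0::complex ^ 'n) 1)) (restrict_space lborel (ball 0 1 - {0}))"
  have sgn: "sgn \<in> measurable ?M (restrict_space borel (sphere (0::complex ^ 'n) 1))"
  proof (rule measurable_restrict_space2)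
    show "sgn \<in> space ?M \<rightarrow> sphere 0 1" by (auto simp: space_scale_measure space_restrict_space norm_sgn)
    have "sgn \<in> measurable (restrict_space lborel (ball 0 1 - {0})) (borel :: (complex ^ 'n) measure)"
      by (rule measurable_restrict_space1) simp
    thus "sgn \<in> measurable ?M (borel :: (complex ^ 'n) measure)"
      by (subst measurable_cong_sets[OF sets_scale_measure refl])
  qed
  have "(\<integral>\<^sup>+x. f x \<partial>sigma) = (\<integral>\<^sup>+x. f (sgn x) \<partial>?M)"
    unfolding sigma_def by (rule nn_integral_distr[OF sgn]) (auto intro: measurable_restrict_space1)
  also have "\<dots> = (1 / emeasure lborel (ball (0::complex ^ 'n) 1)) * (\<integral>\<^sup>+x. f (sgn x) \<partial>restrict_space lborel (ball 0 1 - {0}))"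
    by (rule nn_integral_scale_measure) (rule measurable_restrict_space1, simp)
  also have "(\<integral>\<^sup>+x. f (sgn x) \<partial>restrict_space lborel (ball 0 1 - {0})) = (\<integral>\<^sup>+x. f (sgn x) * indicator (ball 0 1 - {0}) x \<partial>lborel)"
    by (rule nn_integral_restrict_space) simp
  finally show ?thesis .
qed

lemma emeasure_unit_ball: "emeasure lborel (ball (0::complex ^ 'n) 1) \<noteq> 0" "emeasure lborel (ball (0::complex ^ 'n) 1) \<noteq> \<top>"
proof -
  have "measure lborel (ball (0::complex ^ 'n) 1) \<noteq> 0" using content_ball_pos[of 1 "0::complex ^ 'n"] by simp
  thus "emeasure lborel (ball (0::complex ^ 'n) 1) \<noteq> 0" unfolding measure_def by (metis enn2real_0)
  show "emeasure lborel (ball (0::complex ^ 'n) 1) \<noteq> \<top>"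
    using emeasure_bounded_finite[of "ball (0::complex ^ 'n) 1"] by (simp add: less_top)
qed

lemma emeasure_sigma_sphere: "emeasure (sigma :: (complex ^ 'n) measure) (sphere 0 1) = 1"
proof -
  have "emeasure (sigma :: (complex ^ 'n) measure) (sphere 0 1) = (\<integral>\<^sup>+x. 1 \<partial>(sigma :: (complex ^ 'n) measure))" by simp
  also have "\<dots> = (1 / emeasure lborel (ball (0::complex ^ 'n) 1)) * (\<integral>\<^sup>+x. indicator (ball (0::complex ^ 'n) 1 - {0}) x \<partial>lborel)"
    by (subst nn_integral_sigma) auto
  also have "(\<integral>\<^sup>+x. indicator (ball (0::complex ^ 'n) 1 - {0}) x \<partial>lborel) = emeasure lborel (ball (0::complex ^ 'n) 1)"
    by (simp add: emeasure_Diff_null_set finite_imp_null_set_lborel)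
  also have "1 / emeasure lborel (ball (0::complex ^ 'n) 1) * emeasure lborel (ball (0::complex ^ 'n) 1) = 1"
    using ennreal_mult_divide_eq[OF emeasure_unit_ball, of 1] by (simp add: ennreal_divide_times)
  finally show ?thesis .
qed

lemma prob_space_sigma: "prob_space (sigma :: (complex ^ 'n) measure)"
  by (rule prob_spaceI) (simp add: emeasure_sigma_sphere)

lemma nn_integral_sigma_isometry:
  fixes f :: "complex ^ 'n \<Rightarrow> ennreal" and T :: "complex ^ 'n \<Rightarrow> complex ^ 'n"
  assumes f [measurable]: "f \<in> borel_measurable borel" and lin: "linear T" and iso: "\<And>x. norm (T x) = norm x"
  shows "(\<integral>\<^sup>+x. f (T x) \<partial>sigma) = (\<integral>\<^sup>+x. f x \<partial>sigma)"
proof -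
  have T [measurable]: "T \<in> borel_measurable borel"
    using lin by (intro borel_measurable_continuous_onI linear_continuous_on) (simp add: linear_conv_bounded_linear)
  have sgn: "T (sgn x) = sgn (T x)" for x
    by (simp add: sgn_div_norm linear_scale[OF lin] iso)
  have ind: "indicator (ball 0 1 - {0}) (T x) = (indicator (ball 0 1 - {0}) x :: ennreal)" for x
  proof -
    have "T x = 0 \<longleftrightarrow> x = 0" by (metis iso norm_eq_zero)
    thus ?thesis by (simp add: indicator_def iso)
  qed
  have "(\<integral>\<^sup>+x. f (T (sgn x)) * indicator (ball 0 1 - {0}) x \<partial>lborel)
      = (\<integral>\<^sup>+x. f (sgn (T x)) * indicator (ball 0 1 - {0}) (T x) \<partial>lborel)"
    unfolding ind sgn ..
  also have "\<dots> = (\<integral>\<^sup>+x. f (sgn x) * indicator (ball 0 1 - {0}) x \<partial>lborel)"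
    by (rule nn_integral_lborel_isometry[OF _ lin iso])
       (intro borel_measurable_times_ennreal measurable_compose[OF borel_measurable_sgn f] borel_measurable_indicator, simp)
  finally show ?thesis by (simp add: nn_integral_sigma)
qed

section \<open>The Hermitian product and unitary maps\<close>

lemma norm_sq_vec: "(norm (x :: complex ^ 'n))\<^sup>2 = (\<Sum>i\<in>UNIV. (cmod (x $ i))\<^sup>2)"
  by (simp add: norm_vec_def L2_set_def sum_nonneg)

lemma cinner_self: "cinner x x = complex_of_real ((norm (x :: complex ^ 'n))\<^sup>2)"
  unfolding cinner_def norm_sq_vec by (simp add: complex_norm_square[symmetric])

lemma cinner_add_left: "cinner (x + y) z = cinner x z + cinner y z"
  by (simp add: cinner_def distrib_right sum.distrib)

lemma cinner_diff_left: "cinner (x - y) z = cinner x z - cinner y z"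
  by (simp add: cinner_def left_diff_distrib sum_subtractf)

lemma cinner_diff_right: "cinner z (x - y) = cinner z x - cinner z y"
  by (simp add: cinner_def right_diff_distrib sum_subtractf)

lemma cinner_scale_left: "cinner (c *s x) z = c * cinner x z"
  by (simp add: cinner_def sum_distrib_left mult.assoc)

lemma cinner_scale_right: "cinner z (c *s x) = cnj c * cinner z x"
  by (simp add: cinner_def sum_distrib_left mult_ac)

lemma cinner_commute: "cinner x y = cnj (cinner y x)"
  by (simp add: cinner_def mult.commute)

lemma cinner_bound: "cmod (cinner x y) \<le> norm x * norm (y :: complex ^ 'n)"
proof -
  have "cmod (cinner x y) \<le> (\<Sum>k\<in>UNIV. cmod (x $ k * cnj (y $ k)))" unfolding cinner_def by (rule norm_sum)
  also have "\<dots> = (\<Sum>k\<in>UNIV. \<bar>cmod (x $ k)\<bar> * \<bar>cmod (y $ k)\<bar>)" by (simp add: norm_mult)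
  also have "\<dots> \<le> norm x * norm y" unfolding norm_vec_def by (rule L2_set_mult_ineq)
  finally show ?thesis .
qed

lemma norm_vec_scale: "norm (c *s x) = cmod c * norm (x :: complex ^ 'n)"
proof -
  have "(norm (c *s x))\<^sup>2 = (cmod c * norm x)\<^sup>2"
    by (simp add: norm_sq_vec norm_mult power_mult_distrib sum_distrib_left)
  thus ?thesis by simp
qed

lemma scaleR_vec_scale: "r *\<^sub>R (x :: complex ^ 'n) = complex_of_real r *s x"
  by (simp add: vec_eq_iff) (simp add: scaleR_conv_of_real)

lemma vec_scale_one: "1 *s (x :: complex ^ 'n) = x"
  by (simp add: vec_eq_iff)

lemma linear_vec_scale: "linear ((*s) c :: complex ^ 'n \<Rightarrow> complex ^ 'n)"
  by (rule linearI) (simp_all add: vec_eq_iff algebra_simps)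

lemma continuous_on_vec_scale [continuous_intros]:
  "continuous_on S f \<Longrightarrow> continuous_on S g \<Longrightarrow> continuous_on S (\<lambda>x. f x *s (g x :: complex ^ 'n))"
  unfolding vector_scalar_mult_def by (intro continuous_intros)

lemma vec_scale_borel [measurable (raw)]:
  "f \<in> borel_measurable M \<Longrightarrow> g \<in> borel_measurable M \<Longrightarrow> (\<lambda>x. f x *s (g x :: complex ^ 'n)) \<in> borel_measurable M"
  by (rule borel_measurable_continuous_Pair) (auto intro!: continuous_intros)

lemma continuous_on_cinner [continuous_intros]:
  "continuous_on S f \<Longrightarrow> continuous_on S g \<Longrightarrow> continuous_on S (\<lambda>x. cinner (f x) (g x :: complex ^ 'n))"
  unfolding cinner_def by (intro continuous_intros)

lemma cinner_borel [measurable (raw)]: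
  "f \<in> borel_measurable M \<Longrightarrow> g \<in> borel_measurable M \<Longrightarrow> (\<lambda>x. cinner (f x) (g x :: complex ^ 'n)) \<in> borel_measurable M"
  by (rule borel_measurable_continuous_Pair) (auto intro!: continuous_intros)

text \<open>The phase \<open>c\<close> makes the product of \<open>u\<close> with
  \<open>c *s v\<close> real and nonnegative. Then the complex Householder reflection along
  \<open>w = u - c *s v\<close> sends \<open>u\<close> to \<open>c *s v\<close>; without the phase
  the reflection would miss its target. Multiplication by \<open>cnj c\<close> removes the phase
  afterwards.\<close>

lemma unitary_transitive:
  fixes u v :: "complex ^ 'n"
  assumes u: "norm u = 1" and v: "norm v = 1"
  obtains T where "linear T" "\<And>x y. cinner (T x) (T y) = cinner x y" "T u = v"
proof -
  define c where "c = (if cinner u v = 0 then 1 else cinner u v / cmod (cinner u v))"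
  have c1: "cmod c = 1" by (simp add: c_def norm_divide)
  have cc: "cnj c * c = 1" using c1 by (metis complex_norm_square mult.commute of_real_1 power_one)
  define t where "t = cmod (cinner u v)"
  have ct: "cnj c * cinner u v = complex_of_real t"
  proof (cases "cinner u v = 0")
    case False
    have "cnj (cinner u v) * cinner u v = complex_of_real (t\<^sup>2)"
      unfolding t_def using complex_norm_square[of "cinner u v"] by (simp add: mult.commute)
    thus ?thesis using False by (simp add: c_def t_def power2_eq_square field_simps)
  qed (simp add: t_def)
  define w where "w = u - c *s v"
  define n where "n = cinner w w"
  have uu: "cinner u u = 1" "cinner v v = 1" using u v by (auto simp: cinner_self)
  have vu: "c * cinner v u = complex_of_real t"
  proof -
    have "c * cinner v u = cnj (cnj c * cinner u v)" using cinner_commute[of v u] by simp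
    thus ?thesis by (simp add: ct)
  qed
  have uw: "cinner u w = 1 - complex_of_real t" by (simp add: w_def cinner_diff_right cinner_scale_right uu ct)
  have n2: "n = 2 * (1 - complex_of_real t)"
  proof -
    have "cinner (c *s v) w = c * cinner v u - c * (cnj c * cinner v v)"
      by (simp add: w_def cinner_diff_right cinner_scale_right cinner_scale_left algebra_simps)
    also have "\<dots> = complex_of_real t - 1" using cc by (simp add: vu uu mult.commute)
    finally have cvw: "cinner (c *s v) w = complex_of_real t - 1" .
    have "n = cinner u w - cinner (c *s v) w" unfolding n_def by (subst (1) w_def) (rule cinner_diff_left)
    thus ?thesis by (simp add: uw cvw)
  qed
  define P where "P x = (if w = 0 then x else x - (2 * cinner x w / n) *s w)" for x
  have P: "cinner (P x) (P y) = cinner x y" for x y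
  proof (cases "w = 0")
    case False
    have n0: "n \<noteq> 0" using False by (simp add: n_def cinner_self)
    have nr: "cnj n = n" by (simp add: n_def cinner_self)
    have "cinner (P x) (P y) = cinner x y - cnj (2 * cinner y w / n) * cinner x w
        - (2 * cinner x w / n) * (cinner w y - cnj (2 * cinner y w / n) * n)"
      using False by (simp add: P_def cinner_diff_left cinner_diff_right cinner_scale_left cinner_scale_right n_def algebra_simps)
    also have "cnj (2 * cinner y w / n) = 2 * cinner w y / n" using cinner_commute[of w y] nr by simp
    finally show ?thesis using n0 by (simp add: field_simps)
  qed (simp add: P_def)
  have Pu: "P u = c *s v"
  proof (cases "w = 0")
    case True thus ?thesis by (simp add: P_def w_def)
  next
    case False
    have n0: "n \<noteq> 0" using False by (simp add: n_def cinner_self)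
    hence "2 * cinner u w / n = 1" by (simp add: uw n2)
    thus ?thesis using False by (simp only: P_def if_False vec_scale_one) (simp add: w_def)
  qed
  have lP: "linear P"
  proof (rule linearI)
    fix x y :: "complex ^ 'n" and r :: real
    show "P (x + y) = P x + P y"
      by (simp add: P_def cinner_add_left vec_eq_iff algebra_simps add_divide_distrib)
    show "P (r *\<^sub>R x) = r *\<^sub>R P x"
      by (simp add: P_def scaleR_vec_scale cinner_scale_left vec_eq_iff algebra_simps)
  qed
  show thesis
  proof (rule that[of "\<lambda>x. cnj c *s P x"])
    show "linear (\<lambda>x. cnj c *s P x)" using linear_compose[OF lP linear_vec_scale[of "cnj c"]] by (simp add: o_def)
    show "cinner (cnj c *s P x) (cnj c *s P y) = cinner x y" for x y
      using cc by (simp add: cinner_scale_left cinner_scale_right P mult.assoc[symmetric] mult.commute[of c])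
    show "cnj c *s P u = v" using cc by (simp add: Pu vec_eq_iff mult.assoc[symmetric])
  qed
qed

text \<open>It makes the measure of a non-isotropic ball, and the mass of a peak, independent of the
  centre.\<close>

lemma nn_integral_sigma_cinner:
  fixes g :: "complex \<Rightarrow> ennreal" and u v :: "complex ^ 'n"
  assumes [measurable]: "g \<in> borel_measurable borel" and u: "norm u = 1" and v: "norm v = 1"
  shows "(\<integral>\<^sup>+x. g (cinner x u) \<partial>sigma) = (\<integral>\<^sup>+x. g (cinner x v) \<partial>sigma)"
proof -
  obtain T where T: "linear T" "\<And>x y. cinner (T x) (T y) = cinner x y" "T u = v"
    using unitary_transitive[OF u v] by blast
  have "(norm (T x))\<^sup>2 = (norm x)\<^sup>2" for x
    using T(2)[of x x] unfolding cinner_self of_real_eq_iff .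
  hence iso: "norm (T x) = norm x" for x by simp
  have "(\<integral>\<^sup>+x. g (cinner x v) \<partial>sigma) = (\<integral>\<^sup>+x. g (cinner (T x) v) \<partial>sigma)"
    by (rule nn_integral_sigma_isometry[OF _ T(1) iso, symmetric]) measurable
  thus ?thesis by (simp add: T(3)[symmetric] T(2))
qed

text \<open>Each rotation \<open>cis t\<close> preserves \<open>sigma\<close>, and Fubini's theorem
  averages over \<open>t\<close>. This is the slicing of the sphere into circles in complex
  lines.\<close>

lemma nn_integral_sigma_rotate:
  fixes f :: "complex ^ 'n \<Rightarrow> ennreal"
  assumes [measurable]: "f \<in> borel_measurable borel"
  shows "ennreal (2 * pi) * (\<integral>\<^sup>+x. f x \<partial>sigma) = (\<integral>\<^sup>+x. (\<integral>\<^sup>+t. f (cis t *s x) \<partial>circ) \<partial>sigma)"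
proof -
  interpret S: prob_space "sigma :: (complex ^ 'n) measure" by (rule prob_space_sigma)
  interpret C: sigma_finite_measure circ by (rule sigma_finite_circ)
  interpret pair_sigma_finite circ "sigma :: (complex ^ 'n) measure" by unfold_locales
  have "(\<integral>\<^sup>+x. (\<integral>\<^sup>+t. f (cis t *s x) \<partial>circ) \<partial>sigma) = (\<integral>\<^sup>+t. (\<integral>\<^sup>+x. f (cis t *s x) \<partial>sigma) \<partial>circ)"
    by (rule Fubini') measurable
  also have "\<dots> = (\<integral>\<^sup>+t. (\<integral>\<^sup>+x. f x \<partial>sigma) \<partial>circ)"
    by (intro nn_integral_cong nn_integral_sigma_isometry linear_vec_scale) (auto simp: norm_vec_scale)
  also have "\<dots> = ennreal (2 * pi) * (\<integral>\<^sup>+x. f x \<partial>sigma)"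
    unfolding nn_integral_const space_circ emeasure_circ by (rule mult.commute)
  finally show ?thesis ..
qed

section \<open>Domination by the Hardy norm\<close>

lemma epow_borel [measurable (raw)]:
  "f \<in> borel_measurable M \<Longrightarrow> (\<lambda>x. epow (f x) c) \<in> borel_measurable M"
proof -
  assume [measurable]: "f \<in> borel_measurable M"
  show ?thesis unfolding epow_def by measurable
qed

lemma epow_mono: "x \<le> y \<Longrightarrow> 0 \<le> c \<Longrightarrow> epow x c \<le> epow y c"
proof (cases "y = \<top>")
  case False
  assume "x \<le> y" "0 \<le> c"
  hence "epow x c \<le> ennreal (enn2real y powr c)"
    using False by (intro epow_le_ennreal) (auto simp: less_top[symmetric])
  thus ?thesis using False by (simp add: epow_def)
qed (simp add: epow_def)

lemma epow_inverse: "0 < c \<Longrightarrow> epow (epow x c) (1 / c) = x"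
  by (cases x) (auto simp: epow_def powr_powr)

text \<open>\<open>epow\<close> with exponent \<open>1 / c\<close> inverts \<open>epow\<close> with
  exponent \<open>c\<close>, and both are monotone, so a lower bound for the limit inferior can be
  pulled back and pushed forward.\<close>

lemma epow_liminf:
  assumes c: "0 < c"
  shows "epow (liminf X) c \<le> liminf (\<lambda>n. epow (X n) c)"
  unfolding le_Liminf_iff
proof (intro allI impI)
  fix y assume y: "y < epow (liminf X) c"
  have inv: "epow (epow z (1 / c)) c = z" for z using epow_inverse[of "1 / c" z] c by simp
  have "epow y (1 / c) < liminf X"
  proof (rule ccontr)
    assume "\<not> ?thesis"
    hence "epow (liminf X) c \<le> epow (epow y (1 / c)) c" using c by (intro epow_mono) auto
    thus False using y by (simp add: inv)
  qed
  hence "eventually (\<lambda>n. epow y (1 / c) < X n) sequentially"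
    using le_Liminf_iff[of "liminf X" sequentially X] by auto
  thus "eventually (\<lambda>n. y < epow (X n) c) sequentially"
  proof eventually_elim
    case (elim n)
    show ?case
    proof (rule ccontr)
      assume "\<not> ?thesis"
      hence "epow (epow (X n) c) (1 / c) \<le> epow y (1 / c)" using c by (intro epow_mono) auto
      thus False using elim by (simp add: epow_inverse[OF c])
    qed
  qed
qed

lemma slice_pow_cong:
  assumes "\<And>r. 0 \<le> r \<Longrightarrow> r < 1 \<Longrightarrow> g r = h r"
  shows "slice_pow q p g = slice_pow q p h"
proof -
  have "slice_norm q g = slice_norm q h"
    unfolding slice_norm_def using assms by (auto intro!: SUP_cong nn_integral_cong split: split_indicator)
  thus ?thesis by (simp add: slice_pow_def)
qed

text \<open>For \<open>q = \<top>\<close> the norm is an uncountable supremum, which need not be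
  measurable in a parameter. For continuous radial profiles the rational radii give the same
  value.\<close>

definition slice_norm_rat :: "ennreal \<Rightarrow> (real \<Rightarrow> real) \<Rightarrow> ennreal" where
  "slice_norm_rat q g = (if q = \<top> then (SUP r\<in>{0..<1} \<inter> \<rat>. ennreal (g r * (1 - r\<^sup>2))) else slice_norm q g)"

lemma slice_norm_rat_eq:
  assumes g: "continuous_on {0..<1} g"
  shows "slice_norm_rat q g = slice_norm q g"
proof (cases "q = \<top>")
  case True
  let ?h = "\<lambda>r. g r * (1 - r\<^sup>2)"
  have "ennreal (?h r) \<le> (SUP r\<in>{0..<1} \<inter> \<rat>. ennreal (?h r))" if r: "r \<in> {0..<1}" for r
  proof (rule LIMSEQ_le_const2)
    define x where "x n = real_of_int \<lfloor>r * real (Suc n)\<rfloor> / real (Suc n)" for n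
    have x_le: "x n \<le> r" for n
      unfolding x_def by (simp add: divide_le_eq del: of_nat_Suc)
    have x_in: "x n \<in> {0..<1} \<inter> \<rat>" for n
    proof -
      have "0 \<le> \<lfloor>r * real (Suc n)\<rfloor>" using r by auto
      hence "0 \<le> x n" unfolding x_def by auto
      moreover have "x n \<in> \<rat>" unfolding x_def by auto
      ultimately show ?thesis using x_le[of n] r by auto
    qed
    have x_ge: "r - 1 / real (Suc n) \<le> x n" for n
    proof -
      have "r * real (Suc n) - 1 \<le> real_of_int \<lfloor>r * real (Suc n)\<rfloor>" by linarith
      hence "(r * real (Suc n) - 1) / real (Suc n) \<le> x n" unfolding x_def by (intro divide_right_mono) auto
      thus ?thesis by (simp add: diff_divide_distrib del: of_nat_Suc)
    qed
    have "x \<longlonglongrightarrow> r"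
    proof (rule tendsto_sandwich[of "\<lambda>n. r - 1 / real (Suc n)" _ _ "\<lambda>_. r"])
      show "(\<lambda>n. r - 1 / real (Suc n)) \<longlonglongrightarrow> r"
        using tendsto_diff[OF tendsto_const LIMSEQ_inverse_real_of_nat, of r] by (simp add: inverse_eq_divide del: of_nat_Suc)
    qed (use x_le x_ge in auto)
    have "continuous_on {0..<1} ?h" by (intro continuous_intros g)
    hence "(\<lambda>n. ?h (x n)) \<longlonglongrightarrow> ?h r"
      using \<open>x \<longlonglongrightarrow> r\<close> r by (rule continuous_on_tendsto_compose) (use x_in in auto)
    thus "(\<lambda>n. ennreal (?h (x n))) \<longlonglongrightarrow> ennreal (?h r)" by (rule tendsto_ennrealI)
    show "\<exists>N. \<forall>n\<ge>N. ennreal (?h (x n)) \<le> (SUP r\<in>{0..<1} \<inter> \<rat>. ennreal (?h r))"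
      using x_in by (intro exI[of _ 0]) (auto intro!: SUP_upper)
  qed
  hence "(SUP r\<in>{0..<1}. ennreal (?h r)) \<le> (SUP r\<in>{0..<1} \<inter> \<rat>. ennreal (?h r))" by (rule SUP_least)
  moreover have "(SUP r\<in>{0..<1} \<inter> \<rat>. ennreal (?h r)) \<le> (SUP r\<in>{0..<1}. ennreal (?h r))"
    by (rule SUP_subset_mono) auto
  ultimately show ?thesis using True by (simp add: slice_norm_rat_def slice_norm_def)
qed (simp add: slice_norm_rat_def)

lemma slice_norm_rat_measurable:
  assumes [measurable]: "(\<lambda>(x, r). g x r) \<in> borel_measurable (M \<Otimes>\<^sub>M borel)"
  shows "(\<lambda>x. slice_norm_rat q (g x)) \<in> borel_measurable M"
proof (cases "q = \<top>")
  case True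
  have [measurable]: "(\<lambda>x. g x r) \<in> borel_measurable M" for r
    using measurable_compose[OF measurable_Pair2'[of r borel M] assms] by simp
  have "countable ({0..<1::real} \<inter> \<rat>)" using countable_rat by (rule countable_subset[rotated]) auto
  hence "(\<lambda>x. SUP r\<in>{0..<1} \<inter> \<rat>. ennreal (g x r * (1 - r\<^sup>2))) \<in> borel_measurable M"
    by (rule borel_measurable_SUP) measurable
  thus ?thesis using True by (simp add: slice_norm_rat_def)
next
  case False
  have [measurable]: "(\<lambda>(x, r). g x r) \<in> borel_measurable (M \<Otimes>\<^sub>M lborel)"
    using assms by (subst measurable_cong_sets[OF sets_pair_measure_cong[OF refl sets_lborel] refl])
  have "(\<lambda>x. \<integral>\<^sup>+r\<in>{0..<1}. ennreal (g x r powr enn2real q * (1 - r\<^sup>2) powr (enn2real q - 1)) \<partial>lborel) \<in> borel_measurable M"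
    by measurable
  thus ?thesis using False by (simp add: slice_norm_rat_def slice_norm_def)
qed

text \<open>Dilated profiles converge pointwise by continuity. For finite \<open>q\<close> Fatou's
  lemma applies; for \<open>q = \<top>\<close> each radius is compared separately with the
  supremum.\<close>

lemma slice_norm_liminf:
  assumes g: "continuous_on {0..<1} g" and R: "\<And>n. 0 \<le> R n" "\<And>n. R n \<le> (1::real)" "R \<longlonglongrightarrow> 1" and p: "0 < p" "0 < q"
    and gm: "g \<in> borel_measurable borel" and nn: "\<And>r. 0 \<le> g r"
  shows "slice_pow q p g \<le> liminf (\<lambda>n. slice_pow q p (\<lambda>r. g (R n * r)))"
proof -
  have conv: "(\<lambda>n. g (R n * r)) \<longlonglongrightarrow> g r" if r: "r \<in> {0..<1}" for r
  proof (rule continuous_on_tendsto_compose[OF g])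
    show "(\<lambda>n. R n * r) \<longlonglongrightarrow> r" using tendsto_mult_right[OF R(3), of r] by simp
    have "R n * r \<le> 1 * r" for n using R r by (intro mult_right_mono) auto
    hence "R n * r < 1" for n using r by (auto intro: le_less_trans[of _ r])
    thus "eventually (\<lambda>n. R n * r \<in> {0..<1}) sequentially" using R r by auto
  qed fact
  have "slice_norm q g \<le> liminf (\<lambda>n. slice_norm q (\<lambda>r. g (R n * r)))"
  proof (cases "q = \<top>")
    case True
    show ?thesis unfolding slice_norm_def True if_P[OF refl]
    proof (rule SUP_least)
      fix r :: real assume r: "r \<in> {0..<1}"
      have "(\<lambda>n. ennreal (g (R n * r) * (1 - r\<^sup>2))) \<longlonglongrightarrow> ennreal (g r * (1 - r\<^sup>2))"
        by (intro tendsto_ennrealI tendsto_intros conv r)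
      hence "ennreal (g r * (1 - r\<^sup>2)) = liminf (\<lambda>n. ennreal (g (R n * r) * (1 - r\<^sup>2)))"
        by (intro lim_imp_Liminf[symmetric]) auto
      also have "\<dots> \<le> liminf (\<lambda>n. SUP r\<in>{0..<1}. ennreal (g (R n * r) * (1 - r\<^sup>2)))"
        using r by (intro Liminf_mono always_eventually allI SUP_upper)
      finally show "ennreal (g r * (1 - r\<^sup>2)) \<le> liminf (\<lambda>n. SUP r\<in>{0..<1}. ennreal (g (R n * r) * (1 - r\<^sup>2)))" .
    qed
  next
    case False
    define Q where "Q = enn2real q"
    have Q: "0 < Q" using p False by (simp add: Q_def enn2real_positive_iff less_top)
    let ?u = "\<lambda>n r. ennreal (g (R n * r) powr Q * (1 - r\<^sup>2) powr (Q - 1)) * indicator {0..<1} r"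
    have [measurable]: "(\<lambda>r. g (R n * r)) \<in> borel_measurable borel" for n
      by (rule measurable_compose[OF _ gm]) simp
    have "ennreal (g r powr Q * (1 - r\<^sup>2) powr (Q - 1)) * indicator {0..<1} r \<le> liminf (\<lambda>n. ?u n r)" for r
    proof (cases "r \<in> {0..<1}")
      case True
      have "(\<lambda>n. (g (R n * r)) powr Q) \<longlonglongrightarrow> (g r) powr Q"
        using Q nn by (intro tendsto_powr2 conv True tendsto_const) auto
      hence "(\<lambda>n. ?u n r) \<longlonglongrightarrow> ennreal (g r powr Q * (1 - r\<^sup>2) powr (Q - 1)) * indicator {0..<1} r"
        using True by (auto intro!: tendsto_ennrealI tendsto_intros)
      thus ?thesis using lim_imp_Liminf[of sequentially "\<lambda>n. ?u n r"] by simp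
    qed simp
    hence "(\<integral>\<^sup>+r\<in>{0..<1}. ennreal (g r powr Q * (1 - r\<^sup>2) powr (Q - 1)) \<partial>lborel) \<le> (\<integral>\<^sup>+r. liminf (\<lambda>n. ?u n r) \<partial>lborel)"
      by (intro nn_integral_mono)
    also have "\<dots> \<le> liminf (\<lambda>n. \<integral>\<^sup>+r. ?u n r \<partial>lborel)" by (rule nn_integral_liminf) simp
    finally show ?thesis using False by (simp add: slice_norm_def Q_def)
  qed
  hence "slice_pow q p g \<le> epow (liminf (\<lambda>n. slice_norm q (\<lambda>r. g (R n * r)))) (if q = \<top> then p else p / enn2real q)"
    unfolding slice_pow_def using p by (intro epow_mono) auto
  also have "\<dots> \<le> liminf (\<lambda>n. slice_pow q p (\<lambda>r. g (R n * r)))"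
    unfolding slice_pow_def using p by (intro epow_liminf) (auto simp: enn2real_positive_iff less_top)
  finally show ?thesis .
qed

lemma HF_normp_zero:
  "HF_normp p q 0 f = (\<integral>\<^sup>+\<zeta>. slice_pow q p (\<lambda>r. cmod (f (r *\<^sub>R \<zeta>) + radial f (r *\<^sub>R \<zeta>))) \<partial>sigma)"
proof -
  have k: "splus 0 = 1" by (simp add: splus_def)
  have IR: "IR_pow 1 f = (\<lambda>z. f z + radial f z)" by (simp add: IR_pow_def)
  have "(SUP r\<in>{0..<1}. ennreal (g r * (1 - r\<^sup>2) powr 1)) = (SUP r\<in>{0..<1}. ennreal (g r * (1 - r\<^sup>2)))" for g :: "real \<Rightarrow> real"
    by (intro SUP_cong refl) (simp add: abs_square_le_1)
  thus ?thesis unfolding HF_normp_def Let_def k IR slice_pow_def slice_norm_def by simp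
qed

text \<open>The derivative required by \<open>holo_on\<close> is complex linear, so along a complex
  line it is an ordinary complex derivative \<open>d\<close>, and \<open>l * d\<close> is the
  derivative applied to the point itself.\<close>

lemma holo_slice:
  fixes f :: "complex ^ 'n \<Rightarrow> complex"
  assumes f: "holo_on (ball 0 1) f" and l: "cmod l * norm \<zeta> < 1"
  shows "\<exists>d. ((\<lambda>l. f (l *s \<zeta>)) has_field_derivative d) (at l) \<and> l * d = radial f (l *s \<zeta>)"
proof -
  have z: "l *s \<zeta> \<in> ball 0 1" using l by (simp add: norm_vec_scale)
  obtain f' where f': "(f has_derivative f') (at (l *s \<zeta>))" "\<And>c v. f' (c *s v) = c * f' v"
    using f z unfolding holo_on_def by blast
  have "((\<lambda>l. l *s \<zeta>) has_derivative (\<lambda>h. h *s \<zeta>)) (at l)"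
  proof (rule bounded_linear_imp_has_derivative)
    have "linear (\<lambda>h. h *s \<zeta>)" by (rule linearI) (simp_all add: vec_eq_iff algebra_simps)
    thus "bounded_linear (\<lambda>h. h *s \<zeta>)" by (simp add: linear_conv_bounded_linear)
  qed
  from diff_chain_at[OF this f'(1)] have "((\<lambda>l. f (l *s \<zeta>)) has_derivative (\<lambda>h. h * f' \<zeta>)) (at l)"
    by (simp add: o_def f'(2))
  hence "((\<lambda>l. f (l *s \<zeta>)) has_field_derivative f' \<zeta>) (at l)"
    by (simp add: has_field_derivative_def mult.commute[of _ "f' \<zeta>"])
  moreover have "frechet_derivative f (at (l *s \<zeta>)) = f'" using frechet_derivative_at[OF f'(1)] by simp
  hence "l * f' \<zeta> = radial f (l *s \<zeta>)" by (simp add: radial_def f'(2))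
  ultimately show ?thesis by blast
qed

lemma holo_on_continuous: "holo_on U f \<Longrightarrow> open U \<Longrightarrow> continuous_on U f"
  unfolding holo_on_def by (metis continuous_at_imp_continuous_on has_derivative_continuous)

definition RG :: "(complex ^ 'n \<Rightarrow> complex) \<Rightarrow> complex ^ 'n \<Rightarrow> real" where
  "RG f z = (if z \<in> ball 0 1 then cmod (f z + radial f z) else 0)"

text \<open>\<open>radial\<close> is given by a derivative at each point; measurability follows by
  writing it as a limit of difference quotients along the dilations \<open>c n *s z\<close>, with
  \<open>f\<close> extended by zero outside the ball.\<close>

lemma RG_measurable:
  fixes f :: "complex ^ 'n \<Rightarrow> complex"
  assumes f: "holo_on (ball 0 1) f"
  shows "RG f \<in> borel_measurable borel"
proof -
  define f0 where "f0 z = indicator (ball 0 1) z *\<^sub>R f z" for z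
  have f0 [measurable]: "f0 \<in> borel_measurable borel"
    unfolding f0_def by (intro borel_measurable_continuous_on_indicator holo_on_continuous[OF f]) auto
  define c where "c n = complex_of_real (1 + 1 / real (Suc n))" for n
  define u where "u n z = indicator (ball 0 1) z * cmod (f0 z + complex_of_real (real (Suc n)) * (f0 (c n *s z) - f0 z))" for n z
  have [measurable]: "ball (0::complex ^ 'n) 1 \<in> sets borel" by simp
  have um: "u n \<in> borel_measurable borel" for n
  proof -
    have "(\<lambda>z. f0 (c n *s z)) \<in> borel_measurable borel"
      by (rule measurable_compose[OF _ f0]) measurable
    thus ?thesis unfolding u_def[abs_def] by (intro borel_measurable_times borel_measurable_indicator borel_measurable_norm
        borel_measurable_add borel_measurable_diff borel_measurable_const f0) auto
  qed
  have lim: "(\<lambda>n. u n z) \<longlonglongrightarrow> RG f z" for z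
  proof (cases "z \<in> ball 0 1")
    case True
    obtain d where d: "((\<lambda>l. f (l *s z)) has_field_derivative d) (at 1)" "d = radial f z"
      using holo_slice[OF f, of 1 z] True by (auto simp: vec_scale_one)
    have "(\<lambda>n. 1 / real (Suc n)) \<longlonglongrightarrow> 0"
      using LIMSEQ_inverse_real_of_nat unfolding inverse_eq_divide .
    hence "(\<lambda>n. complex_of_real (1 / real (Suc n))) \<longlonglongrightarrow> complex_of_real 0" by (rule tendsto_of_real)
    hence h: "(\<lambda>n. complex_of_real (1 / real (Suc n))) \<longlonglongrightarrow> 0" by (simp only: of_real_0)
    have h': "filterlim (\<lambda>n. complex_of_real (1 / real (Suc n))) (at 0) sequentially"
      using h unfolding filterlim_at by (auto simp del: of_nat_Suc)
    have "(\<lambda>n. (f ((1 + complex_of_real (1 / real (Suc n))) *s z) - f (1 *s z)) / complex_of_real (1 / real (Suc n))) \<longlonglongrightarrow> d"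
      using filterlim_compose[OF d(1)[unfolded DERIV_def] h'] .
    hence 1: "(\<lambda>n. complex_of_real (real (Suc n)) * (f (c n *s z) - f z)) \<longlonglongrightarrow> d"
      by (simp add: c_def vec_scale_one mult.commute del: of_nat_Suc)
    have "(\<lambda>n. c n *s z) \<longlonglongrightarrow> 1 *s z"
      unfolding vector_scalar_mult_def c_def of_real_add of_real_1
      by (intro tendsto_vec_lambda tendsto_mult_right) (use tendsto_add[OF tendsto_const h, of 1] in simp)
    hence "eventually (\<lambda>n. c n *s z \<in> ball 0 1) sequentially"
      using True by (intro topological_tendstoD) (auto simp: vec_scale_one)
    hence "eventually (\<lambda>n. cmod (f z + complex_of_real (real (Suc n)) * (f (c n *s z) - f z)) = u n z) sequentially"
    proof eventually_elim
      case (elim n)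
      thus ?case using True by (simp add: u_def f0_def)
    qed
    moreover have "(\<lambda>n. cmod (f z + complex_of_real (real (Suc n)) * (f (c n *s z) - f z))) \<longlonglongrightarrow> cmod (f z + d)"
      by (intro tendsto_norm tendsto_add tendsto_const 1)
    ultimately have "(\<lambda>n. u n z) \<longlonglongrightarrow> cmod (f z + d)" by (rule Lim_transform_eventually[rotated])
    thus ?thesis using True d(2) by (simp add: RG_def)
  qed (simp add: u_def RG_def)
  show ?thesis by (rule borel_measurable_LIMSEQ_real[OF lim um])
qed

lemma RG_slice:
  fixes f :: "complex ^ 'n \<Rightarrow> complex"
  assumes f: "holo_on (ball 0 1) f" and \<zeta>: "norm \<zeta> = 1"
  shows "(\<lambda>l. f (l *s \<zeta>)) holomorphic_on ball 0 1"
    and "cmod l < 1 \<Longrightarrow> RG f (l *s \<zeta>) = cmod (f (l *s \<zeta>) + l * deriv (\<lambda>l. f (l *s \<zeta>)) l)"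
    and "continuous_on {0..<1} (\<lambda>r. RG f (r *\<^sub>R \<zeta>))"
proof -
  show hol: "(\<lambda>l. f (l *s \<zeta>)) holomorphic_on ball 0 1"
    unfolding holomorphic_on_def field_differentiable_def
  proof
    fix x :: complex assume "x \<in> ball 0 1"
    then obtain d where "((\<lambda>l. f (l *s \<zeta>)) has_field_derivative d) (at x)"
      using holo_slice[OF f, of x \<zeta>] \<zeta> by auto
    thus "\<exists>d. ((\<lambda>l. f (l *s \<zeta>)) has_field_derivative d) (at x within ball 0 1)"
      using has_field_derivative_at_within by blast
  qed
  show eq: "RG f (l *s \<zeta>) = cmod (f (l *s \<zeta>) + l * deriv (\<lambda>l. f (l *s \<zeta>)) l)" if l: "cmod l < 1" for l
  proof -
    obtain d where "((\<lambda>l. f (l *s \<zeta>)) has_field_derivative d) (at l)" "l * d = radial f (l *s \<zeta>)"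
      using holo_slice[OF f, of l \<zeta>] l \<zeta> by auto
    thus ?thesis using l \<zeta> by (simp add: RG_def norm_vec_scale DERIV_imp_deriv)
  qed
  have "continuous_on (ball 0 1) (\<lambda>l. cmod (f (l *s \<zeta>) + l * deriv (\<lambda>l. f (l *s \<zeta>)) l))"
    by (intro continuous_intros holomorphic_on_imp_continuous_on holomorphic_deriv hol) auto
  hence "continuous_on {0..<1} (\<lambda>r. cmod (f (complex_of_real r *s \<zeta>) + complex_of_real r * deriv (\<lambda>l. f (l *s \<zeta>)) (complex_of_real r)))"
    by (rule continuous_on_compose2) (auto intro!: continuous_intros)
  thus "continuous_on {0..<1} (\<lambda>r. RG f (r *\<^sub>R \<zeta>))"
    by (rule continuous_on_eq) (simp add: scaleR_vec_scale eq)
qed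

text \<open>On the complex line through \<open>\<zeta>\<close> the function
  \<open>F l = f ((R * l) *s \<zeta>)\<close> is holomorphic on the disc of radius
  \<open>1 / R > 1\<close>, so the one-variable inequality applies to it.
  \<open>nn_integral_sigma_rotate\<close> integrates the result over all lines.\<close>

lemma slice_rotate_bound:
  fixes f :: "complex ^ 'n \<Rightarrow> complex"
  assumes C: "\<And>F R e. F holomorphic_on ball 0 R \<Longrightarrow> 1 < R \<Longrightarrow> 0 < e \<Longrightarrow>
    (\<integral>\<^sup>+s. slice_pow q p (\<lambda>r. cmod (F (rc r s) + rc r s * deriv F (rc r s))) \<partial>circ)
      \<le> ennreal C * (\<integral>\<^sup>+s. ennreal (((cmod (F (cis s)))\<^sup>2 + e) powr (p / 2)) \<partial>circ)"
    and f: "holo_on (ball 0 1) f" and R: "0 < R" "R < 1" and e: "0 < e"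
  shows "(\<integral>\<^sup>+\<zeta>. slice_pow q p (\<lambda>r. RG f ((R * r) *\<^sub>R \<zeta>)) \<partial>sigma)
     \<le> ennreal C * (\<integral>\<^sup>+\<zeta>. ennreal (((cmod (f (R *\<^sub>R \<zeta>)))\<^sup>2 + e) powr (p / 2)) \<partial>sigma)"
proof -
  have RG [measurable]: "RG f \<in> borel_measurable borel" by (rule RG_measurable[OF f])
  \<comment> \<open>The rational version is Borel on the whole space and agrees with
    \<open>slice_pow\<close> on the sphere, where the profile is continuous.\<close>
  define h where "h \<zeta> = epow (slice_norm_rat q (\<lambda>r. RG f ((R * r) *\<^sub>R \<zeta>))) (if q = \<top> then p else p / enn2real q)" for \<zeta>
  have hm [measurable]: "h \<in> borel_measurable borel"
    unfolding h_def[abs_def] by (intro epow_borel slice_norm_rat_measurable) measurable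
  have h_eq: "h \<zeta> = slice_pow q p (\<lambda>r. RG f ((R * r) *\<^sub>R \<zeta>))" if \<zeta>: "norm \<zeta> = 1" for \<zeta>
  proof -
    have "continuous_on {0..<1} (\<lambda>r. RG f ((R * r) *\<^sub>R \<zeta>))"
    proof (rule continuous_on_compose2[OF RG_slice(3)[OF f \<zeta>]])
      show "continuous_on {0..<1} (\<lambda>r. R * r)" by (intro continuous_intros)
      show "(\<lambda>r. R * r) ` {0..<1} \<subseteq> {0..<1}" using R mult_strict_mono[of R 1 _ 1] by auto
    qed
    thus ?thesis by (simp add: h_def slice_pow_def slice_norm_rat_eq)
  qed
  define f0 where "f0 z = indicator (ball 0 1) z *\<^sub>R f z" for z
  have f0 [measurable]: "f0 \<in> borel_measurable borel"
    unfolding f0_def by (intro borel_measurable_continuous_on_indicator holo_on_continuous[OF f]) auto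
  define \<psi> where "\<psi> \<zeta> = ennreal (((cmod (f0 (R *\<^sub>R \<zeta>)))\<^sup>2 + e) powr (p / 2))" for \<zeta>
  have \<psi>m [measurable]: "\<psi> \<in> borel_measurable borel" unfolding \<psi>_def[abs_def] by measurable
  have \<psi>_eq: "\<psi> \<zeta> = ennreal (((cmod (f (R *\<^sub>R \<zeta>)))\<^sup>2 + e) powr (p / 2))" if "norm \<zeta> = 1" for \<zeta>
    using that R by (simp add: \<psi>_def f0_def)
  have key: "(\<integral>\<^sup>+t. h (cis t *s \<zeta>) \<partial>circ) \<le> ennreal C * (\<integral>\<^sup>+t. \<psi> (cis t *s \<zeta>) \<partial>circ)" if \<zeta>: "norm \<zeta> = 1" for \<zeta>
  proof -
    define F where "F l = f ((complex_of_real R * l) *s \<zeta>)" for l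
    let ?F1 = "\<lambda>l. f (l *s \<zeta>)"
    have RR: "cmod (complex_of_real R * l) < 1" if "cmod l < 1 / R" for l
      using that R by (simp add: norm_mult less_divide_eq mult.commute)
    have "(?F1 \<circ> (\<lambda>l. complex_of_real R * l)) holomorphic_on ball 0 (1 / R)"
      by (rule holomorphic_on_compose_gen[OF _ RG_slice(1)[OF f \<zeta>]]) (use RR in \<open>auto intro!: holomorphic_intros\<close>)
    hence F: "F holomorphic_on ball 0 (1 / R)" by (simp add: o_def F_def[abs_def])
    have dF: "l * deriv F l = (complex_of_real R * l) * deriv ?F1 (complex_of_real R * l)" if "cmod l < 1 / R" for l
    proof -
      have "(?F1 has_field_derivative deriv ?F1 (complex_of_real R * l)) (at (complex_of_real R * l))"
        by (rule holomorphic_derivI[OF RG_slice(1)[OF f \<zeta>]]) (use RR[OF that] in auto)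
      moreover have "((\<lambda>l. complex_of_real R * l) has_field_derivative complex_of_real R) (at l)"
        by (auto intro!: derivative_eq_intros)
      ultimately have "(F has_field_derivative deriv ?F1 (complex_of_real R * l) * complex_of_real R) (at l)"
        unfolding F_def[abs_def] by (rule DERIV_chain2)
      thus ?thesis by (simp add: DERIV_imp_deriv mult_ac)
    qed
    have R1: "1 < 1 / R" using R by simp
    have "h (cis t *s \<zeta>) = slice_pow q p (\<lambda>r. cmod (F (rc r t) + rc r t * deriv F (rc r t)))" for t
    proof -
      have "h (cis t *s \<zeta>) = slice_pow q p (\<lambda>r. RG f ((R * r) *\<^sub>R (cis t *s \<zeta>)))"
        by (rule h_eq) (simp add: norm_vec_scale \<zeta>)
      also have "\<dots> = slice_pow q p (\<lambda>r. cmod (F (rc r t) + rc r t * deriv F (rc r t)))"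
      proof (rule slice_pow_cong)
        fix r :: real assume r: "0 \<le> r" "r < 1"
        have c: "cmod (rc r t) < 1 / R" using r R1 by (simp add: cmod_rc)
        have "(R * r) *\<^sub>R (cis t *s \<zeta>) = (complex_of_real R * rc r t) *s \<zeta>"
          by (simp add: scaleR_vec_scale rc_def vec_eq_iff mult_ac)
        thus "RG f ((R * r) *\<^sub>R (cis t *s \<zeta>)) = cmod (F (rc r t) + rc r t * deriv F (rc r t))"
          by (simp only: F_def RG_slice(2)[OF f \<zeta> RR[OF c]] dF[OF c])
      qed
      finally show ?thesis .
    qed
    moreover have "\<psi> (cis t *s \<zeta>) = ennreal (((cmod (F (cis t)))\<^sup>2 + e) powr (p / 2))" for t
    proof -
      have "R *\<^sub>R (cis t *s \<zeta>) = (complex_of_real R * cis t) *s \<zeta>" by (simp add: scaleR_vec_scale vec_eq_iff mult_ac)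
      thus ?thesis by (subst \<psi>_eq) (simp_all add: norm_vec_scale \<zeta> F_def)
    qed
    ultimately show ?thesis using C[OF F R1 e] by simp
  qed
  have "ennreal (2 * pi) * (\<integral>\<^sup>+x. h x \<partial>sigma) = (\<integral>\<^sup>+x. (\<integral>\<^sup>+t. h (cis t *s x) \<partial>circ) \<partial>sigma)"
    by (rule nn_integral_sigma_rotate) measurable
  also have "\<dots> \<le> (\<integral>\<^sup>+x. ennreal C * (\<integral>\<^sup>+t. \<psi> (cis t *s x) \<partial>circ) \<partial>sigma)"
    by (intro nn_integral_mono key) simp
  also have "\<dots> = ennreal C * (\<integral>\<^sup>+x. (\<integral>\<^sup>+t. \<psi> (cis t *s x) \<partial>circ) \<partial>sigma)"
  proof (rule nn_integral_cmult)
    interpret C: sigma_finite_measure circ by (rule sigma_finite_circ)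
    show "(\<lambda>x. \<integral>\<^sup>+t. \<psi> (cis t *s x) \<partial>circ) \<in> borel_measurable sigma" by measurable
  qed
  also have "\<dots> = ennreal C * (ennreal (2 * pi) * (\<integral>\<^sup>+x. \<psi> x \<partial>sigma))"
    by (subst nn_integral_sigma_rotate) auto
  finally have "ennreal (2 * pi) * (\<integral>\<^sup>+x. h x \<partial>sigma) \<le> ennreal (2 * pi) * (ennreal C * (\<integral>\<^sup>+x. \<psi> x \<partial>sigma))"
    by (simp only: mult.left_commute)
  hence "(\<integral>\<^sup>+x. h x \<partial>sigma) \<le> ennreal C * (\<integral>\<^sup>+x. \<psi> x \<partial>sigma)"
    by (subst (asm) ennreal_mult_le_mult_iff) auto
  also have "(\<integral>\<^sup>+x. h x \<partial>sigma) = (\<integral>\<^sup>+\<zeta>. slice_pow q p (\<lambda>r. RG f ((R * r) *\<^sub>R \<zeta>)) \<partial>sigma)"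
    by (intro nn_integral_cong h_eq) simp
  also have "(\<integral>\<^sup>+x. \<psi> x \<partial>sigma) = (\<integral>\<^sup>+\<zeta>. ennreal (((cmod (f (R *\<^sub>R \<zeta>)))\<^sup>2 + e) powr (p / 2)) \<partial>sigma)"
    by (intro nn_integral_cong \<psi>_eq) simp
  finally show ?thesis .
qed

text \<open>By uniform continuity the boundary values of a dilate differ from those of
  \<open>f\<close> by less than \<open>\<eta>\<close>, and the regularisation is set to
  \<open>e = \<eta>\<^sup>2\<close>, of the same size. Fatou's lemma takes the dilates to
  \<open>f\<close>, and finally \<open>\<eta>\<close> tends to \<open>0\<close>.\<close>

theorem HF_le_Hardy:
  assumes p: "0 < p" and q: "2 \<le> q"
  shows "\<exists>K>0. \<forall>f :: complex ^ 'n \<Rightarrow> complex. holo_on (ball 0 1) f \<longrightarrow> continuous_on (cball 0 1) f \<longrightarrow>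
     HF_normp p q 0 f \<le> ennreal K * (\<integral>\<^sup>+\<zeta>. ennreal (cmod (f \<zeta>) powr p) \<partial>sigma)"
proof -
  obtain C where C0: "C > 0" and C: "\<And>F R e. F holomorphic_on ball 0 R \<Longrightarrow> 1 < R \<Longrightarrow> 0 < e \<Longrightarrow>
    (\<integral>\<^sup>+s. slice_pow q p (\<lambda>r. cmod (F (rc r s) + rc r s * deriv F (rc r s))) \<partial>circ)
      \<le> ennreal C * (\<integral>\<^sup>+s. ennreal (((cmod (F (cis s)))\<^sup>2 + e) powr (p / 2)) \<partial>circ)"
    using littlewood_paley_disc[OF p q] by blast
  have q0: "0 < q" by (rule less_le_trans[OF _ q]) simp
  \<comment> \<open>With \<open>m\<close> the maximum of \<open>cmod (f \<zeta>)\<close> and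
    \<open>\<eta>\<close>, the regularised square is at most
    \<open>4 * m\<^sup>2 + m\<^sup>2\<close>, for which \<open>8\<close> leaves room; the power
    \<open>p / 2\<close> then produces \<open>8 powr (p / 2)\<close>.\<close>
  define K where "K = C * 8 powr (p / 2)"
  have K: "0 < K" using C0 by (simp add: K_def)
  show ?thesis
  proof (intro exI[of _ K] conjI allI impI K)
    fix f :: "complex ^ 'n \<Rightarrow> complex"
    assume f: "holo_on (ball 0 1) f" and fc: "continuous_on (cball 0 1) f"
    define f1 where "f1 z = indicator (cball 0 1) z *\<^sub>R f z" for z
    have f1 [measurable]: "f1 \<in> borel_measurable borel"
      unfolding f1_def by (intro borel_measurable_continuous_on_indicator fc) auto
    define I where "I = (\<integral>\<^sup>+\<zeta>. ennreal (cmod (f \<zeta>) powr p) \<partial>sigma)"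
    have I1: "I = (\<integral>\<^sup>+\<zeta>. ennreal (cmod (f1 \<zeta>) powr p) \<partial>sigma)"
      unfolding I_def by (intro nn_integral_cong) (simp add: f1_def)
    have RG [measurable]: "RG f \<in> borel_measurable borel" by (rule RG_measurable[OF f])
    have HF: "HF_normp p q 0 f = (\<integral>\<^sup>+\<zeta>. slice_pow q p (\<lambda>r. RG f (r *\<^sub>R \<zeta>)) \<partial>sigma)"
      unfolding HF_normp_zero
      by (intro nn_integral_cong slice_pow_cong) (auto simp: RG_def)
    define R where "R n = 1 - 1 / real (Suc (Suc n))" for n
    have R: "0 < R n" "R n < 1" for n by (auto simp: R_def)
    have Rlim: "R \<longlonglongrightarrow> 1"
    proof -
      have "(\<lambda>n. 1 / real (Suc (Suc n))) \<longlonglongrightarrow> 0"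
        using LIMSEQ_Suc[OF LIMSEQ_inverse_real_of_nat] by (simp add: inverse_eq_divide)
      from tendsto_diff[OF tendsto_const this, of 1] show ?thesis by (simp add: R_def[abs_def])
    qed
    have bound: "HF_normp p q 0 f \<le> ennreal K * (I + ennreal (\<eta> powr p))" if \<eta>: "0 < \<eta>" for \<eta>
    proof -
      have "uniformly_continuous_on (cball 0 1) f" by (rule compact_uniformly_continuous[OF fc]) simp
      then obtain d where d: "0 < d" "\<And>x y. x \<in> cball 0 1 \<Longrightarrow> y \<in> cball 0 1 \<Longrightarrow> dist y x < d \<Longrightarrow> dist (f y) (f x) < \<eta>"
        by (rule uniformly_continuous_onE[OF _ \<eta>]) blast
      have ev: "eventually (\<lambda>n. 1 - d < R n) sequentially"
        by (rule order_tendstoD(1)[OF Rlim]) (use d in simp)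
      define X where "X n = (\<integral>\<^sup>+\<zeta>. slice_pow q p (\<lambda>r. RG f ((R n * r) *\<^sub>R \<zeta>)) \<partial>sigma)" for n
      have X_le: "X n \<le> ennreal K * (I + ennreal (\<eta> powr p))" if n: "1 - d < R n" for n
      proof -
        have "X n \<le> ennreal C * (\<integral>\<^sup>+\<zeta>. ennreal (((cmod (f (R n *\<^sub>R \<zeta>)))\<^sup>2 + \<eta>\<^sup>2) powr (p / 2)) \<partial>sigma)"
          unfolding X_def by (rule slice_rotate_bound[OF C f R]) (use \<eta> in auto)
        also have "\<dots> \<le> ennreal C * (\<integral>\<^sup>+\<zeta>. ennreal (8 powr (p / 2)) * (ennreal (cmod (f1 \<zeta>) powr p) + ennreal (\<eta> powr p)) \<partial>sigma)"
        proof (intro mult_left_mono nn_integral_mono)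
          fix \<zeta> :: "complex ^ 'n" assume "\<zeta> \<in> space sigma"
          hence \<zeta>: "norm \<zeta> = 1" by simp
          have "R n *\<^sub>R \<zeta> - \<zeta> = (R n - 1) *\<^sub>R \<zeta>" by (simp add: algebra_simps)
          hence "dist (R n *\<^sub>R \<zeta>) \<zeta> = 1 - R n" using R[of n] \<zeta> by (simp add: dist_norm)
          hence "dist (f (R n *\<^sub>R \<zeta>)) (f \<zeta>) < \<eta>" using n R[of n] \<zeta> by (intro d(2)) auto
          hence le: "cmod (f (R n *\<^sub>R \<zeta>)) \<le> cmod (f \<zeta>) + \<eta>"
            using norm_triangle_ineq2[of "f (R n *\<^sub>R \<zeta>)" "f \<zeta>"] by (simp add: dist_norm)
          let ?m = "max (cmod (f \<zeta>)) \<eta>"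
          have "cmod (f (R n *\<^sub>R \<zeta>)) \<le> 2 * ?m" using le by simp
          hence "(cmod (f (R n *\<^sub>R \<zeta>)))\<^sup>2 \<le> (2 * ?m)\<^sup>2" by (intro power_mono) auto
          moreover have "(2 * ?m)\<^sup>2 = 4 * ?m\<^sup>2" by (simp add: power_mult_distrib)
          moreover have "\<eta>\<^sup>2 \<le> ?m\<^sup>2" using \<eta> by (intro power_mono) auto
          ultimately have "(cmod (f (R n *\<^sub>R \<zeta>)))\<^sup>2 + \<eta>\<^sup>2 \<le> 8 * ?m\<^sup>2"
            using zero_le_power2[of ?m] by linarith
          hence "((cmod (f (R n *\<^sub>R \<zeta>)))\<^sup>2 + \<eta>\<^sup>2) powr (p / 2) \<le> (8 * ?m\<^sup>2) powr (p / 2)"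
            using p by (intro powr_mono2) auto
          also have "\<dots> = 8 powr (p / 2) * ?m powr p"
          proof -
            have "0 < ?m" using \<eta> by simp
            hence "?m\<^sup>2 = ?m powr 2" by (subst powr_numeral) auto
            thus ?thesis by (simp add: powr_mult powr_powr)
          qed
          also have "?m powr p \<le> cmod (f \<zeta>) powr p + \<eta> powr p" by (simp add: max_def)
          finally have "((cmod (f (R n *\<^sub>R \<zeta>)))\<^sup>2 + \<eta>\<^sup>2) powr (p / 2) \<le> 8 powr (p / 2) * (cmod (f \<zeta>) powr p + \<eta> powr p)"
            by (simp add: mult_left_mono)
          hence "ennreal (((cmod (f (R n *\<^sub>R \<zeta>)))\<^sup>2 + \<eta>\<^sup>2) powr (p / 2)) \<le> ennreal (8 powr (p / 2) * (cmod (f \<zeta>) powr p + \<eta> powr p))"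
            by (rule ennreal_leI)
          also have "\<dots> = ennreal (8 powr (p / 2)) * (ennreal (cmod (f1 \<zeta>) powr p) + ennreal (\<eta> powr p))"
            using \<zeta> by (simp add: f1_def ennreal_mult')
          finally show "ennreal (((cmod (f (R n *\<^sub>R \<zeta>)))\<^sup>2 + \<eta>\<^sup>2) powr (p / 2)) \<le> ennreal (8 powr (p / 2)) * (ennreal (cmod (f1 \<zeta>) powr p) + ennreal (\<eta> powr p))" .
        qed auto
        also have "\<dots> = ennreal C * (ennreal (8 powr (p / 2)) * (I + ennreal (\<eta> powr p)))"
          unfolding I1 by (subst nn_integral_cmult, measurable) (simp add: nn_integral_add emeasure_sigma_sphere)
        also have "\<dots> = ennreal K * (I + ennreal (\<eta> powr p))"
          using C0 by (simp add: K_def ennreal_mult' mult.assoc)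
        finally show ?thesis .
      qed
      have "HF_normp p q 0 f \<le> (\<integral>\<^sup>+\<zeta>. liminf (\<lambda>n. slice_pow q p (\<lambda>r. RG f ((R n * r) *\<^sub>R \<zeta>))) \<partial>sigma)"
        unfolding HF
      proof (rule nn_integral_mono)
        fix \<zeta> :: "complex ^ 'n" assume "\<zeta> \<in> space sigma"
        hence \<zeta>: "norm \<zeta> = 1" by simp
        have m: "(\<lambda>r. RG f (r *\<^sub>R \<zeta>)) \<in> borel_measurable borel" by (rule measurable_compose[OF _ RG]) simp
        show "slice_pow q p (\<lambda>r. RG f (r *\<^sub>R \<zeta>)) \<le> liminf (\<lambda>n. slice_pow q p (\<lambda>r. RG f ((R n * r) *\<^sub>R \<zeta>)))"
          by (rule slice_norm_liminf[OF RG_slice(3)[OF f \<zeta>] less_imp_le[OF R(1)] less_imp_le[OF R(2)] Rlim p q0 m])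
             (simp add: RG_def)
      qed
      also have "\<dots> \<le> liminf X" unfolding X_def
      proof (rule nn_integral_liminf)
        fix n
        have "(\<lambda>\<zeta>. epow (slice_norm_rat q (\<lambda>r. RG f ((R n * r) *\<^sub>R \<zeta>))) (if q = \<top> then p else p / enn2real q)) \<in> borel_measurable sigma"
          by (intro measurable_sigma epow_borel slice_norm_rat_measurable) measurable
        moreover have "slice_pow q p (\<lambda>r. RG f ((R n * r) *\<^sub>R \<zeta>)) = epow (slice_norm_rat q (\<lambda>r. RG f ((R n * r) *\<^sub>R \<zeta>))) (if q = \<top> then p else p / enn2real q)"
          if "\<zeta> \<in> space sigma" for \<zeta> :: "complex ^ 'n"
        proof -
          have \<zeta>: "norm \<zeta> = 1" using that by simp
          have "continuous_on {0..<1} (\<lambda>r. RG f ((R n * r) *\<^sub>R \<zeta>))"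
          proof (rule continuous_on_compose2[OF RG_slice(3)[OF f \<zeta>]])
            show "continuous_on {0..<1} (\<lambda>r. R n * r)" by (intro continuous_intros)
            show "(\<lambda>r. R n * r) ` {0..<1} \<subseteq> {0..<1}" using R[of n] mult_strict_mono[of "R n" 1 _ 1] by auto
          qed
          thus ?thesis by (simp add: slice_pow_def slice_norm_rat_eq)
        qed
        ultimately show "(\<lambda>\<zeta>::complex ^ 'n. slice_pow q p (\<lambda>r. RG f ((R n * r) *\<^sub>R \<zeta>))) \<in> borel_measurable sigma"
          by (subst measurable_cong) auto
      qed
      also have "\<dots> \<le> liminf (\<lambda>n::nat. ennreal K * (I + ennreal (\<eta> powr p)))"
        by (rule Liminf_mono) (use ev X_le in \<open>auto elim: eventually_mono\<close>)
      also have "\<dots> = ennreal K * (I + ennreal (\<eta> powr p))" by (simp add: Liminf_const)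
      finally show ?thesis .
    qed
    show "HF_normp p q 0 f \<le> ennreal K * I"
    proof (rule ennreal_le_epsilon)
      fix e :: real assume e: "0 < e"
      define \<eta> where "\<eta> = (e / K) powr (1 / p)"
      have "0 < \<eta>" using e K by (simp add: \<eta>_def)
      moreover have "\<eta> powr p = e / K" using e K p by (simp add: \<eta>_def powr_powr)
      ultimately have "HF_normp p q 0 f \<le> ennreal K * (I + ennreal (e / K))" using bound[of \<eta>] by simp
      also have "\<dots> = ennreal K * I + ennreal e"
        using e K by (simp add: distrib_left ennreal_mult'[symmetric])
      finally show "HF_normp p q 0 f \<le> ennreal K * I + ennreal e" .
    qed
  qed
qed

section \<open>Non-isotropic balls\<close>

lemma fin_borel_measurable:
  assumes "fin_borel_cball (\<mu> :: (complex ^ 'n) measure)" "f \<in> borel_measurable borel"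
  shows "f \<in> borel_measurable \<mu>"
proof -
  have "sets \<mu> = sets (restrict_space borel (cball (0::complex ^ 'n) 1))" using assms by (simp add: fin_borel_cball_def)
  moreover have "f \<in> borel_measurable (restrict_space borel (cball 0 1))" by (rule measurable_restrict_space1[OF assms(2)])
  ultimately show ?thesis using measurable_cong_sets[of \<mu> "restrict_space borel (cball 0 1)" borel borel] by simp
qed

lemma fin_borel_space: "fin_borel_cball (\<mu> :: (complex ^ 'n) measure) \<Longrightarrow> space \<mu> = cball 0 1"
  unfolding fin_borel_cball_def by (auto dest: sets_eq_imp_space_eq simp: space_restrict_space)

text \<open>Non-isotropic balls of small radius are small in the Euclidean metric, so uniform
  continuity can be used on them.\<close>

lemma norm_diff_le_cinner:
  assumes "norm (x :: complex ^ 'n) = 1" "norm y = 1"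
  shows "(norm (x - y))\<^sup>2 \<le> 2 * cmod (1 - cinner x y)"
proof -
  have "complex_of_real ((norm (x - y))\<^sup>2) = 2 - cinner x y - cnj (cinner x y)"
    unfolding cinner_self[symmetric] cinner_diff_left cinner_diff_right cinner_commute[of y x]
    using assms by (simp add: cinner_self)
  hence "(norm (x - y))\<^sup>2 = 2 * Re (1 - cinner x y)" by (simp add: complex_eq_iff)
  also have "\<dots> \<le> 2 * cmod (1 - cinner x y)" by (intro mult_left_mono complex_Re_le_cmod) auto
  finally show ?thesis .
qed

lemma cmod_one_minus_cinner_commute: "cmod (1 - cinner x y) = cmod (1 - cinner y x)"
proof -
  have "1 - cinner x y = cnj (1 - cinner y x)" using cinner_commute[of x y] by simp
  thus ?thesis by (metis complex_mod_cnj)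
qed

lemma cmod_one_plus_cinner_commute: "cmod (1 + cinner x y) = cmod (1 + cinner y x)"
proof -
  have "1 + cinner x y = cnj (1 + cinner y x)" using cinner_commute[of x y] by simp
  thus ?thesis by (metis complex_mod_cnj)
qed

lemma closed_Qball: "closed (Qball \<zeta> \<delta>)"
proof -
  have "closed (sphere 0 1 \<inter> {\<xi>. cmod (1 - cinner \<zeta> \<xi>) \<le> \<delta>})"
    by (intro closed_Int closed_Collect_le continuous_intros) auto
  thus ?thesis by (simp add: Qball_def Int_def)
qed

lemma Qball_in_sets_sigma: "Qball \<zeta> \<delta> \<in> sets sigma"
  unfolding sets_sigma sets_restrict_space using closed_Qball[of \<zeta> \<delta>]
  by (intro image_eqI[of _ _ "Qball \<zeta> \<delta>"]) (auto simp: Qball_def intro: borel_closed)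

lemma Qball_in_sets_fin:
  assumes "fin_borel_cball \<mu>" shows "Qball \<zeta> \<delta> \<in> sets \<mu>"
proof -
  have "sets \<mu> = sets (restrict_space borel (cball 0 1))" using assms by (simp add: fin_borel_cball_def)
  moreover have "Qball \<zeta> \<delta> = cball 0 1 \<inter> Qball \<zeta> \<delta>" by (auto simp: Qball_def)
  hence "Qball \<zeta> \<delta> \<in> sets (restrict_space borel (cball 0 1))"
    unfolding sets_restrict_space by (rule image_eqI) (rule borel_closed[OF closed_Qball])
  ultimately show ?thesis by simp
qed

text \<open>The centre \<open>axis undefined 1\<close> is merely some unit vector;
  \<open>emeasure_Qball\<close> shows that the choice is immaterial.\<close>

definition Qvol :: "'n::finite itself \<Rightarrow> real \<Rightarrow> real" where
  "Qvol _ \<delta> = measure sigma (Qball (axis undefined 1 :: complex ^ 'n) \<delta>)"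

lemma emeasure_Qball:
  fixes \<zeta> :: "complex ^ 'n"
  assumes \<zeta>: "norm \<zeta> = 1"
  shows "emeasure sigma (Qball \<zeta> \<delta>) = ennreal (Qvol TYPE('n) \<delta>)"
proof -
  interpret S: prob_space "sigma :: (complex ^ 'n) measure" by (rule prob_space_sigma)
  have eq: "emeasure sigma (Qball z \<delta>) = (\<integral>\<^sup>+x. indicator {w. cmod (1 - w) \<le> \<delta>} (cinner x z) \<partial>sigma)" for z :: "complex ^ 'n"
  proof -
    have "emeasure sigma (Qball z \<delta>) = (\<integral>\<^sup>+x. indicator (Qball z \<delta>) x \<partial>sigma)"
      by (simp add: Qball_in_sets_sigma)
    also have "\<dots> = (\<integral>\<^sup>+x. indicator {w. cmod (1 - w) \<le> \<delta>} (cinner x z) \<partial>sigma)"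
      by (intro nn_integral_cong) (auto simp: Qball_def cmod_one_minus_cinner_commute[of z] split: split_indicator)
    finally show ?thesis .
  qed
  have "closed {w. cmod (1 - w) \<le> \<delta>}" by (intro closed_Collect_le continuous_intros)
  hence "(indicator {w. cmod (1 - w) \<le> \<delta>} :: complex \<Rightarrow> ennreal) \<in> borel_measurable borel"
    by (intro borel_measurable_indicator borel_closed)
  from nn_integral_sigma_cinner[OF this \<zeta>, of "axis undefined 1"]
  have "emeasure sigma (Qball \<zeta> \<delta>) = emeasure sigma (Qball (axis undefined 1 :: complex ^ 'n) \<delta>)"
    unfolding eq by simp
  thus ?thesis by (simp add: Qvol_def S.emeasure_eq_measure)
qed

text \<open>Finitely many balls of radius \<open>\<delta>\<close> cover the compact sphere, and all
  of them have the same measure.\<close>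

lemma Qvol_pos:
  assumes \<delta>: "0 < \<delta>"
  shows "0 < Qvol TYPE('n::finite) \<delta>"
proof (rule ccontr)
  assume "\<not> ?thesis"
  hence Q0: "Qvol TYPE('n) \<delta> \<le> 0" by simp
  let ?U = "\<lambda>\<zeta> :: complex ^ 'n. {\<xi>. cmod (1 - cinner \<zeta> \<xi>) < \<delta>}"
  have op: "open (?U \<zeta>)" for \<zeta> by (intro open_Collect_less continuous_intros)
  have "sphere 0 1 \<subseteq> (\<Union>\<zeta>\<in>sphere 0 1. ?U \<zeta>)" using \<delta> by (auto simp: cinner_self)
  then obtain D where D: "D \<subseteq> sphere 0 1" "finite D" "sphere 0 1 \<subseteq> (\<Union>\<zeta>\<in>D. ?U \<zeta>)"
    using compactE_image[OF compact_sphere, of "sphere 0 1" ?U "0::complex ^ 'n" 1] op by metis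
  have "sphere 0 1 \<subseteq> (\<Union>\<zeta>\<in>D. Qball \<zeta> \<delta>)" using D(3) by (force simp: Qball_def)
  hence "emeasure sigma (sphere (0::complex ^ 'n) 1) \<le> emeasure sigma (\<Union>\<zeta>\<in>D. Qball \<zeta> \<delta>)"
    by (rule emeasure_mono) (use D in \<open>auto intro!: Qball_in_sets_sigma\<close>)
  also have "\<dots> \<le> (\<Sum>\<zeta>\<in>D. emeasure sigma (Qball \<zeta> \<delta>))"
    by (rule emeasure_subadditive_finite) (use D in \<open>auto intro!: Qball_in_sets_sigma\<close>)
  also have "\<dots> = (\<Sum>\<zeta>\<in>D. 0)"
    using D Q0 by (intro sum.cong refl) (auto simp: emeasure_Qball ennreal_neg)
  finally show False by (simp add: emeasure_sigma_sphere)
qed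

text \<open>Balls of radius \<open>\<delta>\<close> all have the same measure \<open>v\<close>, and
  membership is symmetric in point and centre. Fubini's theorem therefore moves the average from
  \<open>sigma\<close> to \<open>\<mu>\<close>, the factor \<open>v\<close> cancels, and replacing
  \<open>h0 \<zeta>\<close> by \<open>h0 z\<close> costs at most \<open>\<eta>\<close>.\<close>

lemma sphere_measure_lower_bound:
  fixes \<mu> :: "(complex ^ 'n) measure" and h :: "complex ^ 'n \<Rightarrow> real"
  assumes \<mu>: "fin_borel_cball \<mu>" and c: "0 < c"
    and Q: "\<And>\<zeta> \<delta>. \<zeta> \<in> sphere 0 1 \<Longrightarrow> 0 < \<delta> \<Longrightarrow> ennreal c * emeasure sigma (Qball \<zeta> \<delta>) \<le> emeasure \<mu> (Qball \<zeta> \<delta>)"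
    and h: "continuous_on (sphere 0 1) h" and hnn: "\<And>z. 0 \<le> h z"
  shows "ennreal c * (\<integral>\<^sup>+z. ennreal (h z) \<partial>sigma) \<le> (\<integral>\<^sup>+z. ennreal (h z) \<partial>\<mu>)"
proof -
  interpret S: prob_space "sigma :: (complex ^ 'n) measure" by (rule prob_space_sigma)
  interpret M: finite_measure \<mu> using \<mu> by (simp add: fin_borel_cball_def)
  interpret pair_sigma_finite "sigma :: (complex ^ 'n) measure" \<mu> by unfold_locales
  have id [measurable]: "(\<lambda>x. x) \<in> borel_measurable \<mu>" by (rule fin_borel_measurable[OF \<mu>]) simp
  define h0 where "h0 z = indicator (sphere 0 1) z *\<^sub>R h z" for z
  have [measurable]: "h0 \<in> borel_measurable borel"
    unfolding h0_def by (intro borel_measurable_continuous_on_indicator h) auto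
  have h0nn: "0 \<le> h0 z" for z using hnn by (simp add: h0_def)
  have h0m [measurable]: "h0 \<in> borel_measurable \<mu>" by (rule fin_borel_measurable[OF \<mu>]) simp
  have sph: "closed (sphere (0::complex ^ 'n) 1)" by simp
  have Sm: "sphere (0::complex ^ 'n) 1 \<in> sets \<mu>"
  proof -
    have "sphere 0 1 = cball (0::complex ^ 'n) 1 \<inter> sphere 0 1" by auto
    hence "sphere (0::complex ^ 'n) 1 \<in> sets (restrict_space borel (cball 0 1))"
      unfolding sets_restrict_space by (rule image_eqI) (rule borel_closed[OF sph])
    thus ?thesis using \<mu> by (simp add: fin_borel_cball_def)
  qed
  have main: "ennreal c * (\<integral>\<^sup>+z. ennreal (h0 z) \<partial>sigma) \<le> (\<integral>\<^sup>+z. ennreal (h0 z) \<partial>\<mu>) + ennreal \<eta> * emeasure \<mu> (sphere 0 1)" if \<eta>: "0 < \<eta>" for \<eta>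
  proof -
    have "uniformly_continuous_on (sphere 0 1) h" by (rule compact_uniformly_continuous[OF h]) simp
    then obtain d where d: "0 < d" "\<And>x y. x \<in> sphere 0 1 \<Longrightarrow> y \<in> sphere 0 1 \<Longrightarrow> dist y x < d \<Longrightarrow> dist (h y) (h x) < \<eta>"
      by (rule uniformly_continuous_onE[OF _ \<eta>]) blast
    \<comment> \<open>By \<open>norm_diff_le_cinner\<close>, points in a common ball then satisfy
      \<open>(norm (\<zeta> - z))\<^sup>2 \<le> 2 * \<delta> < d\<^sup>2\<close>.\<close>
    define \<delta> where "\<delta> = d\<^sup>2 / 4"
    have \<delta>: "0 < \<delta>" using d by (simp add: \<delta>_def)
    define v where "v = ennreal (Qvol TYPE('n) \<delta>)"
    have v0: "v \<noteq> 0" "v \<noteq> \<top>" using Qvol_pos[OF \<delta>, where 'n='n] by (auto simp: v_def)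
    let ?I = "\<lambda>\<zeta> z. if norm z = 1 \<and> cmod (1 - cinner \<zeta> z) \<le> \<delta> then 1 else (0::ennreal)"
    have near: "h0 \<zeta> \<le> h0 z + \<eta>" if "norm \<zeta> = 1" "norm z = 1" "cmod (1 - cinner \<zeta> z) \<le> \<delta>" for \<zeta> z
    proof -
      have "(norm (\<zeta> - z))\<^sup>2 \<le> 2 * \<delta>" using norm_diff_le_cinner[of \<zeta> z] that by simp
      also have "\<dots> < d\<^sup>2" using d by (simp add: \<delta>_def)
      finally have "norm (\<zeta> - z) < d" using d by (simp add: power2_less_imp_less)
      hence "dist (h \<zeta>) (h z) < \<eta>" using that by (intro d(2)) (auto simp: dist_norm)
      thus ?thesis using that by (simp add: h0_def dist_real_def)
    qed
    have "v * (ennreal c * (\<integral>\<^sup>+z. ennreal (h0 z) \<partial>sigma)) = (\<integral>\<^sup>+\<zeta>. ennreal (h0 \<zeta>) * (ennreal c * v) \<partial>sigma)"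
      by (subst nn_integral_multc) (auto simp: mult_ac)
    also have "\<dots> \<le> (\<integral>\<^sup>+\<zeta>. (\<integral>\<^sup>+z. ennreal (h0 \<zeta>) * ?I \<zeta> z \<partial>\<mu>) \<partial>sigma)"
    proof (rule nn_integral_mono)
      fix \<zeta> :: "complex ^ 'n" assume "\<zeta> \<in> space sigma"
      hence \<zeta>: "norm \<zeta> = 1" by simp
      have "ennreal c * v \<le> emeasure \<mu> (Qball \<zeta> \<delta>)" using Q[of \<zeta> \<delta>] \<zeta> \<delta> by (simp add: emeasure_Qball v_def)
      also have "\<dots> = (\<integral>\<^sup>+z. indicator (Qball \<zeta> \<delta>) z \<partial>\<mu>)" using Qball_in_sets_fin[OF \<mu>] by simp
      also have "\<dots> = (\<integral>\<^sup>+z. ?I \<zeta> z \<partial>\<mu>)" by (intro nn_integral_cong) (auto simp: Qball_def indicator_def)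
      finally have "ennreal (h0 \<zeta>) * (ennreal c * v) \<le> ennreal (h0 \<zeta>) * (\<integral>\<^sup>+z. ?I \<zeta> z \<partial>\<mu>)" by (rule mult_left_mono) simp
      also have "\<dots> = (\<integral>\<^sup>+z. ennreal (h0 \<zeta>) * ?I \<zeta> z \<partial>\<mu>)" by (rule nn_integral_cmult[symmetric]) measurable
      finally show "ennreal (h0 \<zeta>) * (ennreal c * v) \<le> (\<integral>\<^sup>+z. ennreal (h0 \<zeta>) * ?I \<zeta> z \<partial>\<mu>)" .
    qed
    also have "\<dots> = (\<integral>\<^sup>+z. (\<integral>\<^sup>+\<zeta>. ennreal (h0 \<zeta>) * ?I \<zeta> z \<partial>sigma) \<partial>\<mu>)"
      by (rule Fubini'[symmetric]) measurable
    also have "\<dots> \<le> (\<integral>\<^sup>+z. (ennreal (h0 z) + ennreal \<eta> * indicator (sphere 0 1) z) * v \<partial>\<mu>)"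
    proof (rule nn_integral_mono)
      fix z
      have "(\<integral>\<^sup>+\<zeta>. ennreal (h0 \<zeta>) * ?I \<zeta> z \<partial>sigma) \<le> (\<integral>\<^sup>+\<zeta>. (ennreal (h0 z) + ennreal \<eta> * indicator (sphere 0 1) z) * indicator (Qball z \<delta>) \<zeta> \<partial>sigma)"
      proof (rule nn_integral_mono)
        fix \<zeta> :: "complex ^ 'n" assume "\<zeta> \<in> space sigma"
        hence \<zeta>: "norm \<zeta> = 1" by simp
        show "ennreal (h0 \<zeta>) * ?I \<zeta> z \<le> (ennreal (h0 z) + ennreal \<eta> * indicator (sphere 0 1) z) * indicator (Qball z \<delta>) \<zeta>"
        proof (cases "norm z = 1 \<and> cmod (1 - cinner \<zeta> z) \<le> \<delta>")
          case True
          hence "ennreal (h0 \<zeta>) \<le> ennreal (h0 z + \<eta>)" using near[OF \<zeta>] by (intro ennreal_leI) auto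
          also have "\<dots> = ennreal (h0 z) + ennreal \<eta>" using h0nn \<eta> by (intro ennreal_plus) auto
          finally show ?thesis using True \<zeta> by (simp add: Qball_def cmod_one_minus_cinner_commute[of z])
        next
          case False
          thus ?thesis by (simp only: if_False) simp
        qed
      qed
      also have "\<dots> \<le> (ennreal (h0 z) + ennreal \<eta> * indicator (sphere 0 1) z) * v"
      proof (cases "norm z = 1")
        case True
        thus ?thesis by (subst nn_integral_cmult_indicator) (auto simp: Qball_in_sets_sigma emeasure_Qball v_def)
      next
        case False
        thus ?thesis by (simp add: h0_def)
      qed
      finally show "(\<integral>\<^sup>+\<zeta>. ennreal (h0 \<zeta>) * ?I \<zeta> z \<partial>sigma) \<le> (ennreal (h0 z) + ennreal \<eta> * indicator (sphere 0 1) z) * v" .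
    qed
    also have "\<dots> = v * ((\<integral>\<^sup>+z. ennreal (h0 z) \<partial>\<mu>) + ennreal \<eta> * emeasure \<mu> (sphere 0 1))"
      using Sm by (simp add: nn_integral_multc nn_integral_add nn_integral_cmult mult.commute)
    finally show ?thesis using v0 by (subst (asm) ennreal_mult_le_mult_iff) auto
  qed
  have fin: "emeasure \<mu> (sphere 0 1) = ennreal (measure \<mu> (sphere 0 1))" by (rule M.emeasure_eq_measure)
  have "ennreal c * (\<integral>\<^sup>+z. ennreal (h0 z) \<partial>sigma) \<le> (\<integral>\<^sup>+z. ennreal (h0 z) \<partial>\<mu>)"
  proof (rule ennreal_le_epsilon)
    fix e :: real assume e: "0 < e"
    let ?m = "measure \<mu> (sphere 0 1)"
    have m0: "0 \<le> ?m" by (rule measure_nonneg)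
    have "ennreal (e / (?m + 1)) * ennreal ?m = ennreal (e / (?m + 1) * ?m)"
      using e m0 by (intro ennreal_mult[symmetric] divide_nonneg_nonneg) linarith+
    also have "\<dots> \<le> ennreal e"
    proof (rule ennreal_leI)
      have "e / (?m + 1) * ?m = e * (?m / (?m + 1))" by simp
      also have "\<dots> \<le> e * 1"
      proof (rule mult_left_mono)
        have "0 < ?m + 1" using m0 by linarith
        thus "?m / (?m + 1) \<le> 1" by (simp only: divide_le_eq_1_pos)
      qed (use e in simp)
      finally show "e / (?m + 1) * ?m \<le> e" by simp
    qed
    finally have "ennreal (e / (?m + 1)) * ennreal ?m \<le> ennreal e" .
    moreover have "0 < e / (?m + 1)" using e m0 by (intro divide_pos_pos) linarith+
    ultimately show "ennreal c * (\<integral>\<^sup>+z. ennreal (h0 z) \<partial>sigma) \<le> (\<integral>\<^sup>+z. ennreal (h0 z) \<partial>\<mu>) + ennreal e"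
      using main[of "e / (?m + 1)"] unfolding fin by (meson add_left_mono order.trans)
  qed
  also have "(\<integral>\<^sup>+z. ennreal (h0 z) \<partial>\<mu>) \<le> (\<integral>\<^sup>+z. ennreal (h z) \<partial>\<mu>)"
    using hnn by (intro nn_integral_mono ennreal_leI) (auto simp: h0_def split: split_indicator)
  also have "(\<integral>\<^sup>+z. ennreal (h0 z) \<partial>sigma) = (\<integral>\<^sup>+z. ennreal (h z) \<partial>sigma)"
    by (intro nn_integral_cong) (simp add: h0_def)
  finally show ?thesis .
qed

theorem reverse_carleson_if_Qball_bound:
  fixes \<mu> :: "(complex ^ 'n) measure"
  assumes p: "0 < p" and q: "2 \<le> q" and \<mu>: "fin_borel_cball \<mu>" and c: "0 < c"
    and Q: "\<And>\<zeta> \<delta>. \<zeta> \<in> sphere 0 1 \<Longrightarrow> 0 < \<delta> \<Longrightarrow> ennreal c * emeasure sigma (Qball \<zeta> \<delta>) \<le> emeasure \<mu> (Qball \<zeta> \<delta>)"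
  shows "reverse_carleson p q 0 \<mu>"
proof -
  obtain K where K: "0 < K" "\<And>f :: complex ^ 'n \<Rightarrow> complex. holo_on (ball 0 1) f \<Longrightarrow> continuous_on (cball 0 1) f \<Longrightarrow>
     HF_normp p q 0 f \<le> ennreal K * (\<integral>\<^sup>+\<zeta>. ennreal (cmod (f \<zeta>) powr p) \<partial>sigma)"
    using HF_le_Hardy[OF p q] by blast
  show ?thesis unfolding reverse_carleson_def
  proof (intro exI[of _ "K / c"] conjI allI impI)
    show "0 < K / c" using K c by simp
    fix f :: "complex ^ 'n \<Rightarrow> complex"
    assume f: "holo_on (ball 0 1) f \<and> continuous_on (cball 0 1) f \<and> HF_normp p q 0 f < \<top>"
    have "continuous_on (sphere 0 1) (\<lambda>z. cmod (f z) powr p)"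
      using p f by (intro continuous_on_powr' continuous_on_norm continuous_on_const) (auto elim: continuous_on_subset)
    from sphere_measure_lower_bound[OF \<mu> c Q this]
    have b: "ennreal c * (\<integral>\<^sup>+z. ennreal (cmod (f z) powr p) \<partial>sigma) \<le> (\<integral>\<^sup>+z. ennreal (cmod (f z) powr p) \<partial>\<mu>)" by simp
    have "HF_normp p q 0 f \<le> ennreal K * (\<integral>\<^sup>+\<zeta>. ennreal (cmod (f \<zeta>) powr p) \<partial>sigma)" using K(2) f by blast
    also have "ennreal K = ennreal (K / c) * ennreal c" using K c by (subst ennreal_mult[symmetric]) auto
    also have "ennreal (K / c) * ennreal c * (\<integral>\<^sup>+\<zeta>. ennreal (cmod (f \<zeta>) powr p) \<partial>sigma) \<le> ennreal (K / c) * (\<integral>\<^sup>+z. ennreal (cmod (f z) powr p) \<partial>\<mu>)"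
      unfolding mult.assoc by (intro mult_left_mono b) auto
    finally show "HF_normp p q 0 f \<le> ennreal (K / c) * (\<integral>\<^sup>+z. ennreal (cmod (f z) powr p) \<partial>\<mu>)" .
  qed
qed

section \<open>Peaking functions\<close>

definition wslice :: "ennreal \<Rightarrow> real \<Rightarrow> real \<Rightarrow> (real \<Rightarrow> real) \<Rightarrow> ennreal" where
  "wslice q p \<tau> h = (if q = \<top> then epow (SUP r\<in>{0..<1}. ennreal (h r * (1 - r\<^sup>2) powr \<tau>)) p
     else epow (\<integral>\<^sup>+r\<in>{0..<1}. ennreal (h r powr enn2real q * (1 - r\<^sup>2) powr (\<tau> * enn2real q - 1)) \<partial>lborel) (p / enn2real q))"

lemma HF_normp_wslice:
  "HF_normp p q s f = (\<integral>\<^sup>+\<zeta>. wslice q p (real (splus s) - s) (\<lambda>r. cmod (IR_pow (splus s) f (r *\<^sub>R \<zeta>))) \<partial>sigma)"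
  unfolding HF_normp_def wslice_def Let_def by (cases "q = \<top>") simp_all

lemma splus_gt: "0 \<le> s \<Longrightarrow> s < real (splus s)"
  unfolding splus_def by linarith

lemma epow_ennreal: "0 \<le> y \<Longrightarrow> epow (ennreal y) c = ennreal (y powr c)"
  by (simp add: epow_def)

definition wslice_const :: "ennreal \<Rightarrow> real \<Rightarrow> real" where
  "wslice_const q p = (if q = \<top> then 1 else (1/4) powr (p / enn2real q))"

lemma wslice_const_pos: "0 < wslice_const q p" by (simp add: wslice_const_def)

text \<open>Radii with \<open>1 - r\<close> between \<open>1 / n\<close> and \<open>2 / n\<close>,
  the natural scale for degree \<open>n\<close>, already give the bound. There the weight is at
  least \<open>real n powr (- \<tau> * Q) * (real n / 4)\<close>, with \<open>Q\<close> the real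
  value of \<open>q\<close>, and the interval has length \<open>1 / n\<close>, which leaves the
  \<open>1/4\<close> in \<open>wslice_const\<close>.\<close>

lemma wslice_ge:
  assumes n: "4 \<le> n" and H: "0 \<le> H" and \<tau>: "0 < \<tau>" and p: "0 < p" and q: "0 < q"
    and h: "\<And>r. 1 - 2 / real n \<le> r \<Longrightarrow> r \<le> 1 - 1 / real n \<Longrightarrow> H \<le> h r"
  shows "ennreal (wslice_const q p * (H * real n powr (-\<tau>)) powr p) \<le> wslice q p \<tau> h"
proof -
  have n0: "0 < real n" using n by simp
  have rn: "0 \<le> r" "r < 1" "1 / real n \<le> 1 - r\<^sup>2" "1 - r\<^sup>2 \<le> 4 / real n"
    if r: "1 - 2 / real n \<le> r" "r \<le> 1 - 1 / real n" for r
  proof -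
    have "2 / real n \<le> 1/2" using n by (simp add: divide_le_eq)
    thus r0: "0 \<le> r" using r by simp
    have "0 < 1 / real n" using n0 by simp
    thus r1: "r < 1" using r by linarith
    have e: "1 - r\<^sup>2 = (1 - r) * (1 + r)" by (simp add: power2_eq_square algebra_simps)
    have "(1 - r) * 1 \<le> (1 - r) * (1 + r)" "(1 - r) * (1 + r) \<le> (1 - r) * 2"
      using r0 r1 by (intro mult_left_mono; simp)+
    moreover have "(1 - r) * 2 \<le> 2 / real n * 2" using r by (intro mult_right_mono) auto
    moreover have "1 / real n \<le> (1 - r) * 1" using r by simp
    ultimately show "1 / real n \<le> 1 - r\<^sup>2" "1 - r\<^sup>2 \<le> 4 / real n" unfolding e by (simp_all del: mult_1_right)
  qed
  have pw: "real n powr (-\<tau>) \<le> (1 - r\<^sup>2) powr \<tau>" if r: "1 - 2 / real n \<le> r" "r \<le> 1 - 1 / real n" for r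
  proof -
    have "real n powr (-\<tau>) = (1 / real n) powr \<tau>" using n0 by (simp add: powr_minus_divide powr_divide)
    also have "\<dots> \<le> (1 - r\<^sup>2) powr \<tau>" using rn(3)[OF r] n0 \<tau> by (intro powr_mono2) auto
    finally show ?thesis .
  qed
  show ?thesis
  proof (cases "q = \<top>")
    case True
    define r where "r = 1 - 1 / real n"
    have r: "1 - 2 / real n \<le> r" "r \<le> 1 - 1 / real n" using n0 by (auto simp: r_def divide_right_mono)
    have "H * real n powr (-\<tau>) \<le> h r * (1 - r\<^sup>2) powr \<tau>"
      using h[OF r] pw[OF r] H by (intro mult_mono) auto
    hence "ennreal (H * real n powr (-\<tau>)) \<le> ennreal (h r * (1 - r\<^sup>2) powr \<tau>)" by (rule ennreal_leI)
    also have "\<dots> \<le> (SUP r\<in>{0..<1}. ennreal (h r * (1 - r\<^sup>2) powr \<tau>))"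
      using rn[OF r] by (intro SUP_upper) auto
    finally have "epow (ennreal (H * real n powr (-\<tau>))) p \<le> epow (SUP r\<in>{0..<1}. ennreal (h r * (1 - r\<^sup>2) powr \<tau>)) p"
      using p by (intro epow_mono) auto
    thus ?thesis using True H by (simp add: wslice_def wslice_const_def epow_ennreal)
  next
    case False
    define Q where "Q = enn2real q"
    have Q: "0 < Q" using q False by (simp add: Q_def enn2real_positive_iff less_top)
    let ?I = "{1 - 2 / real n..1 - 1 / real n}"
    let ?y = "(H * real n powr (-\<tau>)) powr Q"
    have "ennreal (?y / 4) = ennreal (?y * (real n / 4)) * ennreal (1 / real n)"
      using n0 by (subst ennreal_mult[symmetric]) auto
    also have "\<dots> = (\<integral>\<^sup>+r. ennreal (?y * (real n / 4)) * indicator ?I r \<partial>lborel)"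
      using n0 by (subst nn_integral_cmult_indicator) (auto simp: divide_right_mono diff_divide_distrib[symmetric])
    also have "\<dots> \<le> (\<integral>\<^sup>+r\<in>{0..<1}. ennreal (h r powr Q * (1 - r\<^sup>2) powr (\<tau> * Q - 1)) \<partial>lborel)"
    proof (rule nn_integral_mono)
      fix r :: real
      show "ennreal (?y * (real n / 4)) * indicator ?I r \<le> ennreal (h r powr Q * (1 - r\<^sup>2) powr (\<tau> * Q - 1)) * indicator {0..<1} r"
      proof (cases "r \<in> ?I")
        case True
        hence r: "1 - 2 / real n \<le> r" "r \<le> 1 - 1 / real n" by auto
        note x = rn[OF r]
        have x0: "0 < 1 - r\<^sup>2" using x(3) n0 less_le_trans[of 0 "1 / real n" "1 - r\<^sup>2"] by simp
        have "?y * (real n / 4) = H powr Q * ((real n powr (-\<tau>)) powr Q * (real n / 4))"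
          using H by (simp add: powr_mult)
        also have "\<dots> \<le> h r powr Q * (((1 - r\<^sup>2) powr \<tau>) powr Q * (1 / (1 - r\<^sup>2)))"
        proof (intro mult_mono)
          show "H powr Q \<le> h r powr Q" using h[OF r] H Q by (intro powr_mono2) auto
          show "(real n powr (-\<tau>)) powr Q \<le> ((1 - r\<^sup>2) powr \<tau>) powr Q" using pw[OF r] Q by (intro powr_mono2) auto
          show "real n / 4 \<le> 1 / (1 - r\<^sup>2)" using x(4) x0 n0 by (simp add: field_simps)
        qed (use n0 x0 in auto)
        also have "((1 - r\<^sup>2) powr \<tau>) powr Q * (1 / (1 - r\<^sup>2)) = (1 - r\<^sup>2) powr (\<tau> * Q - 1)"
          using x0 by (simp add: powr_powr powr_diff)
        finally show ?thesis using True x by (simp add: ennreal_leI)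
      qed simp
    qed
    finally have "epow (ennreal (?y / 4)) (p / Q) \<le> wslice q p \<tau> h"
      using False p Q unfolding wslice_def Q_def by (auto intro!: epow_mono)
    moreover have "(?y / 4) powr (p / Q) = wslice_const q p * (H * real n powr (-\<tau>)) powr p"
    proof -
      have "(?y / 4) powr (p / Q) = (1/4 * ?y) powr (p / Q)" by simp
      also have "\<dots> = (1/4) powr (p / Q) * ?y powr (p / Q)" by (rule powr_mult)
      also have "?y powr (p / Q) = (H * real n powr (-\<tau>)) powr p" using Q by (simp add: powr_powr)
      finally show ?thesis using False by (simp add: wslice_const_def Q_def)
    qed
    ultimately show ?thesis by (simp add: epow_ennreal)
  qed
qed

text \<open>Since \<open>1 - r \<le> 1 - r\<^sup>2 \<le> 1\<close>, the integrand is at most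
  \<open>1\<close> or at most \<open>(1 - r) powr (b - 1)\<close>, according to the sign of
  \<open>b - 1\<close>.\<close>

lemma nn_integral_one_minus_powr:
  assumes b: "0 < b"
  shows "(\<integral>\<^sup>+r\<in>{0..<1}. ennreal ((1 - r\<^sup>2) powr (b - 1)) \<partial>lborel) \<le> ennreal (1 + 1 / b)"
proof -
  let ?f = "\<lambda>x. ennreal (x powr (b - 1)) * indicator {0..1} x"
  have "((\<lambda>x. x powr (b - 1)) has_integral (1 powr (b - 1 + 1) / (b - 1 + 1))) {0..1}"
    by (rule has_integral_powr_from_0) (use b in auto)
  hence I: "(\<integral>\<^sup>+x. ?f x \<partial>lborel) = ennreal (1 / b)"
    by (intro nn_integral_has_integral_lebesgue') auto
  have fm: "?f \<in> borel_measurable borel" by measurable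
  have "(\<integral>\<^sup>+x. ?f x \<partial>lborel) = ennreal \<bar>-1\<bar> * (\<integral>\<^sup>+x. ?f (1 + -1 * x) \<partial>lborel)"
    by (rule nn_integral_real_affine[OF fm]) simp
  hence I': "(\<integral>\<^sup>+x. ?f (1 - x) \<partial>lborel) = ennreal (1 / b)" using I by simp
  have fm': "(\<lambda>x. ?f (1 - x)) \<in> borel_measurable borel" by (rule measurable_compose[OF _ fm]) simp
  have "(\<integral>\<^sup>+r\<in>{0..<1}. ennreal ((1 - r\<^sup>2) powr (b - 1)) \<partial>lborel) \<le> (\<integral>\<^sup>+r. indicator {0..1} r + ?f (1 - r) \<partial>lborel)"
  proof (rule nn_integral_mono)
    fix r :: real
    show "ennreal ((1 - r\<^sup>2) powr (b - 1)) * indicator {0..<1} r \<le> indicator {0..1} r + ?f (1 - r)"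
    proof (cases "r \<in> {0..<1}")
      case True
      hence r: "0 \<le> r" "r < 1" by auto
      have x: "1 - r \<le> 1 - r\<^sup>2" "1 - r\<^sup>2 \<le> 1" using r by (auto simp: power2_eq_square mult_left_le)
      have "(1 - r\<^sup>2) powr (b - 1) \<le> 1 + (1 - r) powr (b - 1)"
      proof (cases "1 \<le> b")
        case True
        have "(1 - r\<^sup>2) powr (b - 1) \<le> 1 powr (b - 1)" using x r True by (intro powr_mono2) auto
        thus ?thesis by (simp add: add_increasing2)
      next
        case False
        have "(1 - r\<^sup>2) powr (b - 1) \<le> (1 - r) powr (b - 1)" using x r False by (intro powr_mono2') auto
        thus ?thesis by simp
      qed
      hence "ennreal ((1 - r\<^sup>2) powr (b - 1)) \<le> ennreal (1 + (1 - r) powr (b - 1))" by (rule ennreal_leI)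
      thus ?thesis using True by simp
    qed simp
  qed
  also have "\<dots> = (\<integral>\<^sup>+r. indicator {0..1::real} r \<partial>lborel) + (\<integral>\<^sup>+r. ?f (1 - r) \<partial>lborel)"
    by (rule nn_integral_add) (simp, subst measurable_cong_sets[OF sets_lborel refl], rule fm')
  also have "\<dots> = ennreal (1 + 1 / b)" unfolding I' using b by simp
  finally show ?thesis .
qed

text \<open>It makes the test functions admissible in \<open>reverse_carleson\<close>: the weight is
  integrable because \<open>real (splus s) - s > 0\<close>.\<close>

lemma HF_normp_finite:
  assumes p: "0 < p" and q: "0 < q" and s: "0 \<le> s" and M: "\<And>z. z \<in> ball 0 1 \<Longrightarrow> cmod (IR_pow (splus s) f z) \<le> M"
  shows "HF_normp p q s (f :: complex ^ 'n \<Rightarrow> complex) < \<top>"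
proof -
  define \<tau> where "\<tau> = real (splus s) - s"
  have \<tau>: "0 < \<tau>" using splus_gt[OF s] by (simp add: \<tau>_def)
  have M0: "0 \<le> M" using order.trans[OF norm_ge_zero M[of 0]] by simp
  have "\<exists>B. \<forall>\<zeta>. norm \<zeta> = 1 \<longrightarrow> wslice q p \<tau> (\<lambda>r. cmod (IR_pow (splus s) f (r *\<^sub>R \<zeta>))) \<le> ennreal B"
  proof (cases "q = \<top>")
    case True
    have "wslice q p \<tau> (\<lambda>r. cmod (IR_pow (splus s) f (r *\<^sub>R \<zeta>))) \<le> ennreal (M powr p)" if \<zeta>: "norm \<zeta> = 1" for \<zeta>
      unfolding wslice_def True if_P[OF refl]
    proof (intro epow_le_ennreal SUP_least ennreal_leI)
      fix r :: real assume r: "r \<in> {0..<1}"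
      have "(1 - r\<^sup>2) powr \<tau> \<le> 1 powr \<tau>" using r \<tau> by (intro powr_mono2) (auto simp: abs_square_le_1)
      hence "cmod (IR_pow (splus s) f (r *\<^sub>R \<zeta>)) * (1 - r\<^sup>2) powr \<tau> \<le> M * 1"
        using r \<zeta> M0 by (intro mult_mono M) auto
      thus "cmod (IR_pow (splus s) f (r *\<^sub>R \<zeta>)) * (1 - r\<^sup>2) powr \<tau> \<le> M" by simp
    qed (use M0 p in auto)
    thus ?thesis by blast
  next
    case False
    define Q where "Q = enn2real q"
    have Q: "0 < Q" using q False by (simp add: Q_def enn2real_positive_iff less_top)
    have "wslice q p \<tau> (\<lambda>r. cmod (IR_pow (splus s) f (r *\<^sub>R \<zeta>))) \<le> ennreal ((M powr Q * (1 + 1 / (\<tau> * Q))) powr (p / Q))" if \<zeta>: "norm \<zeta> = 1" for \<zeta>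
    proof -
      have "(\<integral>\<^sup>+r\<in>{0..<1}. ennreal (cmod (IR_pow (splus s) f (r *\<^sub>R \<zeta>)) powr Q * (1 - r\<^sup>2) powr (\<tau> * Q - 1)) \<partial>lborel)
        \<le> (\<integral>\<^sup>+r. ennreal (M powr Q) * (ennreal ((1 - r\<^sup>2) powr (\<tau> * Q - 1)) * indicator {0..<1} r) \<partial>lborel)"
      proof (rule nn_integral_mono)
        fix r :: real
        show "ennreal (cmod (IR_pow (splus s) f (r *\<^sub>R \<zeta>)) powr Q * (1 - r\<^sup>2) powr (\<tau> * Q - 1)) * indicator {0..<1} r
          \<le> ennreal (M powr Q) * (ennreal ((1 - r\<^sup>2) powr (\<tau> * Q - 1)) * indicator {0..<1} r)"
        proof (cases "r \<in> {0..<1}")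
          case True
          have "cmod (IR_pow (splus s) f (r *\<^sub>R \<zeta>)) powr Q \<le> M powr Q"
            using True \<zeta> Q by (intro powr_mono2 M) auto
          hence "cmod (IR_pow (splus s) f (r *\<^sub>R \<zeta>)) powr Q * (1 - r\<^sup>2) powr (\<tau> * Q - 1) \<le> M powr Q * (1 - r\<^sup>2) powr (\<tau> * Q - 1)"
            by (intro mult_right_mono) auto
          thus ?thesis using True by (simp add: ennreal_leI ennreal_mult'[symmetric])
        qed simp
      qed
      also have "\<dots> = ennreal (M powr Q) * (\<integral>\<^sup>+r\<in>{0..<1}. ennreal ((1 - r\<^sup>2) powr (\<tau> * Q - 1)) \<partial>lborel)"
        by (rule nn_integral_cmult) simp
      also have "\<dots> \<le> ennreal (M powr Q) * ennreal (1 + 1 / (\<tau> * Q))"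
        using \<tau> Q by (intro mult_left_mono nn_integral_one_minus_powr) auto
      also have "\<dots> = ennreal (M powr Q * (1 + 1 / (\<tau> * Q)))" using \<tau> Q by (intro ennreal_mult[symmetric]) auto
      finally have "epow (\<integral>\<^sup>+r\<in>{0..<1}. ennreal (cmod (IR_pow (splus s) f (r *\<^sub>R \<zeta>)) powr Q * (1 - r\<^sup>2) powr (\<tau> * Q - 1)) \<partial>lborel) (p / Q)
         \<le> ennreal ((M powr Q * (1 + 1 / (\<tau> * Q))) powr (p / Q))"
        by (rule epow_le_ennreal) (use \<tau> Q p in auto)
      thus ?thesis using False by (simp add: wslice_def Q_def)
    qed
    thus ?thesis by blast
  qed
  then obtain B where B: "\<And>\<zeta>. norm \<zeta> = 1 \<Longrightarrow> wslice q p \<tau> (\<lambda>r. cmod (IR_pow (splus s) f (r *\<^sub>R \<zeta>))) \<le> ennreal B" by blast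
  have "HF_normp p q s f \<le> (\<integral>\<^sup>+\<zeta>. ennreal B \<partial>(sigma :: (complex ^ 'n) measure))"
    unfolding HF_normp_wslice \<tau>_def[symmetric] by (intro nn_integral_mono B) simp
  also have "\<dots> < \<top>" by (simp add: emeasure_sigma_sphere)
  finally show ?thesis .
qed

text \<open>At the radii used in \<open>wslice_ge\<close>, passing from the sphere to the interior
  costs a homogeneous polynomial of degree \<open>n\<close> only a constant factor. The exponent
  comes from \<open>1 / r - 1 \<le> 4 / real n\<close>.\<close>

lemma power_near_one:
  assumes n: "4 \<le> n" and r: "1 - 2 / real n \<le> r" "r \<le> 1"
  shows "exp (-4) \<le> r ^ n"
proof -
  have n0: "0 < real n" using n by simp
  have "2 / real n \<le> 1/2" using n by (simp add: divide_le_eq)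
  hence r2: "1/2 \<le> r" using r by simp
  have "1 / r - 1 = (1 - r) / r" using r2 by (simp add: field_simps)
  also have "\<dots> \<le> (2 / real n) / (1/2)" using r r2 n0 by (intro frac_le) auto
  finally have d: "1 / r - 1 \<le> 4 / real n" by simp
  have "1 / r \<le> exp (1 / r - 1)" using exp_ge_add_one_self[of "1 / r - 1"] by simp
  also have "\<dots> \<le> exp (4 / real n)" using d by simp
  finally have "(1 / r) ^ n \<le> exp (4 / real n) ^ n" using r2 by (intro power_mono) auto
  also have "\<dots> = exp 4" using n0 by (simp add: exp_of_nat_mult[symmetric])
  finally have "1 / exp 4 \<le> 1 / (1 / r) ^ n" using r2 by (intro divide_left_mono) auto
  thus ?thesis using r2 by (simp add: exp_minus inverse_eq_divide power_one_over)
qed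

section \<open>Peak polynomials and their mass\<close>

definition peak :: "nat \<Rightarrow> complex ^ 'n \<Rightarrow> complex ^ 'n \<Rightarrow> complex" where
  "peak n \<eta> z = ((1 + cinner z \<eta>) / 2) ^ n"

lemma peak_deriv:
  fixes \<eta> :: "complex ^ 'n"
  shows "((\<lambda>z. peak n \<eta> z) has_derivative (\<lambda>h. of_nat n * ((1 + cinner z \<eta>) / 2) ^ (n - 1) * (cinner h \<eta> / 2))) (at z)"
proof -
  have "linear (\<lambda>z. cinner z \<eta>)"
    by (rule linearI) (simp_all add: cinner_add_left scaleR_vec_scale cinner_scale_left scaleR_conv_of_real)
  hence bl: "bounded_linear (\<lambda>z. cinner z \<eta>)" by (simp add: linear_conv_bounded_linear)
  have 1: "((\<lambda>z. (1 + cinner z \<eta>) / 2) has_derivative (\<lambda>h. cinner h \<eta> / 2)) (at z)"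
    by (rule derivative_eq_intros bounded_linear_imp_has_derivative[OF bl] refl | simp)+
  have 2: "((\<lambda>w. w ^ n) has_field_derivative of_nat n * ((1 + cinner z \<eta>) / 2) ^ (n - 1)) (at ((1 + cinner z \<eta>) / 2))"
    by (auto intro!: derivative_eq_intros)
  show ?thesis
    using diff_chain_at[OF 1 2[unfolded has_field_derivative_def]] by (simp add: o_def peak_def)
qed

lemma holo_peak: "holo_on U (peak n \<eta>)"
  unfolding holo_on_def
  by (intro ballI exI conjI allI) (rule peak_deriv, simp add: cinner_scale_left)

lemma IR_peak: "IR_pow 1 (peak n \<eta>) z = peak n \<eta> z + of_nat n * ((1 + cinner z \<eta>) / 2) ^ (n - 1) * (cinner z \<eta> / 2)"
  by (simp add: IR_pow_def radial_def frechet_derivative_at[OF peak_deriv, symmetric])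

lemma cont_peak: "continuous_on X (peak n \<eta>)"
  unfolding peak_def by (intro continuous_intros) auto

lemma peak_base_le:
  fixes z \<eta> :: "complex ^ 'n"
  assumes "norm z \<le> 1" "norm \<eta> \<le> 1"
  shows "cmod ((1 + cinner z \<eta>) / 2) \<le> 1" "cmod (cinner z \<eta>) \<le> 1"
proof -
  have "norm z * norm \<eta> \<le> 1 * 1" using assms by (intro mult_mono) auto
  thus c: "cmod (cinner z \<eta>) \<le> 1" using cinner_bound[of z \<eta>] by simp
  show "cmod ((1 + cinner z \<eta>) / 2) \<le> 1"
    using norm_triangle_ineq[of 1 "cinner z \<eta>"] c by (simp add: norm_divide)
qed

lemma HF_peak_finite:
  fixes \<eta> :: "complex ^ 'n"
  assumes "0 < p" "0 < q" "norm \<eta> = 1"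
  shows "HF_normp p q 0 (peak n \<eta>) < \<top>"
proof (rule HF_normp_finite[where M = "1 + real n"])
  fix z :: "complex ^ 'n" assume z: "z \<in> ball 0 1"
  note b = peak_base_le[of z \<eta>]
  have k: "splus 0 = 1" by (simp add: splus_def)
  have "cmod (IR_pow 1 (peak n \<eta>) z) \<le> cmod (peak n \<eta> z) + real n * cmod ((1 + cinner z \<eta>) / 2) ^ (n - 1) * (cmod (cinner z \<eta>) / 2)"
    unfolding IR_peak by (rule order.trans[OF norm_triangle_ineq]) (simp add: norm_mult norm_power norm_divide)
  also have "\<dots> \<le> 1 + real n * 1 * 1"
    using b z assms unfolding peak_def norm_power by (intro add_mono mult_mono power_le_one) auto
  finally show "cmod (IR_pow (splus 0) (peak n \<eta>) z) \<le> 1 + real n" by (simp add: k)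
qed (use assms in auto)

text \<open>One derivative leaves the power \<open>n - 1\<close> of the base times
  \<open>(1 + (of_nat n + 1) * (r * w)) / 2\<close>, whose real part is of order \<open>n\<close>
  when \<open>Re w \<ge> 1/2\<close>. The base at \<open>r *\<^sub>R \<zeta>\<close> is at least
  \<open>r\<close> times the base at \<open>\<zeta>\<close>, and \<open>power_near_one\<close>
  absorbs the powers of \<open>r\<close>.\<close>

lemma IR_peak_ge:
  fixes \<zeta> \<eta> :: "complex ^ 'n"
  assumes n: "4 \<le> n" and r: "1 - 2 / real n \<le> r" "r \<le> 1 - 1 / real n"
    and \<zeta>: "norm \<zeta> = 1" "norm \<eta> = 1" and near: "cmod (1 - cinner \<zeta> \<eta>) \<le> 1/2"
  shows "exp (-4) * (real n / 8) * cmod (peak n \<eta> \<zeta>) \<le> cmod (IR_pow 1 (peak n \<eta>) (r *\<^sub>R \<zeta>))"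
proof -
  define w where "w = cinner \<zeta> \<eta>"
  have w1: "cmod w \<le> 1" using peak_base_le[of \<zeta> \<eta>] \<zeta> by (simp add: w_def)
  have "1 - Re w \<le> 1/2" using near complex_Re_le_cmod[of "1 - w"] by (simp add: w_def)
  hence Rw: "1/2 \<le> Re w" by simp
  have n0: "0 < real n" using n by simp
  have "2 / real n \<le> 1/2" using n by (simp add: divide_le_eq)
  hence r2: "1/2 \<le> r" using r by simp
  have "0 < 1 / real n" using n0 by simp
  hence r1: "r < 1" using r by linarith
  have wr: "cinner (r *\<^sub>R \<zeta>) \<eta> = complex_of_real r * w" by (simp add: w_def scaleR_vec_scale cinner_scale_left)
  obtain m where m: "n = Suc m" using n by (cases n) auto
  have eq: "IR_pow 1 (peak n \<eta>) (r *\<^sub>R \<zeta>) = ((1 + complex_of_real r * w) / 2) ^ m * ((1 + (of_nat n + 1) * (complex_of_real r * w)) / 2)"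
    unfolding IR_peak peak_def wr m by (simp add: field_simps)
  have b: "r * cmod ((1 + w) / 2) \<le> cmod ((1 + complex_of_real r * w) / 2)"
  proof -
    have "(cmod (1 + complex_of_real r * w))\<^sup>2 - (r * cmod (1 + w))\<^sup>2 = (1 - r) * (1 + r + 2 * r * Re w)"
      unfolding power_mult_distrib cmod_power2 by (simp add: power2_eq_square algebra_simps)
    also have "\<dots> \<ge> 0" using r1 r2 Rw by (intro mult_nonneg_nonneg) auto
    finally have "(r * cmod (1 + w))\<^sup>2 \<le> (cmod (1 + complex_of_real r * w))\<^sup>2" by simp
    hence "r * cmod (1 + w) \<le> cmod (1 + complex_of_real r * w)" by (rule power2_le_imp_le) simp
    thus ?thesis by (simp add: norm_divide)
  qed
  have c1: "cmod ((1 + w) / 2) \<le> 1" using peak_base_le[of \<zeta> \<eta>] \<zeta> by (simp add: w_def)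
  have "exp (-4) * cmod (peak n \<eta> \<zeta>) \<le> r ^ n * cmod ((1 + w) / 2) ^ n"
    using power_near_one[OF n r(1)] r1 by (simp add: peak_def w_def norm_power mult_right_mono)
  also have "\<dots> \<le> r ^ m * cmod ((1 + w) / 2) ^ m"
    using r1 r2 c1 by (intro mult_mono power_decreasing) (auto simp: m)
  also have "\<dots> = (r * cmod ((1 + w) / 2)) ^ m" by (simp only: power_mult_distrib)
  also have "\<dots> \<le> cmod ((1 + complex_of_real r * w) / 2) ^ m" using b r2 by (intro power_mono) auto
  finally have 1: "exp (-4) * cmod (peak n \<eta> \<zeta>) \<le> cmod ((1 + complex_of_real r * w) / 2) ^ m" .
  have 2: "real n / 8 \<le> cmod ((1 + (of_nat n + 1) * (complex_of_real r * w)) / 2)"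
  proof -
    have "1/4 \<le> r * Re w" using mult_mono[of "1/2" r "1/2" "Re w"] r2 Rw by simp
    hence "(real n + 1) * (1/4) \<le> (real n + 1) * (r * Re w)" by (intro mult_left_mono) auto
    hence "real n / 4 \<le> Re (1 + (of_nat n + 1) * (complex_of_real r * w))" by (simp add: algebra_simps)
    also have "\<dots> \<le> cmod (1 + (of_nat n + 1) * (complex_of_real r * w))" by (rule complex_Re_le_cmod)
    finally show ?thesis by (simp add: norm_divide)
  qed
  have "exp (-4) * (real n / 8) * cmod (peak n \<eta> \<zeta>) = (exp (-4) * cmod (peak n \<eta> \<zeta>)) * (real n / 8)" by simp
  also have "\<dots> \<le> cmod ((1 + complex_of_real r * w) / 2) ^ m * cmod ((1 + (of_nat n + 1) * (complex_of_real r * w)) / 2)"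
    using 1 2 by (intro mult_mono) auto
  also have "\<dots> = cmod (IR_pow 1 (peak n \<eta>) (r *\<^sub>R \<zeta>))" unfolding eq norm_mult norm_power ..
  finally show ?thesis .
qed

text \<open>Written as a function of the inner product alone, so that the unitary invariance
  \<open>nn_integral_sigma_cinner\<close> applies.\<close>

definition peak_pow :: "real \<Rightarrow> nat \<Rightarrow> complex \<Rightarrow> real" where
  "peak_pow p n w = cmod (((1 + w) / 2) ^ n) powr p"

lemma cmod_peak_powr: "cmod (peak n \<eta> z) powr p = peak_pow p n (cinner z \<eta>)"
  by (simp add: peak_def peak_pow_def)

lemma peak_pow_borel [measurable]: "peak_pow p n \<in> borel_measurable borel"
  unfolding peak_pow_def by measurable

lemma peak_pow_nonneg [simp]: "0 \<le> peak_pow p n w"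
  by (simp add: peak_pow_def)

lemma peak_pow_le:
  assumes "cmod ((1 + w) / 2) \<le> \<kappa>" "0 < p"
  shows "peak_pow p n w \<le> (\<kappa> ^ n) powr p"
  unfolding peak_pow_def norm_power using assms by (intro powr_mono2 power_mono) auto

lemma peak_pow_le_1: "cmod ((1 + w) / 2) \<le> 1 \<Longrightarrow> 0 < p \<Longrightarrow> peak_pow p n w \<le> 1"
  using peak_pow_le[of w 1 p n] by simp

lemma peak_pow_cinner_commute: "peak_pow p n (cinner x y) = peak_pow p n (cinner y x)"
  unfolding peak_pow_def norm_power norm_divide by (simp only: cmod_one_plus_cinner_commute[of x y])

definition peak_mass :: "'n::finite itself \<Rightarrow> real \<Rightarrow> nat \<Rightarrow> ennreal" where
  "peak_mass _ p n = (\<integral>\<^sup>+x. ennreal (peak_pow p n (cinner x (axis undefined 1 :: complex ^ 'n))) \<partial>sigma)"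

lemma nn_integral_peak_pow:
  assumes "norm (\<eta> :: complex ^ 'n) = 1"
  shows "(\<integral>\<^sup>+x. ennreal (peak_pow p n (cinner x \<eta>)) \<partial>sigma) = peak_mass TYPE('n) p n"
  unfolding peak_mass_def using assms by (intro nn_integral_sigma_cinner[of "\<lambda>w. ennreal (peak_pow p n w)"]) auto

lemma peak_mass_le_1:
  assumes "0 < p" shows "peak_mass TYPE('n::finite) p n \<le> 1"
proof -
  have "peak_mass TYPE('n) p n \<le> (\<integral>\<^sup>+x. ennreal 1 \<partial>(sigma :: (complex ^ 'n) measure))"
    unfolding peak_mass_def by (intro nn_integral_mono ennreal_leI peak_pow_le_1 peak_base_le assms) auto
  thus ?thesis by (simp add: emeasure_sigma_sphere)
qed

lemma peak_mass_ge:
  assumes p: "0 < p" and \<delta>: "0 < \<delta>" "\<delta> \<le> 1"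
  shows "ennreal (((1 - \<delta> / 2) ^ n) powr p) * ennreal (Qvol TYPE('n::finite) \<delta>) \<le> peak_mass TYPE('n) p n"
proof -
  let ?e = "axis undefined 1 :: complex ^ 'n"
  have "ennreal (((1 - \<delta> / 2) ^ n) powr p) * ennreal (Qvol TYPE('n) \<delta>)
      = (\<integral>\<^sup>+x. ennreal (((1 - \<delta> / 2) ^ n) powr p) * indicator (Qball ?e \<delta>) x \<partial>sigma)"
    by (subst nn_integral_cmult_indicator) (auto simp: Qball_in_sets_sigma emeasure_Qball)
  also have "\<dots> \<le> peak_mass TYPE('n) p n" unfolding peak_mass_def
  proof (rule nn_integral_mono)
    fix x :: "complex ^ 'n"
    show "ennreal (((1 - \<delta> / 2) ^ n) powr p) * indicator (Qball ?e \<delta>) x \<le> ennreal (peak_pow p n (cinner x ?e))"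
    proof (cases "x \<in> Qball ?e \<delta>")
      case True
      define w where "w = cinner x ?e"
      have "cmod (1 - w) \<le> \<delta>" using True by (simp add: Qball_def w_def cmod_one_minus_cinner_commute[of x])
      hence "1 - \<delta> / 2 \<le> cmod ((1 + w) / 2)"
        using norm_triangle_ineq4[of 2 "1 - w"] norm_triangle_ineq2[of 2 "1 - w"] by (simp add: norm_divide)
      hence "((1 - \<delta> / 2) ^ n) powr p \<le> peak_pow p n w"
        unfolding peak_pow_def norm_power using p \<delta> by (intro powr_mono2 power_mono) auto
      thus ?thesis using True by (simp add: w_def ennreal_leI)
    qed simp
  qed
  finally show ?thesis .
qed

lemma peak_mass_pos:
  assumes "0 < p" shows "0 < peak_mass TYPE('n::finite) p n"
proof -
  have "0 < ennreal (((1 - 1 / 2) ^ n) powr p) * ennreal (Qvol TYPE('n) 1)"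
    using Qvol_pos[of 1, where 'n='n] by (simp add: ennreal_zero_less_mult_iff)
  also have "\<dots> \<le> peak_mass TYPE('n) p n" by (rule peak_mass_ge) (use assms in auto)
  finally show ?thesis .
qed

text \<open>On the ball of radius \<open>\<delta> = 1 - \<kappa>\<close> the base of the peak is at
  least \<open>l = (1 + \<kappa>) / 2 > \<kappa>\<close>, and that ball has positive measure. Hence
  everything away from the pole is negligible against the peak mass.\<close>

lemma peak_mass_dominates_geometric:
  assumes p: "0 < p" and \<kappa>: "0 \<le> \<kappa>" "\<kappa> < 1" and \<epsilon>: "0 < \<epsilon>"
  shows "\<forall>\<^sub>F n in sequentially. ennreal ((\<kappa> ^ n) powr p) \<le> ennreal \<epsilon> * peak_mass TYPE('n::finite) p n"
proof -
  define \<delta> where "\<delta> = 1 - \<kappa>"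
  define l where "l = 1 - \<delta> / 2"
  have \<delta>: "0 < \<delta>" "\<delta> \<le> 1" using \<kappa> by (auto simp: \<delta>_def)
  have l: "0 < l" "\<kappa> < l" using \<kappa> by (simp_all add: l_def \<delta>_def field_simps)
  note V = Qvol_pos[OF \<delta>(1), where 'n='n]
  have "(\<lambda>n. (\<kappa> / l) ^ n) \<longlonglongrightarrow> 0" by (rule LIMSEQ_power_zero) (use \<kappa> l in simp)
  moreover have "0 < (\<epsilon> * Qvol TYPE('n) \<delta>) powr (1 / p)" using V \<epsilon> by simp
  ultimately have "\<forall>\<^sub>F n in sequentially. (\<kappa> / l) ^ n < (\<epsilon> * Qvol TYPE('n) \<delta>) powr (1 / p)"
    by (rule order_tendstoD)
  thus ?thesis
  proof eventually_elim
    case (elim n)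
    have "((\<kappa> / l) ^ n) powr p \<le> ((\<epsilon> * Qvol TYPE('n) \<delta>) powr (1 / p)) powr p"
      using elim \<kappa> l p by (intro powr_mono2) auto
    also have "\<dots> = \<epsilon> * Qvol TYPE('n) \<delta>" using p V \<epsilon> by (simp add: powr_powr)
    finally have a: "((\<kappa> / l) ^ n) powr p \<le> \<epsilon> * Qvol TYPE('n) \<delta>" .
    have "(\<kappa> ^ n) powr p = ((\<kappa> / l) ^ n * l ^ n) powr p" using l by (simp add: power_divide)
    also have "\<dots> = ((\<kappa> / l) ^ n) powr p * (l ^ n) powr p" by (rule powr_mult)
    also have "\<dots> \<le> (\<epsilon> * Qvol TYPE('n) \<delta>) * (l ^ n) powr p" by (intro mult_right_mono a) simp
    finally have "ennreal ((\<kappa> ^ n) powr p) \<le> ennreal (\<epsilon> * (((1 - \<delta> / 2) ^ n) powr p * Qvol TYPE('n) \<delta>))"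
      by (intro ennreal_leI) (simp add: l_def mult_ac)
    also have "\<dots> = ennreal \<epsilon> * (ennreal (((1 - \<delta> / 2) ^ n) powr p) * ennreal (Qvol TYPE('n) \<delta>))"
      using \<epsilon> V by (simp add: ennreal_mult')
    also have "\<dots> \<le> ennreal \<epsilon> * peak_mass TYPE('n) p n" by (intro mult_left_mono peak_mass_ge p \<delta>) simp
    finally show ?case .
  qed
qed

lemma cmod_one_plus_sq: "(cmod (1 + w))\<^sup>2 = 1 + 2 * Re w + (cmod w)\<^sup>2"
  unfolding cmod_power2 by (simp add: power2_eq_square algebra_simps)

text \<open>By the parallelogram law \<open>|1 + w|^2 + |1 - w|^2 \<le> 4\<close>, and here the
  second term exceeds \<open>1/4\<close>.\<close>

lemma peak_base_far:
  assumes "cmod w \<le> 1" "1/2 < cmod (1 - w)"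
  shows "cmod ((1 + w) / 2) \<le> sqrt (15/16)"
proof -
  have "(1/2)\<^sup>2 \<le> (cmod (1 - w))\<^sup>2" using assms by (intro power_mono) auto
  moreover have "(cmod (1 - w))\<^sup>2 = 1 - 2 * Re w + (cmod w)\<^sup>2" using cmod_one_plus_sq[of "- w"] by simp
  moreover have "(cmod w)\<^sup>2 \<le> 1" using assms by (simp add: abs_square_le_1)
  ultimately have "(cmod (1 + w))\<^sup>2 \<le> 15/4" unfolding cmod_one_plus_sq by (simp add: power2_eq_square)
  hence "(cmod ((1 + w) / 2))\<^sup>2 \<le> 15/16" by (simp add: norm_divide power_divide)
  thus ?thesis by (rule real_le_rsqrt)
qed

text \<open>For \<open>Re w \<ge> 0\<close> shrinking \<open>w\<close> decreases
  \<open>|1 + w|\<close>; for \<open>Re w < 0\<close> the base is at most \<open>sqrt (1/2)\<close>.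
  Interior points of the ball are thus compared with boundary points up to a geometric
  error.\<close>

lemma peak_pow_radial_bound:
  assumes p: "0 < p" and w: "cmod w \<le> 1" and r: "0 \<le> r" "r \<le> 1"
  shows "peak_pow p n (complex_of_real r * w) \<le> peak_pow p n w + (sqrt (1/2) ^ n) powr p"
proof (cases "0 \<le> Re w")
  case True
  have "r * Re w \<le> Re w" using True r by (simp add: mult_left_le_one_le)
  moreover have "r\<^sup>2 * (cmod w)\<^sup>2 \<le> (cmod w)\<^sup>2" using r by (intro mult_left_le_one_le) (auto simp: power_le_one)
  ultimately have "(cmod (1 + complex_of_real r * w))\<^sup>2 \<le> (cmod (1 + w))\<^sup>2"
    unfolding cmod_one_plus_sq by (simp add: norm_mult power_mult_distrib)
  hence "cmod (1 + complex_of_real r * w) \<le> cmod (1 + w)" by (rule power2_le_imp_le) simp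
  hence "peak_pow p n (complex_of_real r * w) \<le> peak_pow p n w"
    unfolding peak_pow_def norm_power using p by (intro powr_mono2 power_mono) (auto simp: norm_divide)
  thus ?thesis by (simp add: add_increasing2)
next
  case False
  have "r * Re w \<le> 0" using False r by (simp add: mult_nonneg_nonpos)
  moreover have "(r * cmod w)\<^sup>2 \<le> 1" using r w by (simp add: abs_square_le_1 mult_le_one)
  ultimately have "(cmod (1 + complex_of_real r * w))\<^sup>2 \<le> 2"
    unfolding cmod_one_plus_sq using r by (simp add: norm_mult)
  hence "(cmod ((1 + complex_of_real r * w) / 2))\<^sup>2 \<le> 1/2" by (simp add: norm_divide power_divide)
  hence "cmod ((1 + complex_of_real r * w) / 2) \<le> sqrt (1/2)" by (rule real_le_rsqrt)
  from peak_pow_le[OF this p] show ?thesis by (simp add: add_increasing)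
qed

text \<open>For large \<open>n\<close> at least half of the peak mass lies in
  \<open>Qball \<eta> (1/2)\<close>, because outside it the base is at most
  \<open>sqrt (15/16)\<close>. Inside, the factor \<open>n\<close> gained by the derivative cancels
  the factor \<open>1 / n\<close> lost in the weight.\<close>

lemma HF_peak_lower:
  assumes p: "0 < p" and q: "0 < q"
  shows "\<exists>K>0. \<forall>\<^sub>F n in sequentially. \<forall>\<eta> :: complex ^ 'n. norm \<eta> = 1 \<longrightarrow>
           ennreal K * peak_mass TYPE('n) p n \<le> HF_normp p q 0 (peak n \<eta>)"
proof -
  define K0 where "K0 = wslice_const q p * (exp (-4) / 8) powr p"
  have K0: "0 < K0" using wslice_const_pos[of q p] by (simp add: K0_def)
  have "\<forall>\<^sub>F n in sequentially. ennreal ((sqrt (15/16) ^ n) powr p) \<le> ennreal (1/2) * peak_mass TYPE('n) p n"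
    by (rule peak_mass_dominates_geometric[OF p]) (auto simp: real_sqrt_lt_1_iff)
  moreover have "\<forall>\<^sub>F n in sequentially. 4 \<le> n" by (rule eventually_ge_at_top)
  ultimately have "\<forall>\<^sub>F n in sequentially. \<forall>\<eta> :: complex ^ 'n. norm \<eta> = 1 \<longrightarrow>
           ennreal (K0 / 2) * peak_mass TYPE('n) p n \<le> HF_normp p q 0 (peak n \<eta>)"
  proof eventually_elim
    case (elim n)
    show ?case
    proof (intro allI impI)
      fix \<eta> :: "complex ^ 'n" assume \<eta>: "norm \<eta> = 1"
      let ?c = "peak_mass TYPE('n) p n"
      have k: "splus 0 = 1" by (simp add: splus_def)
      define N where "N = (\<integral>\<^sup>+x. ennreal (peak_pow p n (cinner x \<eta>)) * indicator (Qball \<eta> (1/2)) x \<partial>sigma)"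
      have Qm: "indicator (Qball \<eta> (1/2)) \<in> borel_measurable (sigma :: (complex ^ 'n) measure)"
        by (intro borel_measurable_indicator Qball_in_sets_sigma)
      have Nm: "(\<lambda>x. ennreal (peak_pow p n (cinner x \<eta>)) * indicator (Qball \<eta> (1/2)) x) \<in> borel_measurable sigma"
        using Qm by measurable
      have "?c \<le> (\<integral>\<^sup>+x. ennreal (peak_pow p n (cinner x \<eta>)) * indicator (Qball \<eta> (1/2)) x + ennreal ((sqrt (15/16) ^ n) powr p) \<partial>sigma)"
        unfolding nn_integral_peak_pow[OF \<eta>, symmetric]
      proof (rule nn_integral_mono)
        fix x :: "complex ^ 'n" assume "x \<in> space sigma"
        hence x: "norm x = 1" by simp
        show "ennreal (peak_pow p n (cinner x \<eta>)) \<le> ennreal (peak_pow p n (cinner x \<eta>)) * indicator (Qball \<eta> (1/2)) x + ennreal ((sqrt (15/16) ^ n) powr p)"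
        proof (cases "x \<in> Qball \<eta> (1/2)")
          case False
          hence "1/2 < cmod (1 - cinner x \<eta>)" using x by (simp add: Qball_def cmod_one_minus_cinner_commute[of \<eta>])
          hence "peak_pow p n (cinner x \<eta>) \<le> (sqrt (15/16) ^ n) powr p"
            using x \<eta> by (intro peak_pow_le peak_base_far peak_base_le p) auto
          thus ?thesis using False by (simp add: ennreal_leI)
        qed simp
      qed
      also have "\<dots> = N + ennreal ((sqrt (15/16) ^ n) powr p)"
        unfolding N_def by (subst nn_integral_add[OF Nm]) (auto simp: emeasure_sigma_sphere)
      also have "\<dots> \<le> N + ennreal (1/2) * ?c" using elim by (intro add_left_mono)
      finally have "?c \<le> N + ennreal (1/2) * ?c" .
      moreover have "?c = ennreal (enn2real ?c)" using peak_mass_le_1[OF p, of n, where 'n='n]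
        by (metis ennreal_enn2real infinity_ennreal_def ennreal_one_less_top le_less_trans)
      ultimately have N: "ennreal (1/2) * ?c \<le> N"
      proof (cases N)
        case (real x)
        assume a: "?c \<le> N + ennreal (1/2) * ?c" "?c = ennreal (enn2real ?c)"
        define y where "y = enn2real ?c"
        have y: "?c = ennreal y" "0 \<le> y" using a by (auto simp: y_def)
        have "ennreal (1/2) * ennreal y = ennreal (1/2 * y)" using y by (intro ennreal_mult[symmetric]) auto
        moreover have "ennreal x + ennreal (1/2 * y) = ennreal (x + 1/2 * y)" using y real by (intro ennreal_plus[symmetric]) auto
        ultimately have "ennreal y \<le> ennreal (x + 1/2 * y)" using a(1) unfolding real y by (simp only:)
        hence "y \<le> x + 1/2 * y" using real y by (subst (asm) ennreal_le_iff) auto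
        hence "ennreal (1/2 * y) \<le> ennreal x" by (intro ennreal_leI) simp
        also have "ennreal (1/2 * y) = ennreal (1/2) * ennreal y" using y by (intro ennreal_mult) auto
        finally show ?thesis unfolding y(1) real(2) .
      qed simp
      have "ennreal (K0 / 2) * ?c = ennreal K0 * (ennreal (1/2) * ?c)"
        unfolding mult.assoc[symmetric] using K0 by (subst ennreal_mult[symmetric]) auto
      also have "\<dots> \<le> ennreal K0 * N" by (intro mult_left_mono N) simp
      also have "\<dots> = (\<integral>\<^sup>+x. ennreal K0 * (ennreal (peak_pow p n (cinner x \<eta>)) * indicator (Qball \<eta> (1/2)) x) \<partial>sigma)"
        unfolding N_def by (rule nn_integral_cmult[OF Nm, symmetric])
      also have "\<dots> \<le> HF_normp p q 0 (peak n \<eta>)" unfolding HF_normp_wslice k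
      proof (rule nn_integral_mono)
        fix x :: "complex ^ 'n" assume "x \<in> space sigma"
        hence x: "norm x = 1" by simp
        show "ennreal K0 * (ennreal (peak_pow p n (cinner x \<eta>)) * indicator (Qball \<eta> (1/2)) x)
          \<le> wslice q p (real 1 - 0) (\<lambda>r. cmod (IR_pow 1 (peak n \<eta>) (r *\<^sub>R x)))"
        proof (cases "x \<in> Qball \<eta> (1/2)")
          case True
          hence near: "cmod (1 - cinner x \<eta>) \<le> 1/2" by (simp add: Qball_def cmod_one_minus_cinner_commute[of \<eta>])
          let ?H = "exp (-4) * (real n / 8) * cmod (peak n \<eta> x)"
          have "ennreal (wslice_const q p * (?H * real n powr (- 1)) powr p) \<le> wslice q p 1 (\<lambda>r. cmod (IR_pow 1 (peak n \<eta>) (r *\<^sub>R x)))"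
            by (rule wslice_ge) (use elim p q IR_peak_ge[OF elim(2) _ _ x \<eta> near] in auto)
          moreover have "?H * real n powr (- 1) = exp (-4) / 8 * cmod (peak n \<eta> x)"
            using elim(2) by (simp add: powr_minus field_simps)
          moreover have "wslice_const q p * (exp (-4) / 8 * cmod (peak n \<eta> x)) powr p = K0 * peak_pow p n (cinner x \<eta>)"
            unfolding cmod_peak_powr[symmetric] K0_def by (subst powr_mult) simp
          ultimately have "ennreal (K0 * peak_pow p n (cinner x \<eta>)) \<le> wslice q p 1 (\<lambda>r. cmod (IR_pow 1 (peak n \<eta>) (r *\<^sub>R x)))"
            by (simp only:)
          thus ?thesis using True K0 by (simp add: ennreal_mult)
        qed simp
      qed
      finally show "ennreal (K0 / 2) * ?c \<le> HF_normp p q 0 (peak n \<eta>)" .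
    qed
  qed
  thus ?thesis using K0 by (intro exI[of _ "K0 / 2"]) auto
qed

text \<open>Equality in \<open>|1 + w| \<le> 2\<close> forces \<open>w = 1\<close> and then
  \<open>z = \<eta>\<close>, which lies in the ball. Compactness makes the gap uniform over the
  ball.\<close>

lemma Qball_base_bound:
  fixes z \<zeta> :: "complex ^ 'n"
  assumes z: "norm z \<le> 1" "z \<notin> Qball \<zeta> \<delta>"
  shows "\<exists>\<kappa>. 0 \<le> \<kappa> \<and> \<kappa> < 1 \<and> (\<forall>\<eta>\<in>Qball \<zeta> \<delta>. cmod ((1 + cinner z \<eta>) / 2) \<le> \<kappa>)"
proof (cases "Qball \<zeta> \<delta> = {}")
  case True thus ?thesis by (intro exI[of _ 0]) auto
next
  case False
  have "compact (sphere 0 1 \<inter> Qball \<zeta> \<delta>)" by (intro compact_Int_closed closed_Qball) simp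
  moreover have "sphere 0 1 \<inter> Qball \<zeta> \<delta> = Qball \<zeta> \<delta>" by (auto simp: Qball_def)
  ultimately have "compact (Qball \<zeta> \<delta>)" by simp
  moreover have "continuous_on (Qball \<zeta> \<delta>) (\<lambda>\<eta>. cmod ((1 + cinner z \<eta>) / 2))" by (intro continuous_intros) auto
  ultimately obtain \<eta> where \<eta>: "\<eta> \<in> Qball \<zeta> \<delta>"
    "\<And>y. y \<in> Qball \<zeta> \<delta> \<Longrightarrow> cmod ((1 + cinner z y) / 2) \<le> cmod ((1 + cinner z \<eta>) / 2)"
    using continuous_attains_sup[OF _ False] by blast
  have n\<eta>: "norm \<eta> = 1" using \<eta> by (simp add: Qball_def)
  define w where "w = cinner z \<eta>"
  have b: "cmod ((1 + w) / 2) \<le> 1" "cmod w \<le> 1" using peak_base_le[of z \<eta>] z n\<eta> by (auto simp: w_def)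
  have "cmod ((1 + w) / 2) \<noteq> 1"
  proof
    assume "cmod ((1 + w) / 2) = 1"
    hence "(cmod (1 + w))\<^sup>2 = 4" by (simp add: norm_divide)
    moreover have "(cmod w)\<^sup>2 \<le> 1" using b by (simp add: abs_square_le_1)
    ultimately have R: "1 \<le> Re w" unfolding cmod_one_plus_sq by simp
    have "(cmod w)\<^sup>2 = (Re w)\<^sup>2 + (Im w)\<^sup>2" by (rule cmod_power2)
    moreover have "1 \<le> (Re w)\<^sup>2" using R by (simp add: one_le_power)
    ultimately have "Im w = 0" using \<open>(cmod w)\<^sup>2 \<le> 1\<close> by (smt (verit) zero_le_power2 power2_eq_iff power_zero_numeral)
    moreover have "Re w \<le> 1" using b(2) complex_Re_le_cmod[of w] by simp
    ultimately have w1: "w = 1" using R by (simp add: complex_eq_iff)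
    have "1 \<le> norm z * norm \<eta>" using cinner_bound[of z \<eta>] w1 by (simp add: w_def)
    hence nz: "norm z = 1" using z n\<eta> by simp
    have "(norm (z - \<eta>))\<^sup>2 \<le> 0" using norm_diff_le_cinner[OF nz n\<eta>] w1 by (simp add: w_def)
    hence "z = \<eta>" by simp
    thus False using z \<eta> by simp
  qed
  thus ?thesis using \<eta> b unfolding w_def by (intro exI[of _ "cmod ((1 + cinner z \<eta>) / 2)"]) auto
qed

text \<open>\<open>\<Phi> n z / ?t n\<close> is the normalised average of the peaks with poles in
  \<open>Q\<close>. It is at most \<open>1\<close> on \<open>Q\<close>, eventually at most
  \<open>2\<close> on the whole closed ball, and tends to \<open>0\<close> off \<open>Q\<close>,
  including interior points. Its integral against \<open>\<mu>\<close> thus has limit superior at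
  most \<open>\<mu> Q\<close>.\<close>

theorem Qball_bound_if_reverse_carleson:
  fixes \<mu> :: "(complex ^ 'n) measure"
  assumes p: "0 < p" and q: "0 < q" and \<mu>: "fin_borel_cball \<mu>" and rc: "reverse_carleson p q 0 \<mu>"
  shows "\<exists>c>0. \<forall>\<zeta>\<in>sphere 0 1. \<forall>\<delta>>0. ennreal c * emeasure sigma (Qball \<zeta> \<delta>) \<le> emeasure \<mu> (Qball \<zeta> \<delta>)"
proof -
  interpret S: prob_space "sigma :: (complex ^ 'n) measure" by (rule prob_space_sigma)
  interpret M: finite_measure \<mu> using \<mu> by (simp add: fin_borel_cball_def)
  interpret pair_sigma_finite "sigma :: (complex ^ 'n) measure" \<mu> by unfold_locales
  have id [measurable]: "(\<lambda>x. x) \<in> borel_measurable \<mu>" by (rule fin_borel_measurable[OF \<mu>]) simp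
  obtain C where C: "0 < C" "\<And>f. holo_on (ball 0 1) f \<and> continuous_on (cball 0 1) f \<and> HF_normp p q 0 f < \<top>
        \<Longrightarrow> HF_normp p q 0 f \<le> ennreal C * (\<integral>\<^sup>+ z. ennreal (cmod (f z) powr p) \<partial>\<mu>)"
    using rc unfolding reverse_carleson_def by blast
  obtain K where K: "0 < K" "\<forall>\<^sub>F n in sequentially. \<forall>\<eta> :: complex ^ 'n. norm \<eta> = 1 \<longrightarrow>
           ennreal K * peak_mass TYPE('n) p n \<le> HF_normp p q 0 (peak n \<eta>)"
    using HF_peak_lower[OF p q] by blast
  let ?t = "peak_mass TYPE('n) p"
  have t: "?t n \<noteq> 0" "?t n \<noteq> \<top>" for n
    using peak_mass_pos[OF p, of n, where 'n='n] peak_mass_le_1[OF p, of n, where 'n='n] by (auto simp: top_unique)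
  have "ennreal (K / C) * emeasure sigma (Qball \<zeta> \<delta>) \<le> emeasure \<mu> (Qball \<zeta> \<delta>)" if \<zeta>: "norm \<zeta> = 1" and \<delta>: "0 < \<delta>" for \<zeta> :: "complex ^ 'n" and \<delta>
  proof -
    let ?Q = "Qball \<zeta> \<delta>"
    have Q1: "norm \<eta> = 1" if "\<eta> \<in> ?Q" for \<eta> using that by (simp add: Qball_def)
    have Qs [measurable]: "?Q \<in> sets sigma" by (rule Qball_in_sets_sigma)
    have Qm [measurable]: "?Q \<in> sets \<mu>" by (rule Qball_in_sets_fin[OF \<mu>])
    define \<Phi> where "\<Phi> n z = (\<integral>\<^sup>+\<eta>. ennreal (peak_pow p n (cinner z \<eta>)) * indicator ?Q \<eta> \<partial>sigma)" for n z
    have \<Phi>m [measurable]: "\<Phi> n \<in> borel_measurable \<mu>" for n unfolding \<Phi>_def by measurable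
    have low: "\<forall>\<^sub>F n in sequentially. ennreal (K / C) * emeasure sigma ?Q \<le> (\<integral>\<^sup>+z. \<Phi> n z / ?t n \<partial>\<mu>)"
      using K(2)
    proof eventually_elim
      case (elim n)
      have one: "ennreal K * ?t n \<le> ennreal C * (\<integral>\<^sup>+z. ennreal (peak_pow p n (cinner z \<eta>)) \<partial>\<mu>)" if \<eta>: "norm \<eta> = 1" for \<eta>
      proof -
        have "ennreal K * ?t n \<le> HF_normp p q 0 (peak n \<eta>)" using elim \<eta> by blast
        also have "\<dots> \<le> ennreal C * (\<integral>\<^sup>+z. ennreal (cmod (peak n \<eta> z) powr p) \<partial>\<mu>)"
          by (intro C(2) conjI holo_peak cont_peak HF_peak_finite p q \<eta>)
        finally show ?thesis by (simp only: cmod_peak_powr)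
      qed
      have "ennreal K * ?t n * emeasure sigma ?Q = (\<integral>\<^sup>+\<eta>. ennreal K * ?t n * indicator ?Q \<eta> \<partial>sigma)"
        by (rule nn_integral_cmult_indicator[symmetric]) (rule Qs)
      also have "\<dots> \<le> (\<integral>\<^sup>+\<eta>. (\<integral>\<^sup>+z. ennreal C * (ennreal (peak_pow p n (cinner z \<eta>)) * indicator ?Q \<eta>) \<partial>\<mu>) \<partial>sigma)"
      proof (rule nn_integral_mono)
        fix \<eta> :: "complex ^ 'n"
        show "ennreal K * ?t n * indicator ?Q \<eta> \<le> (\<integral>\<^sup>+z. ennreal C * (ennreal (peak_pow p n (cinner z \<eta>)) * indicator ?Q \<eta>) \<partial>\<mu>)"
        proof (cases "\<eta> \<in> ?Q")
          case True
          show ?thesis using one[OF Q1[OF True]] True by (simp add: nn_integral_cmult)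
        qed simp
      qed
      also have "\<dots> = (\<integral>\<^sup>+z. (\<integral>\<^sup>+\<eta>. ennreal C * (ennreal (peak_pow p n (cinner z \<eta>)) * indicator ?Q \<eta>) \<partial>sigma) \<partial>\<mu>)"
        by (rule Fubini'[symmetric]) measurable
      also have "\<dots> = (\<integral>\<^sup>+z. ennreal C * \<Phi> n z \<partial>\<mu>)"
        unfolding \<Phi>_def by (intro nn_integral_cong nn_integral_cmult) measurable
      also have "\<dots> = ennreal C * (\<integral>\<^sup>+z. \<Phi> n z \<partial>\<mu>)" by (rule nn_integral_cmult) measurable
      finally have "ennreal (1 / C) * (ennreal K * ?t n * emeasure sigma ?Q) / ?t n \<le> ennreal (1 / C) * (ennreal C * (\<integral>\<^sup>+z. \<Phi> n z \<partial>\<mu>)) / ?t n"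
        by (intro divide_right_mono_ennreal mult_left_mono) auto
      moreover have "ennreal (1 / C) * (ennreal C * (\<integral>\<^sup>+z. \<Phi> n z \<partial>\<mu>)) = (\<integral>\<^sup>+z. \<Phi> n z \<partial>\<mu>)"
        using C(1) by (simp add: mult.assoc[symmetric] ennreal_mult[symmetric])
      moreover have "ennreal (1 / C) * (ennreal K * ?t n * emeasure sigma ?Q) / ?t n = ennreal (K / C) * emeasure sigma ?Q"
      proof -
        have "ennreal (K / C) = ennreal (1 / C) * ennreal K" using C(1) K(1) by (subst ennreal_mult[symmetric]) auto
        hence "ennreal (1 / C) * (ennreal K * ?t n * emeasure sigma ?Q) = ennreal (K / C) * emeasure sigma ?Q * ?t n"
          by (simp only: mult_ac)
        thus ?thesis using t by (metis ennreal_mult_divide_eq)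
      qed
      ultimately show ?case by (simp add: nn_integral_divide)
    qed
    have \<Phi>_sphere: "\<Phi> n z \<le> ?t n" if z: "norm z = 1" for n z
    proof -
      have "\<Phi> n z \<le> (\<integral>\<^sup>+\<eta>. ennreal (peak_pow p n (cinner \<eta> z)) \<partial>sigma)"
        unfolding \<Phi>_def by (intro nn_integral_mono) (auto simp: peak_pow_cinner_commute[of _ _ z] split: split_indicator)
      thus ?thesis by (simp only: nn_integral_peak_pow[OF z])
    qed
    have \<Phi>_bound: "\<Phi> n z \<le> ?t n + ennreal ((sqrt (1/2) ^ n) powr p)" if z: "norm z \<le> 1" for n z
    proof -
      define u where "u = (if z = 0 then axis undefined 1 else (1 / norm z) *\<^sub>R z)"
      have u: "norm u = 1" "z = norm z *\<^sub>R u" by (auto simp: u_def)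
      have "\<Phi> n z \<le> (\<integral>\<^sup>+\<eta>. ennreal (peak_pow p n (cinner u \<eta>)) * indicator ?Q \<eta> + ennreal ((sqrt (1/2) ^ n) powr p) \<partial>sigma)"
        unfolding \<Phi>_def
      proof (rule nn_integral_mono)
        fix \<eta> :: "complex ^ 'n" assume "\<eta> \<in> space sigma"
        hence "cmod (cinner u \<eta>) \<le> 1" using u by (intro peak_base_le) auto
        hence "peak_pow p n (complex_of_real (norm z) * cinner u \<eta>) \<le> peak_pow p n (cinner u \<eta>) + (sqrt (1/2) ^ n) powr p"
          using z by (intro peak_pow_radial_bound p) auto
        moreover have "cinner z \<eta> = complex_of_real (norm z) * cinner u \<eta>"
          by (subst u(2)) (simp add: scaleR_vec_scale cinner_scale_left)
        ultimately have "ennreal (peak_pow p n (cinner z \<eta>)) \<le> ennreal (peak_pow p n (cinner u \<eta>) + (sqrt (1/2) ^ n) powr p)"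
          by (intro ennreal_leI) simp
        also have "\<dots> = ennreal (peak_pow p n (cinner u \<eta>)) + ennreal ((sqrt (1/2) ^ n) powr p)" by (rule ennreal_plus) auto
        finally show "ennreal (peak_pow p n (cinner z \<eta>)) * indicator ?Q \<eta> \<le> ennreal (peak_pow p n (cinner u \<eta>)) * indicator ?Q \<eta> + ennreal ((sqrt (1/2) ^ n) powr p)"
          by (auto split: split_indicator)
      qed
      also have "\<dots> = \<Phi> n u + ennreal ((sqrt (1/2) ^ n) powr p)"
        unfolding \<Phi>_def by (subst nn_integral_add) (auto simp: emeasure_sigma_sphere)
      also have "\<dots> \<le> ?t n + ennreal ((sqrt (1/2) ^ n) powr p)" by (intro add_right_mono \<Phi>_sphere u)
      finally show ?thesis .
    qed
    \<comment> \<open>The truncation at \<open>2\<close> provides an integrable majorant valid for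
      every \<open>n\<close>; by \<open>\<Phi>_bound\<close> it eventually changes nothing.\<close>
    define v where "v n z = min 2 (\<Phi> n z / ?t n * indicator (- ?Q) z)" for n z
    have Qc [measurable]: "indicator (- ?Q) \<in> borel_measurable \<mu>"
      by (rule fin_borel_measurable[OF \<mu>]) (use closed_Qball[of \<zeta> \<delta>] in \<open>auto intro!: borel_measurable_indicator borel_open\<close>)
    have vm [measurable]: "v n \<in> borel_measurable \<mu>" for n unfolding v_def by measurable
    have "\<forall>\<^sub>F n in sequentially. ennreal ((sqrt (1/2) ^ n) powr p) \<le> ennreal 1 * ?t n"
      by (rule peak_mass_dominates_geometric[OF p]) (auto simp: real_sqrt_lt_1_iff)
    with low have "\<forall>\<^sub>F n in sequentially. ennreal (K / C) * emeasure sigma ?Q \<le> emeasure \<mu> ?Q + (\<integral>\<^sup>+z. v n z \<partial>\<mu>)"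
    proof eventually_elim
      case (elim n)
      note elim(1)
      also have "(\<integral>\<^sup>+z. \<Phi> n z / ?t n \<partial>\<mu>) \<le> (\<integral>\<^sup>+z. indicator ?Q z + v n z \<partial>\<mu>)"
      proof (rule nn_integral_mono)
        fix z assume "z \<in> space \<mu>"
        hence z: "norm z \<le> 1" using fin_borel_space[OF \<mu>] by simp
        have tt: "?t n / ?t n = 1" using t by (simp add: ennreal_divide_self less_top zero_less_iff_neq_zero)
        show "\<Phi> n z / ?t n \<le> indicator ?Q z + v n z"
        proof (cases "z \<in> ?Q")
          case True
          have "\<Phi> n z / ?t n \<le> ?t n / ?t n" by (intro divide_right_mono_ennreal \<Phi>_sphere Q1 True)
          thus ?thesis using True tt by (simp add: v_def)
        next
          case False
          have "\<Phi> n z \<le> ?t n + ?t n" using \<Phi>_bound[OF z, of n] elim(2) by (simp add: add_left_mono order.trans)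
          hence "\<Phi> n z / ?t n \<le> (?t n + ?t n) / ?t n" by (rule divide_right_mono_ennreal)
          also have "\<dots> = 2" using tt by (simp add: add_divide_distrib_ennreal)
          finally show ?thesis using False by (simp add: v_def)
        qed
      qed
      also have "\<dots> = emeasure \<mu> ?Q + (\<integral>\<^sup>+z. v n z \<partial>\<mu>)" by (subst nn_integral_add) auto
      finally show ?case .
    qed
    moreover have "(\<lambda>n. emeasure \<mu> ?Q + (\<integral>\<^sup>+z. v n z \<partial>\<mu>)) \<longlonglongrightarrow> emeasure \<mu> ?Q + (\<integral>\<^sup>+z. 0 \<partial>\<mu>)"
    proof (intro tendsto_add tendsto_const nn_integral_dominated_convergence[where w = "\<lambda>_. 2"])
      show "AE z in \<mu>. (\<lambda>n. v n z) \<longlonglongrightarrow> 0"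
      proof (rule AE_I2)
        fix z assume "z \<in> space \<mu>"
        hence z: "norm z \<le> 1" using fin_borel_space[OF \<mu>] by simp
        show "(\<lambda>n. v n z) \<longlonglongrightarrow> 0"
        proof (cases "z \<in> ?Q")
          case False
          obtain \<kappa> where \<kappa>: "0 \<le> \<kappa>" "\<kappa> < 1" "\<And>\<eta>. \<eta> \<in> ?Q \<Longrightarrow> cmod ((1 + cinner z \<eta>) / 2) \<le> \<kappa>"
            using Qball_base_bound[OF z False] by blast
          have le: "\<Phi> n z \<le> ennreal ((\<kappa> ^ n) powr p)" for n
          proof -
            have "\<Phi> n z \<le> (\<integral>\<^sup>+\<eta>. ennreal ((\<kappa> ^ n) powr p) \<partial>(sigma :: (complex ^ 'n) measure))"
              unfolding \<Phi>_def by (intro nn_integral_mono) (auto split: split_indicator intro!: ennreal_leI peak_pow_le \<kappa> p)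
            thus ?thesis by (simp add: emeasure_sigma_sphere)
          qed
          show ?thesis
          proof (rule order_tendstoI)
            fix a :: ennreal assume "0 < a"
            then obtain b where b: "0 < b" "b < a" using dense by blast
            define e where "e = enn2real b"
            have bt: "b < \<top>" using b(2) by (rule less_le_trans) simp
            have e: "b = ennreal e" "0 < e" using b bt by (auto simp: e_def enn2real_positive_iff)
            show "\<forall>\<^sub>F n in sequentially. v n z < a"
              using peak_mass_dominates_geometric[OF p \<kappa>(1,2) e(2), where 'n='n]
            proof eventually_elim
              case (elim n)
              have "\<Phi> n z / ?t n \<le> (ennreal e * ?t n) / ?t n"
                by (intro divide_right_mono_ennreal order.trans[OF le elim])
              also have "\<dots> = b" using t e by (simp add: ennreal_mult_divide_eq)
              finally have "v n z \<le> b" using False by (simp add: v_def min.coboundedI2)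
              thus ?case using b by simp
            qed
          qed simp
        qed (simp add: v_def)
      qed
      have "emeasure \<mu> (space \<mu>) < \<top>" by (metis M.emeasure_finite infinity_ennreal_def top.not_eq_extremum)
      thus "(\<integral>\<^sup>+z. 2 \<partial>\<mu>) < \<infinity>" by (simp add: ennreal_mult_less_top)
    qed (auto simp: v_def)
    ultimately have "ennreal (K / C) * emeasure sigma ?Q \<le> emeasure \<mu> ?Q + (\<integral>\<^sup>+z. 0 \<partial>\<mu>)"
      by (intro tendsto_lowerbound) auto
    thus ?thesis by simp
  qed
  thus ?thesis using K(1) C(1) by (intro exI[of _ "K / C"]) auto
qed

section \<open>Random polynomials\<close>

text \<open>A sign pattern is encoded by the set \<open>S\<close> of indices with sign
  \<open>+1\<close>, so that an expectation is a sum over \<open>Pow I\<close> divided by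
  \<open>2 ^ card I\<close>.\<close>

definition rsum :: "'i set \<Rightarrow> ('i \<Rightarrow> 'b::real_vector) \<Rightarrow> 'i set \<Rightarrow> 'b" where
  "rsum I a S = (\<Sum>x\<in>I. (if x \<in> S then 1 else -1 :: real) *\<^sub>R a x)"

lemma sum_Pow_insert:
  assumes "finite F" "x \<notin> F"
  shows "(\<Sum>S\<in>Pow (insert x F). g S) = (\<Sum>S\<in>Pow F. g S + (g (insert x S) :: 'b::comm_monoid_add))"
proof -
  have "inj_on (insert x) (Pow F)" using assms by (auto simp: inj_on_def)
  moreover have "Pow F \<inter> insert x ` Pow F = {}" using assms by auto
  ultimately show ?thesis using assms
    by (simp add: Pow_insert sum.union_disjoint sum.reindex sum.distrib)
qed

lemma rsum_insert:
  assumes "finite F" "x \<notin> F" "S \<subseteq> F"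
  shows "rsum (insert x F) a S = rsum F a S - a x" "rsum (insert x F) a (insert x S) = rsum F a S + a x"
proof -
  have "x \<notin> S" using assms by auto
  thus "rsum (insert x F) a S = rsum F a S - a x" using assms by (simp add: rsum_def)
  have "rsum F a (insert x S) = rsum F a S"
    unfolding rsum_def using assms by (intro sum.cong refl) auto
  thus "rsum (insert x F) a (insert x S) = rsum F a S + a x" using assms by (simp add: rsum_def)
qed

lemma rsum_scaleR: "rsum I (\<lambda>x. c *\<^sub>R a x) S = c *\<^sub>R rsum I a S"
  unfolding rsum_def scaleR_sum_right by (intro sum.cong refl) (simp add: mult.commute)

text \<open>Orthogonality of independent signs, obtained by induction from the parallelogram
  law.\<close>

lemma rsum_sq:
  fixes a :: "'i \<Rightarrow> 'b::real_inner"
  assumes "finite I"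
  shows "(\<Sum>S\<in>Pow I. (norm (rsum I a S))\<^sup>2) = 2 ^ card I * (\<Sum>x\<in>I. (norm (a x))\<^sup>2)"
  using assms
proof induction
  case empty thus ?case by (simp add: rsum_def)
next
  case (insert x F)
  have "(\<Sum>S\<in>Pow (insert x F). (norm (rsum (insert x F) a S))\<^sup>2)
      = (\<Sum>S\<in>Pow F. 2 * (norm (rsum F a S))\<^sup>2 + 2 * (norm (a x))\<^sup>2)"
    unfolding sum_Pow_insert[OF insert(1,2)]
    by (intro sum.cong refl)
       (use insert(1,2) in \<open>auto simp: rsum_insert power2_norm_eq_inner inner_add_left inner_add_right inner_diff_left inner_diff_right\<close>)
  also have "\<dots> = 2 * (2 ^ card F * (\<Sum>x\<in>F. (norm (a x))\<^sup>2)) + 2 ^ card F * (2 * (norm (a x))\<^sup>2)"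
    using insert by (simp add: sum.distrib sum_distrib_left[symmetric] card_Pow)
  also have "\<dots> = 2 ^ card (insert x F) * (\<Sum>x\<in>insert x F. (norm (a x))\<^sup>2)"
    using insert by (simp add: algebra_simps)
  finally show ?case .
qed

text \<open>For \<open>b = \<bar>a\<bar> \<le> 1\<close> the quadratic bounds
  \<open>1 + b + b\<^sup>2\<close> and \<open>1 - b + b\<^sup>2\<close> for the two exponentials add
  up to \<open>2 * (1 + b\<^sup>2)\<close>.\<close>

lemma exp_pm_le:
  fixes a :: real assumes "\<bar>a\<bar> \<le> 1" shows "exp a + exp (- a) \<le> 2 * exp (a\<^sup>2)"
proof -
  define b where "b = \<bar>a\<bar>"
  have b: "0 \<le> b" "b \<le> 1" using assms by (auto simp: b_def)
  have "exp (- b) = 1 / exp b" by (simp add: exp_minus inverse_eq_divide)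
  also have "\<dots> \<le> 1 / (1 + b)" using b exp_ge_add_one_self[of b] by (intro divide_left_mono) (auto intro: mult_pos_pos)
  also have "\<dots> \<le> 1 - b + b\<^sup>2"
  proof -
    have "(1 - b + b\<^sup>2) * (1 + b) = 1 + b ^ 3" by (simp add: power2_eq_square power3_eq_cube algebra_simps)
    hence "1 \<le> (1 - b + b\<^sup>2) * (1 + b)" using b by simp
    thus ?thesis using b by (simp add: divide_le_eq)
  qed
  finally have "exp b + exp (- b) \<le> 2 * (1 + b\<^sup>2)" using exp_bound[OF b] by simp
  also have "\<dots> \<le> 2 * exp (b\<^sup>2)" by (intro mult_left_mono exp_ge_add_one_self) simp
  finally have "exp b + exp (- b) \<le> 2 * exp (a\<^sup>2)" by (simp add: b_def)
  thus ?thesis unfolding b_def by (cases "0 \<le> a") (auto simp: add.commute)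
qed

lemma rsum_exp:
  fixes a :: "'i \<Rightarrow> real"
  assumes "finite I" "\<And>x. x \<in> I \<Longrightarrow> \<bar>a x\<bar> \<le> 1"
  shows "(\<Sum>S\<in>Pow I. exp (rsum I a S)) \<le> 2 ^ card I * exp (\<Sum>x\<in>I. (a x)\<^sup>2)"
  using assms
proof induction
  case empty thus ?case by (simp add: rsum_def)
next
  case (insert x F)
  have "(\<Sum>S\<in>Pow (insert x F). exp (rsum (insert x F) a S)) = (\<Sum>S\<in>Pow F. exp (rsum F a S) * (exp (a x) + exp (- a x)))"
    unfolding sum_Pow_insert[OF insert(1,2)]
    by (intro sum.cong refl) (use insert(1,2) in \<open>auto simp: rsum_insert exp_add exp_diff exp_minus field_simps\<close>)
  also have "\<dots> = (\<Sum>S\<in>Pow F. exp (rsum F a S)) * (exp (a x) + exp (- a x))" by (rule sum_distrib_right[symmetric])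
  also have "\<dots> \<le> (2 ^ card F * exp (\<Sum>x\<in>F. (a x)\<^sup>2)) * (2 * exp ((a x)\<^sup>2))"
    using insert by (intro mult_mono exp_pm_le) (auto intro: add_nonneg_nonneg)
  also have "\<dots> = 2 ^ card (insert x F) * exp (\<Sum>x\<in>insert x F. (a x)\<^sup>2)"
    using insert by (simp add: exp_add mult_ac)
  finally show ?case .
qed

text \<open>\<open>4 * exp 1\<close> bounds the exponential moments of real and imaginary part with
  both signs, \<open>p powr p\<close> is the price for replacing a power by an exponential, and
  \<open>2 powr p\<close> comes from bounding the modulus by twice the larger of the two
  parts.\<close>

definition khinchine_const :: "real \<Rightarrow> real" where
  "khinchine_const p = 2 powr p * p powr p * (4 * exp 1)"

lemma khinchine_const_pos: "0 < p \<Longrightarrow> 0 < khinchine_const p" by (simp add: khinchine_const_def)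

lemma powr_le_exp:
  assumes "0 < p" "0 \<le> (y::real)" shows "y powr p \<le> p powr p * exp y"
proof -
  have "y / p \<le> exp (y / p)" using exp_ge_add_one_self[of "y / p"] by linarith
  hence "y \<le> p * exp (y / p)" using assms by (simp add: field_simps)
  hence "y powr p \<le> (p * exp (y / p)) powr p" using assms by (intro powr_mono2) auto
  also have "\<dots> = p powr p * exp y" using assms by (simp add: powr_mult exp_powr_real)
  finally show ?thesis .
qed

lemma Re_Im_minus_rsum: "Re (rsum I a S) = rsum I (\<lambda>x. Re (a x)) S" "Im (rsum I a S) = rsum I (\<lambda>x. Im (a x)) S"
  "rsum I (\<lambda>x. - b x) S = - rsum I b S"
  by (simp_all add: rsum_def sum_negf)

text \<open>After normalisation the real and imaginary parts have exponential moments bounded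
  independently of the number of terms, and an exponential dominates every power.\<close>

lemma khinchine_unit:
  fixes a :: "'i \<Rightarrow> complex"
  assumes I: "finite I" and a: "(\<Sum>x\<in>I. (cmod (a x))\<^sup>2) \<le> 1" and p: "0 < p"
  shows "(\<Sum>S\<in>Pow I. cmod (rsum I a S) powr p) \<le> khinchine_const p * 2 ^ card I"
proof -
  have ex: "(\<Sum>S\<in>Pow I. exp (rsum I b S)) \<le> 2 ^ card I * exp 1" if b: "\<And>x. \<bar>b x\<bar> \<le> cmod (a x)" for b
  proof -
    have bs: "(b x)\<^sup>2 \<le> (cmod (a x))\<^sup>2" for x using power_mono[OF b[of x], of 2] by simp
    have s: "(\<Sum>x\<in>I. (b x)\<^sup>2) \<le> 1" using sum_mono[of I "\<lambda>x. (b x)\<^sup>2", OF bs] a by simp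
    have "\<bar>b x\<bar> \<le> 1" if "x \<in> I" for x
    proof -
      have "(b x)\<^sup>2 \<le> (\<Sum>x\<in>I. (b x)\<^sup>2)" by (rule member_le_sum[OF that]) (use I in auto)
      hence "(b x)\<^sup>2 \<le> 1" using s by (rule order.trans)
      thus ?thesis by (simp only: abs_square_le_1)
    qed
    hence "(\<Sum>S\<in>Pow I. exp (rsum I b S)) \<le> 2 ^ card I * exp (\<Sum>x\<in>I. (b x)\<^sup>2)" by (intro rsum_exp I)
    also have "\<dots> \<le> 2 ^ card I * exp 1" using s by simp
    finally show ?thesis .
  qed
  let ?R = "\<lambda>x. Re (a x)" and ?J = "\<lambda>x. Im (a x)"
  let ?k = "2 powr p * p powr p"
  have "(\<Sum>S\<in>Pow I. cmod (rsum I a S) powr p)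
      \<le> (\<Sum>S\<in>Pow I. ?k * (exp (rsum I ?R S) + exp (rsum I (\<lambda>x. - ?R x) S) + exp (rsum I ?J S) + exp (rsum I (\<lambda>x. - ?J x) S)))"
  proof (rule sum_mono)
    fix S
    let ?X = "rsum I a S"
    define y where "y = max \<bar>Re ?X\<bar> \<bar>Im ?X\<bar>"
    have y: "0 \<le> y" "cmod ?X \<le> 2 * y" using cmod_le[of ?X] by (auto simp: y_def)
    have "cmod ?X powr p \<le> (2 * y) powr p" using y p by (intro powr_mono2) auto
    also have "\<dots> = 2 powr p * y powr p" by (rule powr_mult)
    also have "\<dots> \<le> 2 powr p * (p powr p * exp y)" by (intro mult_left_mono powr_le_exp p y) simp
    also have "\<dots> \<le> ?k * (exp (Re ?X) + exp (- Re ?X) + exp (Im ?X) + exp (- Im ?X))"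
    proof -
      have "y = Re ?X \<or> y = - Re ?X \<or> y = Im ?X \<or> y = - Im ?X" unfolding y_def by linarith
      moreover have "0 < exp (Re ?X)" "0 < exp (- Re ?X)" "0 < exp (Im ?X)" "0 < exp (- Im ?X)" by simp_all
      ultimately have "exp y \<le> exp (Re ?X) + exp (- Re ?X) + exp (Im ?X) + exp (- Im ?X)"
        by (elim disjE; simp only:; linarith)
      hence "?k * exp y \<le> ?k * (exp (Re ?X) + exp (- Re ?X) + exp (Im ?X) + exp (- Im ?X))" by (intro mult_left_mono) auto
      thus ?thesis by (simp only: mult.assoc)
    qed
    finally show "cmod ?X powr p \<le> ?k * (exp (rsum I ?R S) + exp (rsum I (\<lambda>x. - ?R x) S) + exp (rsum I ?J S) + exp (rsum I (\<lambda>x. - ?J x) S))"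
      by (simp only: Re_Im_minus_rsum)
  qed
  also have "\<dots> = ?k * ((\<Sum>S\<in>Pow I. exp (rsum I ?R S)) + (\<Sum>S\<in>Pow I. exp (rsum I (\<lambda>x. - ?R x) S))
      + (\<Sum>S\<in>Pow I. exp (rsum I ?J S)) + (\<Sum>S\<in>Pow I. exp (rsum I (\<lambda>x. - ?J x) S)))"
    by (simp only: sum_distrib_left[symmetric] sum.distrib)
  also have "\<dots> \<le> ?k * (2 ^ card I * exp 1 + 2 ^ card I * exp 1 + 2 ^ card I * exp 1 + 2 ^ card I * exp 1)"
    by (intro mult_left_mono add_mono ex) (simp_all add: abs_Re_le_cmod abs_Im_le_cmod)
  finally show ?thesis by (simp add: khinchine_const_def algebra_simps)
qed

lemma khinchine_upper:
  fixes a :: "'i \<Rightarrow> complex"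
  assumes I: "finite I" and t: "0 < t" and a: "(\<Sum>x\<in>I. (cmod (a x))\<^sup>2) \<le> t\<^sup>2" and p: "0 < p"
  shows "(\<Sum>S\<in>Pow I. cmod (rsum I a S) powr p) \<le> khinchine_const p * t powr p * 2 ^ card I"
proof -
  let ?b = "\<lambda>x. (1 / t) *\<^sub>R a x"
  have "(\<Sum>x\<in>I. (cmod (?b x))\<^sup>2) = (\<Sum>x\<in>I. (cmod (a x))\<^sup>2) / t\<^sup>2"
    by (simp add: power_divide sum_divide_distrib norm_divide power_mult_distrib)
  also have "\<dots> \<le> 1" using t a by (simp add: divide_le_eq)
  finally have "(\<Sum>S\<in>Pow I. cmod (rsum I ?b S) powr p) \<le> khinchine_const p * 2 ^ card I" by (intro khinchine_unit I p)
  hence "t powr p * (\<Sum>S\<in>Pow I. cmod (rsum I ?b S) powr p) \<le> t powr p * (khinchine_const p * 2 ^ card I)" by (intro mult_left_mono) auto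
  moreover have "t powr p * cmod (rsum I ?b S) powr p = cmod (rsum I a S) powr p" for S
    unfolding rsum_scaleR using t by (simp add: powr_mult[symmetric])
  ultimately show ?thesis by (simp add: sum_distrib_left mult_ac)
qed

definition khinchine_prob :: real where "khinchine_prob = 1 / (2 * khinchine_const 4)"

lemma khinchine_prob_pos: "0 < khinchine_prob" by (simp add: khinchine_prob_def khinchine_const_pos)

text \<open>The Paley--Zygmund argument, with the fourth moment bounded by \<open>khinchine_const 4\<close>.\<close>
lemma khinchine_lower:
  fixes a :: "'i \<Rightarrow> complex"
  assumes I: "finite I" and t: "0 < t" and a: "t\<^sup>2 \<le> (\<Sum>x\<in>I. (cmod (a x))\<^sup>2)"
  shows "khinchine_prob * 2 ^ card I \<le> real (card {S \<in> Pow I. t / 2 \<le> cmod (rsum I a S)})"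
proof -
  define T where "T = sqrt (\<Sum>x\<in>I. (cmod (a x))\<^sup>2)"
  have T2: "T\<^sup>2 = (\<Sum>x\<in>I. (cmod (a x))\<^sup>2)" unfolding T_def by (simp add: sum_nonneg)
  have T: "t \<le> T" unfolding T_def by (rule real_le_rsqrt) (rule a)
  have T0: "0 < T" using t T by simp
  define B where "B = khinchine_const 4"
  have B: "0 < B" by (simp add: B_def khinchine_const_pos)
  \<comment> \<open>With this \<open>c\<close> the split
    \<open>u \<le> u\<^sup>2 / (4 * c) + c\<close> lets the fourth moment contribute
    \<open>T\<^sup>2 / 4\<close>. The small sums contribute another \<open>T\<^sup>2 / 4\<close>, so
    half of the second moment is left for the large ones.\<close>
  define c where "c = B * T\<^sup>2"
  have c: "0 < c" using B T0 by (simp add: c_def)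
  let ?A = "{S \<in> Pow I. t / 2 \<le> cmod (rsum I a S)}"
  let ?X = "\<lambda>S. cmod (rsum I a S)"
  have pt: "(?X S)\<^sup>2 \<le> T\<^sup>2 / 4 + ?X S powr 4 * (1 / (4 * c)) + c * (if S \<in> ?A then 1 else 0)" if S: "S \<in> Pow I" for S
  proof (cases "S \<in> ?A")
    case True
    define u where "u = (?X S)\<^sup>2"
    have u4: "?X S powr 4 = u\<^sup>2" by (cases "?X S = 0") (auto simp: u_def powr_numeral)
    have "u \<le> u\<^sup>2 * (1 / (4 * c)) + c"
    proof -
      have "u\<^sup>2 * (1 / (4 * c)) + c - u = (u / 2 - c)\<^sup>2 / c"
        using c by (simp add: power2_eq_square field_simps)
      also have "\<dots> \<ge> 0" using c by simp
      finally show ?thesis by simp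
    qed
    hence "u \<le> T\<^sup>2 / 4 + ?X S powr 4 * (1 / (4 * c)) + c" unfolding u4 using zero_le_power2[of T] by linarith
    thus ?thesis using True by (simp only: u_def if_True mult_1_right)
  next
    case False
    hence "?X S < t / 2" using S by simp
    hence "(?X S)\<^sup>2 \<le> (T / 2)\<^sup>2" using T by (intro power_mono) auto
    thus ?thesis using False c by (simp add: power_divide add_increasing2)
  qed
  have fin: "finite (Pow I)" using I by simp
  have "2 ^ card I * T\<^sup>2 = (\<Sum>S\<in>Pow I. (?X S)\<^sup>2)" unfolding T2 by (rule rsum_sq[OF I, symmetric])
  also have "\<dots> \<le> (\<Sum>S\<in>Pow I. T\<^sup>2 / 4 + ?X S powr 4 * (1 / (4 * c)) + c * (if S \<in> ?A then 1 else 0))"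
    by (rule sum_mono) (rule pt)
  also have "\<dots> = 2 ^ card I * (T\<^sup>2 / 4) + (\<Sum>S\<in>Pow I. ?X S powr 4) * (1 / (4 * c)) + c * real (card ?A)"
  proof -
    have "(\<Sum>S\<in>Pow I. if S \<in> ?A then 1 else (0::real)) = real (card (Pow I \<inter> ?A))"
      using fin by (simp add: sum.If_cases Int_def conj_commute)
    moreover have "Pow I \<inter> ?A = ?A" by auto
    ultimately show ?thesis
      using I by (simp only: sum.distrib sum_distrib_left[symmetric] sum_distrib_right[symmetric] sum_constant card_Pow) simp
  qed
  also have "\<dots> \<le> 2 ^ card I * (T\<^sup>2 / 4) + (B * T powr 4 * 2 ^ card I) * (1 / (4 * c)) + c * real (card ?A)"
    unfolding B_def using c T0 T2 by (intro add_mono mult_right_mono khinchine_upper I order.refl) auto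
  also have "(B * T powr 4 * 2 ^ card I) * (1 / (4 * c)) = 2 ^ card I * (T\<^sup>2 / 4)"
  proof -
    have "T powr 4 = T\<^sup>2 * T\<^sup>2" using T0 by (simp add: powr_numeral power2_eq_square eval_nat_numeral)
    thus ?thesis using T0 B by (simp add: c_def field_simps)
  qed
  finally have "2 ^ card I * T\<^sup>2 \<le> T\<^sup>2 * (2 * B * real (card ?A))" by (simp add: c_def algebra_simps)
  hence "T\<^sup>2 * 2 ^ card I \<le> T\<^sup>2 * (2 * B * real (card ?A))" by (simp add: mult.commute)
  hence "2 ^ card I \<le> 2 * B * real (card ?A)" using T0 by (subst (asm) mult_le_cancel_left_pos) auto
  thus ?thesis using B by (simp add: khinchine_prob_def B_def field_simps)
qed

section \<open>Monomials attached to words\<close>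

definition wmono :: "nat \<times> (nat \<Rightarrow> 'n) \<Rightarrow> complex ^ 'n \<Rightarrow> complex" where
  "wmono x z = (\<Prod>i<fst x. z $ snd x i)"

text \<open>Words remember the order of their letters, so a monomial occurs with its multinomial
  multiplicity, which is what makes the squared moduli add up exactly. \<open>PiE\<close> fixes the
  values beyond the length, so that each word is counted once.\<close>

definition words :: "nat set \<Rightarrow> (nat \<times> (nat \<Rightarrow> 'n::finite)) set" where
  "words D = Sigma D (\<lambda>n. PiE {..<n} (\<lambda>_. UNIV))"

lemma finite_words: "finite D \<Longrightarrow> finite (words D)"
  unfolding words_def by (intro finite_SigmaI finite_PiE) auto

text \<open>The power \<open>n\<close> of the sum of all \<open>(cmod (z $ j))\<^sup>2\<close> is
  expanded over words. The weight \<open>g\<close> accommodates multipliers that depend on the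
  degree, such as those of \<open>(I + R)\<close>.\<close>

lemma sum_words:
  fixes z :: "complex ^ 'n"
  assumes "finite D"
  shows "(\<Sum>x\<in>words D. g (fst x) * (cmod (wmono x z))\<^sup>2) = (\<Sum>n\<in>D. g n * norm z ^ (2 * n))"
proof -
  have "(\<Sum>x\<in>words D. g (fst x) * (cmod (wmono x z))\<^sup>2)
      = (\<Sum>n\<in>D. \<Sum>w\<in>PiE {..<n} (\<lambda>_. UNIV). g n * (cmod (wmono (n, w) z))\<^sup>2)"
    unfolding words_def using assms by (subst sum.Sigma) (auto intro!: finite_PiE simp: case_prod_beta)
  also have "\<dots> = (\<Sum>n\<in>D. g n * norm z ^ (2 * n))"
  proof (intro sum.cong refl)
    fix n
    have "(\<Sum>w\<in>PiE {..<n} (\<lambda>_. UNIV). (cmod (wmono (n, w) z))\<^sup>2) = (\<Sum>w\<in>PiE {..<n} (\<lambda>_. UNIV). \<Prod>i<n. (cmod (z $ w i))\<^sup>2)"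
      by (simp add: wmono_def prod_norm[symmetric] prod_power_distrib)
    also have "\<dots> = (\<Prod>i<n. \<Sum>j\<in>UNIV. (cmod (z $ j))\<^sup>2)" by (rule prod_sum_PiE[symmetric]) auto
    also have "\<dots> = norm z ^ (2 * n)" by (simp add: norm_vec_def L2_set_def sum_nonneg power_mult)
    finally show "(\<Sum>w\<in>PiE {..<n} (\<lambda>_. UNIV). g n * (cmod (wmono (n, w) z))\<^sup>2) = g n * norm z ^ (2 * n)"
      by (simp add: sum_distrib_left[symmetric])
  qed
  finally show ?thesis .
qed

lemma wmono_scale: "wmono x (c *\<^sub>R z) = complex_of_real c ^ fst x * wmono x z"
  by (simp add: wmono_def prod.distrib scaleR_conv_of_real[of c "_ :: complex"])

lemma wmono_bound: "norm z \<le> 1 \<Longrightarrow> cmod (wmono x z) \<le> 1"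
  unfolding wmono_def prod_norm[symmetric]
  by (intro prod_le_1) (auto intro: order.trans[OF Finite_Cartesian_Product.norm_nth_le])

lemma cont_wmono: "continuous_on X (wmono x)"
  unfolding wmono_def by (intro continuous_intros)

text \<open>The value \<open>d z\<close> is Euler's identity for homogeneous polynomials, which
  makes each monomial an eigenfunction of \<open>radial\<close>.\<close>

lemma wmono_deriv:
  fixes z :: "complex ^ 'n"
  shows "\<exists>d. (wmono x has_derivative d) (at z) \<and> (\<forall>c v. d (c *s v) = c * d v) \<and> d z = of_nat (fst x) * wmono x z"
proof (intro exI conjI allI)
  let ?d = "\<lambda>h :: complex ^ 'n. \<Sum>i<fst x. h $ snd x i * (\<Prod>j\<in>{..<fst x} - {i}. z $ snd x j)"
  have "bounded_linear (\<lambda>z :: complex ^ 'n. z $ k)" for k by (rule bounded_linear_vec_nth)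
  hence "((\<lambda>z :: complex ^ 'n. \<Prod>i<fst x. z $ snd x i) has_derivative ?d) (at z)"
    by (intro has_derivative_prod bounded_linear_imp_has_derivative)
  thus "(wmono x has_derivative ?d) (at z)" unfolding wmono_def .
  show "?d (c *s v) = c * ?d v" for c v by (simp add: sum_distrib_left mult.assoc)
  have "?d z = (\<Sum>i<fst x. wmono x z)"
    unfolding wmono_def by (intro sum.cong refl prod.remove[symmetric]) auto
  thus "?d z = of_nat (fst x) * wmono x z" by simp
qed

lemma wpoly_deriv:
  fixes z :: "complex ^ 'n"
  assumes I: "finite I"
  shows "\<exists>d. ((\<lambda>z. \<Sum>x\<in>I. a x * wmono x z) has_derivative d) (at z) \<and> (\<forall>c v. d (c *s v) = c * d v) \<and>
     d z = (\<Sum>x\<in>I. a x * of_nat (fst x) * wmono x z)"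
proof -
  obtain d where d: "\<And>x. (wmono x has_derivative d x) (at z)" "\<And>x c v. d x (c *s v) = c * d x v" "\<And>x. d x z = of_nat (fst x) * wmono x z"
    using wmono_deriv[of _ z] by metis
  have "((\<lambda>z. \<Sum>x\<in>I. a x * wmono x z) has_derivative (\<lambda>h. \<Sum>x\<in>I. a x * d x h)) (at z)"
    by (intro has_derivative_sum has_derivative_mult_right d)
  thus ?thesis by (intro exI[of _ "\<lambda>h. \<Sum>x\<in>I. a x * d x h"] conjI) (auto simp: d sum_distrib_left mult_ac)
qed

lemma wpoly_holo: "finite I \<Longrightarrow> holo_on U (\<lambda>z. \<Sum>x\<in>I. a x * wmono x z)"
  unfolding holo_on_def by (blast dest: wpoly_deriv[where a = a])

lemma IR_wpoly:
  assumes I: "finite I"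
  shows "IR_pow k (\<lambda>z. \<Sum>x\<in>I. a x * wmono x z) = (\<lambda>z. \<Sum>x\<in>I. a x * (1 + of_nat (fst x)) ^ k * wmono x (z :: complex ^ 'n))"
proof (induction k)
  case 0 thus ?case by (simp add: IR_pow_def)
next
  case (Suc k)
  let ?b = "\<lambda>x. a x * (1 + of_nat (fst x)) ^ k"
  have "IR_pow (Suc k) (\<lambda>z. \<Sum>x\<in>I. a x * wmono x z) = (\<lambda>z. (\<Sum>x\<in>I. ?b x * wmono x z) + radial (\<lambda>z. \<Sum>x\<in>I. ?b x * wmono x z) z)"
    using Suc by (simp add: IR_pow_def)
  also have "\<dots> = (\<lambda>z. \<Sum>x\<in>I. a x * (1 + of_nat (fst x)) ^ Suc k * wmono x z)"
  proof
    fix z :: "complex ^ 'n"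
    obtain d where d: "((\<lambda>z. \<Sum>x\<in>I. ?b x * wmono x z) has_derivative d) (at z)" "d z = (\<Sum>x\<in>I. ?b x * of_nat (fst x) * wmono x z)"
      using wpoly_deriv[OF I, of ?b z] by blast
    have "radial (\<lambda>z. \<Sum>x\<in>I. ?b x * wmono x z) z = (\<Sum>x\<in>I. ?b x * of_nat (fst x) * wmono x z)"
      unfolding radial_def frechet_derivative_at[OF d(1), symmetric] by (rule d(2))
    thus "(\<Sum>x\<in>I. ?b x * wmono x z) + radial (\<lambda>z. \<Sum>x\<in>I. ?b x * wmono x z) z = (\<Sum>x\<in>I. a x * (1 + of_nat (fst x)) ^ Suc k * wmono x z)"
      by (simp add: sum.distrib[symmetric] algebra_simps)
  qed
  finally show ?case .
qed

definition rpoly :: "nat set \<Rightarrow> (nat \<times> (nat \<Rightarrow> 'n)) set \<Rightarrow> complex ^ 'n::finite \<Rightarrow> complex" where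
  "rpoly D S z = rsum (words D) (\<lambda>x. wmono x z) S"

lemma rpoly_alt: "rpoly D S = (\<lambda>z. \<Sum>x\<in>words D. (if x \<in> S then 1 else -1) * wmono x z)"
  unfolding rpoly_def rsum_def by (intro ext sum.cong refl) auto

lemma cont_rpoly: "continuous_on X (rpoly D S)"
  unfolding rpoly_alt by (intro continuous_intros cont_wmono)

lemma IR_rpoly:
  assumes "finite D"
  shows "IR_pow k (rpoly D S) (r *\<^sub>R \<zeta>) = rsum (words D) (\<lambda>x. of_real ((1 + real (fst x)) ^ k * r ^ fst x) * wmono x \<zeta>) S"
  unfolding rpoly_alt IR_wpoly[OF finite_words[OF assms]] rsum_def
  by (intro sum.cong refl) (auto simp: wmono_scale)

lemma rpoly_HF:
  assumes "finite D" "0 < p" "0 < q" "0 \<le> s"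
  shows "holo_on (ball 0 1) (rpoly D S) \<and> continuous_on (cball 0 1) (rpoly D S) \<and> HF_normp p q s (rpoly D (S :: (nat \<times> (nat \<Rightarrow> 'n::finite)) set)) < \<top>"
proof (intro conjI cont_rpoly)
  show "holo_on (ball 0 1) (rpoly D S)" unfolding rpoly_alt by (rule wpoly_holo[OF finite_words[OF assms(1)]])
  show "HF_normp p q s (rpoly D S) < \<top>"
  proof (rule HF_normp_finite[OF assms(2-4)])
    fix z :: "complex ^ 'n" assume z: "z \<in> ball 0 1"
    show "cmod (IR_pow (splus s) (rpoly D S) z) \<le> (\<Sum>x\<in>(words D :: (nat \<times> (nat \<Rightarrow> 'n)) set). (1 + real (fst x)) ^ splus s)"
      unfolding rpoly_alt IR_wpoly[OF finite_words[OF assms(1)]]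
    proof (rule sum_norm_le)
      fix x :: "nat \<times> (nat \<Rightarrow> 'n)"
      have "cmod (1 + of_nat (fst x)) = 1 + real (fst x)" by (metis norm_of_nat of_nat_Suc)
      moreover have "cmod (wmono x z) \<le> 1" using z by (intro wmono_bound) auto
      ultimately show "cmod ((if x \<in> S then 1 else - 1) * (1 + of_nat (fst x)) ^ splus s * wmono x z) \<le> (1 + real (fst x)) ^ splus s"
        by (auto simp: norm_mult norm_power intro!: mult_left_le)
    qed
  qed
qed

text \<open>At each point of the closed ball the squared moduli sum to at most
  \<open>card D\<close>, so Khinchine's inequality holds pointwise and can be integrated against any
  finite measure; of \<open>\<mu>\<close> only the total mass enters.\<close>

lemma rpoly_upper:
  fixes \<mu> :: "(complex ^ 'n) measure"
  assumes \<mu>: "fin_borel_cball \<mu>" and D: "finite D" "D \<noteq> {}" and p: "0 < p"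
  shows "(\<Sum>S\<in>Pow (words D). \<integral>\<^sup>+z. ennreal (cmod (rpoly D S z) powr p) \<partial>\<mu>)
    \<le> ennreal (khinchine_const p * sqrt (real (card D)) powr p * 2 ^ card (words D :: (nat \<times> (nat \<Rightarrow> 'n)) set) * measure \<mu> (space \<mu>))"
proof -
  interpret M: finite_measure \<mu> using \<mu> by (simp add: fin_borel_cball_def)
  let ?I = "words D :: (nat \<times> (nat \<Rightarrow> 'n)) set"
  let ?K = "khinchine_const p * sqrt (real (card D)) powr p * 2 ^ card ?I"
  have m: "(\<lambda>z. ennreal (cmod (rpoly D S z) powr p)) \<in> borel_measurable \<mu>" for S
  proof (rule fin_borel_measurable[OF \<mu>])
    have "rpoly D S \<in> borel_measurable borel" by (intro borel_measurable_continuous_onI cont_rpoly)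
    thus "(\<lambda>z. ennreal (cmod (rpoly D S z) powr p)) \<in> borel_measurable borel" by measurable
  qed
  have c: "0 < real (card D)" using D by (simp add: card_gt_0_iff)
  have "(\<Sum>S\<in>Pow ?I. \<integral>\<^sup>+z. ennreal (cmod (rpoly D S z) powr p) \<partial>\<mu>) = (\<integral>\<^sup>+z. (\<Sum>S\<in>Pow ?I. ennreal (cmod (rpoly D S z) powr p)) \<partial>\<mu>)"
    by (rule nn_integral_sum[symmetric]) (rule m)
  also have "\<dots> \<le> (\<integral>\<^sup>+z. ennreal ?K \<partial>\<mu>)"
  proof (rule nn_integral_mono)
    fix z assume "z \<in> space \<mu>"
    hence z: "norm z \<le> 1" using fin_borel_space[OF \<mu>] by simp
    have "(\<Sum>x\<in>?I. (cmod (wmono x z))\<^sup>2) = (\<Sum>n\<in>D. norm z ^ (2 * n))" using sum_words[OF D(1), of "\<lambda>_. 1" z] by simp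
    also have "\<dots> \<le> (\<Sum>n\<in>D. 1)" using z by (intro sum_mono power_le_one) auto
    finally have "(\<Sum>x\<in>?I. (cmod (wmono x z))\<^sup>2) \<le> (sqrt (real (card D)))\<^sup>2" by simp
    hence "(\<Sum>S\<in>Pow ?I. cmod (rpoly D S z) powr p) \<le> ?K"
      unfolding rpoly_def using c by (intro khinchine_upper finite_words D p) auto
    thus "(\<Sum>S\<in>Pow ?I. ennreal (cmod (rpoly D S z) powr p)) \<le> ennreal ?K" by (subst sum_ennreal) (auto intro: ennreal_leI)
  qed
  also have "\<dots> = ennreal (?K * measure \<mu> (space \<mu>))"
    using khinchine_const_pos[OF p] by (simp add: M.emeasure_eq_measure ennreal_mult'' )
  finally show ?thesis .
qed

text \<open>The inequality is tested on every sign pattern and summed. \<open>C\<close> absorbs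
  Khinchine's constant and the mass of \<open>\<mu>\<close>, and the dependence on \<open>D\<close>
  is the square root of the number of degrees.\<close>

lemma reverse_carleson_rpoly:
  fixes \<mu> :: "(complex ^ 'n) measure"
  assumes \<mu>: "fin_borel_cball \<mu>" and p: "0 < p" and q: "0 < q" and s: "0 \<le> s" and rc: "reverse_carleson p q s \<mu>"
  shows "\<exists>C\<ge>0. \<forall>D. finite D \<longrightarrow> D \<noteq> {} \<longrightarrow>
    (\<Sum>S\<in>Pow (words D :: (nat \<times> (nat \<Rightarrow> 'n)) set). HF_normp p q s (rpoly D S))
      \<le> ennreal (C * sqrt (real (card D)) powr p * 2 ^ card (words D :: (nat \<times> (nat \<Rightarrow> 'n)) set))"
proof -
  obtain C where C: "0 < C" "\<And>f. holo_on (ball 0 1) f \<and> continuous_on (cball 0 1) f \<and> HF_normp p q s f < \<top>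
        \<Longrightarrow> HF_normp p q s f \<le> ennreal C * (\<integral>\<^sup>+ z. ennreal (cmod (f z) powr p) \<partial>\<mu>)"
    using rc unfolding reverse_carleson_def by blast
  let ?C = "C * khinchine_const p * measure \<mu> (space \<mu>)"
  have "(\<Sum>S\<in>Pow (words D :: (nat \<times> (nat \<Rightarrow> 'n)) set). HF_normp p q s (rpoly D S))
      \<le> ennreal (?C * sqrt (real (card D)) powr p * 2 ^ card (words D :: (nat \<times> (nat \<Rightarrow> 'n)) set))"
    if D: "finite D" "D \<noteq> {}" for D
  proof -
    let ?I = "words D :: (nat \<times> (nat \<Rightarrow> 'n)) set"
    have "(\<Sum>S\<in>Pow ?I. HF_normp p q s (rpoly D S)) \<le> (\<Sum>S\<in>Pow ?I. ennreal C * (\<integral>\<^sup>+ z. ennreal (cmod (rpoly D S z) powr p) \<partial>\<mu>))"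
      by (intro sum_mono C(2) rpoly_HF D p q s)
    also have "\<dots> = ennreal C * (\<Sum>S\<in>Pow ?I. \<integral>\<^sup>+ z. ennreal (cmod (rpoly D S z) powr p) \<partial>\<mu>)" by (rule sum_distrib_left[symmetric])
    also have "\<dots> \<le> ennreal C * ennreal (khinchine_const p * sqrt (real (card D)) powr p * 2 ^ card ?I * measure \<mu> (space \<mu>))"
      by (intro mult_left_mono rpoly_upper \<mu> D p) simp
    also have "\<dots> = ennreal (?C * sqrt (real (card D)) powr p * 2 ^ card ?I)"
      using C(1) by (subst ennreal_mult'[symmetric]) (auto simp: mult_ac)
    finally show ?thesis .
  qed
  moreover have "0 \<le> ?C" using C(1) khinchine_const_pos[OF p] by (intro mult_nonneg_nonneg) auto
  ultimately show ?thesis by blast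
qed

section \<open>Absence of reverse Carleson measures for positive smoothness\<close>

lemma sum_ge_card:
  fixes G :: "'a \<Rightarrow> ennreal"
  assumes "finite P" "\<And>S. S \<in> P \<Longrightarrow> A S \<Longrightarrow> c \<le> G S"
  shows "of_nat (card {S \<in> P. A S}) * c \<le> (\<Sum>S\<in>P. G S)"
proof -
  have "of_nat (card {S \<in> P. A S}) * c \<le> (\<Sum>S\<in>{S \<in> P. A S}. G S)"
    by (rule sum_bounded_below) (use assms in auto)
  also have "\<dots> \<le> (\<Sum>S\<in>P. G S)" by (rule sum_mono2) (use assms in auto)
  finally show ?thesis .
qed

lemma no_powr_bound:
  assumes g: "0 < g" and B: "\<And>n :: nat. n0 \<le> n \<Longrightarrow> real n powr g \<le> B"
  shows False
proof -
  obtain n where n: "max (real n0) ((\<bar>B\<bar> + 1) powr (1 / g)) \<le> real n" using real_arch_simple by blast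
  have "\<bar>B\<bar> + 1 = ((\<bar>B\<bar> + 1) powr (1 / g)) powr g" using g by (simp add: powr_powr)
  also have "\<dots> \<le> real n powr g" using n g by (intro powr_mono2) auto
  also have "\<dots> \<le> B" using n by (intro B) auto
  finally show False by simp
qed

theorem no_reverse_carleson_s_pos:
  fixes \<mu> :: "(complex ^ 'n) measure"
  assumes p: "0 < p" and q: "0 < q" and s: "0 < s" and \<mu>: "fin_borel_cball \<mu>"
  shows "\<not> reverse_carleson p q s \<mu>"
proof
  assume rc: "reverse_carleson p q s \<mu>"
  interpret S: prob_space "sigma :: (complex ^ 'n) measure" by (rule prob_space_sigma)
  obtain C where C: "0 \<le> C" "\<And>D. finite D \<Longrightarrow> D \<noteq> {} \<Longrightarrow>
    (\<Sum>S\<in>Pow (words D :: (nat \<times> (nat \<Rightarrow> 'n)) set). HF_normp p q s (rpoly D S))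
      \<le> ennreal (C * sqrt (real (card D)) powr p * 2 ^ card (words D :: (nat \<times> (nat \<Rightarrow> 'n)) set))"
    using reverse_carleson_rpoly[OF \<mu> p q _ rc] s by auto
  define k where "k = splus s"
  have ks: "s < real k" unfolding k_def using s by (intro splus_gt) simp
  define W where "W = wslice_const q p"
  have W: "0 < W" by (simp add: W_def wslice_const_pos)
  define e where "e = exp (-4 :: real)"
  have e: "0 < e" by (simp add: e_def)
  have "real n powr (s * p) \<le> C / (khinchine_prob * W * (e / 2) powr p)" if n: "4 \<le> n" for n
  proof -
    let ?I = "words {n} :: (nat \<times> (nat \<Rightarrow> 'n)) set"
    have n0: "0 < real n" using n by simp
    have fI: "finite ?I" by (rule finite_words) simp
    have fst: "fst x = n" if "x \<in> ?I" for x using that by (cases x) (simp add: words_def)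
    \<comment> \<open>A Borel minorant of the radial integral; with it the finite sum over sign
      patterns can be exchanged with the integral over the sphere.\<close>
    define g where "g S \<zeta> = ennreal (W * (e * real n powr s * cmod (rpoly {n} S \<zeta>)) powr p)" for S :: "(nat \<times> (nat \<Rightarrow> 'n)) set" and \<zeta>
    have gm: "g S \<in> borel_measurable sigma" for S
    proof (rule measurable_sigma)
      have [measurable]: "rpoly {n} S \<in> borel_measurable borel" by (intro borel_measurable_continuous_onI cont_rpoly)
      show "g S \<in> borel_measurable borel" unfolding g_def by measurable
    qed
    have HF: "(\<integral>\<^sup>+\<zeta>. g S \<zeta> \<partial>sigma) \<le> HF_normp p q s (rpoly {n} S)" for S
      unfolding HF_normp_wslice k_def[symmetric]
    proof (rule nn_integral_mono)
      fix \<zeta> :: "complex ^ 'n"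
      let ?F = "cmod (rpoly {n} S \<zeta>)"
      have IR: "cmod (IR_pow k (rpoly {n} S) (r *\<^sub>R \<zeta>)) = (1 + real n) ^ k * \<bar>r\<bar> ^ n * ?F" for r
      proof -
        have "IR_pow k (rpoly {n} S) (r *\<^sub>R \<zeta>) = rsum ?I (\<lambda>x. ((1 + real n) ^ k * r ^ n) *\<^sub>R wmono x \<zeta>) S"
          unfolding IR_rpoly[OF finite.insertI[OF finite.emptyI]] rsum_def
          by (intro sum.cong refl) (simp add: fst scaleR_conv_of_real)
        also have "\<dots> = ((1 + real n) ^ k * r ^ n) *\<^sub>R rpoly {n} S \<zeta>" unfolding rsum_scaleR rpoly_def ..
        finally show ?thesis by (simp add: norm_mult norm_power abs_mult power_abs)
      qed
      let ?H = "(1 + real n) ^ k * e * ?F"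
      have "ennreal (W * (?H * real n powr (- (real k - s))) powr p) \<le> wslice q p (real k - s) (\<lambda>r. cmod (IR_pow k (rpoly {n} S) (r *\<^sub>R \<zeta>)))"
        unfolding W_def
      proof (rule wslice_ge[OF n _ _ p q])
        fix r :: real assume r: "1 - 2 / real n \<le> r" "r \<le> 1 - 1 / real n"
        have "0 \<le> 1 / real n" by simp
        hence r1: "r \<le> 1" using r by linarith
        have "2 / real n \<le> 1" using n by (simp add: divide_le_eq)
        hence "0 \<le> r" using r by linarith
        thus "?H \<le> cmod (IR_pow k (rpoly {n} S) (r *\<^sub>R \<zeta>))"
          unfolding IR using power_near_one[OF n r(1) r1] by (intro mult_right_mono mult_left_mono) (auto simp: e_def)
      qed (use ks e in auto)
      \<comment> \<open>The \<open>k\<close> derivatives gain \<open>real n ^ k\<close> and the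
        weight loses \<open>real n powr (real k - s)\<close>; the power \<open>s\<close>
        remains.\<close>
      moreover have "e * real n powr s * ?F \<le> ?H * real n powr (- (real k - s))"
      proof -
        have "real n powr s = real n ^ k * real n powr (- (real k - s))"
          using n0 by (simp add: powr_realpow[symmetric] powr_add[symmetric])
        also have "\<dots> \<le> (1 + real n) ^ k * real n powr (- (real k - s))" by (intro mult_right_mono power_mono) auto
        finally have "real n powr s * (e * ?F) \<le> (1 + real n) ^ k * real n powr (- (real k - s)) * (e * ?F)"
          using e by (intro mult_right_mono) auto
        thus ?thesis by (simp only: mult_ac)
      qed
      hence "ennreal (W * (e * real n powr s * ?F) powr p) \<le> ennreal (W * (?H * real n powr (- (real k - s))) powr p)"
        using W e p by (intro ennreal_leI mult_left_mono powr_mono2) auto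
      ultimately show "g S \<zeta> \<le> wslice q p (real k - s) (\<lambda>r. cmod (IR_pow k (rpoly {n} S) (r *\<^sub>R \<zeta>)))"
        unfolding g_def by (rule order.trans[rotated])
    qed
    let ?v = "W * (e * real n powr s / 2) powr p"
    have "ennreal (khinchine_prob * 2 ^ card ?I * ?v) = (\<integral>\<^sup>+\<zeta>. ennreal (khinchine_prob * 2 ^ card ?I * ?v) \<partial>(sigma :: (complex ^ 'n) measure))"
      by (simp add: emeasure_sigma_sphere)
    also have "\<dots> \<le> (\<integral>\<^sup>+\<zeta>. (\<Sum>S\<in>Pow ?I. g S \<zeta>) \<partial>sigma)"
    proof (rule nn_integral_mono)
      fix \<zeta> :: "complex ^ 'n" assume "\<zeta> \<in> space sigma"
      hence \<zeta>: "norm \<zeta> = 1" by simp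
      have "(\<Sum>x\<in>?I. (cmod (wmono x \<zeta>))\<^sup>2) = 1" using sum_words[of "{n}" "\<lambda>_. 1" \<zeta>] \<zeta> by simp
      hence "khinchine_prob * 2 ^ card ?I \<le> real (card {S \<in> Pow ?I. 1 / 2 \<le> cmod (rsum ?I (\<lambda>x. wmono x \<zeta>) S)})"
        by (intro khinchine_lower fI) auto
      hence "ennreal (khinchine_prob * 2 ^ card ?I * ?v) \<le> ennreal (real (card {S \<in> Pow ?I. 1 / 2 \<le> cmod (rpoly {n} S \<zeta>)}) * ?v)"
        unfolding rpoly_def using W by (intro ennreal_leI mult_right_mono) auto
      also have "\<dots> = of_nat (card {S \<in> Pow ?I. 1 / 2 \<le> cmod (rpoly {n} S \<zeta>)}) * ennreal ?v"
        by (simp add: ennreal_mult' ennreal_of_nat_eq_real_of_nat)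
      also have "\<dots> \<le> (\<Sum>S\<in>Pow ?I. g S \<zeta>)"
      proof (rule sum_ge_card)
        fix S assume S: "1 / 2 \<le> cmod (rpoly {n} S \<zeta>)"
        have "e * real n powr s * (1 / 2) \<le> e * real n powr s * cmod (rpoly {n} S \<zeta>)"
          using e S by (intro mult_left_mono) auto
        thus "ennreal ?v \<le> g S \<zeta>" unfolding g_def using W e p
          by (intro ennreal_leI mult_left_mono powr_mono2) auto
      qed (use fI in simp)
      finally show "ennreal (khinchine_prob * 2 ^ card ?I * ?v) \<le> (\<Sum>S\<in>Pow ?I. g S \<zeta>)" .
    qed
    also have "\<dots> = (\<Sum>S\<in>Pow ?I. \<integral>\<^sup>+\<zeta>. g S \<zeta> \<partial>sigma)" by (rule nn_integral_sum) (rule gm)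
    also have "\<dots> \<le> (\<Sum>S\<in>Pow ?I. HF_normp p q s (rpoly {n} S))" by (intro sum_mono HF)
    also have "\<dots> \<le> ennreal (C * 2 ^ card ?I)" using C(2)[of "{n}"] by simp
    finally have "khinchine_prob * 2 ^ card ?I * ?v \<le> C * 2 ^ card ?I" using C(1) by (subst (asm) ennreal_le_iff) auto
    hence "2 ^ card ?I * (khinchine_prob * ?v) \<le> 2 ^ card ?I * C" by (simp only: mult_ac)
    hence "khinchine_prob * ?v \<le> C" by (subst (asm) mult_le_cancel_left_pos) auto
    moreover have "(e * real n powr s / 2) powr p = (e / 2) powr p * real n powr (s * p)"
    proof -
      have "(e * real n powr s / 2) powr p = (e / 2 * real n powr s) powr p" by simp
      also have "\<dots> = (e / 2) powr p * real n powr (s * p)" by (simp only: powr_mult powr_powr)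
      finally show ?thesis .
    qed
    ultimately have "real n powr (s * p) * (khinchine_prob * W * (e / 2) powr p) \<le> C" by (simp only: mult_ac)
    moreover have "0 < khinchine_prob * W * (e / 2) powr p" using khinchine_prob_pos W e by simp
    ultimately show ?thesis by (simp only: pos_le_divide_eq)
  qed
  thus False using p s by (intro no_powr_bound[of "s * p" 4]) auto
qed

section \<open>Dyadic degrees and exponents at most one\<close>

lemma dyadic_disjoint:
  fixes r :: real
  assumes "r \<in> {1 - 2 / 2 ^ m..<1 - 1 / 2 ^ m}" "r \<in> {1 - 2 / 2 ^ m'..<1 - 1 / 2 ^ m'}"
  shows "m = (m' :: nat)"
proof -
  have *: False if r: "r < 1 - 1 / 2 ^ a" "1 - 2 / 2 ^ b \<le> r" and "a < b" for a b :: nat and r :: real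
  proof -
    have "(2::real) ^ Suc a \<le> 2 ^ b" using that by (intro power_increasing) auto
    hence "2 / (2::real) ^ b \<le> 2 / 2 ^ Suc a" by (intro divide_left_mono) auto
    thus False using r by simp
  qed
  show ?thesis
  proof (rule ccontr)
    assume "m \<noteq> m'"
    hence "m < m' \<or> m' < m" by linarith
    thus False using *[of r m m'] *[of r m' m] assms by auto
  qed
qed

text \<open>The exponents start at \<open>2\<close> because \<open>power_near_one\<close> needs
  degrees at least \<open>4\<close>.\<close>

definition dyad :: "nat \<Rightarrow> nat set" where "dyad N = (\<lambda>m. 2 ^ m) ` {2..<N + 2}"

lemma card_dyad: "card (dyad N) = N" "finite (dyad N)"
  unfolding dyad_def by (subst card_image) (auto simp: inj_on_def)

text \<open>This is \<open>(I + R)\<close> of the random polynomial at the point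
  \<open>r *\<^sub>R \<zeta>\<close>, by \<open>IR_rpoly\<close> with \<open>k = 1\<close>.\<close>

definition dyadic_rpoly :: "nat \<Rightarrow> (nat \<times> (nat \<Rightarrow> 'n)) set \<Rightarrow> complex ^ 'n::finite \<Rightarrow> real \<Rightarrow> complex" where
  "dyadic_rpoly N S \<zeta> r = rsum (words (dyad N)) (\<lambda>x. of_real ((1 + real (fst x)) * r ^ fst x) * wmono x \<zeta>) S"

text \<open>The half-open interval consists of radii at which degree \<open>2 ^ m\<close> alone
  contributes at least \<open>2 ^ m * exp (-4)\<close> to the root of the sum of squares; the factor
  \<open>1/2\<close> is the one in \<open>khinchine_lower\<close>. Intervals for different
  \<open>m\<close> do not meet.\<close>

definition big :: "nat \<Rightarrow> nat \<Rightarrow> (nat \<times> (nat \<Rightarrow> 'n)) set \<Rightarrow> complex ^ 'n::finite \<Rightarrow> real \<Rightarrow> bool" where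
  "big N m S \<zeta> r \<longleftrightarrow> r \<in> {1 - 2 / 2 ^ m..<1 - 1 / 2 ^ m} \<and> 2 ^ m * exp (-4) / 2 \<le> cmod (dyadic_rpoly N S \<zeta> r)"

text \<open>The \<open>m\<close>-th interval has length \<open>1 / 2 ^ m\<close>, so the factor
  \<open>2 ^ m\<close> gives it weight \<open>1\<close>. \<open>bigtime\<close> counts, with
  fractions, the scales at which the signed sum is large.\<close>

definition bigtime :: "nat \<Rightarrow> (nat \<times> (nat \<Rightarrow> 'n)) set \<Rightarrow> complex ^ 'n::finite \<Rightarrow> ennreal" where
  "bigtime N S \<zeta> = (\<Sum>m\<in>{2..<N + 2}. 2 ^ m * (\<integral>\<^sup>+r. (if big N m S \<zeta> r then 1 else 0) \<partial>lborel))"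

lemma big_measurable [measurable]:
  "(\<lambda>(\<zeta>, r). if big N m S \<zeta> r then 1 else 0 :: ennreal) \<in> borel_measurable (borel \<Otimes>\<^sub>M lborel)"
proof -
  have [measurable]: "wmono x \<in> borel_measurable borel" for x :: "nat \<times> (nat \<Rightarrow> 'a)"
    by (intro borel_measurable_continuous_onI cont_wmono)
  show ?thesis unfolding big_def dyadic_rpoly_def rsum_def by measurable
qed

lemma big_measurable2 [measurable]: "(\<lambda>r. if big N m S \<zeta> r then 1 else 0 :: ennreal) \<in> borel_measurable lborel"
  using measurable_compose[OF measurable_Pair1'[of \<zeta> borel lborel] big_measurable[of N m S]] by simp

lemma bigtime_measurable [measurable]: "bigtime N S \<in> borel_measurable borel"
proof -
  have [measurable]: "(\<lambda>\<zeta>. \<integral>\<^sup>+r. (if big N m S \<zeta> r then 1 else 0) \<partial>lborel) \<in> borel_measurable borel" for m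
    by (rule sigma_finite_measure.borel_measurable_nn_integral[OF sigma_finite_lborel big_measurable])
  show ?thesis unfolding bigtime_def by measurable
qed

lemma nn_integral_dyadic: "(\<integral>\<^sup>+r. indicator {1 - 2 / 2 ^ m..<1 - 1 / 2 ^ m :: real} r \<partial>lborel) = ennreal (1 / 2 ^ m)"
proof -
  have "1 - 2 / 2 ^ m \<le> 1 - 1 / (2::real) ^ m" by (simp add: divide_right_mono)
  thus ?thesis by (simp add: diff_divide_distrib[symmetric])
qed

lemma two_power_cancel: "2 ^ m * ennreal (1 / 2 ^ m) = 1"
proof -
  have "(2::ennreal) ^ m = ennreal (2 ^ m)" by (simp add: ennreal_power[symmetric])
  thus ?thesis by (simp add: ennreal_mult[symmetric])
qed

lemma bigtime_le: "bigtime N S \<zeta> \<le> of_nat N"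
proof -
  have "bigtime N S \<zeta> \<le> (\<Sum>m\<in>{2..<N + 2}. 1)" unfolding bigtime_def
  proof (rule sum_mono)
    fix m
    have "(\<integral>\<^sup>+r. (if big N m S \<zeta> r then 1 else 0) \<partial>lborel) \<le> (\<integral>\<^sup>+r. indicator {1 - 2 / 2 ^ m..<1 - 1 / 2 ^ m :: real} r \<partial>lborel)"
      by (intro nn_integral_mono) (auto simp: big_def)
    hence "2 ^ m * (\<integral>\<^sup>+r. (if big N m S \<zeta> r then 1 else 0) \<partial>lborel) \<le> 2 ^ m * ennreal (1 / 2 ^ m)"
      unfolding nn_integral_dyadic by (intro mult_left_mono) auto
    thus "2 ^ m * (\<integral>\<^sup>+r. (if big N m S \<zeta> r then 1 else 0) \<partial>lborel) \<le> 1" by (simp only: two_power_cancel)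
  qed
  thus ?thesis by simp
qed

text \<open>At a radius in the \<open>m\<close>-th interval the single degree \<open>2 ^ m\<close>
  already makes the sum of squares large, and further degrees can only increase it.
  \<open>khinchine_lower\<close> then makes a fixed proportion of the sign patterns big there, and
  summation over \<open>m\<close> gives the factor \<open>real N\<close>.\<close>

lemma bigtime_sum:
  fixes \<zeta> :: "complex ^ 'n"
  assumes \<zeta>: "norm \<zeta> = 1"
  shows "ennreal (khinchine_prob * 2 ^ card (words (dyad N) :: (nat \<times> (nat \<Rightarrow> 'n)) set) * real N)
     \<le> (\<Sum>S\<in>Pow (words (dyad N)). bigtime N S \<zeta>)"
proof -
  let ?I = "words (dyad N) :: (nat \<times> (nat \<Rightarrow> 'n)) set"
  let ?c = "khinchine_prob * 2 ^ card ?I"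
  have fI: "finite ?I" by (intro finite_words card_dyad)
  have count: "ennreal ?c * indicator {1 - 2 / 2 ^ m..<1 - 1 / 2 ^ m} r \<le> (\<Sum>S\<in>Pow ?I. if big N m S \<zeta> r then 1 else 0)"
    if m: "m \<in> {2..<N + 2}" for m and r :: real
  proof (cases "r \<in> {1 - 2 / 2 ^ m..<1 - 1 / 2 ^ m}")
    case True
    let ?n = "2 ^ m :: nat"
    have n: "4 \<le> ?n" using power_increasing[of 2 m "2::nat"] m by simp
    have n1: "0 < 1 / (2::real) ^ m" "2 / (2::real) ^ m \<le> 1" using m power_increasing[of 1 m "2::real"] by (auto simp: divide_le_eq)
    have "1 - 2 / 2 ^ m \<le> r" "r < 1 - 1 / 2 ^ m" using True by auto
    hence r: "0 \<le> r" "r \<le> 1" "1 - 2 / real ?n \<le> r" using n1 by (linarith, linarith, simp)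
    let ?a = "\<lambda>x. of_real ((1 + real (fst x)) * r ^ fst x) * wmono x \<zeta>"
    have "2 ^ m * exp (-4) \<le> (1 + real ?n) * r ^ ?n"
      by (intro mult_mono power_near_one n r) auto
    hence "(2 ^ m * exp (-4))\<^sup>2 \<le> ((1 + real ?n) * r ^ ?n)\<^sup>2" by (intro power_mono) auto
    also have "\<dots> \<le> (\<Sum>n\<in>dyad N. ((1 + real n) * r ^ n)\<^sup>2)"
      by (rule member_le_sum) (use m in \<open>auto simp: dyad_def\<close>)
    also have "\<dots> = (\<Sum>n\<in>dyad N. ((1 + real n) * r ^ n)\<^sup>2 * norm \<zeta> ^ (2 * n))" using \<zeta> by simp
    also have "\<dots> = (\<Sum>x\<in>?I. ((1 + real (fst x)) * r ^ fst x)\<^sup>2 * (cmod (wmono x \<zeta>))\<^sup>2)"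
      by (rule sum_words[symmetric]) (rule card_dyad)
    also have "\<dots> = (\<Sum>x\<in>?I. (cmod (?a x))\<^sup>2)"
      using r by (intro sum.cong refl) (simp add: norm_mult power_mult_distrib del: of_real_mult of_real_add of_real_power)
    finally have "?c \<le> real (card {S \<in> Pow ?I. 2 ^ m * exp (-4) / 2 \<le> cmod (rsum ?I ?a S)})"
      by (intro khinchine_lower fI) auto
    hence "ennreal ?c \<le> of_nat (card {S \<in> Pow ?I. big N m S \<zeta> r}) * 1"
      using True unfolding big_def dyadic_rpoly_def by (simp add: ennreal_of_nat_eq_real_of_nat ennreal_leI)
    also have "\<dots> \<le> (\<Sum>S\<in>Pow ?I. if big N m S \<zeta> r then 1 else 0)"
      by (rule sum_ge_card) (use fI in auto)
    finally show ?thesis using True by simp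
  qed simp
  have one: "ennreal ?c \<le> 2 ^ m * (\<Sum>S\<in>Pow ?I. \<integral>\<^sup>+r. (if big N m S \<zeta> r then 1 else 0) \<partial>lborel)" if m: "m \<in> {2..<N + 2}" for m
  proof -
    have "ennreal ?c = 2 ^ m * (ennreal ?c * ennreal (1 / 2 ^ m))"
      unfolding mult.left_commute[of "2 ^ m"] two_power_cancel by simp
    also have "\<dots> = 2 ^ m * (\<integral>\<^sup>+r. ennreal ?c * indicator {1 - 2 / 2 ^ m..<1 - 1 / 2 ^ m :: real} r \<partial>lborel)"
      by (subst nn_integral_cmult) (simp_all only: nn_integral_dyadic, measurable)
    also have "\<dots> \<le> 2 ^ m * (\<integral>\<^sup>+r. (\<Sum>S\<in>Pow ?I. if big N m S \<zeta> r then 1 else 0) \<partial>lborel)"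
      by (intro mult_left_mono nn_integral_mono count m) simp
    also have "\<dots> = 2 ^ m * (\<Sum>S\<in>Pow ?I. \<integral>\<^sup>+r. (if big N m S \<zeta> r then 1 else 0) \<partial>lborel)"
      by (subst nn_integral_sum) (rule big_measurable2, rule refl)
    finally show ?thesis .
  qed
  have "ennreal (?c * real N) = (\<Sum>m\<in>{2..<N + 2}. ennreal ?c)"
    using khinchine_prob_pos by (simp add: ennreal_mult ennreal_of_nat_eq_real_of_nat mult.commute)
  also have "\<dots> \<le> (\<Sum>m\<in>{2..<N + 2}. 2 ^ m * (\<Sum>S\<in>Pow ?I. \<integral>\<^sup>+r. (if big N m S \<zeta> r then 1 else 0) \<partial>lborel))"
    by (intro sum_mono one)
  also have "\<dots> = (\<Sum>S\<in>Pow ?I. bigtime N S \<zeta>)"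
    unfolding bigtime_def sum_distrib_left by (rule sum.swap)
  finally show ?thesis .
qed

text \<open>Where the sum is big on the \<open>m\<close>-th interval, the integrand is at least a
  constant times \<open>2 ^ m\<close>, which is the normalising factor in \<open>bigtime\<close>. As
  the intervals are disjoint, the contributions add up.\<close>

lemma wslice_ge_bigtime:
  fixes \<zeta> :: "complex ^ 'n"
  assumes q: "0 < q" "q \<noteq> \<top>" and p: "0 < p"
  shows "epow (ennreal ((exp (-4) / 2) powr enn2real q / 4) * bigtime N S \<zeta>) (p / enn2real q) \<le> wslice q p 1 (\<lambda>r. cmod (dyadic_rpoly N S \<zeta> r))"
proof -
  define Q where "Q = enn2real q"
  have Q: "0 < Q" using q by (simp add: Q_def enn2real_positive_iff less_top)
  define \<kappa> where "\<kappa> = (exp (-4) / 2) powr Q / 4"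
  have \<kappa>: "0 < \<kappa>" by (simp add: \<kappa>_def)
  let ?f = "\<lambda>r. cmod (dyadic_rpoly N S \<zeta> r) powr Q * (1 - r\<^sup>2) powr (1 * Q - 1)"
  have pt: "\<kappa> * 2 ^ m \<le> ?f r \<and> r \<in> {0..<1}" if m: "2 \<le> m" and b: "big N m S \<zeta> r" for m r
  proof -
    define n where "n = (2::real) ^ m"
    have n: "4 \<le> n" unfolding n_def using power_increasing[of 2 m "2::real"] m by simp
    have r: "1 - 2 / n \<le> r" "r < 1 - 1 / n" and Y: "n * exp (-4) / 2 \<le> cmod (dyadic_rpoly N S \<zeta> r)"
      using b by (auto simp: big_def n_def)
    have "2 / n \<le> 1/2" using n by (simp add: divide_le_eq)
    hence r0: "0 \<le> r" using r by linarith
    have n1: "0 < 1 / n" using n by simp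
    hence r1: "r < 1" using r by linarith
    have e: "1 - r\<^sup>2 = (1 - r) * (1 + r)" by (simp add: power2_eq_square algebra_simps)
    have "(1 - r) * 1 \<le> (1 - r) * (1 + r)" "(1 - r) * (1 + r) \<le> (1 - r) * 2"
      using r0 r1 by (intro mult_left_mono; simp)+
    moreover have "(1 - r) * 2 \<le> 2 / n * 2" using r by (intro mult_right_mono) auto
    moreover have "1 / n \<le> (1 - r) * 1" using r by simp
    ultimately have x: "1 / n \<le> 1 - r\<^sup>2" "1 - r\<^sup>2 \<le> 4 / n" unfolding e by (simp_all del: mult_1_right)
    have x0: "0 < 1 - r\<^sup>2" using x n1 by linarith
    have "\<kappa> * n = (n * exp (-4) / 2) powr Q * ((1 / n) powr Q * (n / 4))"
    proof -
      have "(n * exp (-4) / 2) powr Q * (1 / n) powr Q = (n * exp (-4) / 2 * (1 / n)) powr Q" by (simp only: powr_mult)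
      also have "n * exp (-4) / 2 * (1 / n) = exp (-4) / 2" using n by simp
      finally show ?thesis by (simp add: \<kappa>_def mult.assoc[symmetric])
    qed
    also have "\<dots> \<le> cmod (dyadic_rpoly N S \<zeta> r) powr Q * ((1 - r\<^sup>2) powr Q * (1 / (1 - r\<^sup>2)))"
    proof (intro mult_mono)
      show "(n * exp (-4) / 2) powr Q \<le> cmod (dyadic_rpoly N S \<zeta> r) powr Q" using Y n Q by (intro powr_mono2) auto
      show "(1 / n) powr Q \<le> (1 - r\<^sup>2) powr Q" using x n Q by (intro powr_mono2) auto
      show "n / 4 \<le> 1 / (1 - r\<^sup>2)" using x x0 n by (simp add: field_simps)
    qed (use n x0 in auto)
    also have "(1 - r\<^sup>2) powr Q * (1 / (1 - r\<^sup>2)) = (1 - r\<^sup>2) powr (1 * Q - 1)" using x0 by (simp add: powr_diff)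
    finally show ?thesis using r0 r1 by (simp add: n_def)
  qed
  have "ennreal \<kappa> * bigtime N S \<zeta> = (\<Sum>m\<in>{2..<N + 2}. \<integral>\<^sup>+r. ennreal (\<kappa> * 2 ^ m) * (if big N m S \<zeta> r then 1 else 0) \<partial>lborel)"
    unfolding bigtime_def sum_distrib_left
  proof (intro sum.cong refl)
    fix m
    have a: "(\<integral>\<^sup>+r. ennreal (\<kappa> * 2 ^ m) * (if big N m S \<zeta> r then 1 else 0) \<partial>lborel) = ennreal (\<kappa> * 2 ^ m) * (\<integral>\<^sup>+r. (if big N m S \<zeta> r then 1 else 0) \<partial>lborel)"
      by (rule nn_integral_cmult) (rule big_measurable2)
    have b: "ennreal (\<kappa> * 2 ^ m) = ennreal \<kappa> * 2 ^ m" using \<kappa> by (simp add: ennreal_mult ennreal_power[symmetric])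
    show "ennreal \<kappa> * (2 ^ m * (\<integral>\<^sup>+r. (if big N m S \<zeta> r then 1 else 0) \<partial>lborel)) = (\<integral>\<^sup>+r. ennreal (\<kappa> * 2 ^ m) * (if big N m S \<zeta> r then 1 else 0) \<partial>lborel)"
      unfolding a unfolding b by (simp only: mult.assoc)
  qed
  also have "\<dots> = (\<integral>\<^sup>+r. (\<Sum>m\<in>{2..<N + 2}. ennreal (\<kappa> * 2 ^ m) * (if big N m S \<zeta> r then 1 else 0)) \<partial>lborel)"
    by (rule nn_integral_sum[symmetric]) (use big_measurable2 in measurable)
  also have "\<dots> \<le> (\<integral>\<^sup>+r\<in>{0..<1}. ennreal (?f r) \<partial>lborel)"
  proof (rule nn_integral_mono)
    fix r :: real
    show "(\<Sum>m\<in>{2..<N + 2}. ennreal (\<kappa> * 2 ^ m) * (if big N m S \<zeta> r then 1 else 0)) \<le> ennreal (?f r) * indicator {0..<1} r"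
    proof (cases "\<exists>m\<in>{2..<N + 2}. big N m S \<zeta> r")
      case True
      then obtain m where m: "m \<in> {2..<N + 2}" "big N m S \<zeta> r" by blast
      have "(\<Sum>i\<in>{2..<N + 2}. ennreal (\<kappa> * 2 ^ i) * (if big N i S \<zeta> r then 1 else 0)) = (\<Sum>i\<in>{2..<N + 2}. if i = m then ennreal (\<kappa> * 2 ^ m) else 0)"
      proof (intro sum.cong refl)
        fix i
        have "big N i S \<zeta> r \<longleftrightarrow> i = m" using m(2) dyadic_disjoint[of r i m] by (auto simp: big_def)
        thus "ennreal (\<kappa> * 2 ^ i) * (if big N i S \<zeta> r then 1 else 0) = (if i = m then ennreal (\<kappa> * 2 ^ m) else 0)" by simp
      qed
      also have "\<dots> = ennreal (\<kappa> * 2 ^ m)" using m by (subst sum.delta) auto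
      also have "\<dots> \<le> ennreal (?f r) * indicator {0..<1} r" using pt[of m r] m by (simp add: ennreal_leI)
      finally show ?thesis .
    next
      case False
      hence "(\<Sum>m\<in>{2..<N + 2}. ennreal (\<kappa> * 2 ^ m) * (if big N m S \<zeta> r then 1 else 0)) = 0" by (intro sum.neutral) auto
      thus ?thesis by simp
    qed
  qed
  finally have "ennreal \<kappa> * bigtime N S \<zeta> \<le> (\<integral>\<^sup>+r\<in>{0..<1}. ennreal (?f r) \<partial>lborel)" .
  hence "epow (ennreal \<kappa> * bigtime N S \<zeta>) (p / Q) \<le> epow (\<integral>\<^sup>+r\<in>{0..<1}. ennreal (?f r) \<partial>lborel) (p / Q)"
    using p Q by (intro epow_mono) auto
  thus ?thesis using q unfolding wslice_def by (simp add: \<kappa>_def Q_def)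
qed

text \<open>The exponent \<open>p / Q\<close> may be below \<open>1\<close>, so the mean of the
  power cannot be bounded below by the power of the mean. Instead, values bounded by
  \<open>N\<close> with mean at least \<open>c * N\<close> must be of size \<open>c * N / 2\<close>
  for a proportion \<open>c / 2\<close> of the patterns.\<close>

lemma count_large:
  fixes L :: "'a \<Rightarrow> real"
  assumes P: "finite P" and N: "0 < N" and L: "\<And>S. S \<in> P \<Longrightarrow> L S \<le> N"
    and s: "c * real (card P) * N \<le> (\<Sum>S\<in>P. L S)" and c: "0 \<le> c"
  shows "c / 2 * real (card P) \<le> real (card {S \<in> P. c * N / 2 \<le> L S})"
proof -
  let ?A = "{S \<in> P. c * N / 2 \<le> L S}"
  have "(\<Sum>S\<in>P. L S) \<le> (\<Sum>S\<in>P. c * N / 2 + N * (if S \<in> ?A then 1 else 0))"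
  proof (rule sum_mono)
    fix S assume S: "S \<in> P"
    have "0 \<le> c * N" using c N by simp
    thus "L S \<le> c * N / 2 + N * (if S \<in> ?A then 1 else 0)" using S L[OF S] by auto
  qed
  also have "\<dots> = real (card P) * (c * N / 2) + N * real (card ?A)"
  proof -
    have "(\<Sum>S\<in>P. if S \<in> ?A then 1 else (0::real)) = real (card (P \<inter> ?A))"
      using P by (simp add: sum.If_cases Int_def conj_commute)
    moreover have "P \<inter> ?A = ?A" by auto
    ultimately show ?thesis by (simp only: sum.distrib sum_distrib_left[symmetric] sum_constant)
  qed
  finally have "N * (c / 2 * real (card P)) \<le> N * real (card ?A)" using s by (simp add: algebra_simps)
  thus ?thesis using N by (subst (asm) mult_le_cancel_left_pos) auto
qed

theorem no_reverse_carleson_q_le_1: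
  fixes \<mu> :: "(complex ^ 'n) measure"
  assumes p: "0 < p" and q: "0 < q" "q \<le> 1" and \<mu>: "fin_borel_cball \<mu>"
  shows "\<not> reverse_carleson p q 0 \<mu>"
proof
  assume rc: "reverse_carleson p q 0 \<mu>"
  interpret S: prob_space "sigma :: (complex ^ 'n) measure" by (rule prob_space_sigma)
  obtain C where C: "0 \<le> C" "\<And>D. finite D \<Longrightarrow> D \<noteq> {} \<Longrightarrow>
    (\<Sum>S\<in>Pow (words D :: (nat \<times> (nat \<Rightarrow> 'n)) set). HF_normp p q 0 (rpoly D S))
      \<le> ennreal (C * sqrt (real (card D)) powr p * 2 ^ card (words D :: (nat \<times> (nat \<Rightarrow> 'n)) set))"
    using reverse_carleson_rpoly[OF \<mu> p q(1) _ rc] by auto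
  define Q where "Q = enn2real q"
  have qt: "q \<noteq> \<top>" using q(2) by (auto simp: top_unique)
  have Q0: "0 < Q" using q qt by (simp add: Q_def enn2real_positive_iff less_top)
  have Q1: "Q \<le> 1" unfolding Q_def using enn2real_mono[OF q(2)] by simp
  define \<kappa> where "\<kappa> = (exp (-4) / 2) powr Q / 4"
  have \<kappa>: "0 < \<kappa>" by (simp add: \<kappa>_def)
  define c where "c = khinchine_prob"
  have c: "0 < c" by (simp add: c_def khinchine_prob_pos)
  define B where "B = c / 2 * (\<kappa> * c / 2) powr (p / Q)"
  have B: "0 < B" using c \<kappa> by (simp add: B_def)
  have "real N powr (p / 2) \<le> C / B" if N: "1 \<le> N" for N
  proof -
    let ?I = "words (dyad N) :: (nat \<times> (nat \<Rightarrow> 'n)) set"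
    have N0: "0 < real N" using N by simp
    have fI: "finite ?I" by (intro finite_words card_dyad)
    define g where "g S \<zeta> = epow (ennreal \<kappa> * bigtime N S \<zeta>) (p / Q)" for S :: "(nat \<times> (nat \<Rightarrow> 'n)) set" and \<zeta>
    have gm: "g S \<in> borel_measurable sigma" for S
    proof (rule measurable_sigma)
      show "g S \<in> borel_measurable borel" unfolding g_def by measurable
    qed
    have HF: "(\<integral>\<^sup>+\<zeta>. g S \<zeta> \<partial>sigma) \<le> HF_normp p q 0 (rpoly (dyad N) S)" for S
      unfolding HF_normp_wslice
    proof (rule nn_integral_mono)
      fix \<zeta> :: "complex ^ 'n"
      have k: "splus 0 = 1" by (simp add: splus_def)
      have "IR_pow 1 (rpoly (dyad N) S) (r *\<^sub>R \<zeta>) = dyadic_rpoly N S \<zeta> r" for r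
        unfolding IR_rpoly[OF card_dyad(2)] dyadic_rpoly_def by simp
      thus "g S \<zeta> \<le> wslice q p (real (splus 0) - 0) (\<lambda>r. cmod (IR_pow (splus 0) (rpoly (dyad N) S) (r *\<^sub>R \<zeta>)))"
        using wslice_ge_bigtime[OF q(1) qt p, of N S \<zeta>] unfolding k g_def \<kappa>_def Q_def by simp
    qed
    let ?v = "(\<kappa> * (c * real N / 2)) powr (p / Q)"
    have "ennreal (c / 2 * 2 ^ card ?I * ?v) = (\<integral>\<^sup>+\<zeta>. ennreal (c / 2 * 2 ^ card ?I * ?v) \<partial>(sigma :: (complex ^ 'n) measure))"
      by (simp add: emeasure_sigma_sphere)
    also have "\<dots> \<le> (\<integral>\<^sup>+\<zeta>. (\<Sum>S\<in>Pow ?I. g S \<zeta>) \<partial>sigma)"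
    proof (rule nn_integral_mono)
      fix \<zeta> :: "complex ^ 'n" assume "\<zeta> \<in> space sigma"
      hence \<zeta>: "norm \<zeta> = 1" by simp
      define L where "L S = enn2real (bigtime N S \<zeta>)" for S
      have L: "bigtime N S \<zeta> = ennreal (L S)" for S
      proof -
        have "bigtime N S \<zeta> < \<top>" by (rule le_less_trans[OF bigtime_le]) (rule of_nat_less_top)
        thus ?thesis by (simp add: L_def)
      qed
      have L0: "0 \<le> L S" for S by (simp add: L_def)
      have LN: "L S \<le> real N" for S
        using bigtime_le[of N S \<zeta>] unfolding L by (simp add: ennreal_of_nat_eq_real_of_nat)
      have "ennreal (c * 2 ^ card ?I * real N) \<le> ennreal (\<Sum>S\<in>Pow ?I. L S)"
        using bigtime_sum[OF \<zeta>, of N] L0 by (simp add: L c_def)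
      hence "c * real (card (Pow ?I)) * real N \<le> (\<Sum>S\<in>Pow ?I. L S)"
        using fI L0 by (subst (asm) ennreal_le_iff) (auto simp: card_Pow sum_nonneg)
      hence "c / 2 * real (card (Pow ?I)) \<le> real (card {S \<in> Pow ?I. c * real N / 2 \<le> L S})"
        using fI N0 c LN by (intro count_large) auto
      hence "ennreal (c / 2 * 2 ^ card ?I * ?v) \<le> ennreal (real (card {S \<in> Pow ?I. c * real N / 2 \<le> L S}) * ?v)"
        using fI by (intro ennreal_leI mult_right_mono) (auto simp: card_Pow)
      also have "\<dots> = of_nat (card {S \<in> Pow ?I. c * real N / 2 \<le> L S}) * ennreal ?v"
        by (simp add: ennreal_mult' ennreal_of_nat_eq_real_of_nat)
      also have "\<dots> \<le> (\<Sum>S\<in>Pow ?I. g S \<zeta>)"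
      proof (rule sum_ge_card)
        fix S assume S: "c * real N / 2 \<le> L S"
        have "?v \<le> (\<kappa> * L S) powr (p / Q)" using S c \<kappa> p Q0 N0 by (intro powr_mono2 mult_left_mono) auto
        hence "ennreal ?v \<le> epow (ennreal (\<kappa> * L S)) (p / Q)" using \<kappa> L0 by (simp add: epow_ennreal ennreal_leI)
        thus "ennreal ?v \<le> g S \<zeta>" using \<kappa> by (simp add: g_def L ennreal_mult')
      qed (use fI in simp)
      finally show "ennreal (c / 2 * 2 ^ card ?I * ?v) \<le> (\<Sum>S\<in>Pow ?I. g S \<zeta>)" .
    qed
    also have "\<dots> = (\<Sum>S\<in>Pow ?I. \<integral>\<^sup>+\<zeta>. g S \<zeta> \<partial>sigma)" by (rule nn_integral_sum) (rule gm)
    also have "\<dots> \<le> (\<Sum>S\<in>Pow ?I. HF_normp p q 0 (rpoly (dyad N) S))" by (intro sum_mono HF)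
    also have "\<dots> \<le> ennreal (C * sqrt (real N) powr p * 2 ^ card ?I)"
    proof -
      have "dyad N \<noteq> {}" using card_dyad(1)[of N] N by auto
      from C(2)[OF card_dyad(2) this] show ?thesis unfolding card_dyad(1) .
    qed
    finally have "c / 2 * 2 ^ card ?I * ?v \<le> C * sqrt (real N) powr p * 2 ^ card ?I"
      using C(1) by (subst (asm) ennreal_le_iff) auto
    hence "2 ^ card ?I * (c / 2 * ?v) \<le> 2 ^ card ?I * (C * sqrt (real N) powr p)" by (simp only: mult_ac)
    hence "c / 2 * ?v \<le> C * sqrt (real N) powr p" by (subst (asm) mult_le_cancel_left_pos) auto
    also have "sqrt (real N) powr p = real N powr (p / 2)" using N0 by (simp add: powr_half_sqrt[symmetric] powr_powr)
    also have "c / 2 * ?v = B * real N powr (p / Q)"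
    proof -
      have "\<kappa> * (c * real N / 2) = \<kappa> * c / 2 * real N" by simp
      thus ?thesis unfolding B_def by (simp only: powr_mult mult.assoc)
    qed
    finally have "B * real N powr (p / Q) \<le> C * real N powr (p / 2)" .
    \<comment> \<open>\<open>Q \<le> 1\<close> gives \<open>p / Q \<ge> p\<close>, strictly more
      than the exponent \<open>p / 2\<close> on the other side; this gap is the
      contradiction.\<close>
    moreover have "real N powr p \<le> real N powr (p / Q)" using N Q0 Q1 p by (intro powr_mono) (auto simp: le_divide_eq)
    hence "B * real N powr p \<le> B * real N powr (p / Q)" using B by (intro mult_left_mono) auto
    ultimately have "B * real N powr p \<le> C * real N powr (p / 2)" by linarith
    moreover have "real N powr p = real N powr (p / 2) * real N powr (p / 2)" by (simp add: powr_add[symmetric])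
    ultimately have "real N powr (p / 2) * (real N powr (p / 2) * B) \<le> real N powr (p / 2) * C" by (simp only: mult_ac)
    hence "real N powr (p / 2) * B \<le> C" using N0 by (subst (asm) mult_le_cancel_left_pos) auto
    thus ?thesis using B by (simp only: pos_le_divide_eq)
  qed
  thus False using p by (intro no_powr_bound[of "p / 2" 1]) auto
qed

theorem theorem7p2:
  fixes p :: real and q :: ennreal and s :: real
  assumes "0 < p" and "0 < q" and "0 \<le> s"
  shows "(0 < s \<longrightarrow>
            \<not> (\<exists>\<mu> :: (complex ^ 'n) measure. fin_borel_cball \<mu> \<and> reverse_carleson p q s \<mu>))
       \<and> (2 \<le> q \<longrightarrow>
            (\<forall>\<mu> :: (complex ^ 'n) measure. fin_borel_cball \<mu> \<longrightarrow>
               (reverse_carleson p q 0 \<mu> \<longleftrightarrow>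
                (\<exists>c>0. \<forall>\<zeta>\<in>sphere 0 1. \<forall>\<delta>>0.
                    emeasure \<mu> (Qball \<zeta> \<delta>) \<ge> ennreal c * emeasure sigma (Qball \<zeta> \<delta>)))))
       \<and> (q \<le> 1 \<longrightarrow>
            \<not> (\<exists>\<mu> :: (complex ^ 'n) measure. fin_borel_cball \<mu> \<and> reverse_carleson p q 0 \<mu>))"
proof (intro conjI impI allI)
  assume "0 < s"
  thus "\<not> (\<exists>\<mu> :: (complex ^ 'n) measure. fin_borel_cball \<mu> \<and> reverse_carleson p q s \<mu>)"
    using no_reverse_carleson_s_pos assms by blast
next
  fix \<mu> :: "(complex ^ 'n) measure"
  assume q: "2 \<le> q" and \<mu>: "fin_borel_cball \<mu>"
  show "reverse_carleson p q 0 \<mu> \<longleftrightarrow>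
                (\<exists>c>0. \<forall>\<zeta>\<in>sphere 0 1. \<forall>\<delta>>0.
                    emeasure \<mu> (Qball \<zeta> \<delta>) \<ge> ennreal c * emeasure sigma (Qball \<zeta> \<delta>))"
    using Qball_bound_if_reverse_carleson[OF assms(1,2) \<mu>] reverse_carleson_if_Qball_bound[OF assms(1) q \<mu>] by blast
next
  assume "q \<le> 1"
  thus "\<not> (\<exists>\<mu> :: (complex ^ 'n) measure. fin_borel_cball \<mu> \<and> reverse_carleson p q 0 \<mu>)"
    using no_reverse_carleson_q_le_1 assms by blast
qed

end
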